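(* Let $\alpha\in[0,1]$. The cone $\mathbf{T}_+\subset\mathbb{R}^3_+$ is an $\alpha$-sliding minimiser in the half-space $\mathbb{R}^3_+$ with respect to the sliding boundary $\Gamma=\partial\mathbb{R}^3_+$ if and only if $\alpha\ge\sqrt{\frac{2}{3}}$.
   Context: Let $\mathbb{R}^3_+:=\{(x,y,z)\in\mathbb{R}^3: z\ge 0\}$ and $\Gamma:=\{(x,y,z)\in\mathbb{R}^3: z=0\}$. $\mathcal{H}^2$ denotes the 2-dimensional Hausdorff measure. Energy: for $\alpha\in[0,1]$ and $E\subset\mathbb{R}^3_+$, $J_\alpha(E):=\mathcal{H}^2(E\setminus\Gamma)+\alpha\,\mathcal{H}^2(E\cap\Gamma)$. Sliding competitor: let $E\subset\mathbb{R}^3_+$ have locally finite $\mathcal{H}^2$ measure. A set $F$ is a sliding competitor to $E$ if there is a continuous function $\phi:[0,1]\times E\to\mathbb{R}^3$ such that, writing $\phi_t(x)=\phi(t,x)$: (1) $\phi_0$ is the identity; (2) $F=\phi_1(E)$; (3) $\phi_1$ is Lipschitz; (4) setting $W_t:=\{x\in E:\phi_t(x)\ne x\}$ for $t\in[0,1]$ and $W:=\bigcup_{t\in[0,1]}W_t$, there is a compact set $K\subset\mathbb{R}^3$ with $\phi([0,1]\times W)\subset K$; (5) for every $t\in[0,1]$, $\phi_t(x)\in\mathbb{R}^3_+$ for all $x\in E$, and $\phi_t(x)\in\Gamma$ for all $x\in E\cap\Gamma$. $\alpha$-sliding minimiser: $E$ is an $\alpha$-sliding minimiser in $\mathbb{R}^3_+$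 with respect to $\Gamma$ if $J_\alpha(E\setminus F)\le J_\alpha(F\setminus E)$ for every sliding competitor $F$ to $E$. The cone over a set $A$, $\mathrm{cone}(A)$, is the union of all half-lines starting from the origin and intersecting $A$. The cone $\mathbf{T}_+$: let $v_1=\left(\frac{2\sqrt2}{3},0,\frac13\right)$, $v_2=\left(-\frac{\sqrt2}{3},\sqrt{\frac23},\frac13\right)$, $v_3=\left(-\frac{\sqrt2}{3},-\sqrt{\frac23},\frac13\right)$, $v_4=(0,0,-1)$. These are the vertices of a regular tetrahedron centred at the origin. Let $\mathbf{\Delta}^3$ be the cone over the 1-dimensional skeleton (the union of the six edges) of this tetrahedron, and set $\mathbf{T}_+:=\mathbf{\Delta}^3\cap\mathbb{R}^3_+$. *)

theory Defs
  imports "HOL-Analysis.Analysis"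
begin

text \<open>
  The \<open>d\<close>-dimensional Hausdorff outer measure, normalised so that a set of diameter \<open>2r\<close> counts as
  much as a \<open>d\<close>-dimensional ball of radius \<open>r\<close>.  Covers are required to consist of bounded sets because
  \<^const>\<open>diameter\<close> carries no information on unbounded ones; empty members of a cover count as zero
  also for \<open>d = 0\<close>.
\<close>

definition hausdorff_weight :: "nat \<Rightarrow> 'a::metric_space set \<Rightarrow> ennreal" where
  "hausdorff_weight d U =
     (if U = {} then 0 else ennreal (unit_ball_vol (real d) * (diameter U / 2) ^ d))"

definition hausdorff_premeasure :: "nat \<Rightarrow> real \<Rightarrow> 'a::metric_space set \<Rightarrow> ennreal" where
  "hausdorff_premeasure d \<delta> A =
     (INF U \<in> {U :: nat \<Rightarrow> 'a set.
                A \<subseteq> (\<Union>i. U i) \<and> (\<forall>i. bounded (U i) \<and> diameter (U i) \<le> \<delta>)}.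
        \<Sum>i. hausdorff_weight d (U i))"

definition hausdorff_measure :: "nat \<Rightarrow> 'a::metric_space set \<Rightarrow> ennreal" where
  "hausdorff_measure d A = (SUP \<delta> \<in> {0<..}. hausdorff_premeasure d \<delta> A)"

definition locally_finite_hausdorff :: "nat \<Rightarrow> 'a::metric_space set \<Rightarrow> bool" where
  "locally_finite_hausdorff d A \<longleftrightarrow>
     (\<forall>x. \<exists>r>0. hausdorff_measure d (A \<inter> ball x r) < \<infinity>)"

definition half_space :: "(real ^ 3) set" where
  "half_space = {p. p $ 3 \<ge> 0}"

definition sliding_boundary :: "(real ^ 3) set" where
  "sliding_boundary = {p. p $ 3 = 0}"

definition sliding_energy :: "real \<Rightarrow> (real ^ 3) set \<Rightarrow> ennreal" where
  "sliding_energy \<alpha> E =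
     hausdorff_measure 2 (E - sliding_boundary)
     + ennreal \<alpha> * hausdorff_measure 2 (E \<inter> sliding_boundary)"

definition sliding_competitor :: "(real ^ 3) set \<Rightarrow> (real ^ 3) set \<Rightarrow> bool" where
  "sliding_competitor E F \<longleftrightarrow>
     (\<exists>\<phi> :: real \<Rightarrow> real ^ 3 \<Rightarrow> real ^ 3.
        continuous_on ({0..1} \<times> E) (\<lambda>(t, x). \<phi> t x) \<and>
        (\<forall>x\<in>E. \<phi> 0 x = x) \<and>
        F = \<phi> 1 ` E \<and>
        (\<exists>L. lipschitz_on L E (\<phi> 1)) \<and>
        (let W = (\<Union>t\<in>{0..1}. {x \<in> E. \<phi> t x \<noteq> x})
         in \<exists>K. compact K \<and> (\<lambda>(t, x). \<phi> t x) ` ({0..1} \<times> W) \<subseteq> K) \<and>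
        (\<forall>t\<in>{0..1}. (\<forall>x\<in>E. \<phi> t x \<in> half_space) \<and>
                     (\<forall>x\<in>E \<inter> sliding_boundary. \<phi> t x \<in> sliding_boundary)))"

text \<open>
  The first two conjuncts are the standing assumptions under which competitors are considered.
\<close>

definition sliding_minimiser :: "real \<Rightarrow> (real ^ 3) set \<Rightarrow> bool" where
  "sliding_minimiser \<alpha> E \<longleftrightarrow>
     E \<subseteq> half_space \<and>
     locally_finite_hausdorff 2 E \<and>
     (\<forall>F. sliding_competitor E F \<longrightarrow> sliding_energy \<alpha> (E - F) \<le> sliding_energy \<alpha> (F - E))"

definition half_line :: "'a::real_vector \<Rightarrow> 'a set" where
  "half_line v = {t *\<^sub>R v | t. t \<ge> 0}"

definition cone_over :: "'a::real_vector set \<Rightarrow> 'a set" where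
  "cone_over A = \<Union> {half_line v | v. v \<noteq> 0 \<and> half_line v \<inter> A \<noteq> {}}"

definition tetrahedron_vertices :: "(real ^ 3) set" where
  "tetrahedron_vertices =
     {vector [2 * sqrt 2 / 3, 0, 1 / 3],
      vector [- (sqrt 2 / 3), sqrt (2 / 3), 1 / 3],
      vector [- (sqrt 2 / 3), - sqrt (2 / 3), 1 / 3],
      vector [0, 0, - 1]}"

definition tetrahedral_cone :: "(real ^ 3) set" where
  "tetrahedral_cone =
     cone_over (\<Union> {e. e edge_of (convex hull tetrahedron_vertices)})"

definition T_plus :: "(real ^ 3) set" where
  "T_plus = tetrahedral_cone \<inter> half_space"

end

(*
  For alpha >= sqrt (2/3) the cone is calibrated.  Its image F under a sliding map still separates the four
  regions of the cone far out: a region label, constant on the components of the complement of F, extends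
  the labels at infinity, and the top region cannot reach the boundary plane without meeting F.  Attach to
  the label a the vector calib a; differences of these vectors have norm at most 1, and the vertical
  component of the top vector is - sqrt (2/3) while the lower ones are horizontal.  The distributional
  divergence of this piecewise constant field is concentrated on F, has density at most 1 there, and at
  most sqrt (2/3) on the boundary plane, and equality holds for the cone.  Its total mass depends on the
  field at infinity only, which gives the inequality.  Because F is merely a set of finite Hausdorff
  measure, the divergence is computed by slicing F with lines in finitely many directions.

  For alpha < sqrt (2/3), lower the sheets near the origin so that the cone acquires a triangle in the
  boundary plane, and let the displacement decay logarithmically.  To first order this costs
  sqrt 3 * alpha - sqrt 2 < 0 per sheet, and the second order cost tends to 0 with the number of scales.
*)
theory Submission
  imports Defs
begin

section \<open>Hausdorff measure\<close>

text \<open>Of the image \<open>F\<close> only closedness and locally finite measure enter; no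
  rectifiable structure or normal field is set up. The derivative of the labelled field is a matrix
  of signed measures, whose column in direction \<open>e\<close>, \<open>flux e\<close>, comes from
  slicing by lines parallel to \<open>e\<close>. Bounding the trace column by column would lose a
  constant. The way out is that the jumps lie on six lines only: where three independent directions
  jump along the same unit vector \<open>u\<close>, the matrix is \<open>u\<close> times a row, its
  trace is \<open>u \<bullet> flux u\<close>, and slicing parallel to \<open>u\<close> alone never
  exceeds the Hausdorff measure, because projections are 1-Lipschitz.

  The isodiametric inequality is bypassed: the constant relating Hausdorff to Lebesgue measure in
  the plane cancels.

  The fields are cut off by a box whose walls join the barrier. Hence their total divergence is
  zero, and no flux at infinity has to be computed.

  The logarithmic decay of the displacement succeeds because the second order cost is a Dirichlet
  energy in two dimensions, where a point has capacity zero.\<close>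

lemma hausdorff_weight_empty [simp]: "hausdorff_weight d {} = 0"
  by (simp add: hausdorff_weight_def)

lemma hausdorff_premeasure_le:
  assumes "A \<subseteq> (\<Union>i. U i)" "\<And>i. bounded (U i)" "\<And>i. diameter (U i) \<le> \<delta>"
  shows "hausdorff_premeasure d \<delta> A \<le> (\<Sum>i. hausdorff_weight d (U i))"
  unfolding hausdorff_premeasure_def using assms by (intro INF_lower) auto

lemma hausdorff_premeasure_mono: "A \<subseteq> B \<Longrightarrow> hausdorff_premeasure d \<delta> A \<le> hausdorff_premeasure d \<delta> B"
  unfolding hausdorff_premeasure_def by (intro INF_superset_mono) auto

lemma hausdorff_premeasure_antimono:
  "\<delta> \<le> \<delta>' \<Longrightarrow> hausdorff_premeasure d \<delta>' A \<le> hausdorff_premeasure d \<delta> A"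
  unfolding hausdorff_premeasure_def by (intro INF_superset_mono) (auto intro: order_trans)

lemma hausdorff_measure_mono: "A \<subseteq> B \<Longrightarrow> hausdorff_measure d A \<le> hausdorff_measure d B"
  unfolding hausdorff_measure_def by (intro SUP_mono) (blast intro: hausdorff_premeasure_mono)

lemma hausdorff_premeasure_le_measure:
  "0 < \<delta> \<Longrightarrow> hausdorff_premeasure d \<delta> A \<le> hausdorff_measure d A"
  unfolding hausdorff_measure_def by (intro SUP_upper) auto

lemma hausdorff_premeasure_empty: "0 < \<delta> \<Longrightarrow> hausdorff_premeasure d \<delta> {} = 0"
  using hausdorff_premeasure_le[of "{}" "\<lambda>_. {}" \<delta> d] by simp

lemma hausdorff_measure_empty [simp]: "hausdorff_measure d {} = 0"
  unfolding hausdorff_measure_def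
  by (rule antisym[OF SUP_least]) (auto simp: hausdorff_premeasure_empty)

lemma hausdorff_premeasure_approx:
  assumes "hausdorff_premeasure d \<delta> A < c"
  obtains U where "A \<subseteq> (\<Union>i::nat. U i)" "\<And>i. bounded (U i)" "\<And>i. diameter (U i) \<le> \<delta>"
    "(\<Sum>i. hausdorff_weight d (U i)) < c"
  using assms unfolding hausdorff_premeasure_def INF_less_iff by auto

lemma hausdorff_premeasure_UN_le:
  fixes A :: "nat \<Rightarrow> 'a::metric_space set"
  shows "hausdorff_premeasure d \<delta> (\<Union>n. A n) \<le> (\<Sum>n. hausdorff_premeasure d \<delta> (A n))"
proof (rule ennreal_le_epsilon)
  let ?p = "\<lambda>n. hausdorff_premeasure d \<delta> (A n)"
  fix e :: real assume fin: "(\<Sum>n. ?p n) < top" and "0 < e"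
  have lt: "?p n < ?p n + ennreal (e * (1/2) ^ Suc n)" for n
    using ennreal_suminf_lessD[OF fin, of n] \<open>0 < e\<close> by (simp add: less_top)
  have "\<exists>U. A n \<subseteq> (\<Union>i::nat. U i) \<and> (\<forall>i. bounded (U i)) \<and> (\<forall>i. diameter (U i) \<le> \<delta>) \<and>
      (\<Sum>i. hausdorff_weight d (U i)) < ?p n + ennreal (e * (1/2) ^ Suc n)" for n
    using hausdorff_premeasure_approx[OF lt[of n]] by metis
  then obtain U where U: "\<And>n. A n \<subseteq> (\<Union>i::nat. U n i)" "\<And>n i. bounded (U n i)"
      "\<And>n i. diameter (U n i) \<le> \<delta>"
      "\<And>n. (\<Sum>i. hausdorff_weight d (U n i)) < ?p n + ennreal (e * (1/2) ^ Suc n)"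
    by metis
  define V where "V = (\<lambda>k. case_prod U (prod_decode k))"
  have "(\<Union>n. A n) \<subseteq> (\<Union>k. V k)"
  proof
    fix x assume "x \<in> (\<Union>n. A n)"
    then obtain n i where "x \<in> U n i" using U(1) by blast
    then show "x \<in> (\<Union>k. V k)" by (intro UN_I[of "prod_encode (n, i)"]) (auto simp: V_def)
  qed
  then have "hausdorff_premeasure d \<delta> (\<Union>n. A n) \<le> (\<Sum>k. hausdorff_weight d (V k))"
    by (rule hausdorff_premeasure_le) (auto simp: V_def U split: prod.split)
  also have "\<dots> = (\<Sum>k. (\<lambda>(n, i). hausdorff_weight d (U n i)) (prod_decode k))"
    by (intro suminf_cong) (auto simp: V_def split: prod.split)
  also have "\<dots> = (\<Sum>n. \<Sum>i. hausdorff_weight d (U n i))"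
    by (rule suminf_ennreal_2dimen) simp
  also have "\<dots> \<le> (\<Sum>n. ?p n + ennreal (e * (1/2) ^ Suc n))"
    using U(4) by (intro suminf_le) (auto intro: less_imp_le)
  also have "\<dots> = (\<Sum>n. ?p n) + (\<Sum>n. ennreal (e * (1/2) ^ Suc n))"
    by (simp add: suminf_add)
  also have "(\<Sum>n. ennreal (e * (1/2) ^ Suc n)) = ennreal e"
    using \<open>0 < e\<close> sums_mult[OF power_half_series, of e]
    by (intro suminf_ennreal_eq) auto
  finally show "hausdorff_premeasure d \<delta> (\<Union>n. A n) \<le> (\<Sum>n. ?p n) + ennreal e" .
qed

lemma hausdorff_measure_UN_le:
  fixes A :: "nat \<Rightarrow> 'a::metric_space set"
  shows "hausdorff_measure d (\<Union>n. A n) \<le> (\<Sum>n. hausdorff_measure d (A n))"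
proof -
  have "hausdorff_premeasure d \<delta> (\<Union>n. A n) \<le> (\<Sum>n. hausdorff_measure d (A n))" if "0 < \<delta>" for \<delta>
    by (rule order_trans[OF hausdorff_premeasure_UN_le suminf_le])
      (auto simp: hausdorff_premeasure_le_measure that)
  then show ?thesis
    unfolding hausdorff_measure_def[of d "\<Union>n. A n"] by (intro SUP_least) auto
qed

lemma hausdorff_measure_Un_le:
  "hausdorff_measure d (A \<union> B) \<le> hausdorff_measure d A + hausdorff_measure d B"
proof -
  let ?X = "\<lambda>n. if n = 0 then A else if n = Suc 0 then B else {}"
  have "A \<union> B = (\<Union>n. ?X n)" by (auto split: if_splits)
  then have "hausdorff_measure d (A \<union> B) \<le> (\<Sum>n. hausdorff_measure d (?X n))"
    using hausdorff_measure_UN_le[of d ?X] by simp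
  also have "\<dots> = (\<Sum>n\<in>{0,1}. hausdorff_measure d (?X n))"
    by (intro suminf_finite) auto
  finally show ?thesis by simp
qed

text \<open>A covering set of diameter at most \<open>\<delta>\<close> meets at most one of the two
  sets, so every cover splits into a cover of \<open>A\<close> and a cover of \<open>B\<close>.
  Empty sets, of weight 0, fill the vacated places.\<close>

lemma hausdorff_premeasure_separated:
  assumes sep: "\<And>a b. a \<in> A \<Longrightarrow> b \<in> B \<Longrightarrow> r \<le> dist a b" and "\<delta> < r"
  shows "hausdorff_premeasure d \<delta> A + hausdorff_premeasure d \<delta> B \<le> hausdorff_premeasure d \<delta> (A \<union> B)"
  unfolding hausdorff_premeasure_def[of d \<delta> "A \<union> B"]
proof (rule INF_greatest, clarify)
  fix U :: "nat \<Rightarrow> 'a set"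
  assume cov: "A \<union> B \<subseteq> (\<Union>i. U i)" and U: "\<forall>i. bounded (U i) \<and> diameter (U i) \<le> \<delta>"
  define V where "V = (\<lambda>X i. if U i \<inter> X = {} then {} else U i)"
  have cover: "hausdorff_premeasure d \<delta> X \<le> (\<Sum>i. hausdorff_weight d (V X i))"
    if "X \<subseteq> A \<union> B" for X
  proof (rule hausdorff_premeasure_le)
    show "X \<subseteq> (\<Union>i. V X i)" using cov that by (fastforce simp: V_def)
    have "0 \<le> \<delta>" using U diameter_ge_0 order_trans by blast
    then show "diameter (V X i) \<le> \<delta>" for i using U by (auto simp: V_def)
  qed (use U in \<open>auto simp: V_def\<close>)
  have "U i \<inter> A = {} \<or> U i \<inter> B = {}" for i
  proof (rule ccontr)
    assume "\<not> ?thesis"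
    then obtain a b where ab: "a \<in> U i" "a \<in> A" "b \<in> U i" "b \<in> B" by blast
    then have "dist a b \<le> diameter (U i)" using U diameter_bounded_bound by blast
    also have "\<dots> \<le> \<delta>" using U by simp
    finally show False using sep[of a b] ab \<open>\<delta> < r\<close> by simp
  qed
  then have "hausdorff_weight d (V A i) + hausdorff_weight d (V B i) \<le> hausdorff_weight d (U i)" for i
    by (cases "U i \<inter> A = {}"; cases "U i \<inter> B = {}") (auto simp: V_def)
  then have "(\<Sum>i. hausdorff_weight d (V A i) + hausdorff_weight d (V B i))
      \<le> (\<Sum>i. hausdorff_weight d (U i))"
    by (intro suminf_le) auto
  then show "hausdorff_premeasure d \<delta> A + hausdorff_premeasure d \<delta> B \<le> (\<Sum>i. hausdorff_weight d (U i))"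
    using add_mono[OF cover[of A] cover[of B]] by (simp add: suminf_add[symmetric])
qed

lemma hausdorff_measure_separated:
  assumes sep: "\<And>a b. a \<in> A \<Longrightarrow> b \<in> B \<Longrightarrow> r \<le> dist a b" and "0 < r"
  shows "hausdorff_measure d A + hausdorff_measure d B \<le> hausdorff_measure d (A \<union> B)"
proof -
  \<comment> \<open>Two independent scales, so that the suprema over them can be taken one after the
    other.\<close>
  have "hausdorff_premeasure d \<delta> A + hausdorff_premeasure d \<epsilon> B \<le> hausdorff_measure d (A \<union> B)"
    if "\<delta> \<in> {0<..}" "\<epsilon> \<in> {0<..}" for \<delta> \<epsilon> :: real
  proof -
    define \<eta> where "\<eta> = Min {\<delta>, \<epsilon>, r / 2}"
    have \<eta>: "0 < \<eta>" "\<eta> \<le> \<delta>" "\<eta> \<le> \<epsilon>" "\<eta> < r" using that \<open>0 < r\<close> by (auto simp: \<eta>_def min_less_iff_disj)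
    have "hausdorff_premeasure d \<delta> A + hausdorff_premeasure d \<epsilon> B
        \<le> hausdorff_premeasure d \<eta> A + hausdorff_premeasure d \<eta> B"
      by (intro add_mono hausdorff_premeasure_antimono \<eta>)
    also have "\<dots> \<le> hausdorff_premeasure d \<eta> (A \<union> B)"
      by (rule hausdorff_premeasure_separated[OF sep \<eta>(4)])
    also have "\<dots> \<le> hausdorff_measure d (A \<union> B)"
      by (rule hausdorff_premeasure_le_measure[OF \<eta>(1)])
    finally show ?thesis .
  qed
  then have "hausdorff_premeasure d \<delta> A + hausdorff_measure d B \<le> hausdorff_measure d (A \<union> B)"
    if "\<delta> \<in> {0<..}" for \<delta> :: real
    unfolding hausdorff_measure_def[of d B] using that
    by (subst ennreal_SUP_add_right) (auto intro!: SUP_least)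
  then show ?thesis
    unfolding hausdorff_measure_def[of d A]
    by (subst ennreal_SUP_add_left[symmetric]) (auto intro!: SUP_least)
qed


text \<open>Caratheodory's criterion for metric outer measures: the annuli at distance \<open>1/(n+2)\<close> to
  \<open>1/(n+1)\<close> from the closed set are separated from each other except for neighbours.\<close>

lemma hausdorff_measure_closed_split:
  fixes C A :: "'a::metric_space set"
  assumes "closed C"
  shows "hausdorff_measure d (A \<inter> C) + hausdorff_measure d (A - C) \<le> hausdorff_measure d A"
proof (cases "C = {} \<or> hausdorff_measure d A = top")
  case False
  then have ne: "C \<noteq> {}" and fin: "hausdorff_measure d A \<noteq> top" by auto
  define H :: "'a set \<Rightarrow> ennreal" where "H = hausdorff_measure d"
  define S where "S n = {x \<in> A. 1 / real (Suc n) \<le> infdist x C}" for n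
  define R where "R n = {x \<in> A. 1 / real (Suc (Suc n)) \<le> infdist x C \<and> infdist x C < 1 / real (Suc n)}" for n
  have Hfin: "H X < top" if "X \<subseteq> A" for X
    using hausdorff_measure_mono[OF that, of d] fin by (auto simp: H_def less_top[symmetric] top_unique)
  \<comment> \<open>Rings whose indices have the same parity are separated, because a whole ring of
    width \<open>b - a\<close> lies between \<open>R (2 * m + i)\<close> and all earlier ones. For
    \<open>m = 0\<close>, where \<open>b\<close> may be \<open>1 / 0\<close>, there is nothing to
    separate.\<close>
  have part: "H (\<Union>j<m. R (2 * j + i)) = (\<Sum>j<m. H (R (2 * j + i)))" for m i
  proof (induction m)
    case (Suc m)
    let ?P = "\<Union>j<m. R (2 * j + i)"
    define a where "a = 1 / real (Suc (2 * m + i))"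
    define b where "b = 1 / real (2 * m + i)"
    have "H (R (2 * m + i)) + H ?P \<le> H (R (2 * m + i) \<union> ?P)" if "m \<noteq> 0"
      unfolding H_def
    proof (rule hausdorff_measure_separated[where r = "b - a"])
      have "a < b" unfolding a_def b_def using that by (intro divide_strict_left_mono) auto
      then show "0 < b - a" by simp
      fix x y assume x: "x \<in> R (2 * m + i)" and "y \<in> ?P"
      then obtain j where "j < m" and y: "y \<in> R (2 * j + i)" by blast
      then have "b \<le> 1 / real (Suc (Suc (2 * j + i)))"
        unfolding b_def by (intro divide_left_mono) auto
      with y have "b \<le> infdist y C" by (simp add: R_def)
      moreover have "infdist x C < a" using x by (simp add: R_def a_def)
      moreover have "infdist y C \<le> infdist x C + dist y x" by (rule infdist_triangle)
      ultimately show "b - a \<le> dist x y" by (simp add: dist_commute)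
    qed
    moreover have "H (R (2 * m + i) \<union> ?P) \<le> H (R (2 * m + i)) + H ?P"
      unfolding H_def by (rule hausdorff_measure_Un_le)
    ultimately have "H (R (2 * m + i) \<union> ?P) = H (R (2 * m + i)) + H ?P"
      by (cases "m = 0") (auto simp: H_def)
    then show ?case using Suc by (simp add: lessThan_Suc add.commute)
  qed (simp add: H_def)
  have bd: "(\<Sum>j<m. H (R (2 * j + i))) \<le> H A" for m i
    by (simp only: part[symmetric]) (auto simp: H_def R_def intro!: hausdorff_measure_mono)
  \<comment> \<open>Even and odd rings contribute at most \<open>H A\<close> each, so the series
    over all rings converges and its tails become negligible.\<close>
  have "(\<Sum>k<m. H (R k)) \<le> H A + H A" for m
  proof -
    have "(\<Sum>k<m. H (R k)) \<le> (\<Sum>k<2 * m. H (R k))" by (intro sum_mono2) auto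
    also have "\<dots> = (\<Sum>j<m. H (R (2 * j + 0))) + (\<Sum>j<m. H (R (2 * j + 1)))"
      by (induction m) (auto simp: algebra_simps)
    also have "\<dots> \<le> H A + H A" by (intro add_mono bd)
    finally show ?thesis .
  qed
  then have "(\<Sum>k. H (R k)) \<le> H A + H A" by (intro suminf_le_const) auto
  also have "\<dots> < top" using Hfin[of A] by simp
  finally have tot: "(\<Sum>k. H (R k)) < top" .
  define r where "r k = enn2real (H (R k))" for k
  have Hr: "H (R k) = ennreal (r k)" for k
    using Hfin[of "R k"] by (simp add: r_def R_def)
  have r0: "0 \<le> r k" for k by (simp add: r_def)
  have sr: "summable r"
    using tot unfolding Hr by (intro summable_suminf_not_top r0) auto
  have main: "H (A \<inter> C) + H (A - C) \<le> H A + ennreal e" if "0 < e" for e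
  proof -
    obtain n where n: "norm (\<Sum>k. r (k + n)) < e"
      using suminf_exist_split[OF \<open>0 < e\<close> sr] by blast
    have "A - C \<subseteq> S n \<union> (\<Union>k. R (k + n))"
    proof
      fix x assume x: "x \<in> A - C"
      then have pos: "0 < infdist x C"
        using assms ne infdist_pos_not_in_closed by blast
      show "x \<in> S n \<union> (\<Union>k. R (k + n))"
      proof (cases "1 / real (Suc n) \<le> infdist x C")
        case False
        define P where "P m \<longleftrightarrow> 1 / real (Suc m) \<le> infdist x C" for m
        obtain m0 where "inverse (real (Suc m0)) < infdist x C" using reals_Archimedean[OF pos] by blast
        then have "P m0" unfolding P_def inverse_eq_divide by (rule less_imp_le)
        define m where "m = (LEAST m. P m)"
        have m: "P m" "\<And>k. k < m \<Longrightarrow> \<not> P k"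
          unfolding m_def using LeastI[of P, OF \<open>P m0\<close>] not_less_Least by auto
        have "n < m"
        proof (rule ccontr)
          assume "\<not> n < m"
          then have "1 / real (Suc n) \<le> 1 / real (Suc m)" by (intro divide_left_mono) auto
          with m(1) False show False by (simp add: P_def)
        qed
        then obtain k where k: "m = Suc (k + n)" by (metis less_imp_Suc_add add.commute)
        have "x \<in> R (k + n)" using m(1) m(2)[of "k + n"] x by (auto simp: R_def P_def k)
        then show ?thesis by blast
      qed (use x in \<open>simp add: S_def\<close>)
    qed
    then have "H (A - C) \<le> H (S n \<union> (\<Union>k. R (k + n)))"
      unfolding H_def by (rule hausdorff_measure_mono)
    also have "\<dots> \<le> H (S n) + H (\<Union>k. R (k + n))"
      unfolding H_def by (rule hausdorff_measure_Un_le)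
    also have "H (\<Union>k. R (k + n)) \<le> (\<Sum>k. H (R (k + n)))"
      unfolding H_def by (rule hausdorff_measure_UN_le)
    also have "(\<Sum>k. H (R (k + n))) = ennreal (\<Sum>k. r (k + n))"
      unfolding Hr using sr by (intro suminf_ennreal2 r0) (simp add: summable_iff_shift)
    also have "\<dots> \<le> ennreal e" using n by (intro ennreal_leI) auto
    finally have 1: "H (A - C) \<le> H (S n) + ennreal e" by (simp add: add_mono)
    have "H (A \<inter> C) + H (S n) \<le> H (A \<inter> C \<union> S n)"
      unfolding H_def
    proof (rule hausdorff_measure_separated[where r = "1 / real (Suc n)"])
      fix a b assume "a \<in> A \<inter> C" "b \<in> S n"
      then show "1 / real (Suc n) \<le> dist a b"
        using infdist_le[of a C b] by (auto simp: S_def dist_commute)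
    qed simp
    also have "\<dots> \<le> H A" unfolding H_def by (rule hausdorff_measure_mono) (auto simp: S_def)
    finally have 2: "H (A \<inter> C) + H (S n) \<le> H A" .
    have "H (A \<inter> C) + H (A - C) \<le> H (A \<inter> C) + (H (S n) + ennreal e)"
      by (intro add_left_mono 1)
    also have "\<dots> \<le> H A + ennreal e" using 2 by (simp add: add.assoc[symmetric] add_right_mono)
    finally show ?thesis .
  qed
  show ?thesis
    by (rule ennreal_le_epsilon) (rule main[unfolded H_def])
qed (auto simp: top_unique)

section \<open>The Borel measure carried by the Hausdorff outer measure\<close>

definition hausdorff :: "nat \<Rightarrow> 'a::metric_space measure" where
  "hausdorff d = measure_of UNIV (sets borel) (hausdorff_measure d)"

lemma sets_hausdorff [simp, measurable_cong]: "sets (hausdorff d) = sets borel"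
  unfolding hausdorff_def using sets.sigma_sets_eq[of borel] by (simp add: sets_measure_of_conv)

lemma space_hausdorff [simp]: "space (hausdorff d) = UNIV"
  unfolding hausdorff_def by (simp add: space_measure_of_conv)

text \<open>By Caratheodory's theorem the outer measure is countably additive on the sets that split
  every set additively. Closed sets do so by \<open>hausdorff_measure_closed_split\<close>, hence
  all Borel sets do.\<close>

lemma emeasure_hausdorff:
  assumes "A \<in> sets borel"
  shows "emeasure (hausdorff d) A = hausdorff_measure d A"
proof -
  let ?H = "hausdorff_measure d :: 'a set \<Rightarrow> ennreal"
  let ?L = "lambda_system UNIV (Pow UNIV) ?H"
  interpret Pow: sigma_algebra "UNIV :: 'a set" "Pow UNIV" by (rule sigma_algebra_Pow)
  have oms: "outer_measure_space (Pow UNIV) ?H"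
    unfolding outer_measure_space_def positive_def increasing_def countably_subadditive_def
    by (auto intro: hausdorff_measure_mono hausdorff_measure_UN_le)
  have ms: "measure_space UNIV ?L ?H"
    by (rule Pow.caratheodory_lemma[OF oms])
  then interpret L: sigma_algebra UNIV ?L by (simp add: measure_space_def)
  have closed: "C \<in> ?L" if "closed C" for C
    unfolding Pow.lambda_system_eq
  proof (intro CollectI conjI ballI)
    fix A
    have "?H A \<le> ?H (A \<inter> C) + ?H (A - C)"
      using hausdorff_measure_Un_le[of d "A \<inter> C" "A - C"] by (simp add: Int_Diff_Un)
    then show "?H (A \<inter> C) + ?H (A - C) = ?H A"
      using hausdorff_measure_closed_split[OF that, of d A] by (intro antisym) auto
  qed auto
  have sub: "sets borel \<subseteq> ?L"
    unfolding borel_eq_closed sets_measure_of[OF subset_UNIV[of "Collect closed", folded Pow_UNIV]]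
    using closed by (intro L.sigma_sets_subset) blast
  have pos: "positive (sets borel) ?H" by (simp add: positive_def)
  have ca: "countably_additive (sets borel) ?H"
    using ms sub unfolding measure_space_def countably_additive_def by blast
  show ?thesis
    unfolding hausdorff_def using assms pos ca
    by (intro emeasure_measure_of_sigma) (auto simp: sets.sigma_algebra_axioms[of borel, simplified])
qed

section \<open>Lipschitz and isometric images\<close>

lemma diameter_le_dist:
  fixes S :: "'a::metric_space set"
  assumes "0 \<le> d" "\<And>x y. x \<in> S \<Longrightarrow> y \<in> S \<Longrightarrow> dist x y \<le> d"
  shows "diameter S \<le> d"
proof (cases "S = {}")
  case False
  then have "(SUP (x, y) \<in> S \<times> S. dist x y) \<le> d"
    by (intro cSUP_least) (auto intro: assms(2))
  then show ?thesis using False by (simp add: diameter_def)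
qed (use assms(1) in simp)

lemma hausdorff_premeasure_lipschitz_image:
  assumes f: "\<And>x y. x \<in> A \<Longrightarrow> y \<in> A \<Longrightarrow> dist (f x) (f y) \<le> L * dist x y" and "0 < L"
  shows "hausdorff_premeasure d (L * \<delta>) (f ` A) \<le> ennreal (L ^ d) * hausdorff_premeasure d \<delta> A"
proof (rule ennreal_le_epsilon)
  fix e :: real assume fin: "ennreal (L ^ d) * hausdorff_premeasure d \<delta> A < top" and "0 < e"
  have Ld: "0 < L ^ d" using \<open>0 < L\<close> by simp
  have "hausdorff_premeasure d \<delta> A \<noteq> top"
    using fin \<open>0 < L\<close> by (auto simp: ennreal_mult_top)
  then have "hausdorff_premeasure d \<delta> A < hausdorff_premeasure d \<delta> A + ennreal (e / L ^ d)"
    using \<open>0 < e\<close> Ld by simp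
  then obtain U where cov: "A \<subseteq> (\<Union>i::nat. U i)" and U: "\<And>i. bounded (U i)" "\<And>i. diameter (U i) \<le> \<delta>"
    and sum: "(\<Sum>i. hausdorff_weight d (U i)) < hausdorff_premeasure d \<delta> A + ennreal (e / L ^ d)"
    by (rule hausdorff_premeasure_approx) blast
  have le: "dist x y \<le> L * diameter (U i)" if mem: "x \<in> f ` (U i \<inter> A)" "y \<in> f ` (U i \<inter> A)" for i x y
  proof -
    obtain a b where ab: "a \<in> U i" "a \<in> A" "b \<in> U i" "b \<in> A" and xy: "x = f a" "y = f b"
      using mem by blast
    have "dist a b \<le> diameter (U i)" using U ab diameter_bounded_bound by blast
    then have "L * dist a b \<le> L * diameter (U i)" using \<open>0 < L\<close> by simp
    then show ?thesis using f[OF ab(2,4)] xy by simp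
  qed
  have bd: "bounded (f ` (U i \<inter> A))" for i
    unfolding bounded_two_points using le by blast
  have dm: "diameter (f ` (U i \<inter> A)) \<le> L * diameter (U i)" for i
    using le \<open>0 < L\<close> diameter_ge_0[OF U(1)] by (intro diameter_le_dist) auto
  have "hausdorff_premeasure d (L * \<delta>) (f ` A) \<le> (\<Sum>i. hausdorff_weight d (f ` (U i \<inter> A)))"
  proof (rule hausdorff_premeasure_le)
    show "diameter (f ` (U i \<inter> A)) \<le> L * \<delta>" for i
      using dm[of i] U(2)[of i] \<open>0 < L\<close> mult_left_mono[of "diameter (U i)" \<delta> L] by linarith
    show "f ` A \<subseteq> (\<Union>i. f ` (U i \<inter> A))" using cov by blast
  qed (use bd in auto)
  also have "\<dots> \<le> (\<Sum>i. ennreal (L ^ d) * hausdorff_weight d (U i))"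
  proof (rule suminf_le)
    fix i
    show "hausdorff_weight d (f ` (U i \<inter> A)) \<le> ennreal (L ^ d) * hausdorff_weight d (U i)"
    proof (cases "U i \<inter> A = {}")
      case False
      have "0 \<le> diameter (f ` (U i \<inter> A))" by (rule diameter_ge_0[OF bd])
      then have "(diameter (f ` (U i \<inter> A)) / 2) ^ d \<le> (L * (diameter (U i) / 2)) ^ d"
        using dm[of i] by (intro power_mono) auto
      then have "unit_ball_vol (real d) * (diameter (f ` (U i \<inter> A)) / 2) ^ d
          \<le> unit_ball_vol (real d) * (L * (diameter (U i) / 2)) ^ d"
        by (intro mult_left_mono) auto
      also have "\<dots> = L ^ d * (unit_ball_vol (real d) * (diameter (U i) / 2) ^ d)"
        by (simp only: power_mult_distrib mult.left_commute)
      finally show ?thesis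
        using False \<open>0 < L\<close> by (auto simp: hausdorff_weight_def ennreal_mult'[symmetric] intro!: ennreal_leI)
    qed simp
  qed auto
  also have "\<dots> = ennreal (L ^ d) * (\<Sum>i. hausdorff_weight d (U i))" by simp
  also have "\<dots> \<le> ennreal (L ^ d) * (hausdorff_premeasure d \<delta> A + ennreal (e / L ^ d))"
    using sum by (intro mult_left_mono) auto
  also have "\<dots> = ennreal (L ^ d) * hausdorff_premeasure d \<delta> A + ennreal e"
    using \<open>0 < L\<close> \<open>0 < e\<close> by (simp add: distrib_left ennreal_mult'[symmetric])
  finally show "hausdorff_premeasure d (L * \<delta>) (f ` A) \<le> ennreal (L ^ d) * hausdorff_premeasure d \<delta> A + ennreal e" .
qed

lemma hausdorff_measure_lipschitz_image:
  assumes f: "\<And>x y. x \<in> A \<Longrightarrow> y \<in> A \<Longrightarrow> dist (f x) (f y) \<le> L * dist x y" and "0 < L"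
  shows "hausdorff_measure d (f ` A) \<le> ennreal (L ^ d) * hausdorff_measure d A"
  unfolding hausdorff_measure_def[of d "f ` A"]
proof (rule SUP_least)
  fix \<delta> :: real assume "\<delta> \<in> {0<..}"
  then have "0 < \<delta> / L" and eq: "L * (\<delta> / L) = \<delta>" using \<open>0 < L\<close> by auto
  have "hausdorff_premeasure d \<delta> (f ` A) \<le> ennreal (L ^ d) * hausdorff_premeasure d (\<delta> / L) A"
    using hausdorff_premeasure_lipschitz_image[OF f \<open>0 < L\<close>, where \<delta> = "\<delta> / L", unfolded eq] .
  also have "\<dots> \<le> ennreal (L ^ d) * hausdorff_measure d A"
    by (intro mult_left_mono hausdorff_premeasure_le_measure \<open>0 < \<delta> / L\<close>) auto
  finally show "hausdorff_premeasure d \<delta> (f ` A) \<le> \<dots>" .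
qed

lemma hausdorff_measure_isometric_image:
  assumes f: "\<And>x y. x \<in> A \<Longrightarrow> y \<in> A \<Longrightarrow> dist (f x) (f y) = dist x y"
  shows "hausdorff_measure d (f ` A) = hausdorff_measure d A"
proof (rule antisym)
  show "hausdorff_measure d (f ` A) \<le> hausdorff_measure d A"
    using hausdorff_measure_lipschitz_image[of A f 1 d] f by simp
  have inj: "inj_on f A" using f by (metis dist_eq_0_iff inj_onI)
  have "hausdorff_measure d (inv_into A f ` f ` A) \<le> hausdorff_measure d (f ` A)"
  proof -
    have "dist (inv_into A f x) (inv_into A f y) \<le> 1 * dist x y" if "x \<in> f ` A" "y \<in> f ` A" for x y
      using that f inj by auto
    from hausdorff_measure_lipschitz_image[of "f ` A" "inv_into A f" 1 d, OF this] show ?thesis by simp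
  qed
  then show "hausdorff_measure d A \<le> hausdorff_measure d (f ` A)" using inj by simp
qed

section \<open>Translation invariant measures and Lebesgue measure\<close>

lemma nn_integral_translate_lborel_reflect:
  fixes x :: "'a::euclidean_space"
  assumes [measurable]: "f \<in> borel_measurable borel"
  shows "(\<integral>\<^sup>+y. f (x - y) \<partial>lborel) = (\<integral>\<^sup>+y. f y \<partial>lborel)"
proof -
  have "lborel = distr lborel borel (\<lambda>y. x - y)"
    using lborel_affine[of "-1" x] by (simp add: density_1)
  then have "(\<integral>\<^sup>+y. f y \<partial>lborel) = (\<integral>\<^sup>+y. f y \<partial>distr lborel borel (\<lambda>y. x - y))" by metis
  also have "\<dots> = (\<integral>\<^sup>+y. f (x - y) \<partial>lborel)" by (simp add: nn_integral_distr)
  finally show ?thesis by simp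
qed

text \<open>The classical Fubini argument: \<open>\<mu> A * \<lambda> Q = \<mu> Q * \<lambda> A\<close> by integrating
  \<open>1\<^sub>A (x) 1\<^sub>Q (x + y)\<close> in both orders.\<close>

lemma translation_invariant_eq_lborel:
  fixes M :: "'a::euclidean_space measure"
  assumes "sigma_finite_measure M" and sets [measurable_cong]: "sets M = sets borel"
    and inv: "\<And>a A. A \<in> sets borel \<Longrightarrow> emeasure M ((+) a -` A) = emeasure M A"
    and A [measurable]: "A \<in> sets borel"
  shows "emeasure M A = emeasure M (box 0 One) * emeasure lborel A"
proof -
  interpret M: sigma_finite_measure M by fact
  interpret P: pair_sigma_finite M lborel ..
  let ?Q = "box 0 One :: 'a set"
  have space: "space M = UNIV" using sets_eq_imp_space_eq[OF sets] by simp
  have distr: "distr M borel ((+) a) = M" for a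
    by (rule measure_eqI) (auto simp: emeasure_distr inv sets space)
  have tr: "(\<integral>\<^sup>+x. f (a + x) \<partial>M) = (\<integral>\<^sup>+x. f x \<partial>M)" if "f \<in> borel_measurable borel" for f a
    using that by (subst (2) distr[of a, symmetric]) (simp add: nn_integral_distr)
  have lb: "(\<integral>\<^sup>+y. indicator ?Q (x + y) \<partial>lborel) = (1::ennreal)" for x
  proof -
    have "(\<integral>\<^sup>+y. indicator ?Q (x + y) \<partial>lborel) = (\<integral>\<^sup>+y. indicator ?Q y \<partial>(lborel :: 'a measure))"
      by (subst (2) lborel_distr_plus[of x, symmetric], rule nn_integral_distr[symmetric]) measurable
    also have "\<dots> = 1" by (simp add: emeasure_lborel_box_eq inner_Basis)
    finally show ?thesis .
  qed
  have "emeasure M A = (\<integral>\<^sup>+x. indicator A x * (\<integral>\<^sup>+y. indicator ?Q (x + y) \<partial>lborel) \<partial>M)"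
    using A by (simp add: lb sets)
  also have "\<dots> = (\<integral>\<^sup>+x. (\<integral>\<^sup>+y. indicator A x * indicator ?Q (x + y) \<partial>lborel) \<partial>M)"
    by (intro nn_integral_cong nn_integral_cmult[symmetric]) measurable
  also have "\<dots> = (\<integral>\<^sup>+y. (\<integral>\<^sup>+x. indicator A x * indicator ?Q (x + y) \<partial>M) \<partial>lborel)"
    by (rule P.Fubini'[symmetric]) measurable
  also have "\<dots> = (\<integral>\<^sup>+y. (\<integral>\<^sup>+x. indicator A (x - y) * indicator ?Q x \<partial>M) \<partial>lborel)"
  proof (rule nn_integral_cong)
    fix y :: 'a
    show "(\<integral>\<^sup>+x. indicator A x * indicator ?Q (x + y) \<partial>M) = (\<integral>\<^sup>+x. indicator A (x - y) * indicator ?Q x \<partial>M)"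
      using tr[of "\<lambda>x. indicator A (x - y) * indicator ?Q x" y] by (simp add: add.commute)
  qed
  also have "\<dots> = (\<integral>\<^sup>+x. (\<integral>\<^sup>+y. indicator A (x - y) * indicator ?Q x \<partial>lborel) \<partial>M)"
    by (rule P.Fubini') measurable
  also have "\<dots> = (\<integral>\<^sup>+x. emeasure lborel A * indicator ?Q x \<partial>M)"
    by (intro nn_integral_cong) (simp add: nn_integral_multc nn_integral_translate_lborel_reflect)
  also have "\<dots> = emeasure M ?Q * emeasure lborel A"
    by (simp add: nn_integral_cmult_indicator sets mult.commute)
  finally show ?thesis .
qed

lemma linear_isometry_bij:
  fixes T :: "'a::euclidean_space \<Rightarrow> 'b::euclidean_space"
  assumes "linear T" "\<And>x. norm (T x) = norm x" "DIM('a) = DIM('b)"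
  shows "bij T"
proof -
  have "inj T" using assms(1,2) linear_injective_0 by (metis norm_eq_zero)
  moreover from this have "surj T"
    using assms(1,3) dim_image_eq[of T UNIV] dim_eq_full[of "range T"] span_linear_image[of T UNIV]
    by (metis dim_UNIV inj_on_subset span_UNIV subset_UNIV)
  ultimately show ?thesis by (simp add: bij_def)
qed

text \<open>The image measure is translation invariant, hence a multiple of Lebesgue measure. The
  preimage of a centred ball is the ball of the same radius, which fixes the factor as 1. The two
  types may differ as long as their dimensions agree; this is what allows
  \<open>plane \<times> real\<close> to stand for \<open>real^3\<close>.\<close>

lemma lborel_linear_isometry:
  fixes T :: "'a::euclidean_space \<Rightarrow> 'b::euclidean_space"
  assumes T: "linear T" "\<And>x. norm (T x) = norm x" "DIM('a) = DIM('b)"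
  shows "distr lborel borel T = lborel"
proof -
  have "continuous_on UNIV T" by (rule linear_continuous_on) (use T in \<open>simp add: linear_conv_bounded_linear\<close>)
  then have [measurable]: "T \<in> borel_measurable borel" by (rule borel_measurable_continuous_onI)
  have bij: "bij T" by (rule linear_isometry_bij[OF T])
  let ?M = "distr lborel borel T"
  have cball: "emeasure ?M (cball 0 r) = emeasure lborel (cball (0::'b) r)" if "0 \<le> r" for r
  proof -
    have "T -` cball 0 r = cball 0 r" using T(2) by auto
    then show ?thesis using that T(3) by (simp add: emeasure_distr emeasure_cball)
  qed
  have "sigma_finite_measure ?M"
  proof
    show "\<exists>A. countable A \<and> A \<subseteq> sets ?M \<and> \<Union> A = space ?M \<and> (\<forall>a\<in>A. emeasure ?M a \<noteq> \<infinity>)"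
    proof (intro exI[of _ "range (\<lambda>n::nat. cball 0 (real n))"] conjI ballI)
      show "\<Union> (range (\<lambda>n. cball (0::'b) (real n))) = space ?M"
        using real_arch_simple by (auto simp: space_distr)
      show "emeasure ?M a \<noteq> \<infinity>" if "a \<in> range (\<lambda>n::nat. cball 0 (real n))" for a
        using that by (auto simp: cball emeasure_cball)
    qed auto
  qed
  moreover have "emeasure ?M ((+) a -` A) = emeasure ?M A" if [measurable]: "A \<in> sets borel" for a A
  proof -
    obtain b where b: "T b = a" using bij by (metis bij_pointE)
    have [measurable]: "(+) a -` A \<in> sets borel" "T -` A \<in> sets borel"
      using measurable_sets_borel[of "(+) a" borel A] measurable_sets_borel[of T borel A] by auto
    have "T -` (+) a -` A = (+) b -` T -` A" using T(1) b by (auto simp: linear_add)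
    then have "emeasure ?M ((+) a -` A) = emeasure (distr lborel borel ((+) b)) (T -` A)"
      by (simp add: emeasure_distr)
    then show ?thesis by (simp add: emeasure_distr lborel_distr_plus)
  qed
  ultimately have eq: "emeasure ?M A = emeasure ?M (box 0 One) * emeasure lborel A" if "A \<in> sets borel" for A
    using that by (intro translation_invariant_eq_lborel) auto
  have "emeasure lborel (cball (0::'b) 1) = emeasure ?M (box 0 One) * emeasure lborel (cball (0::'b) 1)"
    using eq[of "cball 0 1"] by (simp add: cball)
  moreover have "unit_ball_vol (real DIM('b)) \<noteq> 0"
    using unit_ball_vol_pos[of "real DIM('b)"] by (metis less_irrefl of_nat_0_le_iff)
  ultimately have 1: "emeasure ?M (box 0 One) = 1"
    by (cases "emeasure ?M (box 0 One)")
      (auto simp: emeasure_cball ennreal_mult'[symmetric] ennreal_top_mult)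
  show ?thesis
  proof (rule measure_eqI)
    fix A assume "A \<in> sets ?M"
    then show "emeasure ?M A = emeasure lborel A" by (subst eq) (simp_all only: 1 mult_1 sets_distr)
  qed simp
qed

text \<open>A set lies in the ball about any of its points whose radius is the diameter of the set,
  which costs the factor \<open>2 ^ DIM('a)\<close>. Removing that factor would amount to the
  isodiametric inequality; the crude bound is enough to see that the unit square has positive
  Hausdorff measure.\<close>

lemma emeasure_lborel_le_hausdorff_measure:
  fixes A :: "'a::euclidean_space set"
  assumes "A \<in> sets borel"
  shows "emeasure lborel A \<le> ennreal (2 ^ DIM('a)) * hausdorff_measure DIM('a) A"
proof -
  have "emeasure lborel A \<le> ennreal (2 ^ DIM('a)) * hausdorff_premeasure DIM('a) 1 A"
  proof (rule ennreal_le_epsilon)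
    fix e :: real assume fin: "ennreal (2 ^ DIM('a)) * hausdorff_premeasure DIM('a) 1 A < top" and "0 < e"
    then have "hausdorff_premeasure DIM('a) 1 A \<noteq> top" by (auto simp: ennreal_mult_top)
    then have "hausdorff_premeasure DIM('a) 1 A < hausdorff_premeasure DIM('a) 1 A + ennreal (e / 2 ^ DIM('a))"
      using \<open>0 < e\<close> by simp
    then obtain U where cov: "A \<subseteq> (\<Union>i::nat. U i)" and U: "\<And>i. bounded (U i)"
      and sum: "(\<Sum>i. hausdorff_weight DIM('a) (U i)) < hausdorff_premeasure DIM('a) 1 A + ennreal (e / 2 ^ DIM('a))"
      by (rule hausdorff_premeasure_approx) blast
    define B where "B i = (if U i = {} then {} else cball (SOME x. x \<in> U i) (diameter (U i)))" for i
    have "U i \<subseteq> B i" for i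
    proof
      fix x assume x: "x \<in> U i"
      then have "(SOME x. x \<in> U i) \<in> U i" by (rule someI)
      then show "x \<in> B i" using x diameter_bounded_bound[OF U[of i]] by (auto simp: B_def)
    qed
    then have "A \<subseteq> (\<Union>i. B i)" by (intro order_trans[OF cov UN_mono]) auto
    then have "emeasure lborel A \<le> emeasure lborel (\<Union>i. B i)"
      by (intro emeasure_mono) (auto simp: B_def)
    also have "\<dots> \<le> (\<Sum>i. emeasure lborel (B i))"
      by (intro emeasure_subadditive_countably) (auto simp: B_def)
    also have "\<dots> = (\<Sum>i. ennreal (2 ^ DIM('a)) * hausdorff_weight DIM('a) (U i))"
    proof (rule suminf_cong)
      fix i
      have "diameter (U i) ^ DIM('a) = 2 ^ DIM('a) * (diameter (U i) / 2) ^ DIM('a)"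
        by (simp add: power_divide)
      then show "emeasure lborel (B i) = ennreal (2 ^ DIM('a)) * hausdorff_weight DIM('a) (U i)"
        using diameter_ge_0[OF U[of i]]
        by (simp add: B_def hausdorff_weight_def emeasure_cball ennreal_mult'[symmetric] mult.left_commute)
    qed
    also have "\<dots> = ennreal (2 ^ DIM('a)) * (\<Sum>i. hausdorff_weight DIM('a) (U i))" by simp
    also have "\<dots> \<le> ennreal (2 ^ DIM('a)) * (hausdorff_premeasure DIM('a) 1 A + ennreal (e / 2 ^ DIM('a)))"
      using sum by (intro mult_left_mono) auto
    also have "\<dots> = ennreal (2 ^ DIM('a)) * hausdorff_premeasure DIM('a) 1 A + ennreal e"
      using \<open>0 < e\<close> by (simp add: distrib_left ennreal_mult'[symmetric])
    finally show "emeasure lborel A \<le> \<dots>" .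
  qed
  also have "\<dots> \<le> ennreal (2 ^ DIM('a)) * hausdorff_measure DIM('a) A"
    by (intro mult_left_mono hausdorff_premeasure_le_measure) auto
  finally show ?thesis .
qed

section \<open>Hausdorff measure in the plane\<close>

type_synonym plane = "real \<times> real"

lemma hausdorff_measure_square_finite:
  "hausdorff_measure 2 ({-R..R} \<times> {-R..R} :: plane set) < top" if "0 < R"
proof -
  let ?S = "{-R..R} \<times> {-R..R} :: plane set"
  let ?C = "unit_ball_vol 2 * (2 * R)\<^sup>2"
  have "hausdorff_premeasure 2 \<delta> ?S \<le> ennreal ?C" if "0 < \<delta>" for \<delta> :: real
  proof -
    obtain k :: nat where k: "4 * R / \<delta> < real k" using reals_Archimedean2 by blast
    have "0 < 4 * R / \<delta>" using \<open>0 < R\<close> \<open>0 < \<delta>\<close> by simp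
    with k have k0: "0 < k" by (metis of_nat_0_less_iff order_less_trans)
    define h where "h = 2 * R / real k"
    have h0: "0 < h" using \<open>0 < R\<close> k0 by (simp add: h_def)
    have h: "2 * h \<le> \<delta>" using k \<open>0 < \<delta>\<close> k0 by (simp add: h_def field_simps)
    define I where "I i = {- R + real i * h .. - R + real (Suc i) * h}" for i
    define U where "U n = (if n < k * k then I (n div k) \<times> I (n mod k) else {} :: plane set)" for n
    have I: "\<exists>i<k. x \<in> I i" if "x \<in> {-R..R}" for x
    proof (cases "x = R")
      case True
      have "real k * h = 2 * R" using k0 by (simp add: h_def)
      then have "R \<in> I (k - 1)" using k0 h0 by (auto simp: I_def of_nat_diff algebra_simps)
      then show ?thesis using True k0 by (intro exI[of _ "k - 1"]) auto
    next
      case False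
      define i where "i = nat \<lfloor>(x + R) / h\<rfloor>"
      have nn: "0 \<le> (x + R) / h" using that h0 by auto
      have i1: "real i \<le> (x + R) / h" "(x + R) / h < real i + 1"
        unfolding i_def using nn by linarith+
      have "(x + R) / h < real k"
        using that False h0 k0 by (simp add: h_def field_simps)
      then have "i < k" using i1(1) by linarith
      moreover have "x \<in> I i" using i1 h0 by (simp add: I_def field_simps)
      ultimately show ?thesis by blast
    qed
    have diam: "dist p q \<le> 2 * h" if "p \<in> U n" "q \<in> U n" for p q n
    proof -
      have "\<bar>fst p - fst q\<bar> \<le> h" "\<bar>snd p - snd q\<bar> \<le> h"
        using that by (auto simp: U_def I_def algebra_simps split: if_splits)
      then show ?thesis
        using sqrt_sum_squares_le_sum_abs[of "dist (fst p) (fst q)" "dist (snd p) (snd q)"]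
        by (simp add: dist_prod_def dist_real_def)
    qed
    have bd: "bounded (U n)" for n unfolding bounded_two_points using diam by blast
    have dm: "diameter (U n) \<le> 2 * h" for n
      by (rule diameter_le_dist) (use diam h0 in auto)
    have "hausdorff_premeasure 2 \<delta> ?S \<le> (\<Sum>n. hausdorff_weight 2 (U n))"
    proof (rule hausdorff_premeasure_le[OF _ bd order_trans[OF dm h]], rule subsetI)
      fix p assume "p \<in> ?S"
      then obtain i j where ij: "i < k" "fst p \<in> I i" "j < k" "snd p \<in> I j"
        using I[of "fst p"] I[of "snd p"] by auto
      have "i * k + j < k * k"
      proof -
        have "Suc i * k \<le> k * k" using ij by (intro mult_right_mono) auto
        then show ?thesis using ij by simp
      qed
      then have "p \<in> U (i * k + j)" using ij by (cases p) (simp add: U_def)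
      then show "p \<in> (\<Union>n. U n)" by blast
    qed
    also have "\<dots> = (\<Sum>n<k * k. hausdorff_weight 2 (U n))"
      by (intro suminf_finite) (auto simp: U_def)
    also have "\<dots> \<le> (\<Sum>n<k * k. ennreal (unit_ball_vol 2 * h\<^sup>2))"
    proof (rule sum_mono)
      fix n
      have "(diameter (U n) / 2)\<^sup>2 \<le> h\<^sup>2"
        using dm[of n] diameter_ge_0[OF bd[of n]] by (intro power_mono) auto
      then show "hausdorff_weight 2 (U n) \<le> ennreal (unit_ball_vol 2 * h\<^sup>2)"
        by (auto simp: hausdorff_weight_def intro!: ennreal_leI mult_left_mono)
    qed
    also have "\<dots> = ennreal (real (k * k) * (unit_ball_vol 2 * h\<^sup>2))"
      by (simp add: ennreal_of_nat_eq_real_of_nat ennreal_mult'[symmetric])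
    also have "real (k * k) * (unit_ball_vol 2 * h\<^sup>2) = ?C"
      using k0 by (simp add: h_def power2_eq_square field_simps)
    finally show ?thesis .
  qed
  then have "hausdorff_measure 2 ?S \<le> ennreal ?C"
    unfolding hausdorff_measure_def by (intro SUP_least) auto
  then show ?thesis by (simp add: order_le_less_trans)
qed

lemma hausdorff_measure_bounded_plane_finite:
  fixes A :: "plane set"
  assumes "bounded A"
  shows "hausdorff_measure 2 A < top"
proof -
  obtain R where "0 < R" "\<And>x. x \<in> A \<Longrightarrow> norm x \<le> R" using assms bounded_pos by metis
  then have "\<bar>fst x\<bar> \<le> R \<and> \<bar>snd x\<bar> \<le> R" if "x \<in> A" for x
    using that norm_fst_le[of "fst x" "snd x"] norm_snd_le[of "snd x" "fst x"]
    by (metis order_trans prod.collapse real_norm_def)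
  then have "A \<subseteq> {-R..R} \<times> {-R..R}" by (fastforce simp: abs_le_iff)
  then show ?thesis
    using hausdorff_measure_mono hausdorff_measure_square_finite[OF \<open>0 < R\<close>] by (metis order_le_less_trans)
qed

text \<open>The constant equals \<open>1\<close>, but only its positivity and finiteness matter: both sides of the
  minimality inequality scale with it.\<close>

definition plane_const :: real where
  "plane_const = enn2real (hausdorff_measure 2 (box 0 One :: plane set))"

text \<open>Translation invariance together with finiteness on bounded sets leaves only the
  multiples of Lebesgue measure.\<close>

lemma hausdorff_measure_plane:
  fixes A :: "plane set"
  assumes "A \<in> sets borel"
  shows "hausdorff_measure 2 A = ennreal plane_const * emeasure lborel A"
proof -
  let ?M = "hausdorff 2 :: plane measure"
  have "sigma_finite_measure ?M"
  proof
    show "\<exists>A. countable A \<and> A \<subseteq> sets ?M \<and> \<Union> A = space ?M \<and> (\<forall>a\<in>A. emeasure ?M a \<noteq> \<infinity>)"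
    proof (intro exI[of _ "range (\<lambda>n::nat. cball 0 (real n))"] conjI ballI)
      show "\<Union> (range (\<lambda>n. cball (0::plane) (real n))) = space ?M"
        using real_arch_simple by auto
      show "emeasure ?M a \<noteq> \<infinity>" if "a \<in> range (\<lambda>n::nat. cball 0 (real n))" for a
        using that hausdorff_measure_bounded_plane_finite[of a] by (auto simp: emeasure_hausdorff)
    qed auto
  qed
  moreover have "emeasure ?M ((+) a -` A) = emeasure ?M A" if [measurable]: "A \<in> sets borel" for a A
  proof -
    have [measurable]: "(+) a -` A \<in> sets borel"
      using measurable_sets_borel[of "(+) a" borel A] by auto
    have "A = (+) a ` (+) a -` A" by (auto simp: image_iff intro: bexI[of _ "_ - a"])
    then have "hausdorff_measure 2 A = hausdorff_measure 2 ((+) a -` A)"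
      using hausdorff_measure_isometric_image[of "(+) a -` A" "(+) a" 2] by simp
    then show ?thesis by (simp add: emeasure_hausdorff)
  qed
  ultimately have "emeasure ?M A = emeasure ?M (box 0 One) * emeasure lborel A"
    by (rule translation_invariant_eq_lborel[OF _ sets_hausdorff _ assms])
  then show ?thesis
    using assms hausdorff_measure_bounded_plane_finite[of "box 0 One"]
    by (simp add: emeasure_hausdorff plane_const_def bounded_box)
qed

lemma plane_const_pos: "0 < plane_const"
proof (rule ccontr)
  assume "\<not> ?thesis"
  then have "hausdorff_measure 2 (box 0 One :: plane set) = 0"
    by (subst hausdorff_measure_plane) (auto simp: ennreal_neg)
  then show False
    using emeasure_lborel_le_hausdorff_measure[of "box 0 One :: plane set"]
    by (simp add: emeasure_lborel_box_eq inner_Basis numeral_2_eq_2)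
qed

section \<open>Slicing sets of finite measure\<close>

type_synonym space = "plane \<times> real"

definition slice :: "space set \<Rightarrow> plane \<Rightarrow> real set" where
  "slice S u = {t. (u, t) \<in> S}"

definition slice_count :: "space set \<Rightarrow> plane \<Rightarrow> ennreal" where
  "slice_count S u = emeasure (count_space UNIV) (slice S u)"

text \<open>Projections of Borel sets need not be Borel, but a closed set is a countable union of
  compact ones and these have compact projections. For this reason measurability is settled for
  F-sigma sets before anything else.\<close>

lemma fst_image_fsigma_borel:
  fixes S :: "space set"
  assumes "fsigma_in euclidean S"
  shows "fst ` S \<in> sets borel"
proof -
  obtain C where C: "\<And>n::nat. closed (C n)" "\<Union> (range C) = S"
    using assms unfolding fsigma_in_ascending by auto
  have "fst ` S = (\<Union>n. \<Union>m::nat. fst ` (C n \<inter> cball 0 (real m)))"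
  proof -
    have "S = (\<Union>n. \<Union>m::nat. C n \<inter> cball 0 (real m))"
      using C(2) real_arch_simple by (auto simp: mem_cball_0) 
    then show ?thesis by (auto simp: image_UN)
  qed
  moreover have "fst ` (C n \<inter> cball 0 (real m)) \<in> sets borel" for n m
    using C(1) by (intro borel_compact compact_continuous_image continuous_on_fst continuous_on_id
        closed_Int_compact compact_cball)
  ultimately show ?thesis by auto
qed

text \<open>The line is divided into bins of width \<open>1 / Suc k\<close>. Occupied bins never
  outnumber the points, and for large \<open>k\<close> the points of a finite subset occupy separate
  bins. This turns a cardinality into a countable limit that is measurable in a parameter. The bins
  are not nested, so a lower limit replaces a monotone one.\<close>

lemma emeasure_count_eq_liminf_floor:
  "emeasure (count_space UNIV) A = liminf (\<lambda>k. emeasure (count_space UNIV) ((\<lambda>t. \<lfloor>t * real (Suc k)\<rfloor>) ` A))"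
    (is "?c A = liminf (\<lambda>k. ?d (?f k ` A))")
proof (rule antisym)
  have fin: "ennreal (real (card B)) \<le> liminf (\<lambda>k. ?d (?f k ` A))" if B: "finite B" "B \<subseteq> A" for B
  proof -
    have "eventually (\<lambda>k. inj_on (?f k) B) sequentially"
    proof -
      have "eventually (\<lambda>k. ?f k s \<noteq> ?f k t) sequentially" if "s \<noteq> t" for s t
      proof -
        obtain N :: nat where N: "1 / \<bar>s - t\<bar> < real N" using reals_Archimedean2 by blast
        have "?f k s \<noteq> ?f k t" if "N \<le> k" for k
        proof
          assume "?f k s = ?f k t"
          then have "\<bar>s * real (Suc k) - t * real (Suc k)\<bar> < 1" by linarith
          then have "\<bar>s - t\<bar> * real (Suc k) < 1"
            by (simp add: left_diff_distrib[symmetric] abs_mult)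
          moreover have "1 < \<bar>s - t\<bar> * real N" using N \<open>s \<noteq> t\<close> by (simp add: field_simps)
          moreover have "\<bar>s - t\<bar> * real N \<le> \<bar>s - t\<bar> * real (Suc k)"
            using \<open>N \<le> k\<close> by (intro mult_left_mono) auto
          ultimately show False by linarith
        qed
        then show ?thesis by (auto simp: eventually_sequentially)
      qed
      then have "eventually (\<lambda>k. \<forall>s\<in>B. \<forall>t\<in>B. s \<noteq> t \<longrightarrow> ?f k s \<noteq> ?f k t) sequentially"
        using B(1) by (auto intro!: eventually_ball_finite)
      then show ?thesis by eventually_elim (auto simp: inj_on_def)
    qed
    then have "eventually (\<lambda>k. ennreal (real (card B)) \<le> ?d (?f k ` A)) sequentially"
    proof eventually_elim
      case (elim k)
      have "ennreal (real (card B)) = ?d (?f k ` B)"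
        using B(1) elim by (simp add: emeasure_count_space card_image ennreal_of_nat_eq_real_of_nat)
      also have "\<dots> \<le> ?d (?f k ` A)" using B(2) by (intro emeasure_mono) auto
      finally show ?case .
    qed
    then show ?thesis by (rule Liminf_bounded)
  qed
  show "?c A \<le> liminf (\<lambda>k. ?d (?f k ` A))"
  proof (cases "finite A")
    case True
    then show ?thesis using fin[of A] by (simp add: emeasure_count_space ennreal_of_nat_eq_real_of_nat)
  next
    case False
    have "ennreal (real n) \<le> liminf (\<lambda>k. ?d (?f k ` A))" for n
      using infinite_arbitrarily_large[OF False, of n] fin by metis
    then have "liminf (\<lambda>k. ?d (?f k ` A)) = top"
      by (metis ennreal_of_nat_eq_real_of_nat ennreal_Ex_less_of_nat leD less_top)
    then show ?thesis by simp
  qed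
  have "?d (?f k ` A) \<le> ?c A" for k
    by (cases "finite A") (auto simp: emeasure_count_space card_image_le)
  then have "liminf (\<lambda>k. ?d (?f k ` A)) \<le> liminf (\<lambda>k::nat. ?c A)"
    by (intro Liminf_mono) auto
  then show "liminf (\<lambda>k. ?d (?f k ` A)) \<le> ?c A"
    by (simp add: Liminf_const)
qed

text \<open>A horizontal layer of thickness \<open>1 / Suc k\<close>. The integer index is decoded
  from a natural number so that sums over all layers are ordinary series.\<close>

definition slab :: "nat \<Rightarrow> nat \<Rightarrow> space set" where
  "slab k j = {p. \<lfloor>snd p * real (Suc k)\<rfloor> = int_decode j}"

lemma slab_fsigma: "fsigma_in euclidean (slab k j)"
proof -
  let ?a = "\<lambda>p. snd p * real (Suc k)" let ?i = "real_of_int (int_decode j)"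
  have "slab k j = {p. ?i \<le> ?a p} \<inter> {p. ?a p < ?i + 1}"
    unfolding slab_def by (auto simp: floor_eq_iff)
  also have "fsigma_in euclidean \<dots>"
  proof (rule fsigma_in_Int)
    have "closed {p::space. ?i \<le> ?a p}" by (intro closed_Collect_le continuous_intros)
    then show "fsigma_in euclidean {p::space. ?i \<le> ?a p}" by (intro closed_imp_fsigma_in) simp
    have "open {p::space. ?a p < ?i + 1}" by (intro open_Collect_less continuous_intros)
    then show "fsigma_in euclidean {p::space. ?a p < ?i + 1}"
      by (intro open_imp_fsigma_in metrizable_space_euclidean) simp
  qed
  finally show ?thesis .
qed

lemma fsigma_in_borel: "fsigma_in euclidean S \<Longrightarrow> S \<in> sets borel" for S :: "'a::topological_space set"
  unfolding fsigma_in_ascending by auto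

lemma slab_borel [measurable]: "slab k j \<in> sets borel"
  by (rule fsigma_in_borel[OF slab_fsigma])

lemma slice_count_eq_liminf:
  "slice_count S u = liminf (\<lambda>k. \<Sum>j. indicator (fst ` (S \<inter> slab k j)) u)"
proof -
  have "emeasure (count_space UNIV) ((\<lambda>t. \<lfloor>t * real (Suc k)\<rfloor>) ` slice S u)
      = (\<Sum>j. indicator (fst ` (S \<inter> slab k j)) u)" for k
  proof -
    let ?J = "(\<lambda>t. \<lfloor>t * real (Suc k)\<rfloor>) ` slice S u"
    have "emeasure (count_space UNIV) ?J = emeasure (count_space (UNIV::nat set)) (int_decode -` ?J)"
    proof -
      have "?J = int_decode ` (int_decode -` ?J)"
        using bij_int_decode by (simp add: bij_is_surj surj_image_vimage_eq)
      moreover have "inj_on int_decode X" for X using bij_int_decode by (simp add: bij_def inj_on_def)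
      ultimately show ?thesis
        by (metis (no_types, lifting) emeasure_count_space finite_image_iff card_image subset_UNIV)
    qed
    also have "\<dots> = (\<integral>\<^sup>+j. indicator (int_decode -` ?J) j \<partial>count_space UNIV)" by simp
    also have "\<dots> = (\<Sum>j. indicator (int_decode -` ?J) j)"
      by (rule nn_integral_count_space_nat)
    also have "\<dots> = (\<Sum>j. indicator (fst ` (S \<inter> slab k j)) u)"
      by (intro suminf_cong) (force simp: indicator_def slab_def slice_def image_iff)
    finally show ?thesis .
  qed
  then show ?thesis
    unfolding slice_count_def by (subst emeasure_count_eq_liminf_floor) simp
qed

lemma slice_count_measurable_fsigma:
  assumes "fsigma_in euclidean S"
  shows "slice_count S \<in> borel_measurable borel"
proof -
  have [measurable]: "fst ` (S \<inter> slab k j) \<in> sets borel" for k j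
    by (intro fst_image_fsigma_borel fsigma_in_Int assms slab_fsigma)
  show ?thesis unfolding slice_count_eq_liminf[abs_def] by measurable
qed

text \<open>Projection is 1-Lipschitz and so does not increase the measure of the part of
  \<open>S\<close> in a layer. The layers are disjoint, which bounds the projected total by the
  measure of \<open>S\<close> for every \<open>k\<close>, and Fatou's lemma passes to the count
  itself.\<close>

lemma nn_integral_slice_count_le:
  assumes S: "fsigma_in euclidean S"
  shows "(\<integral>\<^sup>+u. slice_count S u \<partial>lborel) \<le> ennreal (1 / plane_const) * hausdorff_measure 2 S"
proof -
  have Sb [measurable]: "S \<in> sets borel" by (rule fsigma_in_borel[OF S])
  have b [measurable]: "fst ` (S \<inter> slab k j) \<in> sets borel" for k j
    by (intro fst_image_fsigma_borel fsigma_in_Int assms slab_fsigma)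
  have bound: "ennreal plane_const * (\<integral>\<^sup>+u. (\<Sum>j. indicator (fst ` (S \<inter> slab k j)) u) \<partial>lborel)
      \<le> hausdorff_measure 2 S" for k
  proof -
    have "ennreal plane_const * (\<integral>\<^sup>+u. (\<Sum>j. indicator (fst ` (S \<inter> slab k j)) u) \<partial>lborel)
        = (\<Sum>j. ennreal plane_const * emeasure lborel (fst ` (S \<inter> slab k j)))"
      by (subst nn_integral_suminf) auto
    also have "\<dots> = (\<Sum>j. hausdorff_measure 2 (fst ` (S \<inter> slab k j)))"
      by (simp add: hausdorff_measure_plane)
    also have "\<dots> \<le> (\<Sum>j. emeasure (hausdorff 2) (S \<inter> slab k j))"
    proof (rule suminf_le)
      fix j
      have "hausdorff_measure 2 (fst ` (S \<inter> slab k j)) \<le> hausdorff_measure 2 (S \<inter> slab k j)"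
        using hausdorff_measure_lipschitz_image[of "S \<inter> slab k j" fst 1 2] by (simp add: dist_fst_le)
      then show "hausdorff_measure 2 (fst ` (S \<inter> slab k j)) \<le> emeasure (hausdorff 2) (S \<inter> slab k j)"
        by (simp add: emeasure_hausdorff)
    qed auto
    also have "\<dots> = emeasure (hausdorff 2) (\<Union>j. S \<inter> slab k j)"
    proof (rule suminf_emeasure)
      show "disjoint_family (\<lambda>j. S \<inter> slab k j)"
        unfolding disjoint_family_on_def slab_def by (auto, metis int_decode_inverse)
    qed auto
    also have "(\<Union>j. S \<inter> slab k j) = S"
    proof -
      have "\<exists>j. p \<in> slab k j" for p
        by (rule exI[of _ "int_encode \<lfloor>snd p * real (Suc k)\<rfloor>"]) (simp add: slab_def)
      then show ?thesis by blast
    qed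
    finally show ?thesis by (simp add: emeasure_hausdorff)
  qed
  have "(\<integral>\<^sup>+u. (\<Sum>j. indicator (fst ` (S \<inter> slab k j)) u) \<partial>lborel)
      \<le> ennreal (1 / plane_const) * hausdorff_measure 2 S" (is "?I \<le> _") for k
  proof -
    have "?I = ennreal (1 / plane_const) * (ennreal plane_const * ?I)"
      using plane_const_pos by (simp add: mult.assoc[symmetric] ennreal_mult'[symmetric])
    also have "\<dots> \<le> ennreal (1 / plane_const) * hausdorff_measure 2 S"
      by (intro mult_left_mono bound) auto
    finally show ?thesis .
  qed
  then have "liminf (\<lambda>k. \<integral>\<^sup>+u. (\<Sum>j. indicator (fst ` (S \<inter> slab k j)) u) \<partial>lborel)
      \<le> liminf (\<lambda>k::nat. ennreal (1 / plane_const) * hausdorff_measure 2 S)"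
    by (intro Liminf_mono) auto
  moreover have "(\<integral>\<^sup>+u. slice_count S u \<partial>lborel)
      \<le> liminf (\<lambda>k. \<integral>\<^sup>+u. (\<Sum>j. indicator (fst ` (S \<inter> slab k j)) u) \<partial>lborel)"
    unfolding slice_count_eq_liminf[abs_def] by (intro nn_integral_liminf) auto
  ultimately show ?thesis by (simp add: Liminf_const)
qed

section \<open>The measure obtained by integrating the counts over all vertical lines\<close>

text \<open>The fibres meeting \<open>F\<close> infinitely often form a null set when \<open>F\<close> has finite measure; they are
  discarded so that the counting measures below are finite.\<close>

definition fibre_measure :: "space set \<Rightarrow> plane \<Rightarrow> space set \<Rightarrow> ennreal" where
  "fibre_measure F u A = (if slice_count F u = top then 0 else slice_count (F \<inter> A) u)"

definition fibre_integral :: "space set \<Rightarrow> (space \<Rightarrow> ennreal) \<Rightarrow> plane \<Rightarrow> ennreal" where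
  "fibre_integral F g u =
    (if slice_count F u = top then 0 else (\<integral>\<^sup>+t. g (u, t) * indicator F (u, t) \<partial>count_space UNIV))"

definition slice_measure :: "space set \<Rightarrow> space measure" where
  "slice_measure F = measure_of UNIV (sets borel) (\<lambda>A. \<integral>\<^sup>+u. fibre_measure F u A \<partial>lborel)"

lemma sets_slice_measure [simp, measurable_cong]: "sets (slice_measure F) = sets borel"
  unfolding slice_measure_def using sets.sigma_sets_eq[of borel] by (simp add: sets_measure_of_conv)

lemma space_slice_measure [simp]: "space (slice_measure F) = UNIV"
  unfolding slice_measure_def by (simp add: space_measure_of_conv)

lemma slice_count_eq_top_iff: "slice_count S u = top \<longleftrightarrow> infinite (slice S u)"
  by (simp add: slice_count_def emeasure_count_space ennreal_of_nat_eq_real_of_nat)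

lemma fibre_measure_eq_integral: "fibre_measure F u A = fibre_integral F (indicator A) u"
proof -
  have "(\<integral>\<^sup>+t. indicator A (u, t) * indicator F (u, t) \<partial>count_space UNIV)
      = (\<integral>\<^sup>+t. indicator (slice (F \<inter> A) u) t \<partial>count_space UNIV)"
    by (intro nn_integral_cong) (auto simp: slice_def indicator_def)
  then show ?thesis by (simp add: fibre_measure_def fibre_integral_def slice_count_def)
qed

lemma fibre_measure_countably_additive:
  assumes "disjoint_family A"
  shows "(\<Sum>i. fibre_measure F u (A i)) = fibre_measure F u (\<Union>i::nat. A i)"
proof -
  have "(\<Sum>i. emeasure (count_space UNIV) (slice (F \<inter> A i) u))
      = emeasure (count_space UNIV) (\<Union>i. slice (F \<inter> A i) u)"
    using assms by (intro suminf_emeasure) (auto simp: disjoint_family_on_def slice_def)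
  moreover have "(\<Union>i. slice (F \<inter> A i) u) = slice (F \<inter> (\<Union>i. A i)) u" by (auto simp: slice_def)
  ultimately show ?thesis by (simp add: fibre_measure_def slice_count_def)
qed

context
  fixes F :: "space set"
  assumes F: "closed F"
begin

text \<open>Measurability starts from open sets, whose traces on \<open>F\<close> are F-sigma, and
  spreads by Dynkin's theorem. A complement is handled by subtracting counts, which requires them to
  be finite.\<close>

lemma fibre_measure_measurable:
  assumes "A \<in> sets borel"
  shows "(\<lambda>u. fibre_measure F u A) \<in> borel_measurable borel"
proof -
  have closed: "fsigma_in euclidean F" using F by (auto intro: closed_imp_fsigma_in)
  have op: "(\<lambda>u. fibre_measure F u A) \<in> borel_measurable borel" if "open A" for A
  proof -
    have "fsigma_in euclidean (F \<inter> A)"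
      using that by (intro fsigma_in_Int[OF closed] open_imp_fsigma_in metrizable_space_euclidean) simp
    from slice_count_measurable_fsigma[OF this] slice_count_measurable_fsigma[OF closed]
    show ?thesis unfolding fibre_measure_def by measurable
  qed
  have "Int_stable (Collect open :: space set set)" by (auto simp: Int_stable_def)
  moreover have "Collect open \<subseteq> Pow (UNIV :: space set)" by simp
  moreover have "A \<in> sigma_sets UNIV (Collect open)"
    using assms by (simp add: borel_def)
  ultimately show ?thesis
  proof (induction rule: sigma_sets_induct_disjoint)
    case (basic A)
    then show ?case by (auto intro: op)
  next
    case empty
    then show ?case by (auto intro: op)
  next
    case (compl A)
    have "fibre_measure F u (UNIV - A) = fibre_measure F u UNIV - fibre_measure F u A" for u
    proof (cases "slice_count F u = top")
      case False
      then have "finite (slice F u)" by (simp add: slice_count_eq_top_iff)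
      then have "emeasure (count_space UNIV) (slice F u - slice (F \<inter> A) u)
          = emeasure (count_space UNIV) (slice F u) - emeasure (count_space UNIV) (slice (F \<inter> A) u)"
        by (intro emeasure_Diff) (auto simp: slice_def emeasure_count_space finite_subset)
      moreover have "slice (F \<inter> (UNIV - A)) u = slice F u - slice (F \<inter> A) u" by (auto simp: slice_def)
      ultimately show ?thesis using False by (simp add: fibre_measure_def slice_count_def)
    qed (simp add: fibre_measure_def)
    then show ?case using compl op[of UNIV] by simp
  next
    case (union A)
    then show ?case using fibre_measure_countably_additive[of A F] by (simp flip: fibre_measure_countably_additive)
  qed
qed

lemma emeasure_slice_measure:
  assumes "A \<in> sets borel"
  shows "emeasure (slice_measure F) A = (\<integral>\<^sup>+u. fibre_measure F u A \<partial>lborel)"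
proof -
  have "fibre_measure F u {} = 0" for u
    by (cases "slice_count F u = top") (simp_all add: fibre_measure_eq_integral fibre_integral_def)
  then have "positive (sets borel) (\<lambda>A. \<integral>\<^sup>+u. fibre_measure F u A \<partial>lborel)"
    by (simp add: positive_def)
  moreover have "countably_additive (sets borel) (\<lambda>A. \<integral>\<^sup>+u. fibre_measure F u A \<partial>lborel)"
    unfolding countably_additive_def
  proof (intro allI impI)
    fix A :: "nat \<Rightarrow> space set" assume A: "range A \<subseteq> sets borel" "disjoint_family A"
    then have [measurable]: "(\<lambda>u. fibre_measure F u (A i)) \<in> borel_measurable borel" for i
      by (auto intro: fibre_measure_measurable)
    have "(\<Sum>i. \<integral>\<^sup>+u. fibre_measure F u (A i) \<partial>lborel) = (\<integral>\<^sup>+u. (\<Sum>i. fibre_measure F u (A i)) \<partial>lborel)"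
      by (intro nn_integral_suminf[symmetric]) measurable
    then show "(\<Sum>i. \<integral>\<^sup>+u. fibre_measure F u (A i) \<partial>lborel) = (\<integral>\<^sup>+u. fibre_measure F u (\<Union> (range A)) \<partial>lborel)"
      by (simp add: fibre_measure_countably_additive[OF A(2)])
  qed
  ultimately show ?thesis
    unfolding slice_measure_def using assms
    by (intro emeasure_measure_of_sigma) (auto simp: sets.sigma_algebra_axioms[of borel, simplified])
qed

text \<open>For open sets this is \<open>nn_integral_slice_count_le\<close>. The Hausdorff measure
  restricted to \<open>F\<close> is finite, hence outer regular, and this carries the inequality to
  all Borel sets.\<close>

lemma slice_measure_le_hausdorff:
  assumes fin: "hausdorff_measure 2 F < top" and A [measurable]: "A \<in> sets borel"
  shows "emeasure (slice_measure F) A \<le> ennreal (1 / plane_const) * hausdorff_measure 2 (F \<inter> A)"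
proof -
  have [measurable]: "F \<in> sets borel" using F by (rule borel_closed)
  define M where "M = density (hausdorff 2) (indicator F)"
  have emM: "emeasure M B = hausdorff_measure 2 (F \<inter> B)" if [measurable]: "B \<in> sets borel" for B
  proof -
    have "emeasure M B = (\<integral>\<^sup>+x. indicator F x * indicator B x \<partial>hausdorff 2)"
      unfolding M_def by (rule emeasure_density) auto
    also have "\<dots> = (\<integral>\<^sup>+x. indicator (F \<inter> B) x \<partial>hausdorff 2)"
      by (simp only: indicator_inter_arith)
    finally show ?thesis by (simp add: emeasure_hausdorff)
  qed
  have op: "emeasure (slice_measure F) U \<le> ennreal (1 / plane_const) * emeasure M U" if "open U" for U
  proof -
    have "fsigma_in euclidean F" "fsigma_in euclidean U"
      using F that by (auto intro: closed_imp_fsigma_in open_imp_fsigma_in metrizable_space_euclidean)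
    then have "fsigma_in euclidean (F \<inter> U)" by (rule fsigma_in_Int)
    from nn_integral_slice_count_le[OF this]
    have "(\<integral>\<^sup>+u. slice_count (F \<inter> U) u \<partial>lborel) \<le> ennreal (1 / plane_const) * emeasure M U"
      using that by (simp add: emM)
    moreover have "emeasure (slice_measure F) U \<le> (\<integral>\<^sup>+u. slice_count (F \<inter> U) u \<partial>lborel)"
      using that by (subst emeasure_slice_measure) (auto simp: fibre_measure_def intro!: nn_integral_mono)
    ultimately show ?thesis by (rule order_trans[rotated])
  qed
  have "emeasure M (space M) \<noteq> \<infinity>" using fin emM[of UNIV] by (simp add: M_def space_density)
  then have "emeasure M A = (INF U \<in> {U. A \<subseteq> U \<and> open U}. emeasure M U)"
    by (intro outer_regular) (auto simp: M_def)
  show ?thesis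
  proof (rule ennreal_le_epsilon)
    fix e :: real assume "0 < e"
    then have "emeasure M A < emeasure M A + ennreal (e * plane_const)"
      using fin emM[of A] hausdorff_measure_mono[of "F \<inter> A" F 2] plane_const_pos
      by (auto simp: less_top[symmetric] top_unique)
    then obtain U where U: "A \<subseteq> U" "open U" "emeasure M U < emeasure M A + ennreal (e * plane_const)"
      unfolding \<open>emeasure M A = (INF U \<in> {U. A \<subseteq> U \<and> open U}. emeasure M U)\<close> INF_less_iff by auto
    have "emeasure (slice_measure F) A \<le> emeasure (slice_measure F) U"
      using U by (intro emeasure_mono) auto
    also have "\<dots> \<le> ennreal (1 / plane_const) * emeasure M U" by (rule op[OF U(2)])
    also have "\<dots> \<le> ennreal (1 / plane_const) * (emeasure M A + ennreal (e * plane_const))"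
      using U(3) by (intro mult_left_mono) auto
    also have "\<dots> = ennreal (1 / plane_const) * hausdorff_measure 2 (F \<inter> A) + ennreal e"
      using \<open>0 < e\<close> plane_const_pos by (simp add: emM distrib_left ennreal_mult'[symmetric])
    finally show "emeasure (slice_measure F) A \<le> \<dots>" .
  qed
qed

text \<open>A Fubini formula for \<open>slice_measure\<close>. Measurability is part of the
  statement because the monotone class induction needs it along with the formula at each
  stage.\<close>

lemma nn_integral_slice_measure:
  assumes "g \<in> borel_measurable borel"
  shows "(\<lambda>u. fibre_integral F g u) \<in> borel_measurable borel \<and>
    (\<integral>\<^sup>+p. g p \<partial>slice_measure F) = (\<integral>\<^sup>+u. fibre_integral F g u \<partial>lborel)"
  using assms
proof (induction rule: borel_measurable_induct)
  case (cong f g)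
  then have "f = g" by auto
  then show ?case using cong by simp
next
  case (set A)
  then show ?case
    by (simp add: fibre_measure_eq_integral[symmetric, abs_def] emeasure_slice_measure fibre_measure_measurable)
next
  case (mult g c)
  have "fibre_integral F (\<lambda>x. c * g x) = (\<lambda>u. c * fibre_integral F g u)"
    by (auto simp: fibre_integral_def fun_eq_iff nn_integral_cmult mult.assoc)
  moreover have [measurable]: "fibre_integral F g \<in> borel_measurable borel" using mult by simp
  ultimately show ?case using mult by (simp add: nn_integral_cmult)
next
  case (add f g)
  have "fibre_integral F (\<lambda>x. g x + f x) = (\<lambda>u. fibre_integral F g u + fibre_integral F f u)"
    by (auto simp: fibre_integral_def fun_eq_iff nn_integral_add distrib_right)
  moreover have [measurable]: "fibre_integral F g \<in> borel_measurable borel"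
      "fibre_integral F f \<in> borel_measurable borel" using add by simp_all
  ultimately show ?case using add by (simp add: nn_integral_add)
next
  case (seq U)
  have mono: "U m p \<le> U n p" if "m \<le> n" for m n p
    using incseqD[OF \<open>incseq U\<close> that] by (rule le_funD)
  have eq: "fibre_integral F (Sup (range U)) = (\<lambda>u. SUP i. fibre_integral F (U i) u)"
  proof
    fix u
    show "fibre_integral F (Sup (range U)) u = (SUP i. fibre_integral F (U i) u)"
    proof (cases "slice_count F u = top")
      case False
      have "(\<integral>\<^sup>+t. (SUP i. U i (u, t) * indicator F (u, t)) \<partial>count_space UNIV)
          = (SUP i. \<integral>\<^sup>+t. U i (u, t) * indicator F (u, t) \<partial>count_space UNIV)"
        by (intro nn_integral_monotone_convergence_SUP)
          (auto simp: incseq_def le_fun_def intro!: mult_right_mono mono)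
      then show ?thesis using False
        by (simp add: fibre_integral_def SUP_mult_right_ennreal image_comp SUP_apply)
    qed (simp add: fibre_integral_def)
  qed
  have inc: "incseq (\<lambda>i. fibre_integral F (U i))"
    unfolding fibre_integral_def incseq_def le_fun_def
    by (auto intro!: nn_integral_mono mult_right_mono mono)
  have "Sup (range U) = (\<lambda>p. SUP i. U i p)" by (simp add: fun_eq_iff image_comp)
  then have "(\<integral>\<^sup>+p. Sup (range U) p \<partial>slice_measure F) = (\<integral>\<^sup>+p. (SUP i. U i p) \<partial>slice_measure F)"
    by simp
  also have "\<dots> = (SUP i. \<integral>\<^sup>+p. U i p \<partial>slice_measure F)"
    using seq.hyps(1) \<open>incseq U\<close> by (intro nn_integral_monotone_convergence_SUP) auto
  also have "\<dots> = (SUP i. \<integral>\<^sup>+u. fibre_integral F (U i) u \<partial>lborel)" using seq by simp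
  also have "\<dots> = (\<integral>\<^sup>+u. (SUP i. fibre_integral F (U i) u) \<partial>lborel)"
    using seq inc by (intro nn_integral_monotone_convergence_SUP[symmetric]) auto
  finally have "(\<integral>\<^sup>+p. Sup (range U) p \<partial>slice_measure F) = (\<integral>\<^sup>+u. (SUP i. fibre_integral F (U i) u) \<partial>lborel)" .
  moreover have [measurable]: "fibre_integral F (U i) \<in> borel_measurable borel" for i using seq by simp
  have "(\<lambda>u. SUP i. fibre_integral F (U i) u) \<in> borel_measurable borel" by measurable
  ultimately show ?case unfolding \<open>g = Sup (range U)\<close> eq by (intro conjI)
qed

end

section \<open>Integration by parts against piecewise constant functions\<close>

lemma locally_constant_at_left:
  fixes w :: "real \<Rightarrow> 'a"
  assumes "finite S" and lc: "\<And>t. t \<notin> S \<Longrightarrow> \<forall>\<^sub>F s in nhds t. w s = w t"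
  shows "\<exists>l. \<forall>\<^sub>F s in at_left t. w s = l"
proof -
  obtain d where d: "0 < d" "\<And>s. s \<in> S \<Longrightarrow> s \<noteq> t \<Longrightarrow> d \<le> dist t s"
    using finite_set_avoid[OF \<open>finite S\<close>, of t] by blast
  have "w s = w (t - d / 2)" if s: "s \<in> {t - d<..<t}" for s
  proof (rule connected_local_const[where A = "{t - d<..<t}" and f = w])
    show "\<forall>a\<in>{t - d<..<t}. \<forall>\<^sub>F b in at a within {t - d<..<t}. w a = w b"
    proof
      fix a assume a: "a \<in> {t - d<..<t}"
      then have "a \<notin> S" using d(2)[of a] by (auto simp: dist_real_def)
      from lc[OF this] show "\<forall>\<^sub>F b in at a within {t - d<..<t}. w a = w b"
        unfolding eventually_at_filter by eventually_elim auto
    qed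
  qed (use s d(1) in auto)
  moreover have "\<forall>\<^sub>F s in at_left t. s \<in> {t - d<..<t}"
    using d(1) by (intro eventually_at_leftI[of "t - d"]) auto
  ultimately have "\<forall>\<^sub>F s in at_left t. w s = w (t - d / 2)" by (auto elim!: eventually_mono)
  then show ?thesis ..
qed

lemma locally_constant_at_right:
  fixes w :: "real \<Rightarrow> 'a"
  assumes "finite S" and lc: "\<And>t. t \<notin> S \<Longrightarrow> \<forall>\<^sub>F s in nhds t. w s = w t"
  shows "\<exists>l. \<forall>\<^sub>F s in at_right t. w s = l"
proof -
  have "\<forall>\<^sub>F s in nhds t'. w (- s) = w (- t')" if "t' \<notin> uminus ` S" for t'
  proof -
    have "- t' \<notin> S" using that by (metis add.inverse_inverse image_eqI)
    from lc[OF this] show ?thesis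
      by (simp add: filtermap_nhds_minus[symmetric] eventually_filtermap)
  qed
  from locally_constant_at_left[of "uminus ` S" "\<lambda>s. w (- s)" "- t", OF _ this]
  obtain l where "\<forall>\<^sub>F s in at_left (- t). w (- s) = l" using \<open>finite S\<close> by auto
  then show ?thesis
    by (auto simp: at_right_minus[of t] eventually_filtermap)
qed

text \<open>Induction on the number of jumps: removing one of them leaves a function with fewer
  jumps, and the part removed is a step function, integrated by the fundamental theorem. The values
  of \<open>w\<close> at the points of \<open>S\<close> do not matter, only its one-sided limits
  do.\<close>

lemma jump_formula_1d:
  fixes w \<psi> \<psi>' j :: "real \<Rightarrow> real"
  assumes "finite S" and "\<And>t. t \<notin> S \<Longrightarrow> \<forall>\<^sub>F s in nhds t. w s = w t"
    and "\<And>t. t \<in> S \<Longrightarrow> \<exists>l r. (\<forall>\<^sub>F s in at_left t. w s = l) \<and> (\<forall>\<^sub>F s in at_right t. w s = r) \<and> j t = r - l"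
    and der: "\<And>t. (\<psi> has_real_derivative \<psi>' t) (at t)"
    and R: "0 < R" and "S \<subseteq> {-R<..<R}"
  shows "((\<lambda>t. w t * \<psi>' t) has_integral (w R * \<psi> R - w (- R) * \<psi> (- R) - (\<Sum>t\<in>S. \<psi> t * j t))) {-R..R}"
  using assms(1-3) \<open>S \<subseteq> {-R<..<R}\<close>
proof (induction S arbitrary: w rule: finite_induct)
  have ftc: "(\<psi>' has_integral (\<psi> b - \<psi> a)) {a..b}" if "a \<le> b" for a b
    using that der by (intro fundamental_theorem_of_calculus)
      (auto simp: has_real_derivative_iff_has_vector_derivative[symmetric] intro: has_field_derivative_at_within)
  {
    case empty
    define c where "c = w R"
    have const: "w t = c" for t
      unfolding c_def
    proof (rule connected_local_const[where A = UNIV and f = w])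
      show "\<forall>a\<in>UNIV. \<forall>\<^sub>F b in at a within UNIV. w a = w b"
      proof
        fix a show "\<forall>\<^sub>F b in at a within UNIV. w a = w b"
          unfolding eventually_at_filter using empty(1)[of a, simplified] by eventually_elim simp
      qed
    qed auto
    have "((\<lambda>t. c * \<psi>' t) has_integral (c * (\<psi> R - \<psi> (- R)))) {-R..R}"
      using R by (intro has_integral_mult_right ftc) auto
    then show ?case by (simp add: const right_diff_distrib)
  next
    case (insert s S)
    obtain l r where lr: "\<forall>\<^sub>F t in at_left s. w t = l" "\<forall>\<^sub>F t in at_right s. w t = r" "j s = r - l"
      using insert.prems(2)[of s] by auto
    \<comment> \<open>To the right of \<open>s\<close> the jump is subtracted, and at
      \<open>s\<close> the left limit is inserted, so \<open>v\<close> is locally constant at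
      \<open>s\<close> and still jumps by \<open>j\<close> at the points of
      \<open>S\<close>.\<close>
    define v where "v t = (if t = s then l else if s < t then w t - j s else w t)" for t
    have v_less: "\<forall>\<^sub>F x in nhds t. v x = w x" if "t < s" for t
      using eventually_nhds_in_open[OF open_lessThan, of t s] that
      by (auto elim!: eventually_mono simp: v_def)
    have v_gr: "\<forall>\<^sub>F x in nhds t. v x = w x - j s" if "s < t" for t
      using eventually_nhds_in_open[OF open_greaterThan, of t s] that
      by (auto elim!: eventually_mono simp: v_def)
    have lcv: "\<forall>\<^sub>F x in nhds t. v x = v t" if "t \<notin> S" for t
    proof (cases t s rule: linorder_cases)
      case less
      with that insert.prems(1)[of t] have "\<forall>\<^sub>F x in nhds t. w x = w t" by auto
      with v_less[OF less] show ?thesis by eventually_elim (use less in \<open>auto simp: v_def\<close>)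
    next
      case greater
      with that insert.prems(1)[of t] have "\<forall>\<^sub>F x in nhds t. w x = w t" by auto
      with v_gr[OF greater] show ?thesis by eventually_elim (use greater in \<open>auto simp: v_def\<close>)
    next
      case equal
      have "\<forall>\<^sub>F x in at_left s. v x = l" "\<forall>\<^sub>F x in at_right s. v x = l"
        using lr by (auto simp: v_def eventually_at_filter elim!: eventually_mono)
      then have "\<forall>\<^sub>F x in at s. v x = v s"
        by (simp add: eventually_at_split v_def)
      then show ?thesis unfolding equal eventually_at_filter by (auto elim: eventually_mono)
    qed
    have jv: "\<exists>l r. (\<forall>\<^sub>F x in at_left t. v x = l) \<and> (\<forall>\<^sub>F x in at_right t. v x = r) \<and> j t = r - l"
      if tS: "t \<in> S" for t
    proof -
      obtain l' r' where lr': "\<forall>\<^sub>F x in at_left t. w x = l'" "\<forall>\<^sub>F x in at_right t. w x = r'" "j t = r' - l'"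
        using insert.prems(2)[of t] tS by auto
      have "t \<noteq> s" using tS insert.hyps by auto
      define c where "c = (if s < t then j s else 0)"
      have "\<forall>\<^sub>F x in nhds t. v x = w x - c"
        using v_less[of t] v_gr[of t] \<open>t \<noteq> s\<close> by (cases "s < t") (auto simp: c_def)
      then have c: "\<forall>\<^sub>F x in at_left t. v x = w x - c" "\<forall>\<^sub>F x in at_right t. v x = w x - c"
        by (auto simp: eventually_at_filter elim: eventually_mono)
      have "\<forall>\<^sub>F x in at_left t. v x = l' - c" using c(1) lr'(1) by eventually_elim simp
      moreover have "\<forall>\<^sub>F x in at_right t. v x = r' - c" using c(2) lr'(2) by eventually_elim simp
      ultimately show ?thesis using lr'(3) by (intro exI[of _ "l' - c"] exI[of _ "r' - c"]) auto
    qed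
    have s: "- R < s" "s < R" using insert.prems(3) by auto
    have 1: "((\<lambda>t. v t * \<psi>' t) has_integral (v R * \<psi> R - v (- R) * \<psi> (- R) - (\<Sum>t\<in>S. \<psi> t * j t))) {-R..R}"
      using insert.prems(3) by (intro insert.IH lcv jv) auto
    have "((\<lambda>t. j s * \<psi>' t) has_integral (j s * (\<psi> R - \<psi> s))) {s..R}"
      using s by (intro has_integral_mult_right ftc) auto
    then have 2: "((\<lambda>t. if t \<in> {s..R} then j s * \<psi>' t else 0) has_integral (j s * (\<psi> R - \<psi> s))) {-R..R}"
      using s by (subst has_integral_restrict) auto
    have "((\<lambda>t. w t * \<psi>' t) has_integral (v R * \<psi> R - v (- R) * \<psi> (- R) - (\<Sum>t\<in>S. \<psi> t * j t)
        + j s * (\<psi> R - \<psi> s))) {-R..R}"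
      by (rule has_integral_spike_finite[OF _ _ has_integral_add[OF 1 2], of "{s}"])
        (auto simp: v_def algebra_simps)
    also have "v R * \<psi> R - v (- R) * \<psi> (- R) - (\<Sum>t\<in>S. \<psi> t * j t) + j s * (\<psi> R - \<psi> s)
        = w R * \<psi> R - w (- R) * \<psi> (- R) - (\<Sum>t\<in>insert s S. \<psi> t * j t)"
      using s insert.hyps by (simp add: v_def algebra_simps)
    finally show ?case .
  }
qed

lemma indicator_slice: "indicator F (u, t) = indicator (slice F u) t"
  by (simp add: indicator_def slice_def)

context
  fixes F :: "space set"
  assumes F: "closed F" and fin: "hausdorff_measure 2 F < top"
begin

lemma AE_finite_slice: "AE u in lborel. finite (slice F u)"
proof -
  have fs: "fsigma_in euclidean F" using F by (intro closed_imp_fsigma_in) simp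
  have "(\<integral>\<^sup>+u. slice_count F u \<partial>lborel) \<noteq> \<infinity>"
    using nn_integral_slice_count_le[OF fs] fin
    by (metis ennreal_mult_less_top ennreal_less_top infinity_ennreal_def leD)
  then have "AE u in lborel. slice_count F u \<noteq> \<infinity>"
    using slice_count_measurable_fsigma[OF fs] by (intro nn_integral_PInf_AE) auto
  then show ?thesis by eventually_elim (simp add: slice_count_eq_top_iff)
qed

lemma finite_measure_slice_measure: "finite_measure (slice_measure F)"
proof
  have "emeasure (slice_measure F) UNIV \<le> ennreal (1 / plane_const) * hausdorff_measure 2 (F \<inter> UNIV)"
    by (rule slice_measure_le_hausdorff[OF F fin]) auto
  also have "\<dots> < top" using fin by (simp add: ennreal_mult_less_top)
  finally show "emeasure (slice_measure F) (space (slice_measure F)) \<noteq> \<infinity>" by simp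
qed

definition fibre_sum :: "(space \<Rightarrow> real) \<Rightarrow> plane \<Rightarrow> real" where
  "fibre_sum g u = (if finite (slice F u) then \<Sum>t\<in>slice F u. g (u, t) else 0)"

lemma has_bochner_integral_fibre_sum_nonneg:
  assumes g [measurable]: "g \<in> borel_measurable borel" and bd: "\<And>p. 0 \<le> g p" "\<And>p. g p \<le> C"
  shows "has_bochner_integral lborel (fibre_sum g) (\<integral>p. g p \<partial>slice_measure F)"
proof -
  interpret finite_measure "slice_measure F" by (rule finite_measure_slice_measure)
  have eq: "fibre_integral F (\<lambda>p. ennreal (g p)) u = ennreal (fibre_sum g u)" for u
  proof (cases "finite (slice F u)")
    case True
    have "(\<integral>\<^sup>+t. ennreal (g (u, t)) * indicator (slice F u) t \<partial>count_space UNIV)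
        = (\<integral>\<^sup>+t. ennreal (g (u, t)) \<partial>count_space (slice F u))"
      by (simp add: nn_integral_count_space_indicator)
    also have "\<dots> = ennreal (\<Sum>t\<in>slice F u. g (u, t))"
      using True bd by (simp add: nn_integral_count_space_finite sum_ennreal)
    finally show ?thesis
      using True by (simp add: fibre_integral_def fibre_sum_def slice_count_eq_top_iff indicator_slice)
  qed (simp add: fibre_integral_def fibre_sum_def slice_count_eq_top_iff)
  have nonneg: "0 \<le> fibre_sum g u" for u using bd by (simp add: fibre_sum_def sum_nonneg)
  have meas: "(\<lambda>u. ennreal (fibre_sum g u)) \<in> borel_measurable borel"
    and int: "(\<integral>\<^sup>+p. ennreal (g p) \<partial>slice_measure F) = (\<integral>\<^sup>+u. ennreal (fibre_sum g u) \<partial>lborel)"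
    using nn_integral_slice_measure[OF F, of "\<lambda>p. ennreal (g p)"] by (simp_all add: eq)
  have [measurable]: "fibre_sum g \<in> borel_measurable borel"
    using borel_measurable_enn2real[OF meas] nonneg by simp
  have "integrable (slice_measure F) g"
    using bd by (intro integrable_const_bound[of _ C]) auto
  then have "(\<integral>\<^sup>+p. ennreal (g p) \<partial>slice_measure F) = ennreal (\<integral>p. g p \<partial>slice_measure F)"
    using bd by (intro nn_integral_eq_integral) auto
  then show ?thesis
    using nonneg bd by (intro has_bochner_integral_nn_integral) (auto simp: int)
qed

lemma has_bochner_integral_fibre_sum:
  assumes g [measurable]: "g \<in> borel_measurable borel" and bd: "\<And>p. \<bar>g p\<bar> \<le> C"
  shows "has_bochner_integral lborel (fibre_sum g) (\<integral>p. g p \<partial>slice_measure F)"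
proof -
  interpret finite_measure "slice_measure F" by (rule finite_measure_slice_measure)
  have "0 \<le> C" using bd[of 0] by linarith
  have "has_bochner_integral lborel (\<lambda>u. fibre_sum (\<lambda>p. max 0 (g p)) u - fibre_sum (\<lambda>p. max 0 (- g p)) u)
      ((\<integral>p. max 0 (g p) \<partial>slice_measure F) - (\<integral>p. max 0 (- g p) \<partial>slice_measure F))"
    using bd \<open>0 \<le> C\<close>
    by (intro has_bochner_integral_diff has_bochner_integral_fibre_sum_nonneg[where C = C])
      (auto simp: abs_le_iff minus_le_iff)
  moreover have "fibre_sum (\<lambda>p. max 0 (g p)) u - fibre_sum (\<lambda>p. max 0 (- g p)) u = fibre_sum g u" for u
    by (auto simp: fibre_sum_def sum_subtractf[symmetric] max_def intro!: sum.cong)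
  moreover have "(\<integral>p. max 0 (g p) \<partial>slice_measure F) - (\<integral>p. max 0 (- g p) \<partial>slice_measure F)
      = (\<integral>p. g p \<partial>slice_measure F)"
  proof (subst Bochner_Integration.integral_diff[symmetric])
    show "integrable (slice_measure F) (\<lambda>p. max 0 (g p))" "integrable (slice_measure F) (\<lambda>p. max 0 (- g p))"
      using bd \<open>0 \<le> C\<close> by (auto intro!: integrable_const_bound[of _ C] simp: abs_le_iff minus_le_iff)
    show "(\<integral>p. max 0 (g p) - max 0 (- g p) \<partial>slice_measure F) = (\<integral>p. g p \<partial>slice_measure F)"
      by (intro Bochner_Integration.integral_cong) (auto simp: max_def)
  qed
  ultimately show ?thesis by simp
qed

lemma slice_measure_Compl: "emeasure (slice_measure F) (- F) = 0"
  using slice_measure_le_hausdorff[OF F fin, of "- F"] F by (simp add: borel_closed)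

text \<open>Fubini's theorem reduces the volume integral to vertical lines. Almost every line meets
  \<open>F\<close> finitely often and is covered by \<open>jump_formula_1d\<close>; the boundary
  terms vanish because \<open>w\<close> has bounded support.\<close>

lemma jump_formula:
  fixes w j \<psi> \<psi>' :: "space \<Rightarrow> real"
  assumes R: "F \<subseteq> cball 0 R" and w [measurable]: "w \<in> borel_measurable borel"
    and wB: "\<And>p. \<bar>w p\<bar> \<le> B" and w0: "\<And>p. R < norm p \<Longrightarrow> w p = 0"
    and lc: "\<And>p. p \<notin> F \<Longrightarrow> \<forall>\<^sub>F q in nhds p. w q = w p"
    and j [measurable]: "j \<in> borel_measurable borel" and jB: "\<And>p. \<bar>j p\<bar> \<le> B"
    and jump: "\<And>u t. finite (slice F u) \<Longrightarrow> (u, t) \<in> F \<Longrightarrow>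
      \<exists>l r. (\<forall>\<^sub>F s in at_left t. w (u, s) = l) \<and> (\<forall>\<^sub>F s in at_right t. w (u, s) = r) \<and> j (u, t) = r - l"
    and \<psi>: "continuous_on UNIV \<psi>" and \<psi>': "continuous_on UNIV \<psi>'"
    and der: "\<And>u t. ((\<lambda>t. \<psi> (u, t)) has_real_derivative \<psi>' (u, t)) (at t)"
  shows "(\<integral>p. w p * \<psi>' p \<partial>lborel) = - (\<integral>p. \<psi> p * j p \<partial>slice_measure F)"
proof -
  have [measurable]: "\<psi> \<in> borel_measurable borel" "\<psi>' \<in> borel_measurable borel"
    using \<psi> \<psi>' by (auto intro: borel_measurable_continuous_onI)
  have [measurable]: "F \<in> sets borel" using F by (rule borel_closed)
  have bounded: "\<exists>C. \<forall>p\<in>cball 0 R. \<bar>f p\<bar> \<le> C" if "continuous_on UNIV f" for f :: "space \<Rightarrow> real"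
  proof -
    have "bounded (f ` cball 0 R)"
      using that by (intro compact_imp_bounded compact_continuous_image) (auto intro: continuous_on_subset)
    then show ?thesis by (auto simp: bounded_iff)
  qed
  obtain C1 C2 where C1: "\<And>p. p \<in> cball 0 R \<Longrightarrow> \<bar>\<psi> p\<bar> \<le> C1" and C2: "\<And>p. p \<in> cball 0 R \<Longrightarrow> \<bar>\<psi>' p\<bar> \<le> C2"
    using bounded[OF \<psi>] bounded[OF \<psi>'] by metis
  have "0 \<le> B" using wB[of 0] by linarith
  \<comment> \<open>\<open>\<psi>\<close> is bounded on the ball only, so the integrand is truncated
    to \<open>F\<close>, which carries the whole slice measure.\<close>
  define g where "g p = (if p \<in> F then \<psi> p * j p else 0)" for p
  define f where "f p = w p * \<psi>' p" for p
  have [measurable]: "g \<in> borel_measurable borel" "f \<in> borel_measurable borel"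
    unfolding g_def f_def by measurable
  have gB: "\<bar>g p\<bar> \<le> \<bar>C1\<bar> * B" for p
    using R C1[of p] jB[of p] by (auto simp: g_def abs_mult intro!: mult_mono)
  have fB: "\<bar>f p\<bar> \<le> B * \<bar>C2\<bar>" for p
    using C2[of p] wB[of p] w0[of p] \<open>0 \<le> B\<close>
    by (cases "R < norm p") (auto simp: f_def abs_mult intro!: mult_mono)
  have f0: "f p = 0" if "R < norm p" for p using w0[OF that] by (simp add: f_def)
  \<comment> \<open>Strictly larger than \<open>R\<close>, so that \<open>w\<close> vanishes at both
    ends and all jumps lie inside the interval. The absolute value provides for a negative
    \<open>R\<close>.\<close>
  define Q where "Q = \<bar>R\<bar> + 1"
  have Q: "0 < Q" "R < Q" by (auto simp: Q_def)
  have norms: "\<bar>t\<bar> \<le> norm (u, t)" for u :: plane and t :: real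
    using norm_snd_le[of t u] by simp
  have line: "(\<integral>t. f (u, t) \<partial>lborel) = - fibre_sum g u" if finu: "finite (slice F u)" for u
  proof -
    have "((\<lambda>t. w (u, t) * \<psi>' (u, t)) has_integral (w (u, Q) * \<psi> (u, Q) - w (u, - Q) * \<psi> (u, - Q)
        - (\<Sum>t\<in>slice F u. \<psi> (u, t) * j (u, t)))) {-Q..Q}"
    proof (rule jump_formula_1d[OF finu])
      show "\<forall>\<^sub>F s in nhds t. w (u, s) = w (u, t)" if "t \<notin> slice F u" for t
      proof -
        have "((\<lambda>s. (u, s)) \<longlongrightarrow> (u, t)) (nhds t)" by (intro tendsto_intros filterlim_ident)
        moreover have "\<forall>\<^sub>F q in nhds (u, t). w q = w (u, t)" using that by (intro lc) (simp add: slice_def)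
        ultimately show ?thesis by (rule eventually_compose_filterlim[rotated])
      qed
      show "slice F u \<subseteq> {-Q<..<Q}"
      proof
        fix t assume "t \<in> slice F u"
        then have "norm (u, t) \<le> R" using R by (auto simp: slice_def)
        then show "t \<in> {-Q<..<Q}" using norms[of t u] Q by auto
      qed
    qed (use jump finu der Q in \<open>auto simp: slice_def\<close>)
    moreover have "w (u, Q) = 0" "w (u, - Q) = 0"
      using norms[of Q u] norms[of "- Q" u] Q by (auto intro!: w0)
    moreover have "(\<Sum>t\<in>slice F u. \<psi> (u, t) * j (u, t)) = fibre_sum g u"
      using finu by (auto simp: fibre_sum_def g_def slice_def)
    ultimately have "((\<lambda>t. f (u, t)) has_integral - fibre_sum g u) {-Q..Q}"
      by (simp add: f_def)
    then have 1: "((\<lambda>t. f (u, t)) has_integral - fibre_sum g u) UNIV"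
    proof (rule has_integral_on_superset)
      fix t assume "t \<notin> {-Q..Q}"
      then have "R < norm (u, t)" using norms[of t u] Q by auto
      then show "f (u, t) = 0" by (rule f0)
    qed simp
    have "integrable lborel (\<lambda>t. f (u, t))"
    proof (rule integrableI_bounded_set[where A = "{-Q..Q}" and B = "B * \<bar>C2\<bar>"])
      have "f (u, t) = 0" if "t \<notin> {-Q..Q}" for t
        using that norms[of t u] Q by (intro f0) auto
      then show "AE t in lborel. t \<notin> {-Q..Q} \<longrightarrow> f (u, t) = 0" by simp
    qed (use fB Q in auto)
    from has_integral_integral_lborel[OF this] 1 show ?thesis by (rule has_integral_unique)
  qed
  have intf: "integrable (lborel \<Otimes>\<^sub>M lborel) (\<lambda>(u, t). f (u, t))"
    unfolding lborel_prod
  proof (rule integrableI_bounded_set[where A = "cball 0 R" and B = "B * \<bar>C2\<bar>"])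
    show "AE p in lborel. p \<notin> cball 0 R \<longrightarrow> (case p of (u, t) \<Rightarrow> f (u, t)) = 0"
      using f0 by (intro AE_I2) auto
    show "emeasure lborel (cball (0::space) R) < \<infinity>" 
      using emeasure_bounded_finite[of "cball (0::space) R"] by simp
  qed (use fB in auto)
  have hb: "has_bochner_integral lborel (fibre_sum g) (\<integral>p. g p \<partial>slice_measure F)"
    by (rule has_bochner_integral_fibre_sum[OF _ gB]) measurable
  then have [measurable]: "fibre_sum g \<in> borel_measurable lborel"
    by (rule borel_measurable_has_bochner_integral)
  have "(\<integral>p. f p \<partial>lborel) = (\<integral>u. (\<integral>t. f (u, t) \<partial>lborel) \<partial>lborel)"
    using lborel_pair.integral_fst'[OF intf] by (simp add: lborel_prod)
  also have "\<dots> = (\<integral>u. - fibre_sum g u \<partial>lborel)"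
  proof (rule integral_cong_AE)
    show "AE u in lborel. (\<integral>t. f (u, t) \<partial>lborel) = - fibre_sum g u"
      using AE_finite_slice by eventually_elim (rule line)
  qed measurable
  also have "\<dots> = - (\<integral>p. g p \<partial>slice_measure F)"
    using hb by (simp add: has_bochner_integral_iff)
  also have "(\<integral>p. g p \<partial>slice_measure F) = (\<integral>p. \<psi> p * j p \<partial>slice_measure F)"
  proof (rule integral_cong_AE)
    have "AE p in slice_measure F. p \<notin> - F"
      using slice_measure_Compl F by (intro AE_not_in) (auto simp: null_sets_def)
    then show "AE p in slice_measure F. g p = \<psi> p * j p" by eventually_elim (simp add: g_def)
  qed auto
  finally show ?thesis by (simp add: f_def)
qed

end

section \<open>Slicing in arbitrary directions\<close>

lemma borel_measurable_vec_nth [measurable (raw)]: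
  fixes f :: "'a \<Rightarrow> real^'n"
  assumes "f \<in> borel_measurable M"
  shows "(\<lambda>x. f x $ i) \<in> borel_measurable M"
  by (rule measurable_compose[OF assms borel_measurable_continuous_onI]) (intro continuous_intros)

definition is_frame :: "real^3 \<Rightarrow> (space \<Rightarrow> real^3) \<Rightarrow> bool" where
  "is_frame e T \<longleftrightarrow> linear T \<and> (\<forall>p. norm (T p) = norm p) \<and> T (0, 1) = e"

definition frame :: "real^3 \<Rightarrow> space \<Rightarrow> real^3" where
  "frame e = (SOME T. is_frame e T)"

lemma is_frame_frame:
  assumes "norm e = 1"
  shows "is_frame e (frame e)"
proof -
  define T where "T p = (vector [fst (fst p), snd (fst p), snd p] :: real^3)" for p :: space
  have T: "linear T" "norm (T p) = norm p" for p
    by (auto intro!: linearI simp: T_def vec_eq_iff forall_3 norm_vec_def L2_set_def sum_3 norm_prod_def power2_eq_square)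
  have "norm (T (0, 1)) = 1" by (simp add: T norm_prod_def)
  then obtain f where f: "orthogonal_transformation f" "f (T (0, 1)) = e"
    using orthogonal_transformation_exists_1 assms by blast
  have "is_frame e (f \<circ> T)"
    unfolding is_frame_def o_def[symmetric]
    using f(2) linear_compose[OF T(1) orthogonal_transformation_linear[OF f(1)]]
      orthogonal_transformation_norm[OF f(1)] T(2) by simp
  then show ?thesis unfolding frame_def by (rule someI[of "is_frame e"])
qed

context
  fixes e :: "real^3"
  assumes e: "norm e = 1"
begin

lemma frame_linear: "linear (frame e)"
  by (rule is_frame_frame[OF e, unfolded is_frame_def, THEN conjunct1])

lemma frame_norm: "norm (frame e p) = norm p"
  by (rule is_frame_frame[OF e, unfolded is_frame_def, THEN conjunct2, THEN conjunct1, THEN spec])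

lemma frame_axis: "frame e (0, 1) = e"
  by (rule is_frame_frame[OF e, unfolded is_frame_def, THEN conjunct2, THEN conjunct2])

lemma frame_dist: "dist (frame e p) (frame e q) = dist p q"
  using frame_norm[of "p - q"] frame_linear by (simp add: dist_norm linear_diff)

lemma frame_bij: "bij (frame e)"
  by (rule linear_isometry_bij[OF frame_linear frame_norm]) simp

lemma frame_continuous: "continuous_on S (frame e)"
  using frame_linear by (intro linear_continuous_on) (simp add: linear_conv_bounded_linear)

lemma frame_measurable [measurable]: "frame e \<in> borel_measurable borel"
  by (rule borel_measurable_continuous_onI[OF frame_continuous])

lemma frame_vimage_borel: "A \<in> sets borel \<Longrightarrow> frame e -` A \<in> sets borel"
  using measurable_sets_borel[OF frame_measurable] by simp

lemma lborel_frame: "distr lborel borel (frame e) = lborel"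
  by (rule lborel_linear_isometry[OF frame_linear frame_norm]) simp

lemma frame_line: "frame e (u, t) = frame e (u, 0) + t *\<^sub>R e"
proof -
  have "frame e (u, t) = frame e ((u, 0) + t *\<^sub>R (0, 1))" by simp
  then show ?thesis unfolding linear_add[OF frame_linear] linear_scale[OF frame_linear] frame_axis .
qed

lemma frame_inner: "frame e p \<bullet> frame e q = p \<bullet> q"
  unfolding dot_norm linear_add[OF frame_linear, symmetric] frame_norm by (rule refl)

lemma frame_inner_axis: "e \<bullet> frame e (u, t) = t"
  using frame_inner[of "(0, 1)" "(u, t)"] by (simp add: frame_axis)

lemma frame_vimage_closed: "closed F \<Longrightarrow> closed (frame e -` F)"
  by (rule closed_vimage[OF _ frame_continuous])

lemma frame_image_vimage: "frame e ` (frame e -` A) = A"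
  using frame_bij by (simp add: bij_is_surj surj_image_vimage_eq)

lemma hausdorff_measure_frame_vimage: "hausdorff_measure d (frame e -` A) = hausdorff_measure d A"
  using hausdorff_measure_isometric_image[of "frame e -` A" "frame e" d, OF frame_dist]
  unfolding frame_image_vimage by simp

end

text \<open>An integral-geometric measure: a Borel set \<open>A\<close> receives the integral, over
  the lines parallel to \<open>e\<close>, of the number of points of \<open>F \<inter> A\<close> on
  the line, as \<open>emeasure_dir_measure\<close> confirms for sets of finite measure.\<close>

definition dir_measure :: "real^3 \<Rightarrow> (real^3) set \<Rightarrow> (real^3) measure" where
  "dir_measure e F = distr (slice_measure (frame e -` F)) borel (frame e)"

lemma sets_dir_measure [simp, measurable_cong]: "sets (dir_measure e F) = sets borel"
  and space_dir_measure [simp]: "space (dir_measure e F) = UNIV"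
  by (simp_all add: dir_measure_def)

text \<open>A limit along one fixed sequence is measurable in \<open>y\<close>, and 0 is the default
  where it does not exist. On a line that meets \<open>F\<close> finitely often the limit exists and
  is the difference of the one-sided limits; the value of \<open>W\<close> at \<open>y\<close> never
  enters.\<close>

definition jump :: "real^3 \<Rightarrow> (real^3 \<Rightarrow> real^3) \<Rightarrow> real^3 \<Rightarrow> real^3" where
  "jump e W y =
    (if convergent (\<lambda>k. W (y + (1 / Suc k) *\<^sub>R e) - W (y - (1 / Suc k) *\<^sub>R e))
     then lim (\<lambda>k. W (y + (1 / Suc k) *\<^sub>R e) - W (y - (1 / Suc k) *\<^sub>R e)) else 0)"

lemma jump_measurable:
  assumes [measurable]: "W \<in> borel_measurable borel"
  shows "jump e W \<in> borel_measurable borel"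
  unfolding jump_def Cauchy_convergent_iff[symmetric] by measurable

lemma jump_mem:
  assumes "closed X" "0 \<in> X"
    and "\<forall>\<^sub>F k in sequentially. W (y + (1 / Suc k) *\<^sub>R e) - W (y - (1 / Suc k) *\<^sub>R e) \<in> X"
  shows "jump e W y \<in> X"
proof (cases "convergent (\<lambda>k. W (y + (1 / Suc k) *\<^sub>R e) - W (y - (1 / Suc k) *\<^sub>R e))")
  case True
  then show ?thesis
    unfolding jump_def using assms(1,3)
    by (auto simp: convergent_LIMSEQ_iff intro: Lim_in_closed_set)
qed (use assms in \<open>simp add: jump_def\<close>)

lemma jump_eq:
  assumes "\<forall>\<^sub>F k in sequentially. W (y + (1 / Suc k) *\<^sub>R e) - W (y - (1 / Suc k) *\<^sub>R e) = c"
  shows "jump e W y = c"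
proof -
  have "(\<lambda>k. W (y + (1 / Suc k) *\<^sub>R e) - W (y - (1 / Suc k) *\<^sub>R e)) \<longlonglongrightarrow> c"
    by (rule tendsto_eventually[OF assms])
  then show ?thesis by (auto simp: jump_def convergent_def limI)
qed

lemma jump_cong:
  assumes "\<forall>\<^sub>F x in nhds y. W x = V x"
  shows "jump e W y = jump e V y"
proof -
  have *: "\<forall>\<^sub>F k in sequentially. W (y + c k *\<^sub>R e) = V (y + c k *\<^sub>R e)" if "c \<longlonglongrightarrow> 0" for c
  proof (rule eventually_compose_filterlim[OF assms])
    show "(\<lambda>k. y + c k *\<^sub>R e) \<longlonglongrightarrow> y" using that by (auto intro!: tendsto_eq_intros)
  qed
  have lim: "(\<lambda>k. 1 / real (Suc k)) \<longlonglongrightarrow> 0" by (rule lim_1_over_n[THEN LIMSEQ_Suc])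
  have "(\<lambda>k. - (1 / real (Suc k))) \<longlonglongrightarrow> 0" using tendsto_minus[OF lim] by simp
  from *[OF lim] *[OF this]
  have ev: "\<forall>\<^sub>F k in sequentially. W (y + (1 / Suc k) *\<^sub>R e) - W (y - (1 / Suc k) *\<^sub>R e)
      = V (y + (1 / Suc k) *\<^sub>R e) - V (y - (1 / Suc k) *\<^sub>R e)"
    by eventually_elim simp
  show ?thesis
  proof (cases "convergent (\<lambda>k. V (y + (1 / Suc k) *\<^sub>R e) - V (y - (1 / Suc k) *\<^sub>R e))")
    case True
    then obtain l where l: "(\<lambda>k. V (y + (1 / Suc k) *\<^sub>R e) - V (y - (1 / Suc k) *\<^sub>R e)) \<longlonglongrightarrow> l"
      by (auto simp: convergent_def)
    then have "(\<lambda>k. W (y + (1 / Suc k) *\<^sub>R e) - W (y - (1 / Suc k) *\<^sub>R e)) \<longlonglongrightarrow> l"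
      using tendsto_cong[OF ev] by blast
    then show ?thesis using l by (auto simp: jump_def convergent_def limI)
  next
    case False
    then have "\<not> convergent (\<lambda>k. W (y + (1 / Suc k) *\<^sub>R e) - W (y - (1 / Suc k) *\<^sub>R e))"
      using tendsto_cong[OF ev] by (auto simp: convergent_def)
    then show ?thesis using False by (simp add: jump_def)
  qed
qed

locale jump_field =
  fixes F :: "(real^3) set" and W :: "real^3 \<Rightarrow> real^3" and R B :: real
  assumes F_closed: "closed F" and F_bounded: "F \<subseteq> cball 0 R"
    and F_fin: "hausdorff_measure 2 F < top"
    and W_meas [measurable]: "W \<in> borel_measurable borel"
    and W_bd: "\<And>x. norm (W x) \<le> B" and W_0: "\<And>x. R < norm x \<Longrightarrow> W x = 0"
    and W_const: "\<And>x. x \<notin> F \<Longrightarrow> \<forall>\<^sub>F y in nhds x. W y = W x"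
begin

lemmas [measurable] = jump_measurable[OF W_meas]

lemma norm_jump_le: "norm (jump e W y) \<le> 2 * B"
proof -
  have "0 \<le> B" using W_bd[of 0] norm_ge_zero order_trans by blast
  have "norm (W a - W b) \<le> 2 * B" for a b
    using norm_triangle_ineq4[of "W a" "W b"] W_bd[of a] W_bd[of b] by linarith
  then have "jump e W y \<in> cball 0 (2 * B)"
    using \<open>0 \<le> B\<close> by (intro jump_mem) auto
  then show ?thesis by simp
qed

lemma dir_measure_le:
  assumes e: "norm e = 1" and A: "A \<in> sets borel"
  shows "emeasure (dir_measure e F) A \<le> ennreal (1 / plane_const) * hausdorff_measure 2 (F \<inter> A)"
proof -
  note [measurable] = frame_measurable[OF e]
  have "emeasure (dir_measure e F) A = emeasure (slice_measure (frame e -` F)) (frame e -` A)"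
    unfolding dir_measure_def using A by (subst emeasure_distr) (simp_all, measurable)
  also have "\<dots> \<le> ennreal (1 / plane_const) * hausdorff_measure 2 (frame e -` F \<inter> frame e -` A)"
    by (intro slice_measure_le_hausdorff frame_vimage_closed frame_vimage_borel e F_closed A)
      (simp add: hausdorff_measure_frame_vimage e F_fin)
  finally show ?thesis
    by (simp add: hausdorff_measure_frame_vimage e flip: vimage_Int)
qed

lemma finite_measure_dir_measure:
  assumes e: "norm e = 1"
  shows "finite_measure (dir_measure e F)"
proof -
  note [measurable] = frame_measurable[OF e]
  have "finite_measure (slice_measure (frame e -` F))"
    by (intro finite_measure_slice_measure frame_vimage_closed e F_closed)
      (simp add: hausdorff_measure_frame_vimage e F_fin)
  then show ?thesis
    unfolding dir_measure_def by (rule finite_measure.finite_measure_distr) measurable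
qed

text \<open>The distributional derivative of \<open>W\<close> in direction \<open>e\<close> is the
  measure with density \<open>jump e W\<close> with respect to \<open>dir_measure e F\<close>. An
  isometry turning the vertical axis into \<open>e\<close> reduces this to
  \<open>jump_formula\<close>.\<close>

lemma jump_formula_dir:
  fixes \<psi> :: "real^3 \<Rightarrow> real" and g :: "real^3 \<Rightarrow> real^3"
  assumes e: "norm e = 1"
    and der: "\<And>x. (\<psi> has_derivative (\<lambda>h. g x \<bullet> h)) (at x)" and g: "continuous_on UNIV g"
  shows "(\<integral>x. W x $ i * (g x \<bullet> e) \<partial>lborel) = - (\<integral>y. \<psi> y * (jump e W y $ i) \<partial>dir_measure e F)"
proof -
  let ?T = "frame e"
  have cont: "continuous_on UNIV \<psi>"
    using der has_derivative_continuous by (blast intro: continuous_at_imp_continuous_on)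
  have [measurable]: "\<psi> \<in> borel_measurable borel" "g \<in> borel_measurable borel"
    using cont g by (auto intro: borel_measurable_continuous_onI)
  note [measurable] = frame_measurable[OF e]
  define q where "q u = ?T (u, 0)" for u
  have line: "?T (u, t) = q u + t *\<^sub>R e" for u t
    unfolding q_def by (rule frame_line[OF e])
  have shift: "?T (u, t) + c *\<^sub>R e = ?T (u, t + c)" "?T (u, t) - c *\<^sub>R e = ?T (u, t - c)" for u t c
    by (simp_all add: line algebra_simps)
  have sides: "\<exists>l r. (\<forall>\<^sub>F s in at_left t. W (?T (u, s)) $ i = l) \<and> (\<forall>\<^sub>F s in at_right t. W (?T (u, s)) $ i = r) \<and>
        jump e W (?T (u, t)) $ i = r - l" if fin: "finite (slice (?T -` F) u)" for u t
  proof -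
      have lc: "\<forall>\<^sub>F s in nhds t. W (?T (u, s)) = W (?T (u, t))" if "t \<notin> slice (?T -` F) u" for t
      proof -
        have "((\<lambda>s. ?T (u, s)) \<longlongrightarrow> ?T (u, t)) (nhds t)"
          unfolding line by (intro tendsto_intros filterlim_ident)
        then show ?thesis
          using that by (intro eventually_compose_filterlim[OF W_const]) (auto simp: slice_def)
      qed
      obtain l where l: "\<forall>\<^sub>F s in at_left t. W (?T (u, s)) = l"
        using locally_constant_at_left[OF fin lc] by blast
      obtain r where r: "\<forall>\<^sub>F s in at_right t. W (?T (u, s)) = r"
        using locally_constant_at_right[OF fin lc] by blast
      have lim: "(\<lambda>k. 1 / real (Suc k)) \<longlonglongrightarrow> 0" by (rule lim_1_over_n[THEN LIMSEQ_Suc])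
      have "filterlim (\<lambda>k. t + 1 / real (Suc k)) (at_right t) sequentially"
        unfolding filterlim_at using tendsto_add[OF tendsto_const lim, of t] by simp
      from eventually_compose_filterlim[OF r this]
      have R1: "\<forall>\<^sub>F k in sequentially. W (?T (u, t + 1 / real (Suc k))) = r" .
      have "filterlim (\<lambda>k. t - 1 / real (Suc k)) (at_left t) sequentially"
        unfolding filterlim_at using tendsto_diff[OF tendsto_const lim, of t] by simp
      from eventually_compose_filterlim[OF l this]
      have L1: "\<forall>\<^sub>F k in sequentially. W (?T (u, t - 1 / real (Suc k))) = l" .
      have "jump e W (?T (u, t)) = r - l"
      proof (rule jump_eq)
        show "\<forall>\<^sub>F k in sequentially. W (?T (u, t) + (1 / Suc k) *\<^sub>R e) - W (?T (u, t) - (1 / Suc k) *\<^sub>R e) = r - l"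
          using R1 L1 by eventually_elim (simp only: shift)
      qed
      moreover have "\<forall>\<^sub>F s in at_left t. W (?T (u, s)) $ i = l $ i" using l by eventually_elim simp
      moreover have "\<forall>\<^sub>F s in at_right t. W (?T (u, s)) $ i = r $ i" using r by eventually_elim simp
      ultimately show ?thesis by auto
    qed
  have "(\<integral>p. W (?T p) $ i * (g (?T p) \<bullet> e) \<partial>lborel)
      = - (\<integral>p. \<psi> (?T p) * (jump e W (?T p) $ i) \<partial>slice_measure (?T -` F))"
  proof (rule jump_formula[where R = R and B = "2 * B"])
    show "closed (?T -` F)" by (rule frame_vimage_closed[OF e F_closed])
    show "hausdorff_measure 2 (?T -` F) < top" by (simp add: hausdorff_measure_frame_vimage e F_fin)
    show "?T -` F \<subseteq> cball 0 R" using F_bounded by (auto simp: frame_norm[OF e] dest: subsetD)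
    have "norm (W x) \<le> 2 * B" for x using W_bd[of x] norm_ge_zero[of "W x"] by linarith
    then show "\<bar>W (?T p) $ i\<bar> \<le> 2 * B" for p
      using component_le_norm_cart order_trans by blast
    show "\<bar>jump e W (?T p) $ i\<bar> \<le> 2 * B" for p
      using component_le_norm_cart norm_jump_le order_trans by blast
    show "W (?T p) $ i = 0" if "R < norm p" for p
      using W_0[of "?T p"] that by (simp add: frame_norm[OF e])
    show "\<forall>\<^sub>F q in nhds p. W (?T q) $ i = W (?T p) $ i" if "p \<notin> ?T -` F" for p
    proof -
      have "(?T \<longlongrightarrow> ?T p) (nhds p)"
        using continuous_on_tendsto_compose[OF frame_continuous[OF e, of UNIV] filterlim_ident, of p] by auto
      then have "\<forall>\<^sub>F q in nhds p. W (?T q) = W (?T p)"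
        using that by (intro eventually_compose_filterlim[OF W_const]) auto
      then show ?thesis by eventually_elim simp
    qed
    show "continuous_on UNIV (\<lambda>p. \<psi> (?T p))" "continuous_on UNIV (\<lambda>p. g (?T p) \<bullet> e)"
      using continuous_on_compose2[OF cont frame_continuous[OF e]]
        continuous_on_compose2[OF g frame_continuous[OF e]] by (auto intro: continuous_on_inner)
    show "((\<lambda>t. \<psi> (?T (u, t))) has_real_derivative g (?T (u, t)) \<bullet> e) (at t)" for u t
    proof -
      have "((\<lambda>t. q u + t *\<^sub>R e) has_derivative (\<lambda>h. h *\<^sub>R e)) (at t)"
        by (auto intro!: derivative_eq_intros)
      from has_derivative_compose[OF this der]
      show ?thesis
        by (simp add: line has_field_derivative_def mult.commute[of "_ \<bullet> _", abs_def])
    qed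
  qed (measurable, measurable, erule sides)
  moreover have "(\<integral>x. W x $ i * (g x \<bullet> e) \<partial>lborel) = (\<integral>p. W (?T p) $ i * (g (?T p) \<bullet> e) \<partial>lborel)"
    by (subst lborel_frame[OF e, symmetric]) (rule integral_distr, auto)
  moreover have "(\<integral>y. \<psi> y * (jump e W y $ i) \<partial>dir_measure e F)
      = (\<integral>p. \<psi> (?T p) * (jump e W (?T p) $ i) \<partial>slice_measure (?T -` F))"
    unfolding dir_measure_def by (rule integral_distr) auto
  ultimately show ?thesis by simp
qed

end

section \<open>Divergence of piecewise constant fields\<close>

lemma has_real_derivative_pos_part_square:
  "((\<lambda>t::real. (max 0 t)\<^sup>2) has_real_derivative 2 * max 0 t) (at t)"
proof (cases t "0::real" rule: linorder_cases)
  case less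
  show ?thesis
    by (rule has_field_derivative_transform_within_open[where S = "{..<0}" and f = "\<lambda>_. 0"])
      (use less in auto)
next
  case greater
  have "((\<lambda>t::real. t\<^sup>2) has_real_derivative 2 * max 0 t) (at t)"
    using greater by (auto intro!: derivative_eq_intros)
  then show ?thesis
    by (rule has_field_derivative_transform_within_open[where S = "{0<..}"]) (use greater in auto)
next
  case equal
  have "((\<lambda>h::real. (max 0 h)\<^sup>2 / h) \<longlongrightarrow> 0) (at 0)"
  proof (rule Lim_null_comparison)
    show "\<forall>\<^sub>F h in at 0. norm ((max 0 h)\<^sup>2 / h) \<le> \<bar>h\<bar>"
      by (rule always_eventually) (auto simp: max_def power2_eq_square)
    show "((\<lambda>h::real. \<bar>h\<bar>) \<longlongrightarrow> 0) (at 0)" by (auto intro!: tendsto_eq_intros)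
  qed
  then show ?thesis using equal by (simp add: DERIV_def)
qed

text \<open>The squared distance from \<open>x\<close> to the orthant \<open>{..a}\<close>. It is
  continuously differentiable, so the functions \<open>exp (- real n * corner_dist a x)\<close> are
  admissible tests that decrease to the indicator of the orthant.\<close>

definition corner_dist :: "real^3 \<Rightarrow> real^3 \<Rightarrow> real" where
  "corner_dist a x = (\<Sum>i\<in>UNIV. (max 0 (x $ i - a $ i))\<^sup>2)"

lemma corner_dist_nonneg: "0 \<le> corner_dist a x"
  by (simp add: corner_dist_def sum_nonneg)

lemma corner_dist_eq_0_iff: "corner_dist a x = 0 \<longleftrightarrow> x \<le> a"
proof -
  have "(max 0 t)\<^sup>2 = 0 \<longleftrightarrow> t \<le> 0" for t :: real by (auto simp: max_def)
  then show ?thesis by (simp add: corner_dist_def sum_nonneg_eq_0_iff less_eq_vec_def)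
qed

lemma corner_dist_has_derivative:
  "(corner_dist a has_derivative (\<lambda>h. (\<chi> i. 2 * max 0 (x $ i - a $ i)) \<bullet> h)) (at x)"
proof -
  have "((\<lambda>x. (max 0 (x $ i - a $ i))\<^sup>2) has_derivative (\<lambda>h. 2 * max 0 (x $ i - a $ i) * h $ i)) (at x)" for i
  proof -
    have "((\<lambda>x. x $ i - a $ i) has_derivative (\<lambda>h. h $ i)) (at x)"
      by (auto intro!: derivative_eq_intros bounded_linear_imp_has_derivative bounded_linear_vec_nth)
    from has_derivative_compose[OF this
        has_real_derivative_pos_part_square[unfolded has_field_derivative_def]]
    show ?thesis by simp
  qed
  then have "((\<lambda>x. \<Sum>i\<in>UNIV. (max 0 (x $ i - a $ i))\<^sup>2) has_derivative
      (\<lambda>h. \<Sum>i\<in>UNIV. 2 * max 0 (x $ i - a $ i) * h $ i)) (at x)"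
    by (intro has_derivative_sum)
  then show ?thesis by (simp add: corner_dist_def[abs_def] inner_vec_def)
qed

context jump_field
begin

definition flux :: "real^3 \<Rightarrow> (real^3) set \<Rightarrow> real^3" where
  "flux e A = (\<chi> i. \<integral>y. indicator A y * (jump e W y $ i) \<partial>dir_measure e F)"

lemma integrable_jump:
  assumes e: "norm e = 1" and f [measurable]: "f \<in> borel_measurable borel" and bd: "\<And>y. \<bar>f y\<bar> \<le> 1"
  shows "integrable (dir_measure e F) (\<lambda>y. f y * (jump e W y $ i))"
proof -
  interpret finite_measure "dir_measure e F" by (rule finite_measure_dir_measure[OF e])
  show ?thesis
  proof (rule integrable_const_bound[where B = "1 * (2 * B)"])
    have "norm (f y * (jump e W y $ i)) \<le> 1 * (2 * B)" for y
      unfolding real_norm_def abs_mult using bd[of y] norm_jump_le[of e y] component_le_norm_cart[of "jump e W y" i]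
      by (intro mult_mono) auto
    then show "AE y in dir_measure e F. norm (f y * (jump e W y $ i)) \<le> 1 * (2 * B)" by simp
  qed measurable
qed

text \<open>Slices in different directions are unrelated sets of lines, so linearity in
  \<open>e\<close> is invisible on the side of the jumps. On the volume side it is merely the
  linearity of \<open>g x \<bullet> e\<close>.\<close>

lemma jump_linear_smooth:
  fixes \<psi> :: "real^3 \<Rightarrow> real" and g :: "real^3 \<Rightarrow> real^3"
  assumes e: "norm e = 1"
    and der: "\<And>x. (\<psi> has_derivative (\<lambda>h. g x \<bullet> h)) (at x)" and g: "continuous_on UNIV g"
  shows "(\<integral>y. \<psi> y * (jump e W y $ i) \<partial>dir_measure e F)
    = (\<Sum>k\<in>UNIV. e $ k * (\<integral>y. \<psi> y * (jump (axis k 1) W y $ i) \<partial>dir_measure (axis k 1) F))"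
proof -
  have [measurable]: "g \<in> borel_measurable borel" using g by (rule borel_measurable_continuous_onI)
  have "bounded (g ` cball 0 R)"
    using g by (intro compact_imp_bounded compact_continuous_image) (auto intro: continuous_on_subset)
  then obtain C where C: "\<And>x. norm x \<le> R \<Longrightarrow> norm (g x) \<le> C" by (force simp: bounded_iff)
  have "0 \<le> B" using W_bd[of 0] norm_ge_zero order_trans by blast
  have int: "integrable lborel (\<lambda>x. W x $ i * (g x $ k))" for k
  proof (rule integrableI_bounded_set[where A = "cball 0 R" and B = "B * \<bar>C\<bar>"])
    show "emeasure lborel (cball (0::real^3) R) < \<infinity>"
      using emeasure_bounded_finite[of "cball (0::real^3) R"] by simp
    show "AE x in lborel. x \<in> cball 0 R \<longrightarrow> norm (W x $ i * (g x $ k)) \<le> B * \<bar>C\<bar>"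
    proof (intro AE_I2 impI)
      fix x :: "real^3" assume "x \<in> cball 0 R"
      then have "\<bar>g x $ k\<bar> \<le> \<bar>C\<bar>" using C[of x] component_le_norm_cart[of "g x" k] by simp
      moreover have "\<bar>W x $ i\<bar> \<le> B" using W_bd[of x] component_le_norm_cart[of "W x" i] by simp
      ultimately show "norm (W x $ i * (g x $ k)) \<le> B * \<bar>C\<bar>"
        unfolding real_norm_def abs_mult using \<open>0 \<le> B\<close> by (intro mult_mono) auto
    qed
    show "AE x in lborel. x \<notin> cball 0 R \<longrightarrow> W x $ i * (g x $ k) = 0"
      using W_0 by (intro AE_I2) auto
  qed auto
  have "(\<integral>x. W x $ i * (g x \<bullet> e) \<partial>lborel) = (\<integral>x. (\<Sum>k\<in>UNIV. e $ k * (W x $ i * (g x $ k))) \<partial>lborel)"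
    by (intro Bochner_Integration.integral_cong) (auto simp: inner_vec_def sum_distrib_left mult_ac)
  also have "\<dots> = (\<Sum>k\<in>UNIV. e $ k * (\<integral>x. W x $ i * (g x $ k) \<partial>lborel))"
    using int by (subst Bochner_Integration.integral_sum) auto
  also have "\<dots> = (\<Sum>k\<in>UNIV. e $ k * (\<integral>x. W x $ i * (g x \<bullet> axis k 1) \<partial>lborel))"
    by (simp add: inner_axis)
  finally show ?thesis
    using jump_formula_dir[OF e der g] jump_formula_dir[OF norm_axis_1 der g] by (simp add: sum_negf)
qed

text \<open>Linearity passes from smooth tests to orthants by dominated convergence and from
  orthants to Borel sets by Dynkin's theorem. Complements cause no trouble because the flux of the
  whole space is zero.\<close>

lemma flux_linear:
  assumes e: "norm e = 1" and A: "A \<in> sets borel"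
  shows "flux e A = (\<Sum>k\<in>UNIV. e $ k *\<^sub>R flux (axis k 1) A)"
proof -
  define I where "I d i A = (\<integral>y. indicator A y * (jump d W y $ i) \<partial>dir_measure d F)" for d i A
  define lin where "lin A \<longleftrightarrow> (\<forall>i. I e i A = (\<Sum>k\<in>UNIV. e $ k * I (axis k 1) i A))" for A
  have one: "norm (axis k 1 :: real^3) = 1" for k by simp
  have UNIV: "I d i UNIV = 0" if "norm d = 1" for d i
    using jump_formula_dir[OF that, of "\<lambda>_. 1" "\<lambda>_. 0" i] by (simp add: I_def)
  have int: "integrable (dir_measure d F) (\<lambda>y. indicator A y * (jump d W y $ i))"
    if "norm d = 1" "A \<in> sets borel" for d i A
    using that by (intro integrable_jump) auto
  have atMost: "lin {..a}" for a
    unfolding lin_def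
  proof
    fix i
    define \<psi> where "\<psi> n x = exp (- real n * corner_dist a x)" for n x
    have der: "(\<psi> n has_derivative (\<lambda>h. (- real n * \<psi> n x) *\<^sub>R (\<chi> i. 2 * max 0 (x $ i - a $ i)) \<bullet> h)) (at x)" for n x
      unfolding \<psi>_def
      by (auto intro!: derivative_eq_intros corner_dist_has_derivative simp: fun_eq_iff)
    have cont: "continuous_on UNIV (\<psi> n)" for n
      using der has_derivative_continuous by (blast intro: continuous_at_imp_continuous_on)
    then have [measurable]: "\<psi> n \<in> borel_measurable borel" for n
      by (rule borel_measurable_continuous_onI)
    have gcont: "continuous_on UNIV (\<lambda>x. (- real n * \<psi> n x) *\<^sub>R (\<chi> i. 2 * max 0 (x $ i - a $ i)))" for n
      by (intro continuous_intros cont)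
    have lim: "(\<lambda>n. \<integral>y. \<psi> n y * (jump d W y $ i) \<partial>dir_measure d F) \<longlonglongrightarrow> I d i {..a}" if d: "norm d = 1" for d
      unfolding I_def
    proof (rule integral_dominated_convergence[where w = "\<lambda>_. 2 * B"])
      interpret finite_measure "dir_measure d F" by (rule finite_measure_dir_measure[OF d])
      show "integrable (dir_measure d F) (\<lambda>_. 2 * B)" by simp
      have "norm (\<psi> n y * (jump d W y $ i)) \<le> 1 * (2 * B)" for n y
        unfolding real_norm_def abs_mult
        using corner_dist_nonneg[of a y] norm_jump_le[of d y] component_le_norm_cart[of "jump d W y" i]
        by (intro mult_mono) (auto simp: \<psi>_def)
      then show "AE y in dir_measure d F. norm (\<psi> n y * (jump d W y $ i)) \<le> 2 * B" for n by simp
      have "(\<lambda>n. \<psi> n y) \<longlonglongrightarrow> indicator {..a} y" for y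
      proof (cases "y \<le> a")
        case True
        then show ?thesis by (simp add: \<psi>_def corner_dist_eq_0_iff[symmetric])
      next
        case False
        then have pos: "0 < corner_dist a y"
          using corner_dist_nonneg[of a y] corner_dist_eq_0_iff[of a y] by linarith
        have "(\<lambda>n. exp (- corner_dist a y) ^ n) \<longlonglongrightarrow> 0" using pos by (intro LIMSEQ_realpow_zero) auto
        then show ?thesis using False by (simp add: \<psi>_def exp_of_nat_mult[symmetric] mult.commute)
      qed
      then show "AE y in dir_measure d F. (\<lambda>n. \<psi> n y * (jump d W y $ i)) \<longlonglongrightarrow> indicator {..a} y * (jump d W y $ i)"
        by (intro AE_I2 tendsto_mult_right)
    qed measurable
    have "(\<lambda>n. \<Sum>k\<in>UNIV. e $ k * (\<integral>y. \<psi> n y * (jump (axis k 1) W y $ i) \<partial>dir_measure (axis k 1) F))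
        \<longlonglongrightarrow> (\<Sum>k\<in>UNIV. e $ k * I (axis k 1) i {..a})"
      by (intro tendsto_sum tendsto_mult_left lim one)
    then have "(\<lambda>n. \<integral>y. \<psi> n y * (jump e W y $ i) \<partial>dir_measure e F)
        \<longlonglongrightarrow> (\<Sum>k\<in>UNIV. e $ k * I (axis k 1) i {..a})"
      by (subst jump_linear_smooth[OF e der gcont])
    then show "I e i {..a} = (\<Sum>k\<in>UNIV. e $ k * I (axis k 1) i {..a})"
      by (rule LIMSEQ_unique[OF lim[OF e]])
  qed
  have "{..a} \<inter> {..b} = {..inf a b}" for a b :: "real^3" by auto
  then have "Int_stable (range (\<lambda>a::real^3. {..a}))" by (auto simp: Int_stable_def)
  moreover have "range (\<lambda>a::real^3. {..a}) \<subseteq> Pow UNIV" by simp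
  moreover have "A \<in> sigma_sets UNIV (range (\<lambda>a. {..a}))"
    using A by (simp add: borel_eq_atMost)
  ultimately have "lin A"
  proof (induction rule: sigma_sets_induct_disjoint)
    case (basic A)
    then show ?case using atMost by auto
  next
    case empty
    then show ?case by (simp add: lin_def I_def)
  next
    case (compl A)
    then have Ab: "A \<in> sets borel" by (simp add: borel_eq_atMost)
    have "I d i (UNIV - A) = - I d i A" if d: "norm d = 1" for d i
    proof -
      have "I d i (UNIV - A) = (\<integral>y. jump d W y $ i - indicator A y * (jump d W y $ i) \<partial>dir_measure d F)"
        unfolding I_def by (intro Bochner_Integration.integral_cong) (auto simp: indicator_def)
      also have "\<dots> = (\<integral>y. jump d W y $ i \<partial>dir_measure d F) - I d i A"
        using int[OF d Ab, of i] int[OF d, of UNIV i] unfolding I_def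
        by (intro Bochner_Integration.integral_diff) auto
      also have "(\<integral>y. jump d W y $ i \<partial>dir_measure d F) = 0" using UNIV[OF d, of i] by (simp add: I_def)
      finally show ?thesis by simp
    qed
    then show ?case using compl e one by (simp add: lin_def sum_negf)
  next
    case (union A)
    then have Ab: "A n \<in> sets borel" for n by (auto simp: borel_eq_atMost)
    have sums: "(\<lambda>n. I d i (A n)) sums I d i (\<Union>n. A n)" if d: "norm d = 1" for d i
    proof -
      interpret finite_measure "dir_measure d F" by (rule finite_measure_dir_measure[OF d])
      have [measurable]: "A n \<in> sets borel" for n by (rule Ab)
      have lim: "(\<lambda>n. \<Sum>m<n. indicator (A m) y :: real) \<longlonglongrightarrow> indicator (\<Union>n. A n) y" for y
        using indicator_sums[of A y] \<open>disjoint_family A\<close> by (auto simp: disjoint_family_on_def sums_def)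
      have bd: "\<bar>\<Sum>m<n. indicator (A m) y :: real\<bar> \<le> 1" for n y
      proof -
        have "(\<Sum>m<n. indicator (A m) y :: real) = indicator (\<Union>m<n. A m) y"
          using \<open>disjoint_family A\<close> by (intro indicator_UN_disjoint[symmetric]) (auto simp: disjoint_family_on_def)
        then show ?thesis by (simp add: indicator_def)
      qed
      have "(\<lambda>n. \<integral>y. (\<Sum>m<n. indicator (A m) y) * (jump d W y $ i) \<partial>dir_measure d F)
          \<longlonglongrightarrow> (\<integral>y. indicator (\<Union>n. A n) y * (jump d W y $ i) \<partial>dir_measure d F)"
      proof (rule integral_dominated_convergence[where w = "\<lambda>_. 2 * B"])
        have "norm ((\<Sum>m<n. indicator (A m) y) * (jump d W y $ i)) \<le> 1 * (2 * B)" for n y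
          unfolding real_norm_def abs_mult
          using bd[of y n] norm_jump_le[of d y] component_le_norm_cart[of "jump d W y" i]
          by (intro mult_mono) auto
        then show "AE y in dir_measure d F. norm ((\<Sum>m<n. indicator (A m) y) * (jump d W y $ i)) \<le> 2 * B" for n
          by simp
        show "AE y in dir_measure d F. (\<lambda>n. (\<Sum>m<n. indicator (A m) y) * (jump d W y $ i))
            \<longlonglongrightarrow> indicator (\<Union>n. A n) y * (jump d W y $ i)"
          by (intro AE_I2 tendsto_mult_right lim)
      qed auto
      moreover have "(\<integral>y. (\<Sum>m<n. indicator (A m) y) * (jump d W y $ i) \<partial>dir_measure d F) = (\<Sum>m<n. I d i (A m))" for n
        unfolding I_def sum_distrib_right by (intro Bochner_Integration.integral_sum int d Ab)
      ultimately show ?thesis by (simp add: sums_def I_def)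
    qed
    have "(\<lambda>n. \<Sum>k\<in>UNIV. e $ k * I (axis k 1) i (A n)) sums (\<Sum>k\<in>UNIV. e $ k * I (axis k 1) i (\<Union>n. A n))" for i
      by (intro sums_sum sums_mult sums one)
    moreover have "(\<Sum>k\<in>UNIV. e $ k * I (axis k 1) i (A n)) = I e i (A n)" for i n
      using union by (simp add: lin_def)
    ultimately have "(\<lambda>n. I e i (A n)) sums (\<Sum>k\<in>UNIV. e $ k * I (axis k 1) i (\<Union>n. A n))" for i by simp
    then show ?case unfolding lin_def using sums_unique2[OF sums[OF e]] by blast
  qed
  then show ?thesis by (simp add: flux_def vec_eq_iff lin_def I_def)
qed

lemma inner_flux:
  assumes e: "norm e = 1" and A: "A \<in> sets borel"
  shows "x \<bullet> flux e A = (\<integral>y. indicator A y * (x \<bullet> jump e W y) \<partial>dir_measure e F)"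
proof -
  have "x \<bullet> flux e A = (\<Sum>i\<in>UNIV. (\<integral>y. x $ i * (indicator A y * (jump e W y $ i)) \<partial>dir_measure e F))"
    by (simp add: flux_def inner_vec_def)
  also have "\<dots> = (\<integral>y. (\<Sum>i\<in>UNIV. x $ i * (indicator A y * (jump e W y $ i))) \<partial>dir_measure e F)"
    using e A by (intro Bochner_Integration.integral_sum[symmetric] integrable_mult_right integrable_jump) auto
  also have "\<dots> = (\<integral>y. indicator A y * (x \<bullet> jump e W y) \<partial>dir_measure e F)"
    by (intro Bochner_Integration.integral_cong) (auto simp: inner_vec_def sum_distrib_left mult_ac)
  finally show ?thesis .
qed

lemma inner_flux_le:
  assumes e: "norm e = 1" and A: "A \<in> sets borel" and bd: "\<And>y. y \<in> A \<Longrightarrow> \<bar>x \<bullet> jump e W y\<bar> \<le> 1"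
  shows "ennreal \<bar>x \<bullet> flux e A\<bar> \<le> emeasure (dir_measure e F) A"
proof -
  interpret finite_measure "dir_measure e F" by (rule finite_measure_dir_measure[OF e])
  have "\<bar>x \<bullet> flux e A\<bar> \<le> (\<integral>y. indicator A y \<partial>dir_measure e F)"
    unfolding inner_flux[OF e A] real_norm_def[symmetric]
    by (rule Bochner_Integration.integral_norm_bound_integral)
      (use A bd in \<open>auto simp: indicator_def intro!: integrable_const_bound[of _ 1]\<close>)
  also have "\<dots> = measure (dir_measure e F) A" using A by simp
  finally show ?thesis by (simp add: emeasure_eq_measure ennreal_leI)
qed

lemma flux_null:
  assumes e: "norm e = 1" and A: "A \<in> sets borel" and 0: "emeasure (dir_measure e F) A = 0"
  shows "flux e A = 0"
proof -
  have "AE y in dir_measure e F. y \<notin> A"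
    using A 0 by (intro AE_not_in) (auto simp: null_sets_def)
  then have "(\<integral>y. indicator A y * (jump e W y $ i) \<partial>dir_measure e F) = (\<integral>y. 0 \<partial>dir_measure e F)" for i
    using A by (intro integral_cong_AE) (auto elim: eventually_mono)
  then show ?thesis by (simp add: flux_def vec_eq_iff)
qed

lemma flux_Un:
  assumes e: "norm e = 1" and A: "A \<in> sets borel" "A' \<in> sets borel" "A \<inter> A' = {}"
  shows "flux e (A \<union> A') = flux e A + flux e A'"
proof -
  have "(\<integral>y. indicator (A \<union> A') y * (jump e W y $ i) \<partial>dir_measure e F)
      = (\<integral>y. indicator A y * (jump e W y $ i) + indicator A' y * (jump e W y $ i) \<partial>dir_measure e F)" for i
    using A(3) by (intro Bochner_Integration.integral_cong) (auto simp: indicator_def)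
  also have "\<dots> i = (\<integral>y. indicator A y * (jump e W y $ i) \<partial>dir_measure e F)
      + (\<integral>y. indicator A' y * (jump e W y $ i) \<partial>dir_measure e F)" for i
    using e A by (intro Bochner_Integration.integral_add integrable_jump) auto
  finally show ?thesis by (simp add: flux_def vec_eq_iff)
qed

section \<open>The divergence and derivatives of rank one\<close>

text \<open>The mass that the distributional divergence of \<open>W\<close>, a signed measure, gives to \<open>A\<close>.\<close>

definition divergence :: "(real^3) set \<Rightarrow> real" where
  "divergence A = (\<Sum>k\<in>UNIV. flux (axis k 1) A $ k)"

text \<open>Since the field has bounded support, the constant 1 may be used as a test function; its
  gradient is zero.\<close>

lemma divergence_UNIV: "divergence UNIV = 0"
proof -
  have "flux (axis k 1) UNIV $ k = 0" for k
    using jump_formula_dir[OF norm_axis_1, of "\<lambda>_. 1" "\<lambda>_. 0" k k] by (simp add: flux_def)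
  then show ?thesis by (simp add: divergence_def)
qed

lemma divergence_Un:
  assumes "A \<in> sets borel" "A' \<in> sets borel" "A \<inter> A' = {}"
  shows "divergence (A \<union> A') = divergence A + divergence A'"
  using assms by (simp add: divergence_def flux_Un sum.distrib)

lemma divergence_null:
  assumes A: "A \<in> sets borel" and 0: "hausdorff_measure 2 (F \<inter> A) = 0"
  shows "divergence A = 0"
proof -
  have "emeasure (dir_measure (axis k 1) F) A = 0" for k
    using dir_measure_le[OF norm_axis_1 A, of k] 0 by simp
  then show ?thesis using A by (simp add: divergence_def flux_null)
qed

text \<open>The trace of a rank-one matrix \<open>n u\<^sup>T\<close> is \<open>n \<bullet> u\<close>.\<close>

lemma divergence_rank_one:
  assumes A: "A \<in> sets borel" and u: "norm u = 1"
    and perp: "\<And>x k. x \<bullet> u = 0 \<Longrightarrow> x \<bullet> flux (axis k 1) A = 0"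
  shows "divergence A = u \<bullet> flux u A"
proof -
  define r where "r k = u \<bullet> flux (axis k 1) A" for k
  have uu: "u \<bullet> u = 1" using u by (simp add: dot_square_norm)
  have r: "flux (axis k 1) A = r k *\<^sub>R u" for k
  proof -
    let ?v = "flux (axis k 1) A - r k *\<^sub>R u"
    have "?v \<bullet> u = 0" 
      by (simp add: r_def inner_diff_left uu) (rule inner_commute)
    then have "?v \<bullet> ?v = 0" using perp[of ?v k] by (simp add: inner_diff_right)
    then show ?thesis by simp
  qed
  have "u \<bullet> flux u A = (\<Sum>k\<in>UNIV. u $ k * r k)"
    unfolding flux_linear[OF u A] r by (simp add: inner_sum_right uu)
  then show ?thesis by (simp add: divergence_def r mult.commute)
qed

text \<open>Counterpart of \<open>divergence_rank_one\<close> with the restriction on the other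
  factor: here the derivative annihilates every direction orthogonal to \<open>u\<close>, whereas
  there its range lies on the line of \<open>u\<close>. In both cases the trace is the entry at
  \<open>u\<close>.\<close>

lemma divergence_normal:
  assumes A: "A \<in> sets borel" and u: "norm u = 1"
    and perp: "\<And>f. norm f = 1 \<Longrightarrow> f \<bullet> u = 0 \<Longrightarrow> flux f A = 0"
  shows "divergence A = u \<bullet> flux u A"
proof -
  define M where "M v = (\<Sum>k\<in>UNIV. v $ k *\<^sub>R flux (axis k 1) A)" for v
  have lin: "M (v - c *\<^sub>R w) = M v - c *\<^sub>R M w" for v w c
    by (simp add: M_def scaleR_left_diff_distrib sum_subtractf scaleR_sum_right)
  have M: "M e = flux e A" if "norm e = 1" for e
    by (simp add: M_def flux_linear[OF that A])
  have uu: "u \<bullet> u = 1" using u by (simp add: dot_square_norm)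
  have zero: "M v = 0" if "v \<bullet> u = 0" for v
  proof (cases "v = 0")
    case False
    then have "M ((1 / norm v) *\<^sub>R v) = 0"
      using perp[of "(1 / norm v) *\<^sub>R v"] M[of "(1 / norm v) *\<^sub>R v"] that by simp
    moreover have "M ((1 / norm v) *\<^sub>R v) = (1 / norm v) *\<^sub>R M v"
      by (simp add: M_def scaleR_sum_right)
    ultimately show ?thesis using False by simp
  qed (simp add: M_def)
  have "M (axis k 1) = u $ k *\<^sub>R M u" for k
  proof -
    have "M (axis k 1 - (u $ k) *\<^sub>R u) = 0"
      by (rule zero) (simp add: inner_diff_left uu inner_commute[of "axis k 1"] inner_axis)
    then show ?thesis by (simp add: lin)
  qed
  then have "divergence A = (\<Sum>k\<in>UNIV. u $ k * M u $ k)"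
    by (simp add: divergence_def M[symmetric])
  then show ?thesis by (simp add: inner_vec_def M[OF u])
qed

definition controlled :: "(real^3) set \<Rightarrow> bool" where
  "controlled A \<longleftrightarrow> ennreal \<bar>divergence A\<bar> \<le> ennreal (1 / plane_const) * hausdorff_measure 2 (F \<inter> A)"

lemma controlled_Un:
  assumes A: "A \<in> sets borel" "A' \<in> sets borel" "A \<inter> A' = {}" and "controlled A" "controlled A'"
  shows "controlled (A \<union> A')"
proof -
  have [measurable]: "F \<in> sets borel" using F_closed by (rule borel_closed)
  have "ennreal \<bar>divergence (A \<union> A')\<bar> \<le> ennreal \<bar>divergence A\<bar> + ennreal \<bar>divergence A'\<bar>"
    using A by (simp add: divergence_Un ennreal_leI flip: ennreal_plus)
  also have "\<dots> \<le> ennreal (1 / plane_const) * (hausdorff_measure 2 (F \<inter> A) + hausdorff_measure 2 (F \<inter> A'))"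
    using assms unfolding controlled_def distrib_left by (intro add_mono)
  also have "hausdorff_measure 2 (F \<inter> A) + hausdorff_measure 2 (F \<inter> A') = hausdorff_measure 2 (F \<inter> (A \<union> A'))"
    using A plus_emeasure[of "F \<inter> A" "hausdorff 2" "F \<inter> A'"]
    by (simp add: emeasure_hausdorff Int_Un_distrib) (metis Int_assoc Int_commute Int_empty_right plus_emeasure)
  finally show ?thesis by (simp add: controlled_def)
qed

text \<open>The pieces \<open>P i\<close> may overlap. Assuming control on all Borel subsets of a
  piece allows each of them to be reduced by the earlier ones.\<close>

lemma controlled_UN:
  assumes "finite I" and P: "\<And>i. i \<in> I \<Longrightarrow> P i \<in> sets borel"
    and ctrl: "\<And>i A. i \<in> I \<Longrightarrow> A \<in> sets borel \<Longrightarrow> A \<subseteq> P i \<Longrightarrow> controlled A"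
    and A: "A \<in> sets borel"
  shows "controlled (A \<inter> (\<Union>i\<in>I. P i))"
  using \<open>finite I\<close> P ctrl
proof (induction I rule: finite_induct)
  case empty
  then show ?case by (simp add: controlled_def divergence_null)
next
  case (insert i I)
  have [measurable]: "P j \<in> sets borel" if "j \<in> insert i I" for j using insert.prems that by blast
  have U [measurable]: "(\<Union>j\<in>I. P j) \<in> sets borel"
    using insert.hyps by (intro sets.finite_UN) auto
  have "A \<inter> (\<Union>j\<in>insert i I. P j) = A \<inter> (\<Union>j\<in>I. P j) \<union> (A \<inter> P i - (\<Union>j\<in>I. P j))" by auto
  moreover have "controlled (A \<inter> (\<Union>j\<in>I. P j) \<union> (A \<inter> P i - (\<Union>j\<in>I. P j)))"
  proof (rule controlled_Un)
    show "controlled (A \<inter> (\<Union>j\<in>I. P j))" using insert by auto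
    show "controlled (A \<inter> P i - (\<Union>j\<in>I. P j))"
      using A U insert.prems(1)[of i] by (intro insert.prems(2)[of i]) auto
  qed (use A U insert.prems(1)[of i] in auto)
  ultimately show ?case by simp
qed

end

section \<open>Control of the divergence by finitely many directions\<close>

lemma pigeonhole_three:
  assumes f: "\<And>k. k < 13 \<Longrightarrow> f k \<in> L" and L: "finite L" "card L \<le> 6"
  obtains u K where "u \<in> L" "K \<subseteq> {..<13::nat}" "card K = 3" "\<And>k. k \<in> K \<Longrightarrow> f k = u"
proof -
  have "\<exists>u\<in>L. 3 \<le> card {k \<in> {..<13}. f k = u}"
  proof (rule ccontr)
    assume "\<not> ?thesis"
    then have le: "card {k \<in> {..<13}. f k = u} \<le> 2" if "u \<in> L" for u using that by force
    have "{..<13} = (\<Union>u\<in>L. {k \<in> {..<13}. f k = u})" using f by auto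
    then have "card {..<13::nat} \<le> (\<Sum>u\<in>L. card {k \<in> {..<13}. f k = u})"
      using card_UN_le[OF L(1), of "\<lambda>u. {k \<in> {..<13}. f k = u}"] by metis
    also have "\<dots> \<le> (\<Sum>u\<in>L. 2)" using le by (rule sum_mono)
    \<comment> \<open>Origin of the number thirteen: six values taken at most twice each account for
      twelve indices.\<close>
    also have "\<dots> \<le> 12" using L(2) by simp
    finally show False by simp
  qed
  then obtain u where "u \<in> L" "3 \<le> card {k \<in> {..<13}. f k = u}" by blast
  moreover from this(2) obtain K where "K \<subseteq> {k \<in> {..<13}. f k = u}" "card K = 3"
    using obtain_subset_with_card_n by metis
  ultimately show thesis using that[of u K] by blast
qed

text \<open>A Vandermonde argument: a polynomial of degree at most two with three roots vanishes
  identically. It expresses the independence of three vectors on the moment curve.\<close>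

lemma quadratic_three_roots:
  fixes a b c :: real
  assumes "card K = 3" and root: "\<And>k. k \<in> K \<Longrightarrow> a + b * real k + c * (real k)\<^sup>2 = 0"
  shows "a = 0 \<and> b = 0 \<and> c = 0"
proof -
  obtain x y z where K: "K = {x, y, z}" "x \<noteq> y" "y \<noteq> z" "x \<noteq> z"
    using \<open>card K = 3\<close> by (auto simp: card_3_iff)
  have eqs: "a + b * real x + c * (real x)\<^sup>2 = 0" "a + b * real y + c * (real y)\<^sup>2 = 0"
    "a + b * real z + c * (real z)\<^sup>2 = 0"
    using root by (auto simp: K)
  have "(real x - real y) * (b + c * (real x + real y)) = 0" "(real x - real z) * (b + c * (real x + real z)) = 0"
    using eqs by (simp_all add: power2_eq_square algebra_simps)
  then have 1: "b + c * (real x + real y) = 0" "b + c * (real x + real z) = 0" using K by auto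
  then have "c * (real y - real z) = 0" by (simp only: distrib_left right_diff_distrib)
  then have "c = 0" using K by simp
  then show ?thesis using 1 eqs by simp
qed

definition moment_vec :: "nat \<Rightarrow> real^3" where
  "moment_vec k = vector [1, real k, (real k)\<^sup>2]"

definition moment_dir :: "nat \<Rightarrow> real^3" where
  "moment_dir k = (1 / norm (moment_vec k)) *\<^sub>R moment_vec k"

lemma moment_vec_nz: "moment_vec k \<noteq> 0"
  by (auto simp: moment_vec_def vec_eq_iff forall_3)

lemma norm_moment_dir [simp]: "norm (moment_dir k) = 1"
  using moment_vec_nz by (simp add: moment_dir_def)

context jump_field
begin

text \<open>Any three of the thirteen directions on the moment curve are linearly independent and two of
  thirteen jumps on six lines cannot avoid being three on one line, so on each of finitely many pieces
  the derivative of \<open>W\<close> has rank one.\<close>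

lemma controlled_of_jumps:
  assumes L: "finite L" "card L \<le> 6" and unit: "\<And>u. u \<in> L \<Longrightarrow> norm u = 1"
    and A: "A \<in> sets borel"
    and jumps: "\<And>e y. norm e = 1 \<Longrightarrow> y \<in> A \<Longrightarrow> \<exists>u\<in>L. \<exists>r. jump e W y = r *\<^sub>R u \<and> \<bar>r\<bar> \<le> 1"
  shows "controlled A"
proof -
  define P where "P = (\<lambda>(u, K). {y \<in> A. \<forall>k\<in>K. jump (moment_dir k) W y = (u \<bullet> jump (moment_dir k) W y) *\<^sub>R u})"
  define I where "I = L \<times> {K. K \<subseteq> {..<13::nat} \<and> card K = 3}"
  have "finite I" using L by (auto simp: I_def)
  have norm_jump: "norm (jump e W y) \<le> 1" if "norm e = 1" "y \<in> A" for e y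
    using jumps[OF that] unit by auto
  have P: "P (u, K) \<in> sets borel" if "(u, K) \<in> I" for u K
  proof -
    have [measurable]: "A \<in> sets borel" by (rule A)
    have "finite K" using that finite_subset by (auto simp: I_def)
    then have "{y. \<forall>k\<in>K. jump (moment_dir k) W y = (u \<bullet> jump (moment_dir k) W y) *\<^sub>R u} \<in> sets borel"
      by measurable
    moreover have "P (u, K) = A \<inter> {y. \<forall>k\<in>K. jump (moment_dir k) W y = (u \<bullet> jump (moment_dir k) W y) *\<^sub>R u}"
      by (auto simp: P_def)
    ultimately show ?thesis using A by auto
  qed
  have ctrl: "controlled S" if "(u, K) \<in> I" and S: "S \<in> sets borel" "S \<subseteq> P (u, K)" for u K S
  proof -
    have uL: "u \<in> L" and K: "card K = 3" using that by (auto simp: I_def)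
    have u: "norm u = 1" by (rule unit[OF uL])
    have "divergence S = u \<bullet> flux u S"
    proof (rule divergence_rank_one[OF S(1) u])
      fix x k assume xu: "x \<bullet> u = 0"
      have zero: "x \<bullet> flux (moment_dir k) S = 0" if "k \<in> K" for k
      proof -
        have "x \<bullet> jump (moment_dir k) W y = 0" if "y \<in> S" for y
        proof -
          have "jump (moment_dir k) W y = (u \<bullet> jump (moment_dir k) W y) *\<^sub>R u"
            using that S(2) \<open>k \<in> K\<close> by (auto simp: P_def)
          then show ?thesis using xu by (metis inner_scaleR_right mult_zero_right)
        qed
        then have "(\<lambda>y. indicator S y * (x \<bullet> jump (moment_dir k) W y)) = (\<lambda>_. 0)"
          by (auto simp: fun_eq_iff indicator_def)
        then show ?thesis unfolding inner_flux[OF norm_moment_dir S(1)] by simp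
      qed
      \<comment> \<open>By linearity in the direction, the flux along \<open>moment_vec k\<close>
        paired with \<open>x\<close> is a quadratic polynomial in \<open>k\<close> whose
        coefficients are the axis fluxes. It vanishes for the three members of
        \<open>K\<close>.\<close>
      have root: "x \<bullet> flux (axis 1 1) S + x \<bullet> flux (axis 2 1) S * real k + x \<bullet> flux (axis 3 1) S * (real k)\<^sup>2 = 0"
        if "k \<in> K" for k
      proof -
        define n where "n = norm (moment_vec k)"
        have "0 < n" using moment_vec_nz by (simp add: n_def)
        have "moment_dir k $ 1 = 1 / n" "moment_dir k $ 2 = real k / n" "moment_dir k $ 3 = (real k)\<^sup>2 / n"
          by (simp_all add: moment_dir_def n_def[symmetric]) (simp_all add: moment_vec_def)
        then have "x \<bullet> flux (moment_dir k) S = 1 / n * (x \<bullet> flux (axis 1 1) S)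
            + real k / n * (x \<bullet> flux (axis 2 1) S) + (real k)\<^sup>2 / n * (x \<bullet> flux (axis 3 1) S)"
          unfolding flux_linear[OF norm_moment_dir S(1)] by (simp only: sum_3 inner_add_right inner_scaleR_right)
        then have "n * (x \<bullet> flux (moment_dir k) S) = x \<bullet> flux (axis 1 1) S
            + x \<bullet> flux (axis 2 1) S * real k + x \<bullet> flux (axis 3 1) S * (real k)\<^sup>2"
          using \<open>0 < n\<close> by (simp add: distrib_left)
        then show ?thesis by (simp add: zero[OF that])
      qed
      have "x \<bullet> flux (axis 1 1) S = 0 \<and> x \<bullet> flux (axis 2 1) S = 0 \<and> x \<bullet> flux (axis 3 1) S = 0"
        by (rule quadratic_three_roots[OF K root])
      then show "x \<bullet> flux (axis k 1) S = 0" using exhaust_3[of k] by auto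
    qed
    moreover have "\<bar>u \<bullet> jump u W y\<bar> \<le> 1" if "y \<in> S" for y
      using Cauchy_Schwarz_ineq2[of u "jump u W y"] u norm_jump[OF u, of y] that S(2) by (auto simp: P_def)
    \<comment> \<open>Lines in the single direction \<open>u\<close> are used here, so no factor is
      lost against the Hausdorff measure.\<close>
    ultimately have "ennreal \<bar>divergence S\<bar> \<le> emeasure (dir_measure u F) S"
      using inner_flux_le[OF u S(1), of u] by simp
    also have "\<dots> \<le> ennreal (1 / plane_const) * hausdorff_measure 2 (F \<inter> S)"
      by (rule dir_measure_le[OF u S(1)])
    finally show ?thesis by (simp add: controlled_def)
  qed
  have "A \<subseteq> (\<Union>i\<in>I. P i)"
  proof
    fix y assume y: "y \<in> A"
    have "\<forall>k. \<exists>u. u \<in> L \<and> (\<exists>r. jump (moment_dir k) W y = r *\<^sub>R u)" using jumps[OF norm_moment_dir y] by blast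
    then obtain f where f: "\<And>k. f k \<in> L" "\<And>k. \<exists>r. jump (moment_dir k) W y = r *\<^sub>R f k" by metis
    obtain u K where uK: "u \<in> L" "K \<subseteq> {..<13::nat}" "card K = 3" "\<And>k. k \<in> K \<Longrightarrow> f k = u"
      using pigeonhole_three[of f L] f L by blast
    have "jump (moment_dir k) W y = (u \<bullet> jump (moment_dir k) W y) *\<^sub>R u" if k: "k \<in> K" for k
    proof -
      obtain r where "jump (moment_dir k) W y = r *\<^sub>R u" using f(2)[of k] uK(4)[OF k] by auto
      then show ?thesis using unit[OF uK(1)] by (simp add: dot_square_norm)
    qed
    then have "y \<in> P (u, K)" using y by (simp add: P_def)
    moreover have "(u, K) \<in> I" using uK by (simp add: I_def)
    ultimately show "y \<in> (\<Union>i\<in>I. P i)" by blast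
  qed
  moreover have "controlled (A \<inter> (\<Union>i\<in>I. P i))"
    using P ctrl by (intro controlled_UN[OF \<open>finite I\<close> _ _ A]) auto
  ultimately show ?thesis by (simp add: Int_absorb2)
qed

section \<open>Sets contained in a plane\<close>

lemma AE_finite_frame_slice:
  assumes e: "norm e = 1"
  shows "AE u in lborel. slice_count (frame e -` F) u \<noteq> top"
proof -
  have "AE u in lborel. finite (slice (frame e -` F) u)"
    by (intro AE_finite_slice frame_vimage_closed[OF e F_closed])
      (simp add: hausdorff_measure_frame_vimage e F_fin)
  then show ?thesis by eventually_elim (simp add: slice_count_eq_top_iff)
qed

lemma emeasure_dir_measure:
  assumes e: "norm e = 1" and A: "A \<in> sets borel"
  shows "emeasure (dir_measure e F) A = (\<integral>\<^sup>+u. slice_count (frame e -` (F \<inter> A)) u \<partial>lborel)"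
proof -
  note [measurable] = frame_measurable[OF e]
  have "emeasure (dir_measure e F) A = emeasure (slice_measure (frame e -` F)) (frame e -` A)"
    unfolding dir_measure_def using A by (subst emeasure_distr) (simp_all, measurable)
  also have "\<dots> = (\<integral>\<^sup>+u. fibre_measure (frame e -` F) u (frame e -` A) \<partial>lborel)"
    by (intro emeasure_slice_measure frame_vimage_closed frame_vimage_borel e F_closed A)
  also have "\<dots> = (\<integral>\<^sup>+u. slice_count (frame e -` (F \<inter> A)) u \<partial>lborel)"
  proof (rule nn_integral_cong_AE)
    show "AE u in lborel. fibre_measure (frame e -` F) u (frame e -` A) = slice_count (frame e -` (F \<inter> A)) u"
      using AE_finite_frame_slice[OF e] by eventually_elim (simp add: fibre_measure_def)
  qed
  finally show ?thesis .
qed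

text \<open>A line perpendicular to a plane meets it exactly once, so for planar sets the projection
  inequality becomes an equality. This is what makes the estimate sharp for the cone.\<close>

lemma dir_measure_normal:
  assumes u: "norm u = 1" and A: "A \<in> sets borel" and plane: "F \<inter> A \<subseteq> {x. u \<bullet> x = d}"
  shows "emeasure (dir_measure u F) A = ennreal (1 / plane_const) * hausdorff_measure 2 (F \<inter> A)"
proof -
  define X where "X = {v. frame u (v, d) \<in> F \<inter> A}"
  note [measurable] = frame_measurable[OF u]
  have [measurable]: "F \<inter> A \<in> sets borel" using A F_closed by (auto intro: borel_closed)
  have X [measurable]: "X \<in> sets borel" unfolding X_def by measurable
  have "slice_count (frame u -` (F \<inter> A)) v = indicator X v" for v
  proof -
    have "slice (frame u -` (F \<inter> A)) v = (if v \<in> X then {d} else {})"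
      using plane frame_inner_axis[OF u, of v] by (force simp: slice_def X_def)
    then show ?thesis by (simp add: slice_count_def emeasure_count_space)
  qed
  then have "emeasure (dir_measure u F) A = emeasure lborel X"
    by (simp add: emeasure_dir_measure[OF u A])
  moreover have "hausdorff_measure 2 X = hausdorff_measure 2 (F \<inter> A)"
  proof -
    have "(\<lambda>v. frame u (v, d)) ` X = F \<inter> A"
    proof -
      have "x \<in> (\<lambda>v. frame u (v, d)) ` X" if x: "x \<in> F \<inter> A" for x
      proof -
        obtain v t where vt: "frame u (v, t) = x"
          using frame_bij[OF u] by (metis bij_pointE surj_pair)
        moreover have "t = d" using frame_inner_axis[OF u, of v t] vt plane x by auto
        ultimately show ?thesis using x by (auto simp: X_def)
      qed
      then show ?thesis by (auto simp: X_def)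
    qed
    then show ?thesis
      using hausdorff_measure_isometric_image[of X "\<lambda>v. frame u (v, d)" 2]
      by (simp add: frame_dist[OF u] dist_Pair_Pair)
  qed
  moreover have "ennreal (1 / plane_const) * (ennreal plane_const * emeasure lborel X) = emeasure lborel X"
    using plane_const_pos by (simp add: mult.assoc[symmetric] ennreal_mult'[symmetric])
  ultimately show ?thesis using hausdorff_measure_plane[OF X] by metis
qed

text \<open>A line parallel to the plane either lies in it or misses it. The lines that lie in it
  correspond to the points of a line with normal \<open>n\<close> in the parameter plane, a null
  set.\<close>

lemma dir_measure_tangential:
  assumes f: "norm f = 1" and A: "A \<in> sets borel" and u: "u \<noteq> 0" "f \<bullet> u = 0"
    and plane: "F \<inter> A \<subseteq> {x. u \<bullet> x = d}"
  shows "emeasure (dir_measure f F) A = 0"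
proof -
  define n where "n = (u \<bullet> frame f ((1, 0), 0), u \<bullet> frame f ((0, 1), 0))"
  have lin: "u \<bullet> frame f (v, t) = n \<bullet> v" for v t
  proof -
    have "(v, t) = fst v *\<^sub>R ((1, 0), 0) + snd v *\<^sub>R ((0, 1), 0) + t *\<^sub>R (0, 1)"
      by (cases v) simp
    then have "frame f (v, t) = fst v *\<^sub>R frame f ((1, 0), 0) + snd v *\<^sub>R frame f ((0, 1), 0) + t *\<^sub>R f"
      by (metis (no_types) frame_linear[OF f] frame_axis[OF f] linear_add linear_scale)
    then show ?thesis using u(2)
      by (simp add: n_def inner_add_right inner_commute[of u f] inner_prod_def mult.commute)
  qed
  have "n \<noteq> 0"
  proof
    assume "n = 0"
    obtain p where "frame f p = u" using frame_bij[OF f] by (metis bij_pointE)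
    then have "u \<bullet> u = 0" using lin[of "fst p" "snd p"] \<open>n = 0\<close> by simp
    then show False using u by simp
  qed
  have "closed {v. n \<bullet> v = d}" by (rule closed_hyperplane)
  then have "{v. n \<bullet> v = d} \<in> null_sets lborel"
    using negligible_hyperplane[of n d] \<open>n \<noteq> 0\<close>
    by (subst null_sets_completion_iff[symmetric]) (auto simp: negligible_iff_null_sets borel_closed)
  from AE_not_in[OF this] have "AE v in lborel. n \<bullet> v \<noteq> d" by simp
  then have "AE v in lborel. slice_count (frame f -` (F \<inter> A)) v = 0"
  proof eventually_elim
    case (elim v)
    have "(v, t) \<notin> frame f -` (F \<inter> A)" for t
      using subsetD[OF plane, of "frame f (v, t)"] lin[of v t] elim by auto
    then have "slice (frame f -` (F \<inter> A)) v = {}" by (simp add: slice_def)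
    then show ?case by (simp add: slice_count_def)
  qed
  then have "(\<integral>\<^sup>+v. slice_count (frame f -` (F \<inter> A)) v \<partial>lborel) = (\<integral>\<^sup>+v. 0 \<partial>(lborel :: plane measure))"
    by (rule nn_integral_cong_AE)
  then show ?thesis by (simp add: emeasure_dir_measure[OF f A])
qed

lemma divergence_plane:
  assumes u: "norm u = 1" and A: "A \<in> sets borel" and plane: "F \<inter> A \<subseteq> {x. u \<bullet> x = d}"
  shows "divergence A = u \<bullet> flux u A"
proof (rule divergence_normal[OF A u])
  have "u \<noteq> 0" using u by auto
  fix f :: "real^3" assume f: "norm f = 1" "f \<bullet> u = 0"
  show "flux f A = 0"
    by (rule flux_null[OF f(1) A dir_measure_tangential[OF f(1) A \<open>u \<noteq> 0\<close> f(2) plane]])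
qed

end

section \<open>The tetrahedral cone\<close>

text \<open>Index 0 is the vertex below \<Gamma>. Regions are numbered by the vertex they point away
  from, so the top region has number 0 and the three lower ones have 1, 2, 3.\<close>

definition vtx :: "nat \<Rightarrow> real^3" where
  "vtx a = (if a = 0 then vector [0, 0, - 1]
    else if a = 1 then vector [2 * sqrt 2 / 3, 0, 1 / 3]
    else if a = 2 then vector [- (sqrt 2 / 3), sqrt (2 / 3), 1 / 3]
    else vector [- (sqrt 2 / 3), - sqrt (2 / 3), 1 / 3])"

lemma less_4_cases: "a < 4 \<longleftrightarrow> a = 0 \<or> a = 1 \<or> a = 2 \<or> a = (3::nat)"
  by auto

lemma sum_less_4: "(\<Sum>a<4. f a) = f 0 + f 1 + f 2 + f (3::nat)"
  by (simp add: eval_nat_numeral)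

lemma vtx_3: "vtx 0 $ 3 = - 1" "a \<noteq> 0 \<Longrightarrow> vtx a $ 3 = 1 / 3"
  by (auto simp: vtx_def)

lemma vtx_inner: "a < 4 \<Longrightarrow> b < 4 \<Longrightarrow> vtx a \<bullet> vtx b = (if a = b then 1 else - 1 / 3)"
proof -
  have sq: "2 * sqrt 2 * sqrt 2 = (4::real)" "sqrt 2 * (2 * sqrt 2) = (4::real)" by simp_all
  assume "a < 4" "b < 4"
  then show ?thesis
    unfolding less_4_cases by (elim disjE) (simp_all add: vtx_def inner_vec_def sum_3 sq)
qed

lemma sum_vtx: "(\<Sum>a<4. vtx a) = 0"
  by (simp add: sum_less_4 vtx_def vec_eq_iff forall_3)

text \<open>The vertices form a tight frame: the sum of the rank-one matrices of the four unit
  vectors is \<open>4 / 3\<close> times the identity.\<close>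

lemma vtx_expansion: "x = (3 / 4) *\<^sub>R (\<Sum>a<4. (vtx a \<bullet> x) *\<^sub>R vtx a)"
proof -
  have "sqrt 2 * (sqrt 2 * t) = 2 * t" "sqrt (2/3) * (sqrt (2/3) * t) = 2 / 3 * t" for t
    by (simp_all add: mult.assoc[symmetric])
  then show ?thesis
    by (simp add: sum_less_4 vtx_def vec_eq_iff forall_3 inner_vec_def sum_3 algebra_simps)
qed

lemma inj_on_vtx: "inj_on vtx {..<4}"
proof (rule inj_onI, rule ccontr)
  fix a b :: nat assume ab: "a \<in> {..<4}" "b \<in> {..<4}" "vtx a = vtx b" "a \<noteq> b"
  then have "vtx a \<bullet> vtx b = 1" using vtx_inner[of a a] by simp
  then show False using ab vtx_inner[of a b] by simp
qed

lemma tetrahedron_vertices_eq: "tetrahedron_vertices = vtx ` {..<4}"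
proof -
  have "{..<4::nat} = {1, 2, 3, 0}" by auto
  then show ?thesis by (simp add: tetrahedron_vertices_def vtx_def insert_commute)
qed

text \<open>The Gram matrix is \<open>4 / 3\<close> times the identity minus \<open>1 / 3\<close>
  times the all-ones matrix. For coefficients with sum 0 the second part drops out, so pairing with
  one vertex isolates its coefficient.\<close>

lemma affine_independent_vertices: "\<not> affine_dependent tetrahedron_vertices"
proof
  assume "affine_dependent tetrahedron_vertices"
  then obtain U where U: "sum U tetrahedron_vertices = 0" "\<exists>v\<in>tetrahedron_vertices. U v \<noteq> 0"
    "(\<Sum>v\<in>tetrahedron_vertices. U v *\<^sub>R v) = 0"
    by (subst (asm) affine_dependent_explicit_finite) (auto simp: tetrahedron_vertices_eq)
  define u where "u a = U (vtx a)" for a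
  have s0: "(\<Sum>a<4. u a) = 0" and s1: "(\<Sum>a<4. u a *\<^sub>R vtx a) = 0"
    using U inj_on_vtx by (simp_all add: tetrahedron_vertices_eq sum.reindex u_def)
  have "u b = 0" if "b < 4" for b
  proof -
    have "0 = vtx b \<bullet> (\<Sum>a<4. u a *\<^sub>R vtx a)" using s1 by simp
    also have "\<dots> = (\<Sum>a<4. u a * (if a = b then 1 else - 1 / 3))"
      using that by (auto simp: inner_sum_right vtx_inner intro!: sum.cong)
    also have "\<dots> = (\<Sum>a<4. 4 / 3 * (if a = b then u a else 0) - 1 / 3 * u a)"
      by (intro sum.cong) auto
    also have "\<dots> = 4 / 3 * u b"
      using that by (simp only: sum_subtractf sum_distrib_left[symmetric] s0) simp
    finally show ?thesis by simp
  qed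
  then show False using U(2) by (auto simp: tetrahedron_vertices_eq u_def)
qed

text \<open>The faces of a simplex are the hulls of its vertex sets, and dimension one singles out
  the pairs.\<close>

lemma edge_of_tetrahedron_iff:
  "e edge_of (convex hull tetrahedron_vertices) \<longleftrightarrow>
    (\<exists>c d. c < 4 \<and> d < 4 \<and> c \<noteq> d \<and> e = closed_segment (vtx c) (vtx d))" (is "?l \<longleftrightarrow> ?r")
proof
  assume ?l
  then obtain S where S: "S \<subseteq> tetrahedron_vertices" "e = convex hull S" and dim: "aff_dim e = 1"
    using face_of_convex_hull_affine_independent[OF affine_independent_vertices]
    by (auto simp: edge_of_def)
  have "\<not> affine_dependent S"
    using affine_independent_vertices affine_dependent_subset S(1) by blast
  from aff_dim_affine_independent[OF this] have "aff_dim S = int (card S) - 1" by simp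
  then have "card S = 2" using dim S by (simp add: aff_dim_convex_hull)
  then obtain p q where pq: "S = {p, q}" "p \<noteq> q" by (auto simp: card_2_iff)
  with S obtain c d where "c < 4" "d < 4" "p = vtx c" "q = vtx d" by (auto simp: tetrahedron_vertices_eq)
  then show ?r using pq S by (auto simp: segment_convex_hull)
next
  assume ?r
  then obtain c d where cd: "c < 4" "d < 4" "c \<noteq> d" "e = closed_segment (vtx c) (vtx d)" by blast
  have ne: "vtx c \<noteq> vtx d" using cd inj_on_vtx by (auto dest: inj_onD)
  have "{vtx c, vtx d} \<subseteq> tetrahedron_vertices" using cd by (auto simp: tetrahedron_vertices_eq)
  then have "e face_of (convex hull tetrahedron_vertices)"
    using face_of_convex_hull_affine_independent[OF affine_independent_vertices] cd
    by (metis segment_convex_hull)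
  moreover have "aff_dim e = 1"
    using ne cd by (simp add: segment_convex_hull aff_dim_convex_hull aff_dim_2)
  ultimately show ?l by (simp add: edge_of_def)
qed

text \<open>The point \<open>x\<close> lies on the sheet between the regions \<open>a\<close> and \<open>b\<close>, the region \<open>a\<close> being the set
  of all points whose inner product with \<open>vtx a\<close> is the smallest of the four.\<close>

definition tie :: "nat \<Rightarrow> nat \<Rightarrow> real^3 \<Rightarrow> bool" where
  "tie a b x \<longleftrightarrow> vtx a \<bullet> x = vtx b \<bullet> x \<and> (\<forall>c<4. vtx a \<bullet> x \<le> vtx c \<bullet> x)"

lemma cone_overI: "v \<noteq> 0 \<Longrightarrow> y \<in> half_line v \<Longrightarrow> y \<in> A \<Longrightarrow> x \<in> half_line v \<Longrightarrow> x \<in> cone_over A"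
  unfolding cone_over_def by blast

lemma half_lineI: "0 \<le> t \<Longrightarrow> x = t *\<^sub>R v \<Longrightarrow> x \<in> half_line v"
  unfolding half_line_def by blast

text \<open>On the edge between two vertices the inner product with each of the other two is
  \<open>- 1 / 3\<close>, the smallest value that occurs. Scaling by a nonnegative factor keeps such
  a tie. Conversely, a tie between \<open>a\<close> and \<open>b\<close> makes the point a
  nonnegative combination of the remaining two vertices.\<close>

lemma tetrahedral_cone_eq: "tetrahedral_cone = {x. \<exists>a<4. \<exists>b<4. a \<noteq> b \<and> tie a b x}"
proof (intro equalityI subsetI)
  fix x assume "x \<in> tetrahedral_cone"
  then obtain w e where w: "w \<noteq> 0" "x \<in> half_line w" "half_line w \<inter> e \<noteq> {}"
    and e: "e edge_of (convex hull tetrahedron_vertices)"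
    unfolding tetrahedral_cone_def cone_over_def by blast
  obtain t where t: "0 \<le> t" "x = t *\<^sub>R w" using w by (auto simp: half_line_def)
  obtain s where s: "0 \<le> s" "s *\<^sub>R w \<in> e" using w by (auto simp: half_line_def)
  obtain c d where cd: "c < 4" "d < 4" "c \<noteq> d" "s *\<^sub>R w \<in> closed_segment (vtx c) (vtx d)"
    using e s by (auto simp: edge_of_tetrahedron_iff)
  obtain l where l: "0 \<le> l" "l \<le> 1" "s *\<^sub>R w = (1 - l) *\<^sub>R vtx c + l *\<^sub>R vtx d"
    using cd(4) by (auto simp: in_segment)
  obtain a b where ab: "a < 4" "b < 4" "a \<noteq> b" "{..<4} = {a, b, c, d}" "a \<noteq> c" "a \<noteq> d" "b \<noteq> c" "b \<noteq> d"
  proof -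
    have "card ({..<4} - {c, d}) = 2" using cd by (subst card_Diff_subset) auto
    then obtain a b where "{..<4} - {c, d} = {a, b}" "a \<noteq> b" by (auto simp: card_2_iff)
    then show thesis using that[of a b] cd by blast
  qed
  have in1: "vtx e \<bullet> (s *\<^sub>R w) = (1 - l) * (vtx e \<bullet> vtx c) + l * (vtx e \<bullet> vtx d)" for e
    by (simp add: l(3) inner_add_right)
  have va: "vtx a \<bullet> (s *\<^sub>R w) = - 1 / 3" "vtx b \<bullet> (s *\<^sub>R w) = - 1 / 3"
    unfolding in1 using ab cd by (simp_all add: vtx_inner field_simps)
  have ge: "- 1 / 3 \<le> vtx e \<bullet> (s *\<^sub>R w)" if "e < 4" for e
  proof -
    have "(1 - l) * (- 1 / 3) + l * (- 1 / 3) \<le> (1 - l) * (vtx e \<bullet> vtx c) + l * (vtx e \<bullet> vtx d)"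
      using l that cd by (intro add_mono mult_left_mono) (auto simp: vtx_inner)
    then show ?thesis unfolding in1 by (simp add: field_simps)
  qed
  have "s \<noteq> 0" using va by auto
  then have "0 < s" using s by simp
  have x: "vtx e \<bullet> x = t / s * (vtx e \<bullet> (s *\<^sub>R w))" for e using \<open>s \<noteq> 0\<close> by (simp add: t)
  have "tie a b x"
    unfolding tie_def
  proof (intro conjI allI impI)
    show "vtx a \<bullet> x = vtx b \<bullet> x" by (simp only: x va)
    show "vtx a \<bullet> x \<le> vtx e \<bullet> x" if "e < 4" for e
      unfolding x va using t \<open>0 < s\<close> by (intro mult_left_mono ge that) simp
  qed
  then show "x \<in> {x. \<exists>a<4. \<exists>b<4. a \<noteq> b \<and> tie a b x}" using ab by blast
next
  fix x assume "x \<in> {x. \<exists>a<4. \<exists>b<4. a \<noteq> b \<and> tie a b x}"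
  then obtain a b where ab: "a < 4" "b < 4" "a \<noteq> b" and tie: "tie a b x" by blast
  obtain c d where cd: "c < 4" "d < 4" "c \<noteq> d" "{..<4} = {a, b, c, d}" "a \<noteq> c" "a \<noteq> d" "b \<noteq> c" "b \<noteq> d"
  proof -
    have "card ({..<4} - {a, b}) = 2" using ab by (subst card_Diff_subset) auto
    then obtain c d where "{..<4} - {a, b} = {c, d}" "c \<noteq> d" by (auto simp: card_2_iff)
    then show thesis using that[of c d] ab by blast
  qed
  define m where "m = vtx a \<bullet> x"
  define p where "p = 3 / 4 * (vtx c \<bullet> x - m)"
  define q where "q = 3 / 4 * (vtx d \<bullet> x - m)"
  have pq: "0 \<le> p" "0 \<le> q" using tie cd by (auto simp: p_def q_def m_def tie_def)
  \<comment> \<open>The vertices sum to zero, so the common minimum \<open>m\<close> may be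
    subtracted from all four coefficients; the two tied ones vanish and the others become
    nonnegative.\<close>
  have "x = (3 / 4) *\<^sub>R (\<Sum>e<4. (vtx e \<bullet> x) *\<^sub>R vtx e) - (3 / 4 * m) *\<^sub>R (\<Sum>e<4. vtx e)"
    unfolding sum_vtx using vtx_expansion[of x] by simp
  also have "\<dots> = (3 / 4) *\<^sub>R (\<Sum>e<4. (vtx e \<bullet> x - m) *\<^sub>R vtx e)"
    by (simp add: scaleR_left_diff_distrib sum_subtractf scaleR_right_diff_distrib scaleR_sum_right)
  also have "(\<Sum>e<4. (vtx e \<bullet> x - m) *\<^sub>R vtx e) = (vtx c \<bullet> x - m) *\<^sub>R vtx c + (vtx d \<bullet> x - m) *\<^sub>R vtx d"
    using cd ab tie by (simp add: cd(4) m_def tie_def)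
  finally have x: "x = p *\<^sub>R vtx c + q *\<^sub>R vtx d"
    by (simp add: p_def q_def scaleR_right_distrib)
  have seg: "closed_segment (vtx c) (vtx d) \<subseteq> \<Union> {e. e edge_of (convex hull tetrahedron_vertices)}"
    using cd by (auto simp: edge_of_tetrahedron_iff)
  show "x \<in> tetrahedral_cone"
  proof (cases "x = 0")
    case True
    have "vtx c \<noteq> 0" using vtx_inner[OF cd(1) cd(1)] by auto
    moreover have "vtx c \<in> half_line (vtx c)" "x \<in> half_line (vtx c)"
      using True by (auto intro: half_lineI[of 1] half_lineI[of 0])
    moreover have "vtx c \<in> \<Union> {e. e edge_of (convex hull tetrahedron_vertices)}"
      using seg by auto
    ultimately show ?thesis unfolding tetrahedral_cone_def by (intro cone_overI)
  next
    case False
    then have "p + q \<noteq> 0" using x pq by (auto simp: add_nonneg_eq_0_iff)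
    then have pos: "0 < p + q" using pq by simp
    have "(1 / (p + q)) *\<^sub>R x \<in> closed_segment (vtx c) (vtx d)"
      unfolding in_segment
    proof (intro exI conjI)
      show "(1 / (p + q)) *\<^sub>R x = (1 - q / (p + q)) *\<^sub>R vtx c + (q / (p + q)) *\<^sub>R vtx d"
        using pos by (simp add: x scaleR_right_distrib field_simps)
    qed (use pq pos in auto)
    moreover have "(1 / (p + q)) *\<^sub>R x \<in> half_line x" "x \<in> half_line x"
      using pos by (auto intro: half_lineI[of 1] half_lineI[of "1 / (p + q)"])
    ultimately show ?thesis
      using seg unfolding tetrahedral_cone_def by (intro cone_overI[OF False]) auto
  qed
qed

lemma T_plus_eq: "T_plus = {x. 0 \<le> x $ 3 \<and> (\<exists>a<4. \<exists>b<4. a \<noteq> b \<and> tie a b x)}"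
  by (auto simp: T_plus_def tetrahedral_cone_eq half_space_def)

section \<open>Separation by sliding images\<close>

text \<open>The straight-line homotopy from the identity to \<open>f\<close> never hits
  \<open>a\<close>, so it can be followed by the radial projection from \<open>a\<close> onto the
  unit sphere.\<close>

lemma homotopic_Borsuk_straight_line:
  fixes f :: "'a::euclidean_space \<Rightarrow> 'a"
  assumes f: "continuous_on S f" and seg: "\<And>x. x \<in> S \<Longrightarrow> a \<notin> closed_segment x (f x)"
  shows "homotopic_with_canon (\<lambda>x. True) S (sphere 0 1)
    (\<lambda>x. inverse (norm (x - a)) *\<^sub>R (x - a)) (\<lambda>x. inverse (norm (f x - a)) *\<^sub>R (f x - a))"
proof -
  define h where "h z = (1 - fst z) *\<^sub>R snd z + fst z *\<^sub>R f (snd z) - a" for z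
  have nz: "h z \<noteq> 0" if "z \<in> {0..1} \<times> S" for z
  proof
    assume "h z = 0"
    then have "a = (1 - fst z) *\<^sub>R snd z + fst z *\<^sub>R f (snd z)" by (simp add: h_def)
    then have "a \<in> closed_segment (snd z) (f (snd z))" using that by (auto simp: in_segment)
    then show False using seg[of "snd z"] that by auto
  qed
  have "continuous_on ({0..1} \<times> S) (\<lambda>z. f (snd z))"
    by (rule continuous_on_compose2[OF f]) (auto intro: continuous_intros)
  then have "continuous_on ({0..1} \<times> S) h"
    unfolding h_def by (intro continuous_intros)
  then have "continuous_on ({0..1} \<times> S) (\<lambda>z. inverse (norm (h z)) *\<^sub>R h z)"
    using nz by (intro continuous_intros) auto
  moreover have "(\<lambda>z. inverse (norm (h z)) *\<^sub>R h z) \<in> ({0..1} \<times> S) \<rightarrow> sphere 0 1"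
    using nz by (force simp: divide_simps)
  ultimately show ?thesis
    unfolding homotopic_with_def
    by (intro exI[of _ "\<lambda>z. inverse (norm (h z)) *\<^sub>R h z"]) (auto simp: h_def)
qed

text \<open>Up to homotopy the moved frontier, capped off by a large sphere, is the frontier of a convex
  body, so the Borsuk maps of \<open>a\<close> and \<open>b\<close> still distinguish the two sides.\<close>

lemma moved_frontier_separates:
  fixes C :: "'a::euclidean_space set" and f :: "'a \<Rightarrow> 'a"
  assumes dim: "2 \<le> DIM('a)" and C: "closed C" and a: "a \<in> interior C" and b: "b \<notin> C"
    and f: "continuous_on (frontier C) f"
    and moved: "\<And>x. x \<in> frontier C \<Longrightarrow> f x \<noteq> x \<Longrightarrow> norm x \<le> M"
    and seg: "\<And>x. x \<in> frontier C \<Longrightarrow> a \<notin> closed_segment x (f x) \<and> b \<notin> closed_segment x (f x)"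
  shows "\<not> connected_component (- f ` frontier C) a b"
proof
  assume conn: "connected_component (- f ` frontier C) a b"
  \<comment> \<open>Only a bounded part of the frontier is moved. Hence the image is closed, and the
    components of its open complement are path components.\<close>
  have "f ` frontier C = f ` (frontier C \<inter> cball 0 (M + 1)) \<union> (frontier C - ball 0 (M + 1))"
  proof -
    have "f x = x" if "x \<in> frontier C" "x \<notin> cball 0 (M + 1) \<or> x \<notin> ball 0 (M + 1)" for x
      using moved[OF that(1)] that(2) by (force simp: dist_norm)
    then show ?thesis by (force simp: image_iff)
  qed
  moreover have "compact (f ` (frontier C \<inter> cball 0 (M + 1)))"
    using f by (intro compact_continuous_image closed_Int_compact) (auto intro: continuous_on_subset)
  ultimately have "closed (f ` frontier C)"
    by (simp add: compact_imp_closed closed_Un closed_Diff)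
  then have "path_component (- f ` frontier C) a b"
    using conn by (simp add: open_path_connected_component open_Compl)
  then obtain g where g: "path g" "path_image g \<subseteq> - f ` frontier C" "pathstart g = a" "pathfinish g = b"
    by (auto simp: path_component_def)
  obtain N where N: "\<And>x. x \<in> path_image g \<Longrightarrow> norm x < N"
    using bounded_path_image[OF g(1)] by (metis bounded_pos_less)
  \<comment> \<open>The sphere of this radius lies beyond the path and beyond everything moved, so
    the cap stays fixed and does not block the path.\<close>
  define R where "R = max N (M + 1)"
  have ab: "norm a < R" "norm b < R"
    using N[of a] N[of b] g pathstart_in_path_image[of g] pathfinish_in_path_image[of g] by (auto simp: R_def)
  define K where "K = C \<inter> cball 0 R"
  define Y where "Y = frontier K"
  define h where "h x = (if x \<in> frontier C then f x else x)" for x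
  have Y: "compact Y" unfolding Y_def K_def using C by (intro compact_frontier closed_Int_compact) auto
  have Y_cases: "x \<in> frontier C \<inter> cball 0 R \<or> x \<in> sphere 0 R" if x: "x \<in> Y" for x
  proof -
    have "x \<in> K" using x C by (simp add: Y_def frontier_def K_def closed_Int closure_closed)
    moreover have "x \<notin> interior C \<or> x \<notin> ball 0 R"
      using x by (auto simp: Y_def frontier_def K_def interior_cball)
    ultimately show ?thesis using C by (auto simp: K_def frontier_def)
  qed
  have hfix: "h x = x" if "x \<in> sphere 0 R" for x
    using moved[of x] that by (auto simp: h_def R_def)
  have "continuous_on (Y \<inter> frontier C) h"
    by (rule continuous_on_eq[OF continuous_on_subset[OF f]]) (auto simp: h_def)
  moreover have "continuous_on (Y \<inter> sphere 0 R) h"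
    by (rule continuous_on_eq[OF continuous_on_id]) (simp add: hfix)
  ultimately have "continuous_on ((Y \<inter> frontier C) \<union> (Y \<inter> sphere 0 R)) h"
    using Y by (intro continuous_on_closed_Un closed_Int) (auto simp: compact_imp_closed)
  moreover have "(Y \<inter> frontier C) \<union> (Y \<inter> sphere 0 R) = Y" using Y_cases by blast
  ultimately have h: "continuous_on Y h" by simp
  have hseg: "a \<notin> closed_segment x (h x) \<and> b \<notin> closed_segment x (h x)" if x: "x \<in> Y" for x
  proof (cases "x \<in> frontier C")
    case True
    then show ?thesis using seg by (simp add: h_def)
  next
    case False
    then show ?thesis using Y_cases[OF x] ab by (auto simp: h_def)
  qed
  have "path_image g \<subseteq> - h ` Y"
  proof
    fix y assume y: "y \<in> path_image g"
    have "y \<noteq> h x" if x: "x \<in> Y" for x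
    proof (cases "x \<in> frontier C")
      case True
      then show ?thesis using g(2) y by (auto simp: h_def)
    next
      case False
      then show ?thesis using Y_cases[OF x] N[OF y] by (auto simp: h_def R_def)
    qed
    then show "y \<in> - h ` Y" by blast
  qed
  then have "path_component (- h ` Y) a b" using g by (auto simp: path_component_def)
  from Borsuk_maps_homotopic_in_path_component[OF this]
  have "homotopic_with_canon (\<lambda>x. True) Y (sphere 0 1)
      ((\<lambda>x. inverse (norm (x - a)) *\<^sub>R (x - a)) \<circ> h) ((\<lambda>x. inverse (norm (x - b)) *\<^sub>R (x - b)) \<circ> h)"
    by (rule homotopic_with_compose_continuous_right) (use h in auto)
  then have mid: "homotopic_with_canon (\<lambda>x. True) Y (sphere 0 1)
      (\<lambda>x. inverse (norm (h x - a)) *\<^sub>R (h x - a)) (\<lambda>x. inverse (norm (h x - b)) *\<^sub>R (h x - b))"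
    by (simp add: o_def)
  \<comment> \<open>The segments from \<open>x\<close> to \<open>h x\<close> avoid both points, so
    \<open>h\<close> can be replaced by the identity at either end of the homotopy
    \<open>mid\<close>.\<close>
  have 1: "homotopic_with_canon (\<lambda>x. True) Y (sphere 0 1)
    (\<lambda>x. inverse (norm (x - c)) *\<^sub>R (x - c)) (\<lambda>x. inverse (norm (h x - c)) *\<^sub>R (h x - c))"
    if "c = a \<or> c = b" for c
    using hseg that by (intro homotopic_Borsuk_straight_line[OF h]) auto
  have "homotopic_with_canon (\<lambda>x. True) Y (sphere 0 1)
    (\<lambda>x. inverse (norm (x - a)) *\<^sub>R (x - a)) (\<lambda>x. inverse (norm (x - b)) *\<^sub>R (x - b))"
    using homotopic_with_trans[OF homotopic_with_trans[OF 1[of a] mid] homotopic_with_symD[OF 1[of b]]] by simp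
  moreover have aY: "a \<notin> Y" and bY: "b \<notin> Y"
    using hseg by (auto dest: hseg)
  ultimately have "connected_component (- Y) a b"
    using Borsuk_maps_homotopic_in_connected_component_eq[OF Y aY bY dim] by (simp add: divideR_right)
  then obtain T where T: "connected T" "T \<subseteq> - Y" "a \<in> T" "b \<in> T" by (auto simp: connected_component_def)
  have "T \<inter> K \<noteq> {}" using T a ab interior_subset[of C] by (auto simp: K_def)
  moreover have "T - K \<noteq> {}" using T b by (auto simp: K_def)
  ultimately have "T \<inter> Y \<noteq> {}" unfolding Y_def by (rule connected_Int_frontier[OF T(1)])
  then show False using T by blast
qed

section \<open>The four regions of the cone\<close>

definition region :: "nat \<Rightarrow> (real^3) set" where
  "region a = {x. \<forall>b<4. b \<noteq> a \<longrightarrow> vtx a \<bullet> x < vtx b \<bullet> x}"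

definition closed_region :: "nat \<Rightarrow> (real^3) set" where
  "closed_region a = {x. \<forall>b<4. vtx a \<bullet> x \<le> vtx b \<bullet> x}"

lemma region_altdef: "region a = (\<Inter>b\<in>{..<4} - {a}. {x. vtx a \<bullet> x < vtx b \<bullet> x})"
  by (auto simp: region_def)

lemma open_region: "open (region a)"
  unfolding region_altdef by (intro open_INT open_Collect_less continuous_intros ballI) auto

lemma closed_closed_region: "closed (closed_region a)"
proof -
  have "closed_region a = (\<Inter>b\<in>{..<4}. {x. vtx a \<bullet> x \<le> vtx b \<bullet> x})" by (auto simp: closed_region_def)
  also have "closed \<dots>" by (intro closed_INT closed_Collect_le continuous_intros ballI)
  finally show ?thesis .
qed

lemma region_subset_interior: "region a \<subseteq> interior (closed_region a)"
proof (rule interior_maximal[OF _ open_region])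
  show "region a \<subseteq> closed_region a"
  proof
    fix x assume x: "x \<in> region a"
    have "vtx a \<bullet> x \<le> vtx b \<bullet> x" if "b < 4" for b
      using x that by (cases "b = a") (auto simp: region_def intro: less_imp_le)
    then show "x \<in> closed_region a" by (simp add: closed_region_def)
  qed
qed

lemma frontier_closed_region:
  assumes "a < 4" "x \<in> frontier (closed_region a)"
  shows "\<exists>b<4. b \<noteq> a \<and> tie a b x"
proof -
  have x: "x \<in> closed_region a" "x \<notin> interior (closed_region a)"
    using assms closed_closed_region by (auto simp: frontier_def)
  then have "x \<notin> region a" using region_subset_interior by blast
  then obtain b where "b < 4" "b \<noteq> a" "\<not> vtx a \<bullet> x < vtx b \<bullet> x" by (auto simp: region_def)
  then have "tie a b x" using x(1) by (auto simp: tie_def closed_region_def intro: antisym)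
  then show ?thesis using \<open>b < 4\<close> \<open>b \<noteq> a\<close> by blast
qed

lemma region_disjoint: "a < 4 \<Longrightarrow> b < 4 \<Longrightarrow> a \<noteq> b \<Longrightarrow> x \<in> region b \<Longrightarrow> x \<notin> closed_region a"
  by (auto simp: region_def closed_region_def not_le)

lemma not_tie_region: "x \<in> region c \<Longrightarrow> a < 4 \<Longrightarrow> b < 4 \<Longrightarrow> c < 4 \<Longrightarrow> a \<noteq> b \<Longrightarrow> \<not> tie a b x"
  unfolding tie_def region_def by (cases "a = c") (force, force)

lemma in_some_region:
  assumes "\<not> (\<exists>a<4. \<exists>b<4. a \<noteq> b \<and> tie a b x)"
  shows "\<exists>a<4. x \<in> region a"
proof -
  define a where "a = arg_min_on (\<lambda>a. vtx a \<bullet> x) {..<4}"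
  have a: "a < 4" "vtx a \<bullet> x \<le> vtx b \<bullet> x" if "b < 4" for b
    using arg_min_if_finite(1)[of "{..<4::nat}" "\<lambda>a. vtx a \<bullet> x"]
      arg_min_least[of "{..<4::nat}" b "\<lambda>a. vtx a \<bullet> x"] that by (auto simp: a_def)
  have "x \<in> region a"
    unfolding region_def
  proof (intro CollectI allI impI)
    fix b assume b: "b < 4" "b \<noteq> a"
    then have "\<not> tie a b x" using assms a(1) by auto
    then show "vtx a \<bullet> x < vtx b \<bullet> x" using a b by (force simp: tie_def)
  qed
  then show ?thesis using a(1)[of 0] by auto
qed

lemma vtx_0_inner: "vtx 0 \<bullet> x = - x $ 3"
  by (simp add: vtx_def inner_vec_def sum_3)

lemma T_plus_iff: "x \<in> T_plus \<longleftrightarrow> 0 \<le> x $ 3 \<and> (\<exists>a<4. \<exists>b<4. a \<noteq> b \<and> tie a b x)"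
  by (simp add: T_plus_eq)

lemma sum_vtx_inner: "vtx 0 \<bullet> x + vtx 1 \<bullet> x + vtx 2 \<bullet> x + vtx 3 \<bullet> x = 0"
  using arg_cong[OF sum_vtx, of "\<lambda>v. v \<bullet> x"] by (simp add: sum_less_4 inner_add_left)

text \<open>The four inner products sum to zero, so the smallest of them is at most 0; here that one
  is \<open>- x $ 3\<close>.\<close>

lemma tie_0_height: "tie a b x \<Longrightarrow> a = 0 \<or> b = 0 \<Longrightarrow> 0 \<le> x $ 3"
proof -
  assume "tie a b x" "a = 0 \<or> b = 0"
  then have "vtx 0 \<bullet> x \<le> vtx c \<bullet> x" if "c < 4" for c using that by (auto simp: tie_def)
  from this[of 1] this[of 2] this[of 3] show ?thesis
    using sum_vtx_inner[of x] by (simp add: vtx_0_inner)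
qed

section \<open>Sliding maps and their extension below the boundary\<close>

definition lift_up :: "real^3 \<Rightarrow> real^3" where
  "lift_up x = vector [x $ 1, x $ 2, max (x $ 3) 0]"

lemma lift_up_nth [simp]: "lift_up x $ 1 = x $ 1" "lift_up x $ 2 = x $ 2" "lift_up x $ 3 = max (x $ 3) 0"
  by (simp_all add: lift_up_def)

lemma lift_up_id: "0 \<le> x $ 3 \<Longrightarrow> lift_up x = x"
  by (simp add: vec_eq_iff forall_3)

lemma continuous_lift_up: "continuous_on S lift_up"
proof -
  have "lift_up x = x + (max (x $ 3) 0 - x $ 3) *\<^sub>R axis 3 1" for x
    by (simp add: vec_eq_iff forall_3 axis_def)
  then have *: "lift_up = (\<lambda>x. x + (max (x $ 3) 0 - x $ 3) *\<^sub>R axis 3 1)" by blast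
  show ?thesis unfolding * by (intro continuous_intros)
qed

text \<open>Below \<Gamma> the full cone consists of vertical walls, where vertex 0 takes no part in
  the tie. Raising a point changes the other three inner products by the same amount. Once it is on
  \<Gamma> the inner product with vertex 0 is 0, while the smallest of the other three, whose sum is
  then 0, is at most 0.\<close>

lemma lift_up_mem_T_plus:
  assumes tie: "a < 4" "b < 4" "a \<noteq> b" "tie a b x"
  shows "lift_up x \<in> T_plus"
proof (cases "0 \<le> x $ 3")
  case True
  then show ?thesis using tie by (auto simp: lift_up_id T_plus_iff)
next
  case False
  then have ab: "a \<noteq> 0" "b \<noteq> 0" using tie_0_height[OF tie(4)] by auto
  have in_up: "vtx c \<bullet> lift_up x = vtx c \<bullet> x - 1 / 3 * x $ 3" if "c \<noteq> 0" for c
    using False that vtx_3(2)[OF that] by (simp add: inner_vec_def sum_3)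
  have in0: "vtx 0 \<bullet> lift_up x = 0" using False by (simp add: vtx_0_inner)
  have le: "vtx a \<bullet> lift_up x \<le> vtx c \<bullet> lift_up x" if "c < 4" "c \<noteq> 0" for c
  proof -
    have "vtx a \<bullet> x \<le> vtx c \<bullet> x" using tie(4) that(1) unfolding tie_def by blast
    then show ?thesis using ab that by (simp add: in_up)
  qed
  have "vtx a \<bullet> lift_up x \<le> 0"
    using sum_vtx_inner[of "lift_up x"] le[of 1] le[of 2] le[of 3] by (simp add: in0)
  have "tie a b (lift_up x)"
    unfolding tie_def
  proof (intro conjI allI impI)
    show "vtx a \<bullet> lift_up x = vtx b \<bullet> lift_up x" using tie(4) ab by (simp add: in_up tie_def)
    show "vtx a \<bullet> lift_up x \<le> vtx c \<bullet> lift_up x" if "c < 4" for c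
      using le[OF that] in0 \<open>vtx a \<bullet> lift_up x \<le> 0\<close> by (cases "c = 0") auto
  qed
  then show ?thesis using tie False by (auto simp: T_plus_iff)
qed

locale sliding_map =
  fixes \<phi> :: "real^3 \<Rightarrow> real^3" and M :: real
  assumes cont: "continuous_on T_plus \<phi>"
    and upper: "\<And>x. x \<in> T_plus \<Longrightarrow> 0 \<le> \<phi> x $ 3"
    and slide: "\<And>x. x \<in> T_plus \<Longrightarrow> x $ 3 = 0 \<Longrightarrow> \<phi> x $ 3 = 0"
    and moved: "\<And>x. x \<in> T_plus \<Longrightarrow> \<phi> x \<noteq> x \<Longrightarrow> norm x < M \<and> norm (\<phi> x) < M"
begin

text \<open>\<open>\<phi>\<close> extended to the vertical walls below \<open>\<Gamma>\<close>: the motion of \<open>\<Gamma>\<close> is faded out down to depth \<open>1\<close>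
  while heights are kept, so that the extension moves a bounded part of the full tetrahedral cone only.\<close>

definition extended :: "real^3 \<Rightarrow> real^3" where
  "extended x = x + max 0 (1 + min (x $ 3) 0) *\<^sub>R (\<phi> (lift_up x) - lift_up x)"

lemma extended_upper: "0 \<le> x $ 3 \<Longrightarrow> extended x = \<phi> x"
  by (simp add: extended_def lift_up_id min_def)

lemma extended_lower:
  assumes "a < 4" "b < 4" "a \<noteq> b" "tie a b x" "x $ 3 < 0"
  shows "extended x $ 3 = x $ 3"
proof -
  have "lift_up x \<in> T_plus" by (rule lift_up_mem_T_plus[OF assms(1-4)])
  from slide[OF this] have "\<phi> (lift_up x) $ 3 = 0" using assms(5) by simp
  then show ?thesis using assms(5) by (simp add: extended_def)
qed

lemma extended_moved:
  assumes "a < 4" "b < 4" "a \<noteq> b" "tie a b x" "extended x \<noteq> x"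
  shows "norm x \<le> M + 1 \<and> norm (extended x) \<le> M + 1"
proof -
  define s where "s = max 0 (1 + min (x $ 3) 0)"
  have s: "0 \<le> s" "s \<le> 1" by (auto simp: s_def)
  have ex: "extended x = x + s *\<^sub>R (\<phi> (lift_up x) - lift_up x)" by (simp add: extended_def s_def)
  have "lift_up x \<in> T_plus" by (rule lift_up_mem_T_plus[OF assms(1-4)])
  moreover have "\<phi> (lift_up x) \<noteq> lift_up x" and "s \<noteq> 0" using assms(5) ex by auto
  ultimately have n: "norm (lift_up x) < M" "norm (\<phi> (lift_up x)) < M" using moved by auto
  have "norm (x - lift_up x) \<le> 1"
  proof -
    have "x - lift_up x = min (x $ 3) 0 *\<^sub>R axis 3 1" by (simp add: vec_eq_iff forall_3 axis_def)
    then have "norm (x - lift_up x) = \<bar>min (x $ 3) 0\<bar>" by simp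
    then show ?thesis using \<open>s \<noteq> 0\<close> by (auto simp: s_def max_def split: if_splits)
  qed
  moreover have "norm (extended x) \<le> norm (x - lift_up x) + norm ((1 - s) *\<^sub>R lift_up x + s *\<^sub>R \<phi> (lift_up x))"
  proof -
    have "extended x = (x - lift_up x) + ((1 - s) *\<^sub>R lift_up x + s *\<^sub>R \<phi> (lift_up x))"
      by (simp add: ex algebra_simps)
    then show ?thesis using norm_triangle_ineq by metis
  qed
  moreover have "norm ((1 - s) *\<^sub>R lift_up x + s *\<^sub>R \<phi> (lift_up x)) \<le> (1 - s) * M + s * M"
    using n s by (intro norm_triangle_le add_mono) (auto intro!: mult_left_mono)
  ultimately have "norm (extended x) \<le> 1 + ((1 - s) * M + s * M)" by linarith
  moreover have "norm x \<le> 1 + M"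
    using norm_triangle_ineq[of "x - lift_up x" "lift_up x"] n \<open>norm (x - lift_up x) \<le> 1\<close> by simp
  ultimately show ?thesis by (simp add: algebra_simps)
qed

lemma continuous_extended:
  assumes "a < 4"
  shows "continuous_on (frontier (closed_region a)) extended"
proof -
  have "lift_up ` frontier (closed_region a) \<subseteq> T_plus"
  proof clarify
    fix x assume "x \<in> frontier (closed_region a)"
    from frontier_closed_region[OF assms this] show "lift_up x \<in> T_plus"
      using assms lift_up_mem_T_plus by metis
  qed
  then have "continuous_on (frontier (closed_region a)) (\<lambda>x. \<phi> (lift_up x))"
    by (intro continuous_on_compose2[OF cont continuous_lift_up])
  then show ?thesis
    unfolding extended_def[abs_def] by (intro continuous_intros continuous_lift_up)
qed

abbreviation "image_set \<equiv> \<phi> ` T_plus"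

lemma image_extended_frontier:
  assumes "a < 4" "x \<in> frontier (closed_region a)"
  shows "extended x \<in> image_set \<or> extended x $ 3 < 0"
proof -
  obtain b where b: "b < 4" "b \<noteq> a" "tie a b x" using frontier_closed_region[OF assms] by blast
  show ?thesis
  proof (cases "0 \<le> x $ 3")
    case True
    then have "x \<in> T_plus" using b assms(1) unfolding T_plus_iff by blast
    then show ?thesis using extended_upper[OF True] by simp
  next
    case False
    then show ?thesis using extended_lower[OF assms(1) b(1) b(2)[symmetric] b(3)] by simp
  qed
qed

lemma separation_aux:
  assumes "c < 4" "p \<in> region c" "M + 1 < norm p" and x: "x \<in> frontier (closed_region a)" and a: "a < 4"
  shows "p \<notin> closed_segment x (extended x)"
proof -
  obtain b where b: "b < 4" "b \<noteq> a" "tie a b x" using frontier_closed_region[OF a x] by blast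
  show ?thesis
  proof (cases "extended x = x")
    case True
    then show ?thesis using not_tie_region[OF assms(2) a b(1) assms(1)] b by auto
  next
    case False
    then have "closed_segment x (extended x) \<subseteq> cball 0 (M + 1)"
      using extended_moved[OF a b(1) b(2)[symmetric] b(3)] by (intro closed_segment_subset) auto
    then show ?thesis using assms(3) by auto
  qed
qed

text \<open>The extended frontier of region \<open>a\<close> separates \<open>p\<close> from
  \<open>q\<close> in the whole space. Below \<Gamma> the extension keeps heights, so inside the
  half-space that frontier consists of points of the image only.\<close>

lemma arms_separated:
  assumes "a < 4" "b < 4" "a \<noteq> b" and p: "p \<in> region a" "M + 1 < norm p"
    and q: "q \<in> region b" "M + 1 < norm q"
  shows "\<not> connected_component (half_space - image_set) p q"
proof
  assume conn: "connected_component (half_space - image_set) p q"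
  have "\<not> connected_component (- extended ` frontier (closed_region a)) p q"
  proof (rule moved_frontier_separates[where M = "M + 1"])
    show "p \<in> interior (closed_region a)" using p region_subset_interior by blast
    show "q \<notin> closed_region a" using region_disjoint[OF assms(1-3) q(1)] .
    show "norm x \<le> M + 1" if x: "x \<in> frontier (closed_region a)" "extended x \<noteq> x" for x
    proof -
      obtain c where "c < 4" "c \<noteq> a" "tie a c x" using frontier_closed_region[OF assms(1) x(1)] by blast
      then show ?thesis using extended_moved[OF assms(1) _ _ _ x(2)] by blast
    qed
  qed (use assms separation_aux in \<open>auto simp: closed_closed_region continuous_extended\<close>)
  moreover have "half_space - image_set \<subseteq> - extended ` frontier (closed_region a)"
    using image_extended_frontier[OF assms(1)] by (force simp: half_space_def)
  ultimately show False using conn connected_component_of_subset by blast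
qed

text \<open>The frontier of the top region does not go below \<Gamma>, where the image never comes
  either. A point \<open>q\<close> of \<Gamma> outside the image can therefore be joined to the
  point \<open>b\<close> one unit beneath it, and \<open>b\<close> is cut off from the top arm by
  the moved frontier.\<close>

lemma top_arm_avoids_boundary:
  assumes p: "p \<in> region 0" "M + 1 < norm p" and q: "q \<in> half_space - image_set" "q $ 3 = 0"
  shows "\<not> connected_component (half_space - image_set) p q"
proof
  assume conn: "connected_component (half_space - image_set) p q"
  define b where "b = q - axis 3 1"
  have b3: "b $ 3 = - 1" using q by (simp add: b_def axis_def)
  have fr: "x $ 3 \<ge> 0" "extended x = \<phi> x" "x \<in> T_plus" if x: "x \<in> frontier (closed_region 0)" for x
  proof -
    obtain c where c: "c < 4" "c \<noteq> 0" "tie 0 c x" using frontier_closed_region[OF _ x] by auto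
    then show 1: "x $ 3 \<ge> 0" using tie_0_height by blast
    then show "extended x = \<phi> x" by (rule extended_upper)
    show "x \<in> T_plus"
      unfolding T_plus_iff by (intro conjI 1 exI[of _ 0] exI[of _ c]) (use c in auto)
  qed
  have img: "extended ` frontier (closed_region 0) \<subseteq> image_set" using fr by auto
  have "\<not> connected_component (- extended ` frontier (closed_region 0)) p b"
  proof (rule moved_frontier_separates[where M = "M + 1"])
    show "p \<in> interior (closed_region 0)" using p region_subset_interior by blast
    show "b \<notin> closed_region 0"
    proof
      assume "b \<in> closed_region 0"
      then have "vtx 0 \<bullet> b \<le> vtx c \<bullet> b" if "c < 4" for c using that by (simp add: closed_region_def)
      from this[of 1] this[of 2] this[of 3] show False
        using sum_vtx_inner[of b] b3 by (simp add: vtx_0_inner)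
    qed
    show "norm x \<le> M + 1" if x: "x \<in> frontier (closed_region 0)" "extended x \<noteq> x" for x
      using moved[of x] fr[OF x(1)] x(2) by auto
    show "p \<notin> closed_segment x (extended x) \<and> b \<notin> closed_segment x (extended x)"
      if x: "x \<in> frontier (closed_region 0)" for x
    proof
      show "p \<notin> closed_segment x (extended x)" using separation_aux[OF _ p x] by simp
      have "convex half_space"
        unfolding half_space_def using convex_halfspace_ge[of 0 "axis 3 1 :: real^3"]
        by (simp add: inner_axis inner_commute)
      then have "closed_segment x (extended x) \<subseteq> half_space"
        using fr[OF x] upper by (intro closed_segment_subset) (auto simp: half_space_def)
      then show "b \<notin> closed_segment x (extended x)" using b3 by (auto simp: half_space_def)
    qed
  qed (auto simp: closed_closed_region continuous_extended)
  moreover have "connected_component (- extended ` frontier (closed_region 0)) q b"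
  proof -
    have "closed_segment q b \<subseteq> - image_set"
    proof
      fix y assume "y \<in> closed_segment q b"
      then obtain u where u: "0 \<le> u" "y = (1 - u) *\<^sub>R q + u *\<^sub>R b" by (auto simp: in_segment)
      have "y $ 3 = - u" using u q b3 by simp
      show "y \<in> - image_set"
      proof (cases "u = 0")
        case False
        then have "y $ 3 < 0" using \<open>y $ 3 = - u\<close> u by simp
        then show ?thesis using upper by force
      qed (use u q in auto)
    qed
    then have "closed_segment q b \<subseteq> - extended ` frontier (closed_region 0)" using img by blast
    then show ?thesis
      unfolding connected_component_def
      by (intro exI[of _ "closed_segment q b"]) auto
  qed
  moreover have "connected_component (- extended ` frontier (closed_region 0)) p q"
    by (rule connected_component_of_subset[OF conn]) (use img in blast)
  ultimately show False using connected_component_trans by blast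
qed

end

section \<open>Calibration\<close>

lemma hausdorff_measure_plane_frame:
  assumes u: "norm u = 1" and plane: "A \<subseteq> {x. u \<bullet> x = d}"
  shows "hausdorff_measure 2 A = hausdorff_measure 2 {v :: plane. frame u (v, d) \<in> A}"
proof -
  let ?X = "{v. frame u (v, d) \<in> A}"
  have "x \<in> (\<lambda>v. frame u (v, d)) ` ?X" if x: "x \<in> A" for x
  proof -
    obtain v t where vt: "frame u (v, t) = x"
      using frame_bij[OF u] by (metis bij_pointE surj_pair)
    moreover have "t = d" using frame_inner_axis[OF u, of v t] vt plane x by auto
    ultimately show ?thesis using x by auto
  qed
  then have "(\<lambda>v. frame u (v, d)) ` ?X = A" by auto
  then show ?thesis
    using hausdorff_measure_isometric_image[of ?X "\<lambda>v. frame u (v, d)" 2]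
    by (simp add: frame_dist[OF u] dist_Pair_Pair)
qed

lemma hausdorff_measure_bounded_in_plane_finite:
  assumes u: "u \<noteq> 0" and plane: "A \<subseteq> {x. u \<bullet> x = d}" and A: "bounded A"
  shows "hausdorff_measure 2 (A :: (real^3) set) < top"
proof -
  define n where "n = (1 / norm u) *\<^sub>R u"
  have n: "norm n = 1" using u by (simp add: n_def)
  have pl: "A \<subseteq> {x. n \<bullet> x = d / norm u}" using plane by (auto simp: n_def)
  obtain r where r: "\<And>x. x \<in> A \<Longrightarrow> norm x \<le> r" using A by (auto simp: bounded_iff)
  have "bounded {v :: plane. frame n (v, d / norm u) \<in> A}"
  proof (rule boundedI)
    fix v :: plane assume "v \<in> {v. frame n (v, d / norm u) \<in> A}"
    then have "norm (v, d / norm u) \<le> r" using r[of "frame n (v, d / norm u)"] frame_norm[OF n, of "(v, d / norm u)"] by simp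
    then show "norm v \<le> r" using norm_fst_le[of v "d / norm u"] by simp
  qed
  from hausdorff_measure_bounded_plane_finite[OF this] show ?thesis
    by (simp add: hausdorff_measure_plane_frame[OF n pl])
qed

text \<open>In coordinates of the first plane the second equation reads
  \<open>m \<bullet> v = 0\<close>. Here \<open>m\<close> is not zero because \<open>n\<close> is
  not a multiple of \<open>u\<close>, so a line of measure zero remains.\<close>

lemma hausdorff_measure_two_planes:
  fixes u n :: "real^3"
  assumes n: "u \<noteq> 0" "\<And>c. n \<noteq> c *\<^sub>R u" and plane: "A \<subseteq> {x. u \<bullet> x = 0}" "A \<subseteq> {x. n \<bullet> x = 0}"
  shows "hausdorff_measure 2 A = 0"
proof -
  define w where "w = (1 / norm u) *\<^sub>R u"
  have w: "norm w = 1" using n by (simp add: w_def)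
  have pl: "A \<subseteq> {x. w \<bullet> x = 0}" using plane by (auto simp: w_def)
  define m :: plane where "m = (n \<bullet> frame w ((1, 0), 0), n \<bullet> frame w ((0, 1), 0))"
  have lin: "n \<bullet> frame w (v, t) = m \<bullet> v + t * (n \<bullet> w)" for v t
  proof -
    have "(v, t) = fst v *\<^sub>R ((1, 0), 0) + snd v *\<^sub>R ((0, 1), 0) + t *\<^sub>R (0, 1)" by (cases v) simp
    then have "frame w (v, t) = fst v *\<^sub>R frame w ((1, 0), 0) + snd v *\<^sub>R frame w ((0, 1), 0) + t *\<^sub>R w"
      by (metis (no_types) frame_linear[OF w] frame_axis[OF w] linear_add linear_scale)
    then show ?thesis by (simp add: m_def inner_add_right inner_prod_def mult.commute)
  qed
  have "m \<noteq> 0"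
  proof
    assume "m = 0"
    have eq: "n \<bullet> x = (n \<bullet> w) * (w \<bullet> x)" for x
    proof -
      obtain v t where vt: "frame w (v, t) = x" using frame_bij[OF w] by (metis bij_pointE surj_pair)
      then show ?thesis using lin[of v t] frame_inner_axis[OF w, of v t] \<open>m = 0\<close> by simp
    qed
    have "(n - (n \<bullet> w) *\<^sub>R w) \<bullet> x = 0" for x
      using eq[of x] by (simp only: inner_diff_left inner_scaleR_left)
    from this[of "n - (n \<bullet> w) *\<^sub>R w"] have "n = (n \<bullet> w) *\<^sub>R w" by simp
    then have "n = ((n \<bullet> w) / norm u) *\<^sub>R u" by (simp add: w_def)
    then show False using n by blast
  qed
  have "hausdorff_measure 2 A \<le> hausdorff_measure 2 {v :: plane. m \<bullet> v = 0}"
    unfolding hausdorff_measure_plane_frame[OF w pl] using plane(2) lin[of _ 0]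
    by (intro hausdorff_measure_mono) auto
  also have "\<dots> = ennreal plane_const * emeasure lborel {v :: plane. m \<bullet> v = 0}"
    by (intro hausdorff_measure_plane borel_closed closed_hyperplane)
  also have "emeasure lborel {v :: plane. m \<bullet> v = 0} = 0"
  proof -
    have "{v. m \<bullet> v = 0} \<in> null_sets lborel"
      using negligible_hyperplane[of m 0] \<open>m \<noteq> 0\<close>
      by (subst null_sets_completion_iff[symmetric])
        (auto simp: negligible_iff_null_sets intro!: borel_closed closed_hyperplane)
    then show ?thesis by (simp add: null_sets_def)
  qed
  finally show ?thesis by simp
qed

text \<open>Slice measures of subsets of \<open>N\<close> see \<open>F\<close> inside
  \<open>N\<close> only. Openness of \<open>N\<close> makes the jump local too, since it is a limit
  of differences of nearby values.\<close>

lemma divergence_local: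
  assumes 1: "jump_field F W R B" and 2: "jump_field F' W' R' B'"
    and N: "open N" and F: "F \<inter> N = F' \<inter> N" and W: "\<And>x. x \<in> N \<Longrightarrow> W x = W' x"
  shows "jump_field.divergence F W N = jump_field.divergence F' W' N"
proof -
  interpret A: jump_field F W R B by (rule 1)
  interpret B: jump_field F' W' R' B' by (rule 2)
  have NB [measurable]: "N \<in> sets borel" using N by (rule borel_open)
  have jump: "jump e W y = jump e W' y" if "y \<in> N" for e y
    using eventually_nhds_in_open[OF N that] W by (intro jump_cong) (auto elim: eventually_mono)
  have "A.flux e N = B.flux e N" if e: "norm e = 1" for e
  proof -
    have eq: "restrict_space (dir_measure e F) N = restrict_space (dir_measure e F') N"
    proof (rule measure_eqI)
      fix X assume "X \<in> sets (restrict_space (dir_measure e F) N)"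
      then have X: "X \<in> sets borel" "X \<subseteq> N" by (auto simp: sets_restrict_space_iff)
      then have "F \<inter> X = F' \<inter> X" using F by blast
      then have "emeasure (dir_measure e F) X = emeasure (dir_measure e F') X"
        using X by (simp add: A.emeasure_dir_measure[OF e] B.emeasure_dir_measure[OF e])
      then show "emeasure (restrict_space (dir_measure e F) N) X = emeasure (restrict_space (dir_measure e F') N) X"
        using X by (simp add: emeasure_restrict_space)
    qed (simp add: sets_restrict_space)
    have "(\<integral>y. indicator N y * (jump e W y $ i) \<partial>dir_measure e F)
        = (\<integral>y. indicator N y * (jump e W' y $ i) \<partial>dir_measure e F')" for i
    proof -
      have "(\<integral>y. indicator N y *\<^sub>R (jump e W y $ i) \<partial>dir_measure e F)
          = (\<integral>y. indicator N y *\<^sub>R (jump e W' y $ i) \<partial>dir_measure e F)"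
        by (intro Bochner_Integration.integral_cong) (auto simp: indicator_def jump)
      also have "\<dots> = (\<integral>y. indicator N y *\<^sub>R (jump e W' y $ i) \<partial>dir_measure e F')"
        using integral_restrict_space[of N "dir_measure e F" "\<lambda>y. jump e W' y $ i"]
          integral_restrict_space[of N "dir_measure e F'" "\<lambda>y. jump e W' y $ i"] by (simp add: eq)
      finally show ?thesis by simp
    qed
    then show ?thesis by (simp add: A.flux_def B.flux_def)
  qed
  then show ?thesis by (simp add: A.divergence_def B.divergence_def)
qed

section \<open>Calibrating fields of labelled sets\<close>

text \<open>The calibrating vectors; they are normalised to be horizontal for the three lower regions, so
  that only the top region has a flux through \<open>\<Gamma>\<close>.\<close>

definition calib :: "nat \<Rightarrow> real^3" where
  "calib a = sqrt (3 / 8) *\<^sub>R (vtx a - (1 / 3) *\<^sub>R axis 3 1)"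

lemma calib_diff: "calib a - calib b = sqrt (3 / 8) *\<^sub>R (vtx a - vtx b)"
  by (simp add: calib_def scaleR_right_diff_distrib)

text \<open>Two vertices of the tetrahedron are at distance \<open>sqrt (8 / 3)\<close>, which
  explains the factor \<open>sqrt (3 / 8)\<close> in \<open>calib\<close>.\<close>

lemma norm_calib_diff:
  assumes "a < 4" "b < 4" "a \<noteq> b"
  shows "norm (calib a - calib b) = 1"
proof -
  have "(norm (vtx a - vtx b))\<^sup>2 = 8 / 3"
    using assms by (simp add: power2_norm_eq_inner inner_diff_left inner_diff_right vtx_inner inner_commute)
  then have "(norm (calib a - calib b))\<^sup>2 = 1" by (simp add: calib_diff power_mult_distrib)
  then show ?thesis by (simp add: power2_eq_1_iff) (smt (verit) norm_ge_zero)
qed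

text \<open>Origin of the threshold: the heights of the bottom vertex and of the upper ones differ
  by \<open>4 / 3\<close>, and scaling by \<open>sqrt (3 / 8)\<close> turns this into
  \<open>sqrt (2 / 3)\<close>.\<close>

lemma calib_3: "calib 0 $ 3 = - sqrt (2 / 3)" "a \<noteq> 0 \<Longrightarrow> calib a $ 3 = 0"
proof -
  have "sqrt (3 / 8) * 4 / 3 = sqrt (2 / 3)"
    by (rule real_sqrt_unique[symmetric]) (auto simp: power_mult_distrib power_divide)
  then show "calib 0 $ 3 = - sqrt (2 / 3)" by (simp add: calib_def vtx_3)
  show "a \<noteq> 0 \<Longrightarrow> calib a $ 3 = 0" by (simp add: calib_def vtx_3)
qed

lemma norm_calib_le: "a < 4 \<Longrightarrow> norm (calib a) \<le> 1"
proof -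
  assume a: "a < 4"
  have "(norm (vtx a - (1 / 3) *\<^sub>R axis 3 1))\<^sup>2 = 1 - 2 / 3 * (vtx a $ 3) + 1 / 9"
    using a by (simp add: power2_norm_eq_inner inner_diff_left inner_diff_right vtx_inner inner_axis inner_axis')
      (simp add: field_simps)
  then have "(norm (calib a))\<^sup>2 \<le> 1"
    using vtx_3(2)[of a] by (cases "a = 0") (auto simp: calib_def power_mult_distrib vtx_3)
  then show ?thesis using power2_le_imp_le[of "norm (calib a)" 1] by simp
qed

text \<open>Common setting for the cone and for its sliding images. Fixing the label 1 on
  \<open>S\<close> is a convention that keeps the field Borel. The condition on \<Gamma> makes the
  field horizontal near the boundary points outside \<open>S\<close>, so that no flux leaves
  there.\<close>

locale labelling =
  fixes S :: "(real^3) set" and lab :: "real^3 \<Rightarrow> nat" and M :: real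
  assumes S_closed: "closed S" and S_half: "S \<subseteq> half_space"
    and S_fin: "\<And>r. hausdorff_measure 2 (S \<inter> cball 0 r) < top"
    and M_pos: "0 < M"
    and lab_less: "\<And>x. lab x < 4"
    and lab_S: "\<And>x. x \<in> S \<Longrightarrow> lab x = 1"
    and lab_const: "\<And>x. x \<in> half_space - S \<Longrightarrow> \<forall>\<^sub>F y in nhds x. y \<in> half_space \<longrightarrow> lab y = lab x"
    and lab_boundary: "\<And>x. x \<in> half_space - S \<Longrightarrow> x \<in> sliding_boundary \<Longrightarrow> lab x \<noteq> 0"
begin

definition big_box :: "(real^3) set" where
  "big_box = {x. \<bar>x $ 1\<bar> < M + 1 \<and> \<bar>x $ 2\<bar> < M + 1 \<and> 0 < x $ 3 \<and> x $ 3 < M + 1}"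

definition closed_box :: "(real^3) set" where
  "closed_box = {x. \<bar>x $ 1\<bar> \<le> M + 1 \<and> \<bar>x $ 2\<bar> \<le> M + 1 \<and> 0 \<le> x $ 3 \<and> x $ 3 \<le> M + 1}"

text \<open>The field is cut off at the box, so the walls have to be part of the barrier. Its floor
  lies in \<Gamma>: the flux through \<Gamma> is recorded as the jump from 0 across the
  floor.\<close>

definition barrier :: "(real^3) set" where
  "barrier = S \<inter> closed_box \<union> (closed_box - big_box)"

definition field :: "real^3 \<Rightarrow> real^3" where
  "field x = (if x \<in> big_box then calib (lab x) else 0)"

lemma open_big_box: "open big_box"
  unfolding big_box_def by (intro open_Collect_conj open_Collect_less continuous_intros)

lemma closed_closed_box: "closed closed_box"
  unfolding closed_box_def by (intro closed_Collect_conj closed_Collect_le continuous_intros)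

lemma big_box_subset: "big_box \<subseteq> closed_box" "big_box \<subseteq> half_space"
  by (auto simp: big_box_def closed_box_def half_space_def)

lemma closed_box_subset: "closed_box \<subseteq> cball 0 (3 * (M + 1))"
proof
  fix x assume "x \<in> closed_box"
  then have "\<bar>x $ 1\<bar> + \<bar>x $ 2\<bar> + \<bar>x $ 3\<bar> \<le> 3 * (M + 1)" by (auto simp: closed_box_def)
  then show "x \<in> cball 0 (3 * (M + 1))" using norm_le_l1_cart[of x] by (simp add: sum_3)
qed

lemma closed_barrier: "closed barrier"
  unfolding barrier_def
  by (intro closed_Un closed_Int closed_Diff S_closed closed_closed_box open_big_box)

lemma hausdorff_box_boundary_finite: "hausdorff_measure 2 (closed_box - big_box) < top"
proof -
  define P where "P i d = closed_box \<inter> {x. axis i 1 \<bullet> x = d}" for i and d :: real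
  have P: "hausdorff_measure 2 (P i d) < top" for i d
  proof (rule hausdorff_measure_bounded_in_plane_finite[where u = "axis i 1" and d = d])
    show "bounded (P i d)"
      using closed_box_subset by (intro bounded_subset[OF bounded_cball, of "P i d"]) (auto simp: P_def)
  qed (auto simp: P_def)
  have "closed_box - big_box \<subseteq> P 1 (M + 1) \<union> (P 1 (- (M + 1)) \<union> (P 2 (M + 1) \<union> (P 2 (- (M + 1)) \<union> (P 3 0 \<union> P 3 (M + 1)))))"
  proof
    fix x assume x: "x \<in> closed_box - big_box"
    then have "x $ 1 = M + 1 \<or> x $ 1 = - (M + 1) \<or> x $ 2 = M + 1 \<or> x $ 2 = - (M + 1) \<or> x $ 3 = 0 \<or> x $ 3 = M + 1"
      unfolding closed_box_def big_box_def by simp linarith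
    then show "x \<in> P 1 (M + 1) \<union> (P 1 (- (M + 1)) \<union> (P 2 (M + 1) \<union> (P 2 (- (M + 1)) \<union> (P 3 0 \<union> P 3 (M + 1)))))"
      using x by (auto simp: P_def inner_axis')
  qed
  then have "hausdorff_measure 2 (closed_box - big_box) \<le> hausdorff_measure 2
      (P 1 (M + 1) \<union> (P 1 (- (M + 1)) \<union> (P 2 (M + 1) \<union> (P 2 (- (M + 1)) \<union> (P 3 0 \<union> P 3 (M + 1))))))"
    by (rule hausdorff_measure_mono)
  also have "\<dots> \<le> hausdorff_measure 2 (P 1 (M + 1)) + (hausdorff_measure 2 (P 1 (- (M + 1))) +
      (hausdorff_measure 2 (P 2 (M + 1)) + (hausdorff_measure 2 (P 2 (- (M + 1))) +
      (hausdorff_measure 2 (P 3 0) + hausdorff_measure 2 (P 3 (M + 1))))))"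
    by (intro order_trans[OF hausdorff_measure_Un_le] add_mono order_refl)
  also have "\<dots> < top" using P by (simp add: ennreal_add_less_top)
  finally show ?thesis .
qed

lemma barrier_fin: "hausdorff_measure 2 barrier < top"
proof -
  have "hausdorff_measure 2 barrier \<le> hausdorff_measure 2 (S \<inter> closed_box) + hausdorff_measure 2 (closed_box - big_box)"
    unfolding barrier_def by (rule hausdorff_measure_Un_le)
  also have "hausdorff_measure 2 (S \<inter> closed_box) \<le> hausdorff_measure 2 (S \<inter> cball 0 (3 * (M + 1)))"
    using closed_box_subset by (intro hausdorff_measure_mono) blast
  finally show ?thesis
    using S_fin[of "3 * (M + 1)"] hausdorff_box_boundary_finite
    by (meson add_right_mono ennreal_add_less_top order_le_less_trans)
qed

lemma field_eventually:
  assumes "x \<in> big_box" "x \<notin> S"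
  shows "\<forall>\<^sub>F y in nhds x. field y = field x"
proof -
  have "\<forall>\<^sub>F y in nhds x. y \<in> big_box" by (rule eventually_nhds_in_open[OF open_big_box assms(1)])
  moreover have "\<forall>\<^sub>F y in nhds x. y \<in> half_space \<longrightarrow> lab y = lab x"
    using assms big_box_subset by (intro lab_const) auto
  ultimately show ?thesis
    by eventually_elim (use assms big_box_subset in \<open>auto simp: field_def\<close>)
qed

text \<open>Inside the box and off \<open>S\<close> every label class is open, because labels are
  locally constant there. On \<open>S\<close> the label is constant.\<close>

lemma field_measurable: "field \<in> borel_measurable borel"
proof -
  define U where "U a = {x \<in> big_box - S. lab x = a}" for a
  have "open (U a)" for a
    unfolding open_subopen[of "U a"]
  proof
    fix x assume x: "x \<in> U a"
    have "\<forall>\<^sub>F y in nhds x. y \<in> big_box - S"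
      using x by (intro eventually_nhds_in_open open_Diff open_big_box S_closed) (auto simp: U_def)
    moreover have "\<forall>\<^sub>F y in nhds x. y \<in> half_space \<longrightarrow> lab y = lab x"
      using x big_box_subset by (intro lab_const) (auto simp: U_def)
    ultimately have "\<forall>\<^sub>F y in nhds x. y \<in> U a"
      by eventually_elim (use x big_box_subset in \<open>auto simp: U_def\<close>)
    then show "\<exists>T. open T \<and> x \<in> T \<and> T \<subseteq> U a" by (auto simp: eventually_nhds)
  qed
  then have [measurable]: "U a \<in> sets borel" for a by (rule borel_open)
  have [measurable]: "big_box \<inter> S \<in> sets borel"
    using open_big_box S_closed by (auto intro: borel_open borel_closed)
  have "field x = (\<Sum>a<4. indicator (U a) x *\<^sub>R calib a) + indicator (big_box \<inter> S) x *\<^sub>R calib 1" for x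
  proof -
    have "(\<Sum>a<4. indicator (U a) x *\<^sub>R calib a) = (if x \<in> big_box - S then calib (lab x) else 0)"
    proof -
      have "(\<Sum>a<4. indicator (U a) x *\<^sub>R calib a)
          = (\<Sum>a<4. if a = lab x then (if x \<in> big_box - S then calib a else 0) else 0)"
        by (intro sum.cong) (auto simp: U_def indicator_def)
      then show ?thesis using lab_less by simp
    qed
    then show ?thesis using lab_S by (auto simp: field_def)
  qed
  then have eq: "field = (\<lambda>x. (\<Sum>a<4. indicator (U a) x *\<^sub>R calib a) + indicator (big_box \<inter> S) x *\<^sub>R calib 1)"
    by blast
  show ?thesis unfolding eq by measurable
qed

lemma jump_field: "jump_field barrier field (3 * (M + 1)) 1"
proof
  show "closed barrier" by (rule closed_barrier)
  show "barrier \<subseteq> cball 0 (3 * (M + 1))" using closed_box_subset by (auto simp: barrier_def)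
  show "hausdorff_measure 2 barrier < top" by (rule barrier_fin)
  show "field \<in> borel_measurable borel" by (rule field_measurable)
  show "norm (field x) \<le> 1" for x using norm_calib_le lab_less by (simp add: field_def)
  show "field x = 0" if "3 * (M + 1) < norm x" for x
    using that big_box_subset closed_box_subset by (force simp: field_def)
  show "\<forall>\<^sub>F y in nhds x. field y = field x" if x: "x \<notin> barrier" for x
  proof (cases "x \<in> closed_box")
    case True
    then show ?thesis using x by (intro field_eventually) (auto simp: barrier_def)
  next
    case False
    have "\<forall>\<^sub>F y in nhds x. y \<in> - closed_box"
      using False closed_closed_box by (intro eventually_nhds_in_open) auto
    then show ?thesis by eventually_elim (use False big_box_subset in \<open>auto simp: field_def\<close>)
  qed
qed

sublocale jump_field barrier field "3 * (M + 1)" 1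
  by (rule jump_field)

lemma jump_in_box:
  assumes "y \<in> big_box"
  shows "\<exists>a<4. \<exists>b<4. jump e field y = calib a - calib b"
proof -
  define D where "D = (\<lambda>(a, b). calib a - calib b) ` ({..<4} \<times> {..<4})"
  have "finite D" by (simp add: D_def)
  have "\<forall>\<^sub>F k in sequentially. y + c k *\<^sub>R e \<in> big_box" if "c \<longlonglongrightarrow> 0" for c
  proof -
    have "(\<lambda>k. y + c k *\<^sub>R e) \<longlonglongrightarrow> y" using that by (auto intro!: tendsto_eq_intros)
    then show ?thesis using topological_tendstoD[OF _ open_big_box assms] by blast
  qed
  note ev = this
  have lim: "(\<lambda>k. 1 / real (Suc k)) \<longlonglongrightarrow> 0" by (rule lim_1_over_n[THEN LIMSEQ_Suc])
  have lim': "(\<lambda>k. - (1 / real (Suc k))) \<longlonglongrightarrow> 0" using tendsto_minus[OF lim] by simp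
  have "jump e field y \<in> D"
  proof (rule jump_mem)
    show "closed D" using \<open>finite D\<close> by (rule finite_imp_closed)
    show "0 \<in> D" unfolding D_def by (rule image_eqI[of _ _ "(0, 0)"]) auto
    show "\<forall>\<^sub>F k in sequentially. field (y + (1 / Suc k) *\<^sub>R e) - field (y - (1 / Suc k) *\<^sub>R e) \<in> D"
      using ev[OF lim] ev[OF lim']
      by eventually_elim (use lab_less in \<open>auto simp: field_def D_def\<close>)
  qed
  then show ?thesis by (auto simp: D_def)
qed

text \<open>The six lines belong to the six unordered pairs of labels. A pair in the reverse order
  has coefficient \<open>- 1\<close>, and equal labels have coefficient 0.\<close>

lemma controlled_in_box:
  assumes A: "A \<in> sets borel" "A \<subseteq> big_box"
  shows "controlled A"
proof (rule controlled_of_jumps[where L = "(\<lambda>(a, b). calib a - calib b) ` {(0, 1), (0, 2), (0, 3), (1, 2), (1, 3), (2, 3)}"])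
  let ?P = "{(0, 1), (0, 2), (0, 3), (1, 2), (1, 3), (2, 3)} :: (nat \<times> nat) set"
  let ?L = "(\<lambda>(a, b). calib a - calib b) ` ?P"
  show "card ?L \<le> 6" by (rule order_trans[OF card_image_le]) auto
  show "norm u = 1" if "u \<in> ?L" for u using that by (auto simp: norm_calib_diff)
  fix e y :: "real^3" assume "y \<in> A"
  then obtain a b where ab: "a < 4" "b < 4" "jump e field y = calib a - calib b"
    using A jump_in_box[of y e] by blast
  show "\<exists>u\<in>?L. \<exists>r. jump e field y = r *\<^sub>R u \<and> \<bar>r\<bar> \<le> 1"
  proof (cases a b rule: linorder_cases)
    case less
    then have p: "(a, b) \<in> ?P" using ab by (auto simp: less_4_cases)
    have "calib a - calib b \<in> ?L"
      using imageI[OF p, of "\<lambda>(a, b). calib a - calib b"] by (simp only: prod.case)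
    moreover have "jump e field y = 1 *\<^sub>R (calib a - calib b)" using ab by simp
    ultimately show ?thesis by (metis abs_one order_refl)
  next
    case equal
    have "calib 0 - calib 1 \<in> ?L" by simp
    moreover have "jump e field y = 0 *\<^sub>R (calib 0 - calib 1)" using ab equal by simp
    ultimately show ?thesis by (metis abs_zero zero_le_one)
  next
    case greater
    then have p: "(b, a) \<in> ?P" using ab by (auto simp: less_4_cases)
    have "calib b - calib a \<in> ?L"
      using imageI[OF p, of "\<lambda>(a, b). calib a - calib b"] by (simp only: prod.case)
    moreover have "jump e field y = - 1 *\<^sub>R (calib b - calib a)" using ab by simp
    moreover have "\<bar>- 1 :: real\<bar> \<le> 1" by simp
    ultimately show ?thesis by blast
  qed
qed (use A in auto)

text \<open>The ball has radius \<open>M\<close> and the box half-width \<open>M + 1\<close>, so the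
  only wall that the core meets is the floor.\<close>

definition core :: "(real^3) set" where "core = cball 0 M"

lemma core_borel [measurable]: "core \<in> sets borel"
  by (simp add: core_def)

lemma boundary_borel [measurable]: "sliding_boundary \<in> sets borel"
proof -
  have "closed sliding_boundary"
    unfolding sliding_boundary_def by (intro closed_Collect_eq continuous_intros)
  then show ?thesis by (rule borel_closed)
qed

lemma core_cases:
  assumes "x \<in> core" "x \<in> closed_box"
  shows "x \<in> big_box \<or> x \<in> sliding_boundary"
proof -
  have "\<bar>x $ i\<bar> < M + 1" for i using assms(1) component_le_norm_cart[of x i] by (simp add: core_def)
  from this[of 1] this[of 2] this[of 3] show ?thesis
    using assms(2) by (auto simp: big_box_def closed_box_def sliding_boundary_def)
qed

lemma barrier_core: "barrier \<inter> (core \<inter> big_box) = (S \<inter> core) - sliding_boundary"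
proof -
  have "x \<in> closed_box" if x: "x \<in> core" "x \<in> half_space" for x
  proof -
    have "\<bar>x $ i\<bar> \<le> M + 1" for i using x(1) component_le_norm_cart[of x i] by (simp add: core_def)
    from this[of 1] this[of 2] this[of 3] show ?thesis
      using x(2) by (auto simp: closed_box_def half_space_def)
  qed
  then show ?thesis using core_cases S_half big_box_subset
    by (auto simp: barrier_def big_box_def sliding_boundary_def)
qed

lemma divergence_core:
  "divergence core = divergence (core \<inter> big_box) + divergence (core \<inter> sliding_boundary)"
proof -
  have [measurable]: "big_box \<in> sets borel" by (rule borel_open[OF open_big_box])
  define A where "A = core \<inter> big_box"
  define B where "B = core \<inter> sliding_boundary"
  have disj: "A \<inter> B = {}" by (auto simp: A_def B_def big_box_def sliding_boundary_def)
  have [measurable]: "A \<in> sets borel" "B \<in> sets borel" by (auto simp: A_def B_def)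
  have "divergence core = divergence (A \<union> B \<union> (core - (A \<union> B)))"
    by (intro arg_cong[of _ _ divergence]) (auto simp: A_def B_def)
  also have "\<dots> = divergence (A \<union> B) + divergence (core - (A \<union> B))"
    by (intro divergence_Un) auto
  also have "divergence (A \<union> B) = divergence A + divergence B"
    using disj by (intro divergence_Un) auto
  also have "divergence (core - (A \<union> B)) = 0"
  proof (rule divergence_null)
    have "barrier \<inter> (core - (A \<union> B)) = {}"
      using core_cases big_box_subset by (auto simp: barrier_def A_def B_def)
    then show "hausdorff_measure 2 (barrier \<inter> (core - (A \<union> B))) = 0" by simp
  qed auto
  finally show ?thesis by (simp add: A_def B_def)
qed

lemma divergence_boundary:
  "divergence (core \<inter> sliding_boundary)
    = (\<integral>y. indicator (core \<inter> sliding_boundary) y * (jump (axis 3 1) field y $ 3) \<partial>dir_measure (axis 3 1) barrier)"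
proof -
  have "divergence (core \<inter> sliding_boundary) = axis 3 1 \<bullet> flux (axis 3 1) (core \<inter> sliding_boundary)"
    by (rule divergence_plane[where d = 0]) (auto simp: sliding_boundary_def inner_axis')
  then show ?thesis by (simp add: inner_axis' flux_def)
qed

text \<open>Below \<Gamma> the field vanishes, so the upward jump is a limit of calibrating vectors
  taken just above, or the default 0. Off \<open>S\<close> the label above agrees with the label on
  \<Gamma>, which is not 0, and the vector is horizontal.\<close>

lemma jump_boundary:
  assumes y: "y \<in> core" "y \<in> sliding_boundary"
  shows "jump (axis 3 1) field y $ 3 \<in> {0, - sqrt (2 / 3)}"
    and "y \<notin> S \<Longrightarrow> jump (axis 3 1) field y $ 3 = 0"
proof -
  let ?e = "axis 3 1 :: real^3"
  have M: "\<bar>y $ i\<bar> < M + 1" for i using y(1) component_le_norm_cart[of y i] by (simp add: core_def)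
  have lim: "(\<lambda>k. 1 / real (Suc k)) \<longlonglongrightarrow> 0" by (rule lim_1_over_n[THEN LIMSEQ_Suc])
  then have "\<forall>\<^sub>F k in sequentially. 1 / real (Suc k) < M + 1"
    using order_tendstoD(2)[OF lim, of "M + 1"] M_pos by simp
  then have up: "\<forall>\<^sub>F k in sequentially. y + (1 / Suc k) *\<^sub>R ?e \<in> big_box"
    by eventually_elim
      (use y(2) M[of 1] M[of 2] in \<open>auto simp: big_box_def sliding_boundary_def axis_def\<close>)
  have down: "y - (1 / Suc k) *\<^sub>R ?e \<notin> big_box" for k
    using y(2) by (auto simp: big_box_def sliding_boundary_def axis_def)
  have ev: "\<forall>\<^sub>F k in sequentially. field (y + (1 / Suc k) *\<^sub>R ?e) - field (y - (1 / Suc k) *\<^sub>R ?e)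
      = calib (lab (y + (1 / Suc k) *\<^sub>R ?e))"
    using up by eventually_elim (use down in \<open>simp add: field_def\<close>)
  have "jump ?e field y \<in> insert 0 (calib ` {..<4})"
  proof (rule jump_mem)
    show "\<forall>\<^sub>F k in sequentially. field (y + (1 / Suc k) *\<^sub>R ?e) - field (y - (1 / Suc k) *\<^sub>R ?e)
      \<in> insert 0 (calib ` {..<4})"
      using ev by eventually_elim (use lab_less in simp)
  qed (auto intro: finite_imp_closed)
  then obtain a where "jump ?e field y = 0 \<or> jump ?e field y = calib a" by auto
  then show "jump ?e field y $ 3 \<in> {0, - sqrt (2 / 3)}"
    using calib_3(1) calib_3(2)[of a] by (cases "a = 0") auto
  assume "y \<notin> S"
  then have yS: "y \<in> half_space - S" using y by (simp add: half_space_def sliding_boundary_def)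
  have "(\<lambda>k. y + (1 / Suc k) *\<^sub>R ?e) \<longlonglongrightarrow> y"
    using tendsto_add[OF tendsto_const tendsto_scaleR[OF lim tendsto_const]] by simp
  from eventually_compose_filterlim[OF lab_const[OF yS] this] up
  have "\<forall>\<^sub>F k in sequentially. lab (y + (1 / Suc k) *\<^sub>R ?e) = lab y"
    by eventually_elim (use big_box_subset in blast)
  with ev have "\<forall>\<^sub>F k in sequentially. field (y + (1 / Suc k) *\<^sub>R ?e) - field (y - (1 / Suc k) *\<^sub>R ?e)
      = calib (lab y)"
    by eventually_elim simp
  then have "jump ?e field y = calib (lab y)" by (rule jump_eq)
  then show "jump ?e field y $ 3 = 0" using lab_boundary[OF yS y(2)] by (simp add: calib_3)
qed

lemma minus_divergence_core_le:
  "ennreal (- divergence core) \<le> ennreal (1 / plane_const) *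
    (hausdorff_measure 2 (S \<inter> core - sliding_boundary)
      + ennreal (sqrt (2 / 3)) * hausdorff_measure 2 (S \<inter> core \<inter> sliding_boundary))"
proof -
  let ?\<Gamma> = sliding_boundary let ?e = "axis 3 1 :: real^3" let ?b = "sqrt (2 / 3)"
  have [measurable]: "big_box \<in> sets borel" by (rule borel_open[OF open_big_box])
  have [measurable]: "S \<in> sets borel" by (rule borel_closed[OF S_closed])
  have e: "norm ?e = 1" by simp
  interpret m: finite_measure "dir_measure ?e barrier" by (rule finite_measure_dir_measure[OF e])
  have "controlled (core \<inter> big_box)" by (rule controlled_in_box) auto
  then have 1: "ennreal \<bar>divergence (core \<inter> big_box)\<bar> \<le> ennreal (1 / plane_const) * hausdorff_measure 2 (S \<inter> core - ?\<Gamma>)"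
    unfolding controlled_def barrier_core .
  have "- divergence (core \<inter> ?\<Gamma>)
      = (\<integral>y. indicator (core \<inter> ?\<Gamma>) y * (- (jump ?e field y $ 3)) \<partial>dir_measure ?e barrier)"
    by (simp add: divergence_boundary)
  also have "\<dots> \<le> (\<integral>y. ?b * indicator (S \<inter> core \<inter> ?\<Gamma>) y \<partial>dir_measure ?e barrier)"
  proof (rule integral_mono)
    show "integrable (dir_measure ?e barrier) (\<lambda>y. indicator (core \<inter> ?\<Gamma>) y * (- (jump ?e field y $ 3)))"
      using integrable_jump[OF e, of "\<lambda>y. - indicator (core \<inter> ?\<Gamma>) y" 3] by (simp add: indicator_def)
    show "integrable (dir_measure ?e barrier) (\<lambda>y. ?b * indicator (S \<inter> core \<inter> ?\<Gamma>) y)"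
      by (auto intro!: integrable_mult_right m.integrable_const_bound[of _ 1])
    \<comment> \<open>Off \<open>S\<close> the vertical jump vanishes, which is where the labels on
      \<Gamma> come in; on \<open>S\<close> it costs at most \<open>?b\<close>.\<close>
    show "indicator (core \<inter> ?\<Gamma>) y * (- (jump ?e field y $ 3)) \<le> ?b * indicator (S \<inter> core \<inter> ?\<Gamma>) y" for y
      using jump_boundary[of y] by (auto simp: indicator_def)
  qed
  also have "\<dots> = ?b * measure (dir_measure ?e barrier) (S \<inter> core \<inter> ?\<Gamma>)" by simp
  finally have "ennreal (- divergence (core \<inter> ?\<Gamma>)) \<le> ennreal ?b * emeasure (dir_measure ?e barrier) (S \<inter> core \<inter> ?\<Gamma>)"
    by (simp add: m.emeasure_eq_measure ennreal_leI flip: ennreal_mult)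
  also have "\<dots> \<le> ennreal ?b * (ennreal (1 / plane_const) * hausdorff_measure 2 (barrier \<inter> (S \<inter> core \<inter> ?\<Gamma>)))"
    by (intro mult_left_mono dir_measure_le[OF e]) auto
  also have "\<dots> \<le> ennreal ?b * (ennreal (1 / plane_const) * hausdorff_measure 2 (S \<inter> core \<inter> ?\<Gamma>))"
    by (intro mult_left_mono hausdorff_measure_mono) auto
  finally have 2: "ennreal (- divergence (core \<inter> ?\<Gamma>))
      \<le> ennreal ?b * (ennreal (1 / plane_const) * hausdorff_measure 2 (S \<inter> core \<inter> ?\<Gamma>))" .
  have "ennreal (- divergence core) \<le> ennreal \<bar>divergence (core \<inter> big_box)\<bar> + ennreal (- divergence (core \<inter> ?\<Gamma>))"
    unfolding divergence_core
    by (cases "0 \<le> - divergence (core \<inter> ?\<Gamma>)")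
      (auto simp: ennreal_neg intro!: ennreal_leI simp flip: ennreal_plus)
  also have "\<dots> \<le> ennreal (1 / plane_const) * hausdorff_measure 2 (S \<inter> core - ?\<Gamma>)
      + ennreal ?b * (ennreal (1 / plane_const) * hausdorff_measure 2 (S \<inter> core \<inter> ?\<Gamma>))"
    by (rule add_mono[OF 1 2])
  finally show ?thesis by (simp add: distrib_left mult.left_commute)
qed

end

section \<open>The cone as a labelled set\<close>

lemma hausdorff_measure_finite_UN_le:
  assumes "finite I"
  shows "hausdorff_measure d (\<Union>i\<in>I. A i) \<le> (\<Sum>i\<in>I. hausdorff_measure d (A i))"
  using assms
proof induction
  case (insert i I)
  then show ?case
    using order_trans[OF hausdorff_measure_Un_le[of d "A i" "\<Union>i\<in>I. A i"] add_left_mono] by simp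
qed simp

lemma closed_T_plus: "closed T_plus"
proof -
  have "T_plus = {x. 0 \<le> x $ 3} \<inter> (\<Union>(a, b)\<in>{(a, b). a < 4 \<and> b < 4 \<and> a \<noteq> b}.
      {x. vtx a \<bullet> x = vtx b \<bullet> x} \<inter> (\<Inter>c\<in>{..<4}. {x. vtx a \<bullet> x \<le> vtx c \<bullet> x}))"
    by (auto simp: T_plus_eq tie_def)
  also have "closed \<dots>"
  proof (intro closed_Int closed_UN)
    show "finite {(a, b). a < (4::nat) \<and> b < (4::nat) \<and> a \<noteq> b}"
      by (rule finite_subset[of _ "{..<4} \<times> {..<4}"]) auto
  qed (auto intro!: closed_Int closed_INT closed_Collect_le closed_Collect_eq continuous_intros)
  finally show ?thesis .
qed

lemma T_plus_half: "T_plus \<subseteq> half_space"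
  by (auto simp: T_plus_def)

text \<open>Pairing with \<open>vtx c\<close> annihilates the right-hand side but yields
  \<open>- 4 / 3\<close> on the left.\<close>

lemma vtx_diff_not_parallel:
  assumes "a < 4" "b < 4" "c < 4" "a \<noteq> b" "a \<noteq> c" "b \<noteq> c"
  shows "vtx a - vtx c \<noteq> k *\<^sub>R (vtx a - vtx b)"
proof
  assume "vtx a - vtx c = k *\<^sub>R (vtx a - vtx b)"
  then have "vtx c \<bullet> (vtx a - vtx c) = vtx c \<bullet> (k *\<^sub>R (vtx a - vtx b))" by simp
  then show False using assms by (simp add: inner_diff_right vtx_inner)
qed

lemma vtx_neq: "a < 4 \<Longrightarrow> b < 4 \<Longrightarrow> a \<noteq> b \<Longrightarrow> vtx a \<noteq> vtx b"
  using inj_on_vtx by (auto dest: inj_onD)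

lemma triple_null:
  assumes "a < 4" "b < 4" "c < 4" "a \<noteq> b" "a \<noteq> c" "b \<noteq> c"
  shows "hausdorff_measure 2 {x. vtx a \<bullet> x = vtx b \<bullet> x \<and> vtx a \<bullet> x = vtx c \<bullet> x} = 0"
  using assms vtx_diff_not_parallel[OF assms]
  by (intro hausdorff_measure_two_planes[of "vtx a - vtx b" "vtx a - vtx c"])
    (auto simp: vtx_neq inner_diff_left)

lemma axis_not_parallel:
  assumes "a < 4" "b < 4" "a \<noteq> b"
  shows "axis 3 1 \<noteq> k *\<^sub>R (vtx a - vtx b)"
proof
  assume eq: "axis 3 1 = k *\<^sub>R (vtx a - vtx b)"
  \<comment> \<open>An upper vertex other than \<open>a\<close> and \<open>b\<close> is orthogonal
    to \<open>vtx a - vtx b\<close> but not to the vertical axis. There are three upper vertices and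
    at most two are excluded.\<close>
  obtain c where c: "c < 4" "c \<noteq> a" "c \<noteq> b" "c \<noteq> 0"
  proof -
    have "\<not> {1, 2, 3} \<subseteq> {a, b}"
    proof
      assume "{1, 2, 3} \<subseteq> {a, b}"
      then have "card {1, 2, 3::nat} \<le> card {a, b}" by (intro card_mono) auto
      then show False using assms by simp
    qed
    then obtain c where "c \<in> {1, 2, 3}" "c \<notin> {a, b}" by blast
    then show thesis using that[of c] by auto
  qed
  have "vtx c \<bullet> axis 3 1 = vtx c \<bullet> (k *\<^sub>R (vtx a - vtx b))" using eq by simp
  then show False using c assms by (simp add: inner_diff_right vtx_inner inner_axis vtx_3)
qed

lemma T_plus_boundary_null: "hausdorff_measure 2 (T_plus \<inter> sliding_boundary) = 0"
proof -
  let ?I = "{..<4} \<times> {..<4} \<inter> {(a, b). a \<noteq> b} :: (nat \<times> nat) set"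
  let ?A = "\<lambda>(a, b). {x. (vtx a - vtx b) \<bullet> x = 0 \<and> axis 3 1 \<bullet> x = 0}"
  have "hausdorff_measure 2 (T_plus \<inter> sliding_boundary) \<le> hausdorff_measure 2 (\<Union>i\<in>?I. ?A i)"
    by (intro hausdorff_measure_mono)
      (auto simp: T_plus_eq sliding_boundary_def inner_axis' inner_diff_left tie_def)
  also have "\<dots> \<le> (\<Sum>i\<in>?I. hausdorff_measure 2 (?A i))"
    by (rule hausdorff_measure_finite_UN_le) auto
  also have "\<dots> = 0"
  proof (rule sum.neutral, rule ballI)
    fix i assume "i \<in> ?I"
    then obtain a b where i: "i = (a, b)" "a < 4" "b < 4" "a \<noteq> b" by auto
    then show "hausdorff_measure 2 (?A i) = 0"
      unfolding i prod.case using vtx_neq[of a b] axis_not_parallel[of a b]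
      by (intro hausdorff_measure_two_planes[of "vtx a - vtx b" "axis 3 1"]) auto
  qed
  finally show ?thesis by simp
qed

lemma T_plus_locally_finite: "hausdorff_measure 2 (T_plus \<inter> cball x r) < top"
proof -
  let ?I = "{..<4} \<times> {..<4} \<inter> {(a, b). a \<noteq> b} :: (nat \<times> nat) set"
  let ?A = "\<lambda>(a, b). {y. (vtx a - vtx b) \<bullet> y = 0} \<inter> cball x r"
  have "hausdorff_measure 2 (T_plus \<inter> cball x r) \<le> hausdorff_measure 2 (\<Union>i\<in>?I. ?A i)"
    by (intro hausdorff_measure_mono) (auto simp: T_plus_eq inner_diff_left tie_def)
  also have "\<dots> \<le> (\<Sum>i\<in>?I. hausdorff_measure 2 (?A i))"
    by (rule hausdorff_measure_finite_UN_le) auto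
  also have "\<dots> < top"
  proof -
    have "hausdorff_measure 2 (?A i) < top" if "i \<in> ?I" for i
    proof -
      obtain a b where i: "i = (a, b)" by (cases i)
      show ?thesis
        unfolding i prod.case using that i
        by (intro hausdorff_measure_bounded_in_plane_finite[of "vtx a - vtx b" _ 0]) (auto simp: vtx_neq)
    qed
    then show ?thesis by (simp add: less_top)
  qed
  finally show ?thesis .
qed

definition cone_label :: "real^3 \<Rightarrow> nat" where
  "cone_label x = (if x \<in> half_space - T_plus then SOME a. a < 4 \<and> x \<in> region a else 1)"

lemma cone_label_eq:
  assumes "x \<in> half_space" "a < 4" "x \<in> region a"
  shows "x \<notin> T_plus" and "cone_label x = a"
proof -
  show T: "x \<notin> T_plus" using not_tie_region[OF assms(3)] assms(2) by (auto simp: T_plus_eq)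
  have "b = a" if "b < 4 \<and> x \<in> region b" for b
    using that assms by (auto simp: region_def) (metis less_asym)
  then have "(SOME b. b < 4 \<and> x \<in> region b) = a"
    by (intro some_equality) (use assms in blast)+
  then show "cone_label x = a" using T assms(1) by (simp add: cone_label_def)
qed

lemma cone_label_region:
  assumes "x \<in> half_space - T_plus"
  shows "\<exists>a<4. x \<in> region a \<and> cone_label x = a"
proof -
  have "\<not> (\<exists>a<4. \<exists>b<4. a \<noteq> b \<and> tie a b x)" using assms by (auto simp: T_plus_eq half_space_def)
  then obtain a where "a < 4" "x \<in> region a" using in_some_region by blast
  then show ?thesis using cone_label_eq[of x a] assms by auto
qed

lemma region_0_height: "x \<in> region 0 \<Longrightarrow> 0 < x $ 3"
proof -
  assume "x \<in> region 0"
  then have "vtx 0 \<bullet> x < vtx 1 \<bullet> x" "vtx 0 \<bullet> x < vtx 2 \<bullet> x" "vtx 0 \<bullet> x < vtx 3 \<bullet> x" by (auto simp: region_def)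
  then show ?thesis using sum_vtx_inner[of x] by (simp add: vtx_0_inner)
qed

lemma labelling_T_plus:
  assumes "0 < M"
  shows "labelling T_plus cone_label M"
proof
  show "closed T_plus" by (rule closed_T_plus)
  show "T_plus \<subseteq> half_space" by (rule T_plus_half)
  show "hausdorff_measure 2 (T_plus \<inter> cball 0 r) < top" for r by (rule T_plus_locally_finite)
  show "0 < M" by (rule assms)
  show "cone_label x < 4" for x
    using cone_label_region[of x] by (cases "x \<in> half_space - T_plus") (auto simp: cone_label_def)
  show "cone_label x = 1" if "x \<in> T_plus" for x using that by (simp add: cone_label_def)
  show "\<forall>\<^sub>F y in nhds x. y \<in> half_space \<longrightarrow> cone_label y = cone_label x" if x: "x \<in> half_space - T_plus" for x
  proof -
    obtain a where a: "a < 4" "x \<in> region a" "cone_label x = a" using cone_label_region[OF x] by blast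
    have "\<forall>\<^sub>F y in nhds x. y \<in> region a" by (rule eventually_nhds_in_open[OF open_region a(2)])
    then show ?thesis by eventually_elim (use cone_label_eq(2)[OF _ a(1)] a(3) in auto)
  qed
  show "cone_label x \<noteq> 0" if x: "x \<in> half_space - T_plus" "x \<in> sliding_boundary" for x
  proof -
    obtain a where "a < 4" "x \<in> region a" "cone_label x = a" using cone_label_region[OF x(1)] by blast
    then show ?thesis
      using region_0_height[of x] x(2) by (cases "a = 0") (auto simp: sliding_boundary_def)
  qed
qed

text \<open>The strict version of \<open>tie\<close>, without the lines where three regions meet:
  sheets of different pairs are disjoint, and near a point of a sheet inside the box only two labels
  occur off the sheet.\<close>

definition sheet :: "nat \<times> nat \<Rightarrow> (real^3) set" where
  "sheet = (\<lambda>(a, b). {x. vtx a \<bullet> x = vtx b \<bullet> x \<and> (\<forall>c<4. c \<noteq> a \<longrightarrow> c \<noteq> b \<longrightarrow> vtx a \<bullet> x < vtx c \<bullet> x)})"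

definition pairs :: "(nat \<times> nat) set" where
  "pairs = {(a, b). a < b \<and> b < 4}"

lemma finite_pairs: "finite pairs"
  unfolding pairs_def by (rule finite_subset[of _ "{..<4} \<times> {..<4}"]) auto

lemma sheet_disjoint: "i \<in> pairs \<Longrightarrow> j \<in> pairs \<Longrightarrow> i \<noteq> j \<Longrightarrow> sheet i \<inter> sheet j = {}"
proof (rule ccontr)
  assume ij: "i \<in> pairs" "j \<in> pairs" "i \<noteq> j" "sheet i \<inter> sheet j \<noteq> {}"
  obtain a b c d where eq: "i = (a, b)" "j = (c, d)" by (metis surj_pair)
  obtain x where x: "x \<in> sheet (a, b)" "x \<in> sheet (c, d)" using ij eq by blast
  have lt: "a < b" "b < 4" "c < d" "d < 4" "a < 4" "c < 4" using ij eq by (auto simp: pairs_def)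
  have min1: "vtx a \<bullet> x \<le> vtx e \<bullet> x" "vtx e \<bullet> x \<le> vtx a \<bullet> x \<Longrightarrow> e = a \<or> e = b" if "e < 4" for e
    using x(1) that by (cases "e = a \<or> e = b"; force simp: sheet_def)+
  have min2: "vtx c \<bullet> x \<le> vtx e \<bullet> x" "vtx e \<bullet> x \<le> vtx c \<bullet> x \<Longrightarrow> e = c \<or> e = d" if "e < 4" for e
    using x(2) that by (cases "e = c \<or> e = d"; force simp: sheet_def)+
  have eqd: "vtx c \<bullet> x = vtx d \<bullet> x" using x(2) by (simp add: sheet_def)
  have "c = a \<or> c = b" using min1(2)[OF lt(6)] min2(1)[OF lt(5)] by blast
  moreover have "d = a \<or> d = b" using min1(2)[OF lt(4)] min2(1)[OF lt(5)] eqd by simp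
  ultimately show False using lt ij(3) eq by auto
qed

lemma tie_sheet_or_triple:
  assumes "a < 4" "b < 4" "a \<noteq> b" "tie a b x"
  shows "(\<exists>i\<in>pairs. x \<in> sheet i) \<or>
    (\<exists>c<4. c \<noteq> a \<and> c \<noteq> b \<and> vtx a \<bullet> x = vtx b \<bullet> x \<and> vtx a \<bullet> x = vtx c \<bullet> x)"
proof (rule disjCI)
  assume no: "\<not> (\<exists>c<4. c \<noteq> a \<and> c \<noteq> b \<and> vtx a \<bullet> x = vtx b \<bullet> x \<and> vtx a \<bullet> x = vtx c \<bullet> x)"
  have eq: "vtx a \<bullet> x = vtx b \<bullet> x" and le: "\<And>c. c < 4 \<Longrightarrow> vtx a \<bullet> x \<le> vtx c \<bullet> x"
    using assms(4) by (auto simp: tie_def)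
  have lt: "vtx a \<bullet> x < vtx c \<bullet> x" if "c < 4" "c \<noteq> a" "c \<noteq> b" for c
    using le[of c] no eq that by (auto simp: order_le_less)
  show "\<exists>i\<in>pairs. x \<in> sheet i"
  proof (cases "a < b")
    case True
    then have "(a, b) \<in> pairs" "x \<in> sheet (a, b)" using assms lt eq by (auto simp: pairs_def sheet_def)
    then show ?thesis by blast
  next
    case False
    then have "(b, a) \<in> pairs" "x \<in> sheet (b, a)" using assms lt eq by (auto simp: pairs_def sheet_def)
    then show ?thesis by blast
  qed
qed

lemma open_conditions_eventually:
  assumes "x \<in> sheet (a, b)"
  shows "\<forall>\<^sub>F y in nhds x. \<forall>c<4. c \<noteq> a \<longrightarrow> c \<noteq> b \<longrightarrow> vtx a \<bullet> y < vtx c \<bullet> y \<and> vtx b \<bullet> y < vtx c \<bullet> y"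
proof -
  let ?U = "\<Inter>c\<in>{..<4} - {a, b}. {y. vtx a \<bullet> y < vtx c \<bullet> y} \<inter> {y. vtx b \<bullet> y < vtx c \<bullet> y}"
  have "open ?U"
    by (intro open_INT ballI open_Int open_Collect_less continuous_intros) auto
  moreover have "x \<in> ?U" using assms by (auto simp: sheet_def)
  ultimately have "\<forall>\<^sub>F y in nhds x. y \<in> ?U" by (rule eventually_nhds_in_open)
  then show ?thesis by eventually_elim auto
qed

lemma (in jump_field) divergence_UN:
  assumes "finite I" "\<And>i. i \<in> I \<Longrightarrow> A i \<in> sets borel" "\<And>i j. i \<in> I \<Longrightarrow> j \<in> I \<Longrightarrow> i \<noteq> j \<Longrightarrow> A i \<inter> A j = {}"
  shows "divergence (\<Union>i\<in>I. A i) = (\<Sum>i\<in>I. divergence (A i))"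
  using assms
proof (induction I rule: finite_induct)
  case empty
  then show ?case by (simp add: divergence_null)
next
  case (insert i I)
  have "divergence (A i \<union> (\<Union>j\<in>I. A j)) = divergence (A i) + divergence (\<Union>j\<in>I. A j)"
  proof (rule divergence_Un)
    show "(\<Union>j\<in>I. A j) \<in> sets borel" using insert by (intro sets.finite_UN) auto
    show "A i \<inter> (\<Union>j\<in>I. A j) = {}" using insert.hyps insert.prems(2)[of i] by fastforce
  qed (use insert.prems in auto)
  then show ?case using insert by simp
qed

context
  fixes M :: real
  assumes M: "0 < M"
begin

interpretation T: labelling T_plus cone_label M
  by (rule labelling_T_plus[OF M])

lemma sheet_borel [measurable]: "sheet i \<in> sets borel"
proof -
  obtain a b where i: "i = (a, b)" by (cases i)
  have "sheet i = {x. vtx a \<bullet> x = vtx b \<bullet> x} \<inter> (\<Inter>c\<in>{c\<in>{..<4}. c \<noteq> a \<and> c \<noteq> b}. {x. vtx a \<bullet> x < vtx c \<bullet> x})"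
    by (auto simp: sheet_def i)
  also have "\<dots> \<in> sets borel"
  proof (rule sets.Int)
    show "{x. vtx a \<bullet> x = vtx b \<bullet> x} \<in> sets borel" by measurable
    show "(\<Inter>c\<in>{c\<in>{..<4}. c \<noteq> a \<and> c \<noteq> b}. {x. vtx a \<bullet> x < vtx c \<bullet> x}) \<in> sets borel"
      by (intro borel_open open_INT ballI open_Collect_less continuous_intros) auto
  qed
  finally show ?thesis .
qed

text \<open>The equality case. Crossing the sheet in direction \<open>u\<close> leads from region
  \<open>a\<close> to region \<open>b\<close>, so the jump is \<open>- u\<close> everywhere. On a
  plane with normal \<open>u\<close> the slice measure in that direction is the full Hausdorff
  measure up to the constant factor.\<close>

lemma divergence_sheet:
  assumes "a < 4" "b < 4" "a \<noteq> b" and A [measurable]: "A \<in> sets borel" and A_sub: "A \<subseteq> T.big_box \<inter> sheet (a, b)"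
  shows "ennreal (- T.divergence A) = ennreal (1 / plane_const) * hausdorff_measure 2 (T.barrier \<inter> A)"
    and "T.divergence A \<le> 0"
proof -
  define u where "u = calib a - calib b"
  have u: "norm u = 1" unfolding u_def by (rule norm_calib_diff[OF assms(1-3)])
  have plane: "T.barrier \<inter> A \<subseteq> {x. u \<bullet> x = 0}"
    using A_sub by (auto simp: u_def calib_diff sheet_def inner_diff_left)
  have jump: "jump u T.field y = - u" if y: "y \<in> A" for y
  proof (rule jump_eq)
    have yA: "y \<in> T.big_box" "y \<in> sheet (a, b)" using y A_sub by auto
    define P where "P x \<longleftrightarrow> x \<in> T.big_box \<and>
      (\<forall>c<4. c \<noteq> a \<longrightarrow> c \<noteq> b \<longrightarrow> vtx a \<bullet> x < vtx c \<bullet> x \<and> vtx b \<bullet> x < vtx c \<bullet> x)" for x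
    have evP: "\<forall>\<^sub>F x in nhds y. P x"
      unfolding P_def using yA
      by (intro eventually_conj eventually_nhds_in_open T.open_big_box open_conditions_eventually)
    have uy: "u \<bullet> y = 0" using yA by (simp add: u_def calib_diff sheet_def inner_diff_left)
    have plus: "T.field x = calib b" if "P x" "0 < u \<bullet> x" for x
    proof -
      have "vtx b \<bullet> x < vtx a \<bullet> x" using that(2) by (simp add: u_def calib_diff inner_diff_left zero_less_mult_iff)
      then have "x \<in> region b" using that(1) by (auto simp: region_def P_def)
      then have "cone_label x = b"
        using that(1) T.big_box_subset assms(2) by (intro cone_label_eq) (auto simp: P_def)
      then show ?thesis using that(1) by (simp add: T.field_def P_def)
    qed
    have minus: "T.field x = calib a" if "P x" "u \<bullet> x < 0" for x
    proof -
      have "vtx a \<bullet> x < vtx b \<bullet> x" using that(2) by (simp add: u_def calib_diff inner_diff_left mult_less_0_iff)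
      then have "x \<in> region a" using that(1) by (auto simp: region_def P_def)
      then have "cone_label x = a"
        using that(1) T.big_box_subset assms(1) by (intro cone_label_eq) (auto simp: P_def)
      then show ?thesis using that(1) by (simp add: T.field_def P_def)
    qed
    have lim: "(\<lambda>k. 1 / real (Suc k)) \<longlonglongrightarrow> 0" by (rule lim_1_over_n[THEN LIMSEQ_Suc])
    have "(\<lambda>k. y + (1 / real (Suc k)) *\<^sub>R u) \<longlonglongrightarrow> y"
      using tendsto_add[OF tendsto_const tendsto_scaleR[OF lim tendsto_const]] by simp
    from eventually_compose_filterlim[OF evP this]
    have 1: "\<forall>\<^sub>F k in sequentially. P (y + (1 / real (Suc k)) *\<^sub>R u)" .
    have "(\<lambda>k. y - (1 / real (Suc k)) *\<^sub>R u) \<longlonglongrightarrow> y"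
      using tendsto_diff[OF tendsto_const tendsto_scaleR[OF lim tendsto_const]] by simp
    from eventually_compose_filterlim[OF evP this]
    have 2: "\<forall>\<^sub>F k in sequentially. P (y - (1 / real (Suc k)) *\<^sub>R u)" .
    have "u \<bullet> u = 1" using u by (simp add: dot_square_norm)
    then have side: "0 < u \<bullet> (y + (1 / real (Suc k)) *\<^sub>R u)" "u \<bullet> (y - (1 / real (Suc k)) *\<^sub>R u) < 0" for k
      by (simp_all add: inner_add_right inner_diff_right uy)
    have mu: "calib b - calib a = - u" by (simp add: u_def)
    show "\<forall>\<^sub>F k in sequentially. T.field (y + (1 / real (Suc k)) *\<^sub>R u) - T.field (y - (1 / real (Suc k)) *\<^sub>R u) = - u"
      using 1 2 by eventually_elim (simp only: plus[OF _ side(1)] minus[OF _ side(2)] mu)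
  qed
  interpret m: finite_measure "dir_measure u T.barrier" by (rule T.finite_measure_dir_measure[OF u])
  have "T.divergence A = u \<bullet> T.flux u A" by (rule T.divergence_plane[OF u A plane])
  also have "\<dots> = (\<integral>y. indicator A y * (u \<bullet> jump u T.field y) \<partial>dir_measure u T.barrier)"
    by (rule T.inner_flux[OF u A])
  also have "\<dots> = (\<integral>y. - indicator A y \<partial>dir_measure u T.barrier)"
    using u by (intro Bochner_Integration.integral_cong) (auto simp: indicator_def jump dot_square_norm)
  also have "\<dots> = - measure (dir_measure u T.barrier) A" by simp
  finally have div: "T.divergence A = - measure (dir_measure u T.barrier) A" .
  then show "T.divergence A \<le> 0" by simp
  have "ennreal (- T.divergence A) = emeasure (dir_measure u T.barrier) A"
    by (simp add: div m.emeasure_eq_measure)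
  then show "ennreal (- T.divergence A) = ennreal (1 / plane_const) * hausdorff_measure 2 (T.barrier \<inter> A)"
    using T.dir_measure_normal[OF u A plane] by simp
qed

text \<open>The six sheets account for everything: triple lines are null, and so is the part of the
  cone in \<Gamma>. For images of the cone only the corresponding inequality is available.\<close>

lemma minus_divergence_core_T_plus:
  "ennreal (- T.divergence T.core) = ennreal (1 / plane_const) * hausdorff_measure 2 (T_plus \<inter> T.core)"
proof -
  let ?\<Gamma> = sliding_boundary let ?e = "axis 3 1 :: real^3"
  define G where "G = T.core \<inter> T.big_box"
  have [measurable]: "T.big_box \<in> sets borel" by (rule borel_open[OF T.open_big_box])
  have Gb [measurable]: "G \<in> sets borel" by (simp add: G_def)
  have TG: "T.barrier \<inter> G = T_plus \<inter> T.core - ?\<Gamma>" unfolding G_def by (rule T.barrier_core)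
  define N where "N = G - (\<Union>i\<in>pairs. sheet i)"
  have [measurable]: "(\<Union>i\<in>pairs. sheet i) \<in> sets borel"
    using finite_pairs by (intro sets.finite_UN) auto
  have Nb [measurable]: "N \<in> sets borel" by (simp add: N_def)
  have null: "hausdorff_measure 2 (T.barrier \<inter> N) = 0"
  proof -
    let ?I = "{(a, b, c). a < 4 \<and> b < 4 \<and> c < 4 \<and> a \<noteq> b \<and> a \<noteq> c \<and> b \<noteq> (c::nat)}"
    let ?A = "\<lambda>(a, b, c). {x. vtx a \<bullet> x = vtx b \<bullet> x \<and> vtx a \<bullet> x = vtx c \<bullet> x}"
    have fin: "finite ?I" by (rule finite_subset[of _ "{..<4} \<times> {..<4} \<times> {..<4}"]) auto
    have "T.barrier \<inter> N \<subseteq> (\<Union>i\<in>?I. ?A i)"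
    proof
      fix x assume x: "x \<in> T.barrier \<inter> N"
      then have "x \<in> T_plus" using TG by (auto simp: N_def)
      then obtain a b where ab: "a < 4" "b < 4" "a \<noteq> b" "tie a b x" by (auto simp: T_plus_eq)
      have "\<not> (\<exists>i\<in>pairs. x \<in> sheet i)" using x by (auto simp: N_def)
      then obtain c where "c < 4" "c \<noteq> a" "c \<noteq> b" "vtx a \<bullet> x = vtx b \<bullet> x" "vtx a \<bullet> x = vtx c \<bullet> x"
        using tie_sheet_or_triple[OF ab] by blast
      then show "x \<in> (\<Union>i\<in>?I. ?A i)" using ab by (intro UN_I[of "(a, b, c)"]) auto
    qed
    then have "hausdorff_measure 2 (T.barrier \<inter> N) \<le> hausdorff_measure 2 (\<Union>i\<in>?I. ?A i)"
      by (rule hausdorff_measure_mono)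
    also have "\<dots> \<le> (\<Sum>i\<in>?I. hausdorff_measure 2 (?A i))"
      by (rule hausdorff_measure_finite_UN_le[OF fin])
    also have "\<dots> = 0" by (rule sum.neutral) (auto simp: triple_null)
    finally show ?thesis by simp
  qed
  have disj: "i \<in> pairs \<Longrightarrow> j \<in> pairs \<Longrightarrow> i \<noteq> j \<Longrightarrow> (G \<inter> sheet i) \<inter> (G \<inter> sheet j) = {}" for i j
    using sheet_disjoint[of i j] by blast
  have ab: "fst i < 4" "snd i < 4" "fst i \<noteq> snd i" if "i \<in> pairs" for i
    using that by (auto simp: pairs_def)
  have sub: "G \<inter> sheet i \<subseteq> T.big_box \<inter> sheet (fst i, snd i)" for i by (auto simp: G_def)
  have G_eq: "G = (\<Union>i\<in>pairs. G \<inter> sheet i) \<union> N" by (auto simp: N_def)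
  have [measurable]: "(\<Union>i\<in>pairs. G \<inter> sheet i) \<in> sets borel"
    using finite_pairs by (intro sets.finite_UN) auto
  have divG: "T.divergence G = (\<Sum>i\<in>pairs. T.divergence (G \<inter> sheet i))"
  proof -
    have "T.divergence G = T.divergence (\<Union>i\<in>pairs. G \<inter> sheet i) + T.divergence N"
      by (subst G_eq, rule T.divergence_Un) (auto simp: N_def)
    then show ?thesis
      using T.divergence_null[OF Nb null] T.divergence_UN[OF finite_pairs, of "\<lambda>i. G \<inter> sheet i"] disj by simp
  qed
  have "T.divergence (T.core \<inter> ?\<Gamma>) = 0"
  proof -
    interpret m: finite_measure "dir_measure ?e T.barrier" by (rule T.finite_measure_dir_measure) simp
    have [measurable]: "T_plus \<in> sets borel" by (rule borel_closed[OF closed_T_plus])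
    have "emeasure (dir_measure ?e T.barrier) (T_plus \<inter> ?\<Gamma>)
        \<le> ennreal (1 / plane_const) * hausdorff_measure 2 (T.barrier \<inter> (T_plus \<inter> ?\<Gamma>))"
      by (rule T.dir_measure_le) auto
    also have "\<dots> \<le> ennreal (1 / plane_const) * hausdorff_measure 2 (T_plus \<inter> ?\<Gamma>)"
      by (intro mult_left_mono hausdorff_measure_mono) auto
    finally have "T_plus \<inter> ?\<Gamma> \<in> null_sets (dir_measure ?e T.barrier)"
      by (simp add: T_plus_boundary_null null_sets_def)
    from AE_not_in[OF this]
    have "AE y in dir_measure ?e T.barrier. indicator (T.core \<inter> ?\<Gamma>) y * (jump ?e T.field y $ 3) = 0"
      by eventually_elim (use T.jump_boundary(2) in \<open>auto simp: indicator_def\<close>)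
    then show ?thesis unfolding T.divergence_boundary by (rule integral_eq_zero_AE)
  qed
  then have "- T.divergence T.core = (\<Sum>i\<in>pairs. - T.divergence (G \<inter> sheet i))"
    by (simp add: T.divergence_core G_def[symmetric] divG sum_negf)
  also have "ennreal \<dots> = (\<Sum>i\<in>pairs. ennreal (- T.divergence (G \<inter> sheet i)))"
    using divergence_sheet(2)[OF ab, of _ "G \<inter> sheet _"] sub by (intro sum_ennreal[symmetric]) auto
  also have "\<dots> = (\<Sum>i\<in>pairs. ennreal (1 / plane_const) * hausdorff_measure 2 (T.barrier \<inter> (G \<inter> sheet i)))"
    using divergence_sheet(1)[OF ab _ sub] by (intro sum.cong) auto
  also have "\<dots> = ennreal (1 / plane_const) * (\<Sum>i\<in>pairs. emeasure (hausdorff 2) (T.barrier \<inter> (G \<inter> sheet i)))"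
    by (simp add: sum_distrib_left emeasure_hausdorff borel_closed T.closed_barrier)
  also have "(\<Sum>i\<in>pairs. emeasure (hausdorff 2) (T.barrier \<inter> (G \<inter> sheet i)))
      = emeasure (hausdorff 2) (\<Union>i\<in>pairs. T.barrier \<inter> (G \<inter> sheet i))"
  proof (rule sum_emeasure)
    show "disjoint_family_on (\<lambda>i. T.barrier \<inter> (G \<inter> sheet i)) pairs"
      using disj unfolding disjoint_family_on_def by blast
  qed (auto simp: finite_pairs borel_closed T.closed_barrier)
  also have "\<dots> = hausdorff_measure 2 (T_plus \<inter> T.core)"
  proof -
    let ?X = "\<Union>i\<in>pairs. T.barrier \<inter> (G \<inter> sheet i)"
    have [measurable]: "T.barrier \<in> sets borel" by (rule borel_closed[OF T.closed_barrier])
    have Xb: "?X \<in> sets borel" using finite_pairs by (intro sets.finite_UN) auto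
    have "T_plus \<inter> T.core \<subseteq> ?X \<union> ((T.barrier \<inter> N) \<union> (T_plus \<inter> ?\<Gamma>))"
      using TG by (auto simp: N_def)
    then have "hausdorff_measure 2 (T_plus \<inter> T.core) \<le> hausdorff_measure 2 (?X \<union> ((T.barrier \<inter> N) \<union> (T_plus \<inter> ?\<Gamma>)))"
      by (rule hausdorff_measure_mono)
    also have "\<dots> \<le> hausdorff_measure 2 ?X + (hausdorff_measure 2 (T.barrier \<inter> N) + hausdorff_measure 2 (T_plus \<inter> ?\<Gamma>))"
      by (intro order_trans[OF hausdorff_measure_Un_le] add_mono order_refl hausdorff_measure_Un_le)
    finally have "hausdorff_measure 2 (T_plus \<inter> T.core) \<le> hausdorff_measure 2 ?X"
      by (simp add: null T_plus_boundary_null)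
    moreover have "hausdorff_measure 2 ?X \<le> hausdorff_measure 2 (T_plus \<inter> T.core)"
      using TG by (intro hausdorff_measure_mono) auto
    ultimately show ?thesis using Xb by (simp add: emeasure_hausdorff)
  qed
  finally show ?thesis .
qed

end

section \<open>Sliding images of the cone as labelled sets\<close>

lemma Int_Un_cong: "A \<inter> K = B \<inter> K \<Longrightarrow> (A \<inter> C \<union> D) \<inter> K = (B \<inter> C \<union> D) \<inter> K"
  by blast

context sliding_map
begin

definition arm :: "nat \<Rightarrow> (real^3) set" where
  "arm a = {p \<in> region a. M + 1 < norm p}"

definition linked :: "nat \<Rightarrow> real^3 \<Rightarrow> bool" where
  "linked a x \<longleftrightarrow> (\<exists>p\<in>arm a. connected_component (half_space - image_set) x p)"

text \<open>By \<open>arms_separated\<close> at most one of the tests succeeds, so their order is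
  immaterial. Arm 1, the components that reach no arm and the image itself share the label
  1.\<close>

definition image_label :: "real^3 \<Rightarrow> nat" where
  "image_label x = (if linked 0 x then 0 else if linked 2 x then 2 else if linked 3 x then 3 else 1)"

lemma linked_imp_mem: "linked a x \<Longrightarrow> x \<in> half_space - image_set"
  unfolding linked_def by (meson connected_component_in)

lemma image_label_image: "x \<in> image_set \<Longrightarrow> image_label x = 1"
  using linked_imp_mem by (auto simp: image_label_def)

lemma image_set_far:
  assumes "M \<le> norm x"
  shows "x \<in> image_set \<longleftrightarrow> x \<in> T_plus"
proof
  assume "x \<in> image_set"
  then obtain y where y: "y \<in> T_plus" "x = \<phi> y" by blast
  then show "x \<in> T_plus" using moved[OF y(1)] assms by (cases "\<phi> y = y") auto
next
  assume x: "x \<in> T_plus"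
  then have "\<phi> x = x" using moved[OF x] assms by force
  then show "x \<in> image_set" using x by (metis imageI)
qed

lemma image_label_arm:
  assumes x: "x \<in> region a" "a < 4" "x \<in> half_space" "M + 1 < norm x"
  shows "image_label x = a"
proof -
  have "x \<notin> T_plus" using cone_label_eq(1)[OF x(3,2,1)] .
  then have xS: "x \<in> half_space - image_set" using image_set_far[of x] x by simp
  then have "linked a x" using x by (auto simp: linked_def arm_def intro: connected_component_refl)
  moreover have "\<not> linked b x" if "b < 4" "b \<noteq> a" for b
    using arms_separated[OF x(2) that(1) that(2)[symmetric] x(1,4)] by (auto simp: linked_def arm_def)
  moreover have "a = 0 \<or> a = 1 \<or> a = 2 \<or> a = 3" using x(2) by linarith
  ultimately show ?thesis unfolding image_label_def by (elim disjE) simp_all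
qed

lemma closed_image_set: "closed image_set"
proof -
  have fix_far: "\<phi> x = x" if "x \<in> T_plus" "M \<le> norm x" for x
    using moved[OF that(1)] that(2) by (cases "\<phi> x = x") auto
  have "image_set = \<phi> ` (T_plus \<inter> cball 0 M) \<union> (T_plus - ball 0 M)"
  proof (intro equalityI subsetI)
    fix y assume "y \<in> image_set"
    then obtain x where x: "x \<in> T_plus" "y = \<phi> x" by blast
    show "y \<in> \<phi> ` (T_plus \<inter> cball 0 M) \<union> (T_plus - ball 0 M)"
      using x fix_far[OF x(1)] by (cases "norm x \<le> M") auto
  next
    fix y assume "y \<in> \<phi> ` (T_plus \<inter> cball 0 M) \<union> (T_plus - ball 0 M)"
    then show "y \<in> image_set"
    proof
      assume "y \<in> T_plus - ball 0 M"
      then have "y \<in> T_plus" "\<phi> y = y" using fix_far[of y] by auto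
      then show ?thesis by (metis imageI)
    qed blast
  qed
  moreover have "compact (\<phi> ` (T_plus \<inter> cball 0 M))"
    using cont closed_T_plus
    by (intro compact_continuous_image closed_Int_compact) (auto intro: continuous_on_subset)
  ultimately show ?thesis using closed_T_plus by (simp add: compact_imp_closed closed_Un closed_Diff)
qed

lemma image_set_half: "image_set \<subseteq> half_space"
  using upper by (auto simp: half_space_def)

lemma image_set_finite:
  assumes lip: "L-lipschitz_on T_plus \<phi>"
  shows "hausdorff_measure 2 (image_set \<inter> cball 0 r) < top"
proof -
  let ?T = "T_plus \<inter> cball 0 (max r M)"
  have "image_set \<inter> cball 0 r \<subseteq> \<phi> ` ?T"
  proof
    fix y assume y: "y \<in> image_set \<inter> cball 0 r"
    then obtain x where x: "x \<in> T_plus" "y = \<phi> x" by blast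
    have "norm x \<le> max r M" using moved[OF x(1)] x y by (cases "\<phi> x = x") auto
    then show "y \<in> \<phi> ` ?T" using x by auto
  qed
  then have "hausdorff_measure 2 (image_set \<inter> cball 0 r) \<le> hausdorff_measure 2 (\<phi> ` ?T)"
    by (rule hausdorff_measure_mono)
  also have "\<dots> \<le> ennreal ((max L 1)\<^sup>2) * hausdorff_measure 2 ?T"
  proof (rule hausdorff_measure_lipschitz_image)
    fix x y assume xy: "x \<in> ?T" "y \<in> ?T"
    have "dist (\<phi> x) (\<phi> y) \<le> L * dist x y" using lipschitz_onD[OF lip] xy by blast
    also have "\<dots> \<le> max L 1 * dist x y" by (intro mult_right_mono) auto
    finally show "dist (\<phi> x) (\<phi> y) \<le> max L 1 * dist x y" .
  qed simp
  also have "\<dots> < top" using T_plus_locally_finite by (simp add: ennreal_mult_less_top)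
  finally show ?thesis .
qed

text \<open>A small ball intersected with the half-space is convex, so nearby points of the
  half-space are joined by segments that avoid the image.\<close>

lemma linked_eventually:
  assumes x: "x \<in> half_space - image_set"
  shows "\<forall>\<^sub>F y in nhds x. y \<in> half_space \<longrightarrow> (\<forall>a. linked a y = linked a x)"
proof -
  obtain r where r: "0 < r" "ball x r \<subseteq> - image_set"
    using closed_image_set x openE[of "- image_set" x] by auto
  have "\<forall>\<^sub>F y in nhds x. y \<in> ball x r" using r by (intro eventually_nhds_in_open) auto
  then show ?thesis
  proof eventually_elim
    case (elim y)
    show ?case
    proof (intro impI allI)
      fix a assume y: "y \<in> half_space"
      have "convex half_space"
        unfolding half_space_def using convex_halfspace_ge[of 0 "axis 3 1 :: real^3"]
        by (simp add: inner_axis inner_commute)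
      then have "closed_segment x y \<subseteq> ball x r \<inter> half_space"
        using elim y x r by (intro closed_segment_subset convex_Int convex_ball) auto
      then have "closed_segment x y \<subseteq> half_space - image_set" using r by auto
      then have "connected_component (half_space - image_set) x y"
        unfolding connected_component_def by (intro exI[of _ "closed_segment x y"]) auto
      then show "linked a y = linked a x"
        unfolding linked_def by (metis connected_component_sym connected_component_trans)
    qed
  qed
qed

text \<open>The radius is \<open>M + 1\<close> because the extension below \<Gamma> may move points
  up to that distance from the origin, and the arms are recognised only beyond it.\<close>

lemma labelling_image:
  assumes lip: "L-lipschitz_on T_plus \<phi>" and "0 < M"
  shows "labelling image_set image_label (M + 1)"
proof
  show "closed image_set" by (rule closed_image_set)
  show "image_set \<subseteq> half_space" by (rule image_set_half)
  show "hausdorff_measure 2 (image_set \<inter> cball 0 r) < top" for r by (rule image_set_finite[OF lip])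
  show "0 < M + 1" using assms by simp
  show "image_label x < 4" for x by (simp add: image_label_def)
  show "image_label x = 1" if "x \<in> image_set" for x by (rule image_label_image[OF that])
  show "\<forall>\<^sub>F y in nhds x. y \<in> half_space \<longrightarrow> image_label y = image_label x"
    if "x \<in> half_space - image_set" for x
    using linked_eventually[OF that] by eventually_elim (simp add: image_label_def)
  show "image_label x \<noteq> 0" if x: "x \<in> half_space - image_set" "x \<in> sliding_boundary" for x
  proof -
    have "\<not> linked 0 x"
    proof
      assume "linked 0 x"
      then obtain p where p: "p \<in> region 0" "M + 1 < norm p" "connected_component (half_space - image_set) x p"
        by (auto simp: linked_def arm_def)
      then show False
        using top_arm_avoids_boundary[OF p(1,2) x(1)] x(2) connected_component_sym
        by (auto simp: sliding_boundary_def)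
    qed
    then show ?thesis by (simp add: image_label_def)
  qed
qed

text \<open>Both total divergences vanish and they agree far out, hence they agree on a large ball.\<close>

lemma hausdorff_T_plus_le_image:
  assumes lip: "L-lipschitz_on T_plus \<phi>" and "0 < M"
  shows "hausdorff_measure 2 (T_plus \<inter> cball 0 (M + 1))
    \<le> hausdorff_measure 2 (image_set \<inter> cball 0 (M + 1) - sliding_boundary)
      + ennreal (sqrt (2 / 3)) * hausdorff_measure 2 (image_set \<inter> cball 0 (M + 1) \<inter> sliding_boundary)"
    (is "?l \<le> ?r")
proof -
  have M1: "0 < M + 1" using \<open>0 < M\<close> by simp
  interpret T: labelling T_plus cone_label "M + 1" by (rule labelling_T_plus[OF M1])
  interpret I: labelling image_set image_label "M + 1" by (rule labelling_image[OF assms])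
  have core: "T.core = cball 0 (M + 1)" by (simp add: T.core_def)
  have "T.divergence (- T.core) = I.divergence (- T.core)"
  proof (rule divergence_local[OF T.jump_field I.jump_field])
    show "open (- T.core)" by (simp add: core open_Compl)
    have far: "x \<in> image_set \<longleftrightarrow> x \<in> T_plus" if "x \<notin> T.core" for x
      using image_set_far[of x] that by (simp add: core)
    then have "T_plus \<inter> - T.core = image_set \<inter> - T.core" by (intro set_eqI) (simp only: Int_iff Compl_iff, metis)
    then show "T.barrier \<inter> - T.core = I.barrier \<inter> - T.core"
      unfolding T.barrier_def I.barrier_def by (rule Int_Un_cong)
    show "T.field x = I.field x" if x: "x \<in> - T.core" for x
    proof (cases "x \<in> T.big_box")
      case True
      then have xh: "x \<in> half_space" using T.big_box_subset by blast
      have "cone_label x = image_label x"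
      proof (cases "x \<in> T_plus")
        case True
        then show ?thesis using far[of x] x by (simp add: cone_label_def image_label_image)
      next
        case False
        then obtain a where a: "a < 4" "x \<in> region a" "cone_label x = a" using cone_label_region[of x] xh by blast
        then show ?thesis using image_label_arm[OF a(2,1) xh] x by (simp add: core)
      qed
      then show ?thesis using True by (simp add: T.field_def I.field_def)
    qed (simp add: T.field_def I.field_def)
  qed
  moreover have "T.divergence T.core + T.divergence (- T.core) = 0"
    using T.divergence_Un[of T.core "- T.core"] T.divergence_UNIV by simp
  moreover have "I.divergence T.core + I.divergence (- T.core) = 0"
    using I.divergence_Un[of T.core "- T.core"] I.divergence_UNIV by simp
  ultimately have "- T.divergence T.core = - I.divergence I.core" by simp
  then have "ennreal (1 / plane_const) * ?l \<le> ennreal (1 / plane_const) * ?r"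
    using minus_divergence_core_T_plus[OF M1] I.minus_divergence_core_le by (simp add: core I.core_def)
  then have "ennreal plane_const * (ennreal (1 / plane_const) * ?l) \<le> ennreal plane_const * (ennreal (1 / plane_const) * ?r)"
    by (rule mult_left_mono) simp
  then show ?thesis
    using plane_const_pos by (simp add: mult.assoc[symmetric] ennreal_mult'[symmetric])
qed

end

section \<open>Minimality at and above the threshold\<close>

lemma sliding_competitor_obtains:
  assumes "sliding_competitor T_plus F"
  obtains \<phi> M L where "sliding_map \<phi> M" "0 < M" "L-lipschitz_on T_plus \<phi>" "F = \<phi> ` T_plus"
proof -
  from assms show thesis
    unfolding sliding_competitor_def Let_def
  proof (elim exE conjE)
    fix \<phi> :: "real \<Rightarrow> real^3 \<Rightarrow> real^3" and L K
    assume id: "\<forall>x\<in>T_plus. \<phi> 0 x = x" and F: "F = \<phi> 1 ` T_plus" and L: "L-lipschitz_on T_plus (\<phi> 1)"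
      and half: "\<forall>t\<in>{0..1}. (\<forall>x\<in>T_plus. \<phi> t x \<in> half_space) \<and>
                       (\<forall>x\<in>T_plus \<inter> sliding_boundary. \<phi> t x \<in> sliding_boundary)"
      and K: "compact K" "(\<lambda>(t, x). \<phi> t x) ` ({0..1} \<times> (\<Union>t\<in>{0..1}. {x \<in> T_plus. \<phi> t x \<noteq> x})) \<subseteq> K"
    obtain M where M: "0 < M" "\<And>x. x \<in> K \<Longrightarrow> norm x < M"
      using compact_imp_bounded[OF K(1)] unfolding bounded_pos_less by blast
    have "sliding_map (\<phi> 1) M"
    proof
      show "continuous_on T_plus (\<phi> 1)" using L by (rule lipschitz_on_continuous_on)
      show "0 \<le> \<phi> 1 x $ 3" if "x \<in> T_plus" for x using half that by (auto simp: half_space_def)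
      show "\<phi> 1 x $ 3 = 0" if "x \<in> T_plus" "x $ 3 = 0" for x using half that by (auto simp: sliding_boundary_def)
      show "norm x < M \<and> norm (\<phi> 1 x) < M" if x: "x \<in> T_plus" "\<phi> 1 x \<noteq> x" for x
      proof -
        \<comment> \<open>A point displaced at time 1 belongs to the moving set, so its whole
          trajectory lies in \<open>K\<close>, including its starting point at time 0.\<close>
        have W: "x \<in> (\<Union>t\<in>{0..1::real}. {x \<in> T_plus. \<phi> t x \<noteq> x})" using x by (intro UN_I[of 1]) auto
        have "\<phi> t x \<in> K" if "t \<in> {0..1}" for t
          using W that by (intro subsetD[OF K(2)] image_eqI[of _ _ "(t, x)"] SigmaI) simp_all
        from this[of 0] this[of 1] show ?thesis using M(2) id x by auto
      qed
    qed
    then show thesis using that M(1) L F by metis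
  qed
qed

lemma le_of_add_le_ennreal: "x + c \<le> y + c \<Longrightarrow> c < top \<Longrightarrow> x \<le> y" for x y c :: ennreal
  using ennreal_add_left_cancel_le[of c x y] unfolding add.commute[of _ c] by auto

text \<open>\<open>hausdorff_T_plus_le_image\<close> compares the two sets inside a ball outside
  which they agree. Subtracting the common part, which has finite measure there, gives the
  inequality for the differences. The energy of what is lost does not depend on
  \<open>\<alpha>\<close>, as the cone has no area in \<Gamma>, while that of what is gained
  increases with it.\<close>

lemma T_plus_minimiser:
  assumes \<alpha>: "sqrt (2 / 3) \<le> \<alpha>"
  shows "sliding_minimiser \<alpha> T_plus"
  unfolding sliding_minimiser_def
proof (intro conjI allI impI)
  let ?\<Gamma> = sliding_boundary let ?H = "hausdorff_measure 2 :: (real^3) set \<Rightarrow> ennreal" let ?b = "ennreal (sqrt (2 / 3))"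
  show "T_plus \<subseteq> half_space" by (rule T_plus_half)
  show "locally_finite_hausdorff 2 T_plus"
    unfolding locally_finite_hausdorff_def
  proof (intro allI exI[of _ 1] conjI)
    fix x :: "real^3"
    have "?H (T_plus \<inter> ball x 1) \<le> ?H (T_plus \<inter> cball x 1)" by (intro hausdorff_measure_mono) auto
    then show "?H (T_plus \<inter> ball x 1) < \<infinity>" using T_plus_locally_finite[of x 1] by simp
  qed simp
  fix F assume "sliding_competitor T_plus F"
  then obtain \<phi> M L where map: "sliding_map \<phi> M" and M: "0 < M" and lip: "L-lipschitz_on T_plus \<phi>"
    and F: "F = \<phi> ` T_plus"
    by (rule sliding_competitor_obtains)
  interpret sliding_map \<phi> M by (rule map)
  let ?B = "cball (0::real^3) (M + 1)"
  have far: "x \<in> F \<longleftrightarrow> x \<in> T_plus" if "x \<notin> ?B" for x using image_set_far[of x] that F by simp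
  have [measurable]: "F \<in> sets borel" "T_plus \<in> sets borel" "?\<Gamma> \<in> sets borel"
    using closed_image_set closed_T_plus labelling.boundary_borel[OF labelling_T_plus[OF M]]
    by (auto simp: F borel_closed)
  have null: "?H (T_plus \<inter> ?\<Gamma> \<inter> X) = 0" for X
    using hausdorff_measure_mono[OF Int_lower1[of "T_plus \<inter> ?\<Gamma>" X], of 2] T_plus_boundary_null by simp
  have split: "?H (T_plus - F) + ?H (T_plus \<inter> F \<inter> ?B) = ?H (T_plus \<inter> ?B)"
  proof -
    have "emeasure (hausdorff 2) (T_plus - F) + emeasure (hausdorff 2) (T_plus \<inter> F \<inter> ?B)
        = emeasure (hausdorff 2) ((T_plus - F) \<union> (T_plus \<inter> F \<inter> ?B))"
      by (intro plus_emeasure) auto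
    moreover have "(T_plus - F) \<union> (T_plus \<inter> F \<inter> ?B) = T_plus \<inter> ?B"
      using far by (intro set_eqI) (simp only: Un_iff Int_iff Diff_iff, metis)
    ultimately show ?thesis by (simp add: emeasure_hausdorff)
  qed
  have "?H (T_plus \<inter> ?B) \<le> ?H (F \<inter> ?B - ?\<Gamma>) + ?b * ?H (F \<inter> ?B \<inter> ?\<Gamma>)"
    using hausdorff_T_plus_le_image[OF lip M] F by simp
  also have "\<dots> \<le> (?H ((F - T_plus) - ?\<Gamma>) + ?H (T_plus \<inter> F \<inter> ?B)) + ?b * (?H ((F - T_plus) \<inter> ?\<Gamma>) + ?H (T_plus \<inter> ?\<Gamma> \<inter> F))"
    by (intro add_mono mult_left_mono order_trans[OF hausdorff_measure_mono hausdorff_measure_Un_le]) auto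
  also have "\<dots> = (?H ((F - T_plus) - ?\<Gamma>) + ?b * ?H ((F - T_plus) \<inter> ?\<Gamma>)) + ?H (T_plus \<inter> F \<inter> ?B)"
    by (simp add: null add_ac)
  finally have "?H (T_plus - F) + ?H (T_plus \<inter> F \<inter> ?B)
      \<le> (?H ((F - T_plus) - ?\<Gamma>) + ?b * ?H ((F - T_plus) \<inter> ?\<Gamma>)) + ?H (T_plus \<inter> F \<inter> ?B)"
    by (simp add: split)
  moreover have "?H (T_plus \<inter> F \<inter> ?B) < top"
    using hausdorff_measure_mono[of "T_plus \<inter> F \<inter> ?B" "T_plus \<inter> ?B" 2] T_plus_locally_finite[of 0 "M + 1"]
    by (auto intro: order_le_less_trans)
  ultimately have main: "?H (T_plus - F) \<le> ?H ((F - T_plus) - ?\<Gamma>) + ?b * ?H ((F - T_plus) \<inter> ?\<Gamma>)"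
    by (rule le_of_add_le_ennreal)
  have "sliding_energy \<alpha> (T_plus - F) \<le> ?H (T_plus - F)"
  proof -
    have "(T_plus - F) \<inter> ?\<Gamma> = T_plus \<inter> ?\<Gamma> \<inter> - F" by blast
    then have "?H ((T_plus - F) \<inter> ?\<Gamma>) = 0" using null by metis
    then show ?thesis
      unfolding sliding_energy_def using hausdorff_measure_mono[OF Diff_subset] by simp
  qed
  also note main
  also have "?H ((F - T_plus) - ?\<Gamma>) + ?b * ?H ((F - T_plus) \<inter> ?\<Gamma>) \<le> sliding_energy \<alpha> (F - T_plus)"
    unfolding sliding_energy_def by (intro add_mono mult_right_mono ennreal_leI \<alpha>) auto
  finally show "sliding_energy \<alpha> (T_plus - F) \<le> sliding_energy \<alpha> (F - T_plus)" .
qed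

section \<open>A competitor for small weights\<close>

text \<open>Strips, faces and gaps are all of this shape. The set \<open>I\<close> is left free so
  that neighbouring pieces can share an end point or be made disjoint by half-open
  intervals.\<close>

definition trapezoid :: "'a::real_vector \<Rightarrow> 'a \<Rightarrow> 'a \<Rightarrow> real set \<Rightarrow> real \<Rightarrow> real \<Rightarrow> real \<Rightarrow> real \<Rightarrow> 'a set" where
  "trapezoid c a b I p q p' q' =
    {c + \<xi> *\<^sub>R a + \<eta> *\<^sub>R b | \<xi> \<eta>. \<xi> \<in> I \<and> p * \<xi> + q < \<eta> \<and> \<eta> < p' * \<xi> + q'}"

lemma trapezoid_borel:
  fixes a b c :: "'a::euclidean_space"
  assumes [measurable]: "I \<in> sets borel" and "a \<noteq> 0" "b \<noteq> 0" "a \<bullet> b = 0"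
  shows "trapezoid c a b I p q p' q' \<in> sets borel"
proof -
  define \<xi> where "\<xi> x = (x - c) \<bullet> a / (a \<bullet> a)" for x
  define \<eta> where "\<eta> x = (x - c) \<bullet> b / (b \<bullet> b)" for x
  have [measurable]: "\<xi> \<in> borel_measurable borel" "\<eta> \<in> borel_measurable borel"
    by (simp_all add: \<xi>_def[abs_def] \<eta>_def[abs_def])
  have \<xi>\<eta>: "\<xi> (c + s *\<^sub>R a + t *\<^sub>R b) = s" "\<eta> (c + s *\<^sub>R a + t *\<^sub>R b) = t" for s t
    using assms by (simp_all add: \<xi>_def \<eta>_def inner_add_left inner_commute[of b a])
  have "trapezoid c a b I p q p' q'
      = {x. x = c + \<xi> x *\<^sub>R a + \<eta> x *\<^sub>R b \<and> \<xi> x \<in> I \<and> p * \<xi> x + q < \<eta> x \<and> \<eta> x < p' * \<xi> x + q'}"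
    (is "?l = ?r")
  proof (intro equalityI subsetI)
    fix x assume "x \<in> ?l"
    then obtain s t where "x = c + s *\<^sub>R a + t *\<^sub>R b" "s \<in> I" "p * s + q < t" "t < p' * s + q'"
      unfolding trapezoid_def by blast
    then show "x \<in> ?r" by (simp add: \<xi>\<eta>)
  next
    fix x assume "x \<in> ?r"
    then show "x \<in> ?l" unfolding trapezoid_def by blast
  qed
  also have "\<dots> = {x \<in> space borel. x = c + \<xi> x *\<^sub>R a + \<eta> x *\<^sub>R b \<and> \<xi> x \<in> I \<and> p * \<xi> x + q < \<eta> x \<and> \<eta> x < p' * \<xi> x + q'}"
    by simp
  also have "\<dots> \<in> sets borel" by measurable
  finally show ?thesis .
qed

lemma emeasure_planar_trapezoid:
  assumes [measurable]: "I \<in> sets borel" and I: "{s<..<s'} \<subseteq> I" "I \<subseteq> {s..s'}" and "s \<le> s'"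
    and le: "\<And>x. x \<in> {s..s'} \<Longrightarrow> p * x + q \<le> p' * x + q'"
  shows "emeasure lborel {(x, y :: real). x \<in> I \<and> p * x + q < y \<and> y < p' * x + q'}
    = ennreal ((p' - p) * (s'\<^sup>2 - s\<^sup>2) / 2 + (q' - q) * (s' - s))" (is "emeasure _ ?A = _")
proof -
  have A: "?A \<in> sets (lborel \<Otimes>\<^sub>M lborel)"
  proof -
    have "?A = {z \<in> space (lborel \<Otimes>\<^sub>M lborel). fst z \<in> I \<and> p * fst z + q < snd z \<and> snd z < p' * fst z + q'}"
      by (auto simp: space_pair_measure)
    also have "\<dots> \<in> sets (lborel \<Otimes>\<^sub>M lborel)" by measurable
    finally show ?thesis .
  qed
  let ?f = "\<lambda>x. (p' - p) * x + (q' - q)"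
  have "emeasure lborel ?A = (\<integral>\<^sup>+ x. emeasure lborel (Pair x -` ?A) \<partial>lborel)"
    using lborel.emeasure_pair_measure_alt[OF A] by (simp add: lborel_prod)
  also have "\<dots> = (\<integral>\<^sup>+ x. ennreal (?f x) * indicator {s..s'} x \<partial>lborel)"
  proof (rule nn_integral_cong_AE)
    have "AE x in lborel. x \<noteq> s \<and> x \<noteq> s'"
      using AE_lborel_singleton[of s] AE_lborel_singleton[of s'] by eventually_elim simp
    then show "AE x in lborel. emeasure lborel (Pair x -` ?A) = ennreal (?f x) * indicator {s..s'} x"
    proof eventually_elim
      case (elim x)
      show ?case
      proof (cases "x \<in> I")
        case True
        then have "Pair x -` ?A = {p * x + q <..< p' * x + q'}" by auto
        then show ?thesis using True I(2) le[of x] by (auto simp: algebra_simps)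
      next
        case False
        then have "x \<notin> {s..s'}" using elim I(1) by force
        then show ?thesis using False by simp
      qed
    qed
  qed
  also have "\<dots> = ennreal (((p' - p) * s'\<^sup>2 / 2 + (q' - q) * s') - ((p' - p) * s\<^sup>2 / 2 + (q' - q) * s))"
  proof (rule nn_integral_FTC_Icc)
    fix x assume "x \<in> {s..s'}"
    show "((\<lambda>x. (p' - p) * x\<^sup>2 / 2 + (q' - q) * x) has_real_derivative ?f x) (at x)"
      by (auto intro!: derivative_eq_intros)
    show "0 \<le> ?f x" using le[OF \<open>x \<in> {s..s'}\<close>] by (simp add: algebra_simps)
  qed (use \<open>s \<le> s'\<close> in auto)
  also have "((p' - p) * s'\<^sup>2 / 2 + (q' - q) * s') - ((p' - p) * s\<^sup>2 / 2 + (q' - q) * s)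
      = (p' - p) * (s'\<^sup>2 - s\<^sup>2) / 2 + (q' - q) * (s' - s)"
    by (simp add: field_simps)
  finally show ?thesis .
qed

text \<open>Only \<open>b\<close> is a unit vector. Stretching the first parameter by the length
  \<open>r\<close> of \<open>a\<close> makes the parametrisation isometric, and the planar formula
  applies.\<close>

lemma hausdorff_measure_trapezoid:
  fixes a b c :: "'a::euclidean_space"
  assumes I: "I \<in> sets borel" "{s<..<s'} \<subseteq> I" "I \<subseteq> {s..s'}" and "s \<le> s'"
    and le: "\<And>x. x \<in> {s..s'} \<Longrightarrow> p * x + q \<le> p' * x + q'"
    and ab: "norm a = r" "0 < r" "norm b = 1" "a \<bullet> b = 0"
  shows "hausdorff_measure 2 (trapezoid c a b I p q p' q')
    = ennreal (plane_const * (r * ((p' - p) * (s'\<^sup>2 - s\<^sup>2) / 2 + (q' - q) * (s' - s))))"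
proof -
  define J where "J = (\<lambda>x. x / r) -` I"
  define B where "B = {(x, y :: real). x \<in> J \<and> p / r * x + q < y \<and> y < p' / r * x + q'}"
  define f where "f z = c + (fst z / r) *\<^sub>R a + snd z *\<^sub>R b" for z :: plane
  have J [measurable]: "J \<in> sets borel"
    unfolding J_def using measurable_sets[of "\<lambda>x. x / r" borel borel I] I(1) by simp
  have J_sub: "{r * s<..<r * s'} \<subseteq> J" "J \<subseteq> {r * s..r * s'}"
    using I(2,3) \<open>0 < r\<close> by (fastforce simp: J_def field_simps subset_iff)+
  have rI: "x / r \<in> {s..s'}" if "x \<in> {r * s..r * s'}" for x
    using that \<open>0 < r\<close> by (simp add: field_simps)
  have "trapezoid c a b I p q p' q' = f ` B"
  proof (intro equalityI subsetI)
    fix x assume "x \<in> trapezoid c a b I p q p' q'"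
    then obtain s t where "x = c + s *\<^sub>R a + t *\<^sub>R b" "s \<in> I" "p * s + q < t" "t < p' * s + q'"
      unfolding trapezoid_def by blast
    then show "x \<in> f ` B" using \<open>0 < r\<close>
      by (intro image_eqI[of _ _ "(r * s, t)"]) (simp_all add: f_def B_def J_def)
  next
    fix x assume "x \<in> f ` B"
    then obtain s t where "x = f (s, t)" "(s, t) \<in> B" by auto
    then show "x \<in> trapezoid c a b I p q p' q'"
      unfolding trapezoid_def f_def B_def J_def
      by (intro CollectI exI[of _ "s / r"] exI[of _ t]) simp
  qed
  moreover have "hausdorff_measure 2 (f ` B) = hausdorff_measure 2 B"
  proof (rule hausdorff_measure_isometric_image)
    fix z w :: plane
    have "f z - f w = ((fst z - fst w) / r) *\<^sub>R a + (snd z - snd w) *\<^sub>R b"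
      by (simp add: f_def algebra_simps diff_divide_distrib)
    then have "(norm (f z - f w))\<^sup>2 = (norm (((fst z - fst w) / r) *\<^sub>R a))\<^sup>2 + (norm ((snd z - snd w) *\<^sub>R b))\<^sup>2"
      using ab by (simp only:) (rule norm_add_Pythagorean, simp add: orthogonal_def)
    also have "\<dots> = (fst z - fst w)\<^sup>2 + (snd z - snd w)\<^sup>2" using ab by (simp add: power_divide)
    finally show "dist (f z) (f w) = dist z w"
      by (simp add: dist_norm norm_prod_def real_sqrt_unique)
  qed
  moreover have "hausdorff_measure 2 B = ennreal plane_const * emeasure lborel B"
  proof (rule hausdorff_measure_plane)
    have "B = {z \<in> space borel. fst z \<in> J \<and> p / r * fst z + q < snd z \<and> snd z < p' / r * fst z + q'}"
      by (auto simp: B_def)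
    also have "\<dots> \<in> sets borel" unfolding borel_prod[symmetric] by measurable
    finally show "B \<in> sets borel" .
  qed
  moreover have "emeasure lborel B
      = ennreal ((p' / r - p / r) * ((r * s')\<^sup>2 - (r * s)\<^sup>2) / 2 + (q' - q) * (r * s' - r * s))"
    unfolding B_def
  proof (rule emeasure_planar_trapezoid[OF J J_sub])
    show "r * s \<le> r * s'" using \<open>s \<le> s'\<close> \<open>0 < r\<close> by simp
    show "p / r * x + q \<le> p' / r * x + q'" if "x \<in> {r * s..r * s'}" for x
      using le[OF rI[OF that]] by simp
  qed
  moreover have "(p' / r - p / r) * ((r * s')\<^sup>2 - (r * s)\<^sup>2) / 2 + (q' - q) * (r * s' - r * s)
      = r * ((p' - p) * (s'\<^sup>2 - s\<^sup>2) / 2 + (q' - q) * (s' - s))"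
    using \<open>0 < r\<close> by (simp add: field_simps power2_eq_square)
  ultimately show ?thesis using plane_const_pos by (simp add: ennreal_mult')
qed

section \<open>The profile of the lowered sheets\<close>

text \<open>The height of the competitor where the sheet had height \<open>t / sqrt 2\<close>: the sheet is lowered by the
  constant that flattens the cone up to \<open>t = 1\<close>, and the lowering fades out linearly on each of the
  dyadic intervals \<open>[2\<^sup>k, 2\<^sup>k\<^sup>+\<^sup>1]\<close>, \<open>k < N\<close>.  Spreading it over \<open>N\<close> scales makes the second order
  cost \<open>O(1 / N)\<close>.\<close>

definition ramp :: "nat \<Rightarrow> real \<Rightarrow> real" where
  "ramp N t = (max (t - 1) 0 + (\<Sum>k<N. max 0 (min 1 (t / 2 ^ k - 1))) / real N) / sqrt 2"

text \<open>The breakpoints 0, 1, 2, 4, ... of \<open>ramp\<close>. Piece 0 is the flat part, piece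
  \<open>Suc k\<close> is the interval from \<open>2 ^ k\<close> to \<open>2 ^ Suc k\<close>;
  \<open>slope\<close> and \<open>offset\<close> are the coefficients of the affine function on a
  piece.\<close>

definition node :: "nat \<Rightarrow> real" where
  "node j = (case j of 0 \<Rightarrow> 0 | Suc k \<Rightarrow> 2 ^ k)"

definition slope :: "nat \<Rightarrow> nat \<Rightarrow> real" where
  "slope N j = (case j of 0 \<Rightarrow> 0 | Suc k \<Rightarrow> (1 + 1 / (real N * 2 ^ k)) / sqrt 2)"

definition offset :: "nat \<Rightarrow> nat \<Rightarrow> real" where
  "offset N j = (case j of 0 \<Rightarrow> 0 | Suc k \<Rightarrow> ((real k - 1) / real N - 1) / sqrt 2)"

lemma node_Suc [simp]: "node (Suc j) = 2 ^ j" and node_0 [simp]: "node 0 = 0"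
  by (simp_all add: node_def)

lemma node_mono: "i \<le> j \<Longrightarrow> node i \<le> node j"
  by (cases i; cases j) simp_all

lemma ramp_nonneg: "0 \<le> ramp N t"
  unfolding ramp_def by (intro divide_nonneg_nonneg add_nonneg_nonneg sum_nonneg) auto

lemma clamp_eq_0: "u \<le> 1 \<Longrightarrow> max 0 (min 1 (u - 1)) = 0" for u :: real
  by (simp add: max_def min_def)

lemma ramp_eq_0:
  assumes "t \<le> 1"
  shows "ramp N t = 0"
proof -
  have "t / 2 ^ k \<le> 1" for k :: nat
    using order_trans[OF assms one_le_power[of "2::real" k]] by (subst pos_divide_le_eq) simp_all
  then have "max 0 (min 1 (t / 2 ^ k - 1)) = 0" for k :: nat
    by (rule clamp_eq_0)
  then show ?thesis using assms by (simp add: ramp_def)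
qed

lemma ramp_less:
  assumes "0 < N" "0 < t" "t < 2 ^ N"
  shows "ramp N t < t / sqrt 2"
proof (cases "t \<le> 1")
  case True
  then show ?thesis using assms by (simp add: ramp_eq_0)
next
  case False
  have "(\<Sum>k<N. max 0 (min 1 (t / 2 ^ k - 1))) < (\<Sum>k<N. 1)"
  proof (rule sum_strict_mono_ex1)
    \<comment> \<open>Before \<open>2 ^ N\<close> the summand of the last scale is not yet
      saturated, so some lowering remains.\<close>
    have "t / 2 ^ (N - 1) < 2"
      using assms by (simp add: field_simps power_Suc[symmetric] del: power_Suc)
    then show "\<exists>k\<in>{..<N}. max 0 (min 1 (t / 2 ^ k - 1)) < 1"
      using assms(1) by (intro bexI[of _ "N - 1"]) auto
  qed auto
  then have "(\<Sum>k<N. max 0 (min 1 (t / 2 ^ k - 1))) / real N < 1"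
    using assms(1) by simp
  then show ?thesis
    using False unfolding ramp_def by (intro divide_strict_right_mono) auto
qed

lemma ramp_eq_far:
  assumes "0 < N" "2 ^ N \<le> t"
  shows "ramp N t = t / sqrt 2"
proof -
  have t: "2 * 2 ^ k \<le> t" if "k < N" for k
    using order_trans[OF power_increasing[of "Suc k" N "2::real"] assms(2)] that by simp
  have "(\<Sum>k<N. max 0 (min 1 (t / 2 ^ k - 1))) = (\<Sum>k<N. 1)"
    using t by (intro sum.cong) (auto simp: min_def max_def field_simps)
  moreover have "1 \<le> t" using order_trans[OF one_le_power[of "2::real" N] assms(2)] by simp
  ultimately show ?thesis using assms(1) by (simp add: ramp_def)
qed

lemma ramp_le: "0 < N \<Longrightarrow> 0 \<le> t \<Longrightarrow> ramp N t \<le> t / sqrt 2"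
  using ramp_less[of N t] ramp_eq_far[of N t] ramp_eq_0[of 0 N]
  by (cases "t = 0"; cases "t < 2 ^ N") auto

text \<open>On a dyadic interval all summands of smaller scale have reached 1, those of larger scale
  are still 0, and only the one of that scale varies.\<close>

lemma ramp_piece:
  assumes N: "0 < N" and j: "j \<le> N" and t: "node j \<le> t" "t \<le> node (Suc j)"
  shows "ramp N t = slope N j * t + offset N j"
proof (cases j)
  case 0
  then show ?thesis using t by (simp add: ramp_eq_0 slope_def offset_def)
next
  case (Suc i)
  then have i: "i < N" "2 ^ i \<le> t" "t \<le> 2 * 2 ^ i" using j t by simp_all
  have "max 0 (min 1 (t / 2 ^ k - 1)) = (if k < i then 1 else 0) + (if k = i then t / 2 ^ i - 1 else 0)"
    for k
  proof -
    consider "k < i" | "k = i" | "i < k" by linarith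
    then show ?thesis
    proof cases
      case 1
      then have "2 * 2 ^ k \<le> t"
        using order_trans[OF power_increasing[of "Suc k" i "2::real"] i(2)] by simp
      then show ?thesis using 1 by (simp add: min_def max_def field_simps)
    next
      case 2
      then show ?thesis using i by (simp add: min_def max_def field_simps)
    next
      case 3
      then have "t \<le> 2 ^ k"
        using order_trans[OF i(3), of "2 ^ k"] power_increasing[of "Suc i" k "2::real"] by simp
      then have "t / 2 ^ k \<le> 1" by (subst pos_divide_le_eq) simp_all
      then show ?thesis using 3 by (simp only: clamp_eq_0) simp
    qed
  qed
  then have "(\<Sum>k<N. max 0 (min 1 (t / 2 ^ k - 1)))
      = (\<Sum>k<N. if k < i then 1 else 0) + (\<Sum>k<N. if k = i then t / 2 ^ i - 1 else 0)"
    by (simp only: sum.distrib)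
  also have "(\<Sum>k<N. if k < i then 1 else 0) = real (card ({..<N} \<inter> {k. k < i}))"
    by (simp add: sum.If_cases)
  also have "{..<N} \<inter> {k. k < i} = {..<i}" using i(1) by auto
  also have "(\<Sum>k<N. if k = i then t / 2 ^ i - 1 else 0) = t / 2 ^ i - 1" using i(1) by simp
  finally have "(\<Sum>k<N. max 0 (min 1 (t / 2 ^ k - 1))) = real i + (t / 2 ^ i - 1)" by simp
  moreover have "1 \<le> t" using order_trans[OF one_le_power[of "2::real" i] i(2)] by simp
  ultimately have "ramp N t = (t - 1 + (real i + (t / 2 ^ i - 1)) / real N) / sqrt 2"
    by (simp add: ramp_def)
  also have "\<dots> = slope N j * t + offset N j"
    using N by (simp add: Suc slope_def offset_def field_simps)
  finally show ?thesis .
qed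

section \<open>Lipschitz functions\<close>

definition lipschitz_fun :: "('a::metric_space \<Rightarrow> real) \<Rightarrow> bool" where
  "lipschitz_fun f \<longleftrightarrow> (\<exists>L. \<forall>x y. \<bar>f x - f y\<bar> \<le> L * dist x y)"

named_theorems lipschitz_fun_intros

lemma lipschitz_fun_const [lipschitz_fun_intros]: "lipschitz_fun (\<lambda>x. c)"
  unfolding lipschitz_fun_def by (intro exI[of _ 0]) simp

lemma lipschitz_fun_combine:
  fixes f g h :: "'a::metric_space \<Rightarrow> real"
  assumes "lipschitz_fun f" "lipschitz_fun g"
    and "\<And>x y. \<bar>h x - h y\<bar> \<le> \<bar>f x - f y\<bar> + \<bar>g x - g y\<bar>"
  shows "lipschitz_fun h"
proof -
  obtain K L where "\<And>x y. \<bar>f x - f y\<bar> \<le> K * dist x y" "\<And>x y. \<bar>g x - g y\<bar> \<le> L * dist x y"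
    using assms(1,2) unfolding lipschitz_fun_def by blast
  then have "\<bar>h x - h y\<bar> \<le> (K + L) * dist x y" for x y
    using assms(3)[of x y] by (smt (verit) distrib_right)
  then show ?thesis unfolding lipschitz_fun_def by blast
qed

lemma lipschitz_fun_add [lipschitz_fun_intros]:
  "lipschitz_fun f \<Longrightarrow> lipschitz_fun g \<Longrightarrow> lipschitz_fun (\<lambda>x. f x + g x)"
  by (erule (1) lipschitz_fun_combine) linarith

lemma lipschitz_fun_diff [lipschitz_fun_intros]:
  "lipschitz_fun f \<Longrightarrow> lipschitz_fun g \<Longrightarrow> lipschitz_fun (\<lambda>x. f x - g x)"
  by (erule (1) lipschitz_fun_combine) linarith

lemma lipschitz_fun_max [lipschitz_fun_intros]:
  "lipschitz_fun f \<Longrightarrow> lipschitz_fun g \<Longrightarrow> lipschitz_fun (\<lambda>x. max (f x) (g x))"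
  by (erule (1) lipschitz_fun_combine) linarith

lemma lipschitz_fun_min [lipschitz_fun_intros]:
  "lipschitz_fun f \<Longrightarrow> lipschitz_fun g \<Longrightarrow> lipschitz_fun (\<lambda>x. min (f x) (g x))"
  by (erule (1) lipschitz_fun_combine) linarith

lemma lipschitz_fun_divide [lipschitz_fun_intros]:
  assumes "lipschitz_fun f"
  shows "lipschitz_fun (\<lambda>x. f x / c)"
proof -
  obtain L where "\<And>x y. \<bar>f x - f y\<bar> \<le> L * dist x y"
    using assms unfolding lipschitz_fun_def by blast
  then have "\<bar>f x / c - f y / c\<bar> \<le> L / \<bar>c\<bar> * dist x y" for x y
    by (simp add: diff_divide_distrib[symmetric] divide_right_mono)
  then show ?thesis unfolding lipschitz_fun_def by blast
qed

lemma lipschitz_fun_sum [lipschitz_fun_intros]: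
  fixes f :: "nat \<Rightarrow> 'a::metric_space \<Rightarrow> real"
  shows "(\<And>i. lipschitz_fun (f i)) \<Longrightarrow> lipschitz_fun (\<lambda>x. \<Sum>i<n. f i x)"
  by (induction n) (simp_all add: lipschitz_fun_intros)

lemma lipschitz_fun_inner [lipschitz_fun_intros]: "lipschitz_fun (\<lambda>x. v \<bullet> x)" for v :: "'a::real_inner"
  unfolding lipschitz_fun_def
proof (intro exI allI)
  show "\<bar>v \<bullet> x - v \<bullet> y\<bar> \<le> norm v * dist x y" for x y
    using Cauchy_Schwarz_ineq2[of v "x - y"] by (simp add: inner_diff_right dist_norm)
qed

lemma lipschitz_fun_ramp [lipschitz_fun_intros]: "lipschitz_fun f \<Longrightarrow> lipschitz_fun (\<lambda>x. ramp N (f x))"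
  unfolding ramp_def by (intro lipschitz_fun_intros)

lemma lipschitz_fun_imp_lipschitz_on:
  fixes f :: "'a::metric_space \<Rightarrow> real"
  assumes "lipschitz_fun f"
  shows "\<exists>L. L-lipschitz_on S f"
proof -
  obtain L where L: "\<And>x y. \<bar>f x - f y\<bar> \<le> L * dist x y"
    using assms unfolding lipschitz_fun_def by blast
  have "\<bar>L\<bar>-lipschitz_on S f"
  proof (rule lipschitz_onI)
    fix x y :: 'a
    have "L * dist x y \<le> \<bar>L\<bar> * dist x y" by (intro mult_right_mono) auto
    then show "dist (f x) (f y) \<le> \<bar>L\<bar> * dist x y" using L[of x y] by (simp add: dist_real_def)
  qed simp
  then show ?thesis ..
qed

lemma lipschitz_on_add_scaled:
  fixes f :: "'a::real_normed_vector \<Rightarrow> real"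
  assumes "lipschitz_fun f"
  shows "\<exists>L. L-lipschitz_on S (\<lambda>x. x + f x *\<^sub>R v)"
proof -
  obtain L where L: "L-lipschitz_on S f" using lipschitz_fun_imp_lipschitz_on[OF assms] by blast
  have "(1 + L * norm v)-lipschitz_on S (\<lambda>x. x + f x *\<^sub>R v)"
  proof (rule lipschitz_onI)
    fix x y assume xy: "x \<in> S" "y \<in> S"
    have "(x + f x *\<^sub>R v) - (y + f y *\<^sub>R v) = (x - y) + (f x - f y) *\<^sub>R v" by (simp add: algebra_simps)
    then have "dist (x + f x *\<^sub>R v) (y + f y *\<^sub>R v) \<le> norm (x - y) + norm ((f x - f y) *\<^sub>R v)"
      unfolding dist_norm by (simp only: norm_triangle_ineq)
    also have "norm ((f x - f y) *\<^sub>R v) = \<bar>f x - f y\<bar> * norm v" by simp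
    also have "\<bar>f x - f y\<bar> * norm v \<le> L * dist x y * norm v"
      using lipschitz_onD[OF L xy] by (intro mult_right_mono) (simp_all add: dist_real_def)
    finally show "dist (x + f x *\<^sub>R v) (y + f y *\<^sub>R v) \<le> (1 + L * norm v) * dist x y"
      by (simp add: dist_norm algebra_simps)
  qed (use lipschitz_on_nonneg[OF L] in simp)
  then show ?thesis ..
qed

section \<open>The cone in coordinates adapted to its sheets\<close>

abbreviation up :: "real^3" where "up \<equiv> axis 3 1"

text \<open>The normalised horizontal parts of the three upper vertices. The vertical sheets stand
  over the rays in these directions; \<open>side_dir\<close> is the same vector turned by a right
  angle.\<close>

definition ridge_dir :: "nat \<Rightarrow> real^3" where
  "ridge_dir k = (if k = 1 then vector [1, 0, 0]
    else if k = 2 then vector [- 1 / 2, sqrt 3 / 2, 0] else vector [- 1 / 2, - sqrt 3 / 2, 0])"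

definition side_dir :: "nat \<Rightarrow> real^3" where
  "side_dir k = (if k = 1 then vector [0, 1, 0]
    else if k = 2 then vector [- sqrt 3 / 2, - 1 / 2, 0] else vector [sqrt 3 / 2, - 1 / 2, 0])"

text \<open>For \<open>k = 1, 2, 3\<close> the sheet opposite to the \<open>k\<close>-th ridge is the graph of \<open>out k / sqrt 2\<close> over the
  sector where \<open>out k\<close> is the largest of the three; the vertical sheets lie over the rays between the
  sectors.\<close>

definition out :: "nat \<Rightarrow> real^3 \<Rightarrow> real" where
  "out k x = - ridge_dir k \<bullet> x"

definition level :: "real^3 \<Rightarrow> real" where
  "level x = max (out 1 x) (max (out 2 x) (out 3 x))"

definition over_ridge :: "real^3 \<Rightarrow> bool" where
  "over_ridge x \<longleftrightarrow> out 1 x = level x \<and> out 2 x = level x \<or> out 1 x = level x \<and> out 3 x = level x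
    \<or> out 2 x = level x \<and> out 3 x = level x"

lemma out_1: "out 1 x = - x $ 1"
  and out_2: "out 2 x = x $ 1 / 2 - sqrt 3 / 2 * x $ 2"
  and out_3: "out 3 x = x $ 1 / 2 + sqrt 3 / 2 * x $ 2"
  by (simp_all add: out_def ridge_dir_def inner_vec_def sum_3)

lemmas out_eq = out_1 out_2 out_3

text \<open>With \<open>A k = out k x / sqrt 2\<close> and height \<open>z\<close>, the inner
  products are \<open>- z\<close> for vertex 0 and \<open>z / 3 - 4 / 3 * A k\<close> for the
  others. A tie with vertex 0 says that \<open>z\<close> is the maximum of the \<open>A k\<close>; a
  tie between two others says that both attain the maximum and that \<open>z\<close> does not exceed
  it.\<close>

lemma T_plus_level:
  "x \<in> T_plus \<longleftrightarrow> 0 \<le> x $ 3 \<and>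
    (x $ 3 = level x / sqrt 2 \<or> x $ 3 \<le> level x / sqrt 2 \<and> over_ridge x)"
proof -
  have ex4: "(\<exists>a<4::nat. P a) \<longleftrightarrow> P 0 \<or> P 1 \<or> P 2 \<or> P 3" for P
    using less_4_cases by metis
  have all4: "(\<forall>a<4::nat. P a) \<longleftrightarrow> P 0 \<and> P 1 \<and> P 2 \<and> P 3" for P
    using less_4_cases by metis
  define z where "z = x $ 3"
  define A where "A k = out k x / sqrt 2" for k
  have out: "out k x = sqrt 2 * A k" for k by (simp add: A_def)
  have s2: "sqrt 2 * sqrt 2 = (2::real)" "sqrt 2 * (sqrt 2 * t) = 2 * t" for t
    by (simp_all add: mult.assoc[symmetric])
  have s3: "sqrt (2/3) = sqrt 2 * sqrt 3 / 3"
    by (simp add: real_sqrt_divide field_simps)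
  have v0: "vtx 0 \<bullet> x = - z" by (simp add: vtx_def inner_vec_def sum_3 z_def)
  have v: "vtx k \<bullet> x = - (4 / 3) * A k + z / 3" if "k = 1 \<or> k = 2 \<or> k = 3" for k
    using that
    by (elim disjE) (simp_all add: vtx_def inner_vec_def sum_3 A_def z_def out_eq[simplified] s3 field_simps s2)
  have lev: "level x / sqrt 2 = max (A 1) (max (A 2) (A 3))"
    unfolding level_def A_def max_def by (simp add: divide_le_cancel)
  have ridge: "over_ridge x \<longleftrightarrow> (let m = max (A 1) (max (A 2) (A 3)) in
      A 1 = m \<and> A 2 = m \<or> A 1 = m \<and> A 3 = m \<or> A 2 = m \<and> A 3 = m)"
    unfolding lev[symmetric] over_ridge_def out Let_def by (simp add: field_simps s2)
  have c: "- z = - (4 / 3) * a + z / 3 \<longleftrightarrow> z = a" "- z \<le> - (4 / 3) * a + z / 3 \<longleftrightarrow> a \<le> z"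
    "- (4 / 3) * a + z / 3 = - z \<longleftrightarrow> z = a" "- (4 / 3) * a + z / 3 \<le> - z \<longleftrightarrow> z \<le> a"
    "- (4 / 3) * a + z / 3 = - (4 / 3) * b + z / 3 \<longleftrightarrow> a = b"
    "- (4 / 3) * a + z / 3 \<le> - (4 / 3) * b + z / 3 \<longleftrightarrow> b \<le> a" for a b
    by auto
  show ?thesis
    unfolding T_plus_eq mem_Collect_eq tie_def ex4 all4 lev ridge Let_def v0 z_def[symmetric]
    unfolding v[OF disjI1, OF refl] v[OF disjI2, OF disjI1, OF refl] v[OF disjI2, OF disjI2, OF refl] c
    unfolding max_def by (simp split: if_splits) argo
qed

lemma level_nonneg: "0 \<le> level x"
  unfolding level_def out_eq by linarith

lemma horizontal_shift: "out k (x + t *\<^sub>R up) = out k x" "level (x + t *\<^sub>R up) = level x"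
  "over_ridge (x + t *\<^sub>R up) = over_ridge x" "(x + t *\<^sub>R up) $ 3 = x $ 3 + t"
proof -
  have "ridge_dir k \<bullet> up = 0" for k by (simp add: ridge_dir_def inner_axis)
  then have out: "out k (x + t *\<^sub>R up) = out k x" for k by (simp add: out_def inner_add_right)
  then show "out k (x + t *\<^sub>R up) = out k x" "level (x + t *\<^sub>R up) = level x"
    "over_ridge (x + t *\<^sub>R up) = over_ridge x"
    by (simp_all only: level_def over_ridge_def)
  show "(x + t *\<^sub>R up) $ 3 = x $ 3 + t" by (simp add: axis_def)
qed

text \<open>Meant for \<open>\<bar>\<eta>\<bar> < sqrt 3 * \<xi>\<close>, the open sector of 120
  degrees around \<open>- ridge_dir k\<close> on which \<open>out k\<close> is strictly the largest
  of the three.\<close>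

definition off_ridge_point :: "nat \<Rightarrow> real \<Rightarrow> real \<Rightarrow> real \<Rightarrow> real^3" where
  "off_ridge_point k \<xi> \<eta> z = \<xi> *\<^sub>R - ridge_dir k + \<eta> *\<^sub>R side_dir k + z *\<^sub>R up"

text \<open>The factor 2 makes \<open>level\<close> equal to \<open>\<xi>\<close>: the other two
  directions form an angle of 120 degrees with \<open>ridge_dir k\<close>, so their
  \<open>out\<close> is half the distance from the axis.\<close>

definition ridge_point :: "nat \<Rightarrow> real \<Rightarrow> real \<Rightarrow> real^3" where
  "ridge_point k \<xi> z = (2 * \<xi>) *\<^sub>R ridge_dir k + z *\<^sub>R up"

lemma ridge_cases: "k \<in> {1..3::nat} \<longleftrightarrow> k = 1 \<or> k = 2 \<or> k = 3"
  by auto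

lemma off_ridge_point:
  fixes z :: real
  assumes k: "k \<in> {1..3}" and \<eta>: "\<bar>\<eta>\<bar> < sqrt 3 * \<xi>"
  defines "x \<equiv> off_ridge_point k \<xi> \<eta> z"
  shows "out k x = \<xi>" "level x = \<xi>" "\<not> over_ridge x" "x $ 3 = z"
proof -
  have s: "sqrt 3 * (sqrt 3 * t) = 3 * t" for t by (simp add: mult.assoc[symmetric])
  have "sqrt 3 * \<bar>\<eta>\<bar> < sqrt 3 * (sqrt 3 * \<xi>)" using \<eta> by (intro mult_strict_left_mono) simp_all
  then have \<eta>': "\<bar>sqrt 3 * \<eta>\<bar> < 3 * \<xi>" by (simp add: s abs_mult)
  show "x $ 3 = z" using k unfolding ridge_cases
    by (elim disjE) (simp_all add: x_def off_ridge_point_def ridge_dir_def side_dir_def axis_def)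
  have "out k x = \<xi> \<and> level x = \<xi> \<and> \<not> over_ridge x"
    using k \<eta>' unfolding ridge_cases over_ridge_def level_def out_eq
    by (elim disjE) (simp_all add: x_def off_ridge_point_def ridge_dir_def side_dir_def axis_def
        out_eq[simplified] algebra_simps s max_def, (auto simp: field_simps)?)
  then show "out k x = \<xi>" "level x = \<xi>" "\<not> over_ridge x" by auto
qed

lemma off_ridge_obtains:
  assumes "\<not> over_ridge x"
  obtains k \<eta> where "k \<in> {1..3}" "\<bar>\<eta>\<bar> < sqrt 3 * level x" "x = off_ridge_point k (level x) \<eta> (x $ 3)"
proof -
  have s: "sqrt 3 * (sqrt 3 * t) = 3 * t" for t by (simp add: mult.assoc[symmetric])
  define l where "l = level x"
  have le: "out 1 x \<le> l" "out 2 x \<le> l" "out 3 x \<le> l" and "out 1 x = l \<or> out 2 x = l \<or> out 3 x = l"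
    unfolding l_def level_def by linarith+
  moreover have "\<not> (out 1 x = l \<and> out 2 x = l)" "\<not> (out 1 x = l \<and> out 3 x = l)" "\<not> (out 2 x = l \<and> out 3 x = l)"
    using assms by (simp_all add: over_ridge_def l_def)
  ultimately have less: "\<exists>k\<in>{1..3}. out k x = l \<and> (\<forall>i. i = 1 \<or> i = 2 \<or> i = 3 \<longrightarrow> i \<noteq> k \<longrightarrow> out i x < l)"
    unfolding less_le by (elim disjE; (intro bexI[of _ 1] bexI[of _ 2] bexI[of _ 3])?) (metis | simp)+
  have "\<exists>k\<in>{1..3}. out k x = l \<and> (\<forall>i\<in>{1..3}. i \<noteq> k \<longrightarrow> out i x < l)"
    using less unfolding ridge_cases Ball_def .
  then obtain k where k: "k \<in> {1..3}" "out k x = l"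
    and less: "\<And>i. i \<in> {1..3} \<Longrightarrow> i \<noteq> k \<Longrightarrow> out i x < out k x" by auto
  define \<eta> where "\<eta> = side_dir k \<bullet> x"
  have "x = off_ridge_point k (out k x) \<eta> (x $ 3)"
    using k(1) unfolding ridge_cases
    by (elim disjE) (simp_all add: off_ridge_point_def ridge_dir_def side_dir_def axis_def out_eq[simplified]
        \<eta>_def vec_eq_iff forall_3 inner_vec_def sum_3 algebra_simps s)
  moreover have "sqrt 3 * \<eta> < 3 * out k x \<and> - (sqrt 3 * \<eta>) < 3 * out k x"
    using k(1) less[of 1] less[of 2] less[of 3] unfolding ridge_cases
    by (elim disjE) (simp_all add: \<eta>_def side_dir_def out_eq[simplified] inner_vec_def sum_3 algebra_simps s)
  then have "\<bar>sqrt 3 * \<eta>\<bar> < 3 * out k x" by linarith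
  then have "sqrt 3 * \<bar>\<eta>\<bar> < sqrt 3 * (sqrt 3 * out k x)" by (simp add: s abs_mult)
  then have "\<bar>\<eta>\<bar> < sqrt 3 * out k x" by (simp only: mult_less_cancel_left) simp
  ultimately show thesis using that[of k \<eta>] k by (simp add: l_def)
qed

lemma ridge_point:
  fixes z :: real
  assumes k: "k \<in> {1..3}" and "0 \<le> \<xi>"
  defines "x \<equiv> ridge_point k \<xi> z"
  shows "out k x = - 2 * \<xi>" "level x = \<xi>" "over_ridge x" "x $ 3 = z"
proof -
  have s: "sqrt 3 * (sqrt 3 * t) = 3 * t" for t by (simp add: mult.assoc[symmetric])
  show "x $ 3 = z" using k unfolding ridge_cases
    by (elim disjE) (simp_all add: x_def ridge_point_def ridge_dir_def axis_def)
  have "out k x = - 2 * \<xi> \<and> level x = \<xi> \<and> over_ridge x"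
    using k \<open>0 \<le> \<xi>\<close> unfolding ridge_cases over_ridge_def level_def out_eq
    by (elim disjE) (simp_all add: x_def ridge_point_def ridge_dir_def axis_def
        out_eq[simplified] algebra_simps s max_def)
  then show "out k x = - 2 * \<xi>" "level x = \<xi>" "over_ridge x" by auto
qed

section \<open>The pressed cone as a sliding competitor\<close>

lemma ramp_eq_0_iff: "ramp N t = 0 \<longleftrightarrow> t \<le> 1"
proof
  assume "ramp N t = 0"
  moreover have "(t - 1) / sqrt 2 \<le> ramp N t"
    unfolding ramp_def
    by (intro divide_right_mono order_trans[OF max.cobounded1[of "t - 1" 0]])
      (simp_all add: divide_nonneg_nonneg sum_nonneg)
  ultimately have "(t - 1) / sqrt 2 \<le> 0" by simp
  then show "t \<le> 1" by (simp add: divide_le_0_iff)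
qed (rule ramp_eq_0)

lemma T_plus_le_level: "x \<in> T_plus \<Longrightarrow> 0 \<le> x $ 3 \<and> x $ 3 \<le> level x / sqrt 2"
  by (auto simp: T_plus_level)

text \<open>\<open>level\<close> vanishes only on the vertical axis, so together with the height it
  controls the norm. The constants are crude; they serve to confine the moved points to a
  ball.\<close>

lemma norm_le_level: "norm x \<le> 5 * level x + \<bar>x $ 3\<bar>"
proof -
  have le: "out k x \<le> level x" if "k \<in> {1..3}" for k
    using that unfolding ridge_cases level_def by (elim disjE) simp_all
  have out: "- x $ 1 \<le> level x" "x $ 1 / 2 - sqrt 3 / 2 * x $ 2 \<le> level x" "x $ 1 / 2 + sqrt 3 / 2 * x $ 2 \<le> level x"
    using le[of 1] le[of 2] le[of 3] by (simp_all add: out_eq[simplified])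
  have "1 * \<bar>x $ 2\<bar> \<le> sqrt 3 * \<bar>x $ 2\<bar>" by (intro mult_right_mono) simp_all
  also have "\<dots> = \<bar>sqrt 3 * x $ 2\<bar>" by (simp add: abs_mult)
  also have "\<dots> \<le> 3 * level x" using out by linarith
  finally have "\<bar>x $ 2\<bar> \<le> 3 * level x" by simp
  moreover have "\<bar>x $ 1\<bar> \<le> 2 * level x" using out level_nonneg[of x] by linarith
  ultimately show ?thesis using norm_le_l1_cart[of x] by (simp add: sum_3)
qed

lemma lipschitz_fun_level [lipschitz_fun_intros]: "lipschitz_fun level"
  unfolding level_def out_def by (intro lipschitz_fun_intros)

lemma lipschitz_fun_height [lipschitz_fun_intros]: "lipschitz_fun (\<lambda>x::real^3. x $ 3)"
  using lipschitz_fun_inner[of up] by (simp add: inner_axis inner_commute)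

text \<open>The minimum treats both kinds of sheets at once: a slanted sheet, at height
  \<open>level x / sqrt 2\<close>, drops onto the ramp, and of a vertical sheet only the part above
  the ramp moves.\<close>

definition descent :: "nat \<Rightarrow> real^3 \<Rightarrow> real" where
  "descent N x = min (x $ 3) (ramp N (level x)) - x $ 3"

definition press :: "nat \<Rightarrow> real^3 \<Rightarrow> real^3" where
  "press N x = x + descent N x *\<^sub>R up"

lemma lipschitz_fun_descent: "lipschitz_fun (descent N)"
  unfolding descent_def by (intro lipschitz_fun_intros)

lemma press: "level (press N x) = level x" "over_ridge (press N x) = over_ridge x"
  "press N x $ 3 = min (x $ 3) (ramp N (level x))"
  unfolding press_def horizontal_shift by (simp_all add: descent_def)

lemma descent_bounds: "0 \<le> x $ 3 \<Longrightarrow> - x $ 3 \<le> descent N x" "descent N x \<le> 0"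
  using ramp_nonneg[of N "level x"] by (simp_all add: descent_def)

lemma level_less_of_descent:
  assumes "0 < N" "x \<in> T_plus" "descent N x \<noteq> 0"
  shows "level x < 2 ^ N"
proof (rule ccontr)
  assume "\<not> level x < 2 ^ N"
  then have "ramp N (level x) = level x / sqrt 2" using ramp_eq_far[OF assms(1)] by simp
  then show False using assms T_plus_le_level[of x] by (simp add: descent_def)
qed

lemma sliding_competitor_press:
  assumes N: "0 < N"
  shows "sliding_competitor T_plus (press N ` T_plus)"
proof -
  let ?\<phi> = "\<lambda>t x. x + (t * descent N x) *\<^sub>R up"
  have "\<exists>L. L-lipschitz_on T_plus (?\<phi> 1)"
    using lipschitz_on_add_scaled[OF lipschitz_fun_descent] by simp
  then obtain L where L: "L-lipschitz_on T_plus (?\<phi> 1)" ..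
  show ?thesis
    unfolding sliding_competitor_def Let_def
  proof (intro exI conjI)
    have "continuous_on S (descent N)" for S
      using lipschitz_fun_imp_lipschitz_on[OF lipschitz_fun_descent] lipschitz_on_continuous_on by blast
    then have "continuous_on ({0..1::real} \<times> T_plus) (\<lambda>z. descent N (snd z))"
      by (rule continuous_on_compose2) (auto intro: continuous_on_snd continuous_on_id)
    then show "continuous_on ({0..1} \<times> T_plus) (\<lambda>(t, x). ?\<phi> t x)"
      unfolding case_prod_beta by (intro continuous_intros)
    show "\<forall>x\<in>T_plus. ?\<phi> 0 x = x" by simp
    show "press N ` T_plus = ?\<phi> 1 ` T_plus" by (simp add: press_def)
    show "L-lipschitz_on T_plus (?\<phi> 1)" by (rule L)
    \<comment> \<open>By \<open>norm_le_level\<close> the horizontal part contributes at most 5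
      times the level of a moved point, and the height at most once more; that level is below
      \<open>2 ^ N\<close>.\<close>
    show "compact (cball (0::real^3) (6 * 2 ^ N))" by simp
    have height: "0 \<le> ?\<phi> t x $ 3 \<and> ?\<phi> t x $ 3 \<le> x $ 3" if "x \<in> T_plus" "t \<in> {0..1}" for x t
    proof -
      have "t * - descent N x \<le> 1 * - descent N x" "0 \<le> t * - descent N x"
        using that descent_bounds(2)[of N x] by (intro mult_right_mono mult_nonneg_nonneg; simp)+
      moreover have "- x $ 3 \<le> descent N x" using T_plus_le_level[OF that(1)] by (intro descent_bounds) simp
      ultimately show ?thesis unfolding horizontal_shift by simp
    qed
    show "(\<lambda>(t, x). ?\<phi> t x) ` ({0..1} \<times> (\<Union>t\<in>{0..1}. {x \<in> T_plus. ?\<phi> t x \<noteq> x})) \<subseteq> cball 0 (6 * 2 ^ N)"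
    proof clarify
      fix t s :: real and x assume ts: "t \<in> {0..1}" and x: "x \<in> T_plus" "?\<phi> s x \<noteq> x"
      then have "descent N x \<noteq> 0" by auto
      then have "level x < 2 ^ N" by (rule level_less_of_descent[OF N x(1)])
      moreover have "level x / sqrt 2 \<le> level x" using level_nonneg[of x] by (simp add: divide_le_eq mult_right_le_one_le mult_le_cancel_left1)
      moreover have "norm (?\<phi> t x) \<le> 5 * level x + \<bar>?\<phi> t x $ 3\<bar>"
        using norm_le_level[of "?\<phi> t x"] unfolding horizontal_shift .
      ultimately have "norm (?\<phi> t x) \<le> 6 * 2 ^ N"
        using height[OF x(1) ts] T_plus_le_level[OF x(1)] by linarith
      then show "?\<phi> t x \<in> cball 0 (6 * 2 ^ N)" by simp
    qed
    show "\<forall>t\<in>{0..1}. (\<forall>x\<in>T_plus. ?\<phi> t x \<in> half_space) \<and> (\<forall>x\<in>T_plus \<inter> sliding_boundary. ?\<phi> t x \<in> sliding_boundary)"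
    proof (intro ballI conjI)
      show "?\<phi> t x \<in> half_space" if "t \<in> {0..1}" "x \<in> T_plus" for t x
        using height[OF that(2,1)] by (simp add: half_space_def)
      show "?\<phi> t x \<in> sliding_boundary" if "t \<in> {0..1}" "x \<in> T_plus \<inter> sliding_boundary" for t x
      proof -
        have "x \<in> T_plus" "x $ 3 = 0" using that(2) by (auto simp: sliding_boundary_def)
        then show ?thesis
          unfolding sliding_boundary_def mem_Collect_eq using height[of x t] that(1) by linarith
      qed
    qed
  qed
qed

lemma press_image_le: "y \<in> press N ` T_plus \<Longrightarrow> y $ 3 \<le> ramp N (level y)"
  by (auto simp: press)

text \<open>Vertical sheets only lose points, as what is pressed there stays over the ridge and
  below the cone. New points therefore come from the slanted sheets, and only from levels that the
  ramp has lowered.\<close>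

lemma press_image_diff:
  assumes N: "0 < N" and y: "y \<in> press N ` T_plus - T_plus"
  shows "\<not> over_ridge y \<and> y $ 3 = ramp N (level y) \<and> level y \<le> 2 ^ N"
proof -
  obtain x where x: "x \<in> T_plus" "y = press N x" using y by blast
  then have not: "press N x \<notin> T_plus" and h: "0 \<le> x $ 3" "x $ 3 \<le> level x / sqrt 2"
    using y T_plus_le_level[of x] by auto
  have le: "ramp N (level x) \<le> level x / sqrt 2" by (rule ramp_le[OF N level_nonneg])
  have "\<not> over_ridge x"
    using not h le ramp_nonneg[of N "level x"] unfolding T_plus_level[of "press N x"] press by auto
  moreover from this have "x $ 3 = level x / sqrt 2" using x(1) by (simp add: T_plus_level)
  moreover have "level x < 2 ^ N"
  proof (rule level_less_of_descent[OF N x(1)])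
    show "descent N x \<noteq> 0" using not x(1) by (auto simp: press_def)
  qed
  ultimately show ?thesis using le by (simp add: x(2) press)
qed

section \<open>The pieces added and removed by pressing\<close>

lemma ridge_dir_orthonormal:
  "norm (ridge_dir k) = 1" "norm (side_dir k) = 1" "ridge_dir k \<bullet> side_dir k = 0"
  "ridge_dir k \<bullet> up = 0" "side_dir k \<bullet> up = 0"
  by (simp_all add: ridge_dir_def side_dir_def norm_eq_sqrt_inner inner_vec_def sum_3 inner_axis axis_def)

lemma norm_inclined: "norm (s *\<^sub>R up - ridge_dir k) = sqrt (1 + s\<^sup>2)"
proof -
  have "ridge_dir k \<bullet> ridge_dir k = 1" by (simp add: dot_square_norm ridge_dir_orthonormal)
  then show ?thesis
    by (simp add: norm_eq_sqrt_inner inner_diff_left inner_diff_right ridge_dir_orthonormal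
        inner_commute[of up "ridge_dir k"] power2_eq_square)
qed

text \<open>The competitor gains the strips, the strip \<open>j = 0\<close> being a third of the triangle in \<open>\<Gamma>\<close>; it loses
  the faces and, in the vertical sheets, the gaps below them.\<close>

definition strip :: "nat \<Rightarrow> nat \<Rightarrow> nat \<Rightarrow> (real^3) set" where
  "strip N k j = trapezoid (offset N j *\<^sub>R up) (slope N j *\<^sub>R up - ridge_dir k) (side_dir k)
    {node j..node (Suc j)} (- sqrt 3) 0 (sqrt 3) 0"

definition face :: "nat \<Rightarrow> nat \<Rightarrow> (real^3) set" where
  "face N k = trapezoid 0 ((1 / sqrt 2) *\<^sub>R up - ridge_dir k) (side_dir k) {0..<2 ^ N} (- sqrt 3) 0 (sqrt 3) 0"

definition gap :: "nat \<Rightarrow> nat \<Rightarrow> nat \<Rightarrow> (real^3) set" where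
  "gap N k j = trapezoid 0 (2 *\<^sub>R ridge_dir k) up {node j..<node (Suc j)} (slope N j) (offset N j) (1 / sqrt 2) 0"

lemma stripI:
  assumes "node j \<le> \<xi>" "\<xi> \<le> node (Suc j)" "\<bar>\<eta>\<bar> < sqrt 3 * \<xi>"
  shows "off_ridge_point k \<xi> \<eta> (slope N j * \<xi> + offset N j) \<in> strip N k j"
  unfolding strip_def trapezoid_def
  using assms by (intro CollectI exI[of _ \<xi>] exI[of _ \<eta>]) (auto simp: off_ridge_point_def algebra_simps)

lemma faceE:
  assumes "x \<in> face N k"
  obtains \<xi> \<eta> where "0 < \<xi>" "\<xi> < 2 ^ N" "\<bar>\<eta>\<bar> < sqrt 3 * \<xi>" "x = off_ridge_point k \<xi> \<eta> (\<xi> / sqrt 2)"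
proof -
  obtain \<xi> \<eta> where 1: "x = \<xi> *\<^sub>R ((1 / sqrt 2) *\<^sub>R up - ridge_dir k) + \<eta> *\<^sub>R side_dir k"
    "\<xi> \<in> {0..<2 ^ N}" "- sqrt 3 * \<xi> < \<eta>" "\<eta> < sqrt 3 * \<xi>"
    using assms unfolding face_def trapezoid_def by auto
  have \<eta>: "\<bar>\<eta>\<bar> < sqrt 3 * \<xi>" using 1 by (simp add: abs_less_iff)
  then have "0 < sqrt 3 * \<xi>" by (rule order_le_less_trans[OF abs_ge_zero])
  then have "0 < \<xi>" by (simp add: zero_less_mult_iff)
  then show thesis using that[of \<xi> \<eta>] 1 \<eta> by (simp add: off_ridge_point_def algebra_simps)
qed

lemma gapE:
  assumes "x \<in> gap N k j"
  obtains \<xi> z where "node j \<le> \<xi>" "\<xi> < node (Suc j)" "slope N j * \<xi> + offset N j < z" "z < \<xi> / sqrt 2"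
    "x = ridge_point k \<xi> z"
proof -
  obtain \<xi> z where "x = 0 + \<xi> *\<^sub>R (2 *\<^sub>R ridge_dir k) + z *\<^sub>R up" "\<xi> \<in> {node j..<node (Suc j)}"
    "slope N j * \<xi> + offset N j < z" "z < 1 / sqrt 2 * \<xi> + 0"
    using assms unfolding gap_def trapezoid_def by blast
  then show thesis using that[of \<xi> z] by (simp add: ridge_point_def mult.commute)
qed

lemma face_properties:
  assumes N: "0 < N" and k: "k \<in> {1..3}" and x: "x \<in> face N k"
  shows "x \<in> T_plus - press N ` T_plus - sliding_boundary" "out k x = level x" "\<not> over_ridge x"
proof -
  obtain \<xi> \<eta> where *: "0 < \<xi>" "\<xi> < 2 ^ N" "\<bar>\<eta>\<bar> < sqrt 3 * \<xi>" "x = off_ridge_point k \<xi> \<eta> (\<xi> / sqrt 2)"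
    using x by (rule faceE)
  note p = off_ridge_point[OF k *(3), of "\<xi> / sqrt 2", folded *(4)]
  show "out k x = level x" "\<not> over_ridge x" using p by simp_all
  have "x \<in> T_plus" "x \<notin> sliding_boundary"
    using p *(1) by (simp_all add: T_plus_level sliding_boundary_def)
  moreover have "x \<notin> press N ` T_plus"
    using press_image_le[of x N] ramp_less[OF N *(1,2)] p by auto
  ultimately show "x \<in> T_plus - press N ` T_plus - sliding_boundary" by simp
qed

lemma gap_properties:
  assumes N: "0 < N" and k: "k \<in> {1..3}" and j: "j \<le> N" and x: "x \<in> gap N k j"
  shows "x \<in> T_plus - press N ` T_plus - sliding_boundary" "out k x = - 2 * level x" "over_ridge x"
    "0 < level x" "level x \<in> {node j..<node (Suc j)}"
proof -
  obtain \<xi> z where *: "node j \<le> \<xi>" "\<xi> < node (Suc j)" "slope N j * \<xi> + offset N j < z" "z < \<xi> / sqrt 2"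
    "x = ridge_point k \<xi> z"
    using x by (rule gapE)
  have z: "ramp N \<xi> < z" using ramp_piece[OF N j *(1) less_imp_le[OF *(2)]] *(3) by simp
  then have "0 < z" using ramp_nonneg[of N \<xi>] by linarith
  then have "0 < \<xi> / sqrt 2" using *(4) by linarith
  then have \<xi>: "0 < \<xi>" by (simp add: zero_less_divide_iff)
  note p = ridge_point[OF k less_imp_le[OF \<xi>], of z, folded *(5)]
  show "out k x = - 2 * level x" "over_ridge x" "0 < level x" "level x \<in> {node j..<node (Suc j)}"
    using p \<xi> * by simp_all
  have "x \<in> T_plus" "x \<notin> sliding_boundary"
    using p \<open>0 < z\<close> *(4) by (simp_all add: T_plus_level sliding_boundary_def)
  moreover have "x \<notin> press N ` T_plus"
    using press_image_le[of x N] z p by auto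
  ultimately show "x \<in> T_plus - press N ` T_plus - sliding_boundary" by simp
qed

lemma dyadic_interval:
  fixes t :: real
  assumes "1 < t" "t \<le> 2 ^ N"
  shows "\<exists>i<N. 2 ^ i \<le> t \<and> t \<le> 2 ^ Suc i"
  using assms
proof (induction N)
  case (Suc N)
  show ?case
  proof (cases "t \<le> 2 ^ N")
    case True
    then show ?thesis using Suc less_SucI by blast
  next
    case False
    then show ?thesis using Suc.prems by (intro exI[of _ N]) simp
  qed
qed simp

text \<open>For what is added an upper bound suffices, so covering by strips that share boundary
  lines is enough. The removed set needs a lower bound, hence disjoint faces and gaps.\<close>

lemma press_image_diff_subset:
  assumes N: "0 < N"
  defines "D \<equiv> press N ` T_plus - T_plus"
  shows "D \<inter> sliding_boundary \<subseteq> (\<Union>k\<in>{1..3}. strip N k 0)"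
    and "D - sliding_boundary \<subseteq> (\<Union>k\<in>{1..3}. \<Union>j\<in>{1..N}. strip N k j)"
proof -
  have piece: "y \<in> (\<Union>k\<in>{1..3}. strip N k j)"
    if y: "y \<in> D" and j: "node j \<le> level y" "level y \<le> node (Suc j)" "j \<le> N" for y j
  proof -
    have *: "\<not> over_ridge y" "y $ 3 = ramp N (level y)"
      using press_image_diff[OF N, of y] y by (simp_all add: D_def)
    obtain k \<eta> where k: "k \<in> {1..3}" "\<bar>\<eta>\<bar> < sqrt 3 * level y" "y = off_ridge_point k (level y) \<eta> (y $ 3)"
      using *(1) by (rule off_ridge_obtains)
    have "y $ 3 = slope N j * level y + offset N j" using ramp_piece[OF N j(3,1,2)] *(2) by simp
    then have "y \<in> strip N k j" using stripI[OF j(1,2) k(2), of k N] k(3) by simp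
    then show ?thesis using k(1) by blast
  qed
  show "D \<inter> sliding_boundary \<subseteq> (\<Union>k\<in>{1..3}. strip N k 0)"
  proof
    fix y assume y: "y \<in> D \<inter> sliding_boundary"
    then have "ramp N (level y) = 0"
      using press_image_diff[OF N, of y] by (simp add: D_def sliding_boundary_def)
    then show "y \<in> (\<Union>k\<in>{1..3}. strip N k 0)"
      using y level_nonneg[of y] by (intro piece) (simp_all add: ramp_eq_0_iff)
  qed
  show "D - sliding_boundary \<subseteq> (\<Union>k\<in>{1..3}. \<Union>j\<in>{1..N}. strip N k j)"
  proof
    fix y assume y: "y \<in> D - sliding_boundary"
    have l: "1 < level y" "level y \<le> 2 ^ N"
      using y press_image_diff[OF N, of y] ramp_eq_0[of "level y" N]
      by (force simp: D_def sliding_boundary_def)+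
    have "\<exists>i<N. 2 ^ i \<le> level y \<and> level y \<le> 2 ^ Suc i"
      using l N by (intro dyadic_interval) simp_all
    then obtain i where "i < N" "2 ^ i \<le> level y" "level y \<le> 2 ^ Suc i" by blast
    then show "y \<in> (\<Union>k\<in>{1..3}. \<Union>j\<in>{1..N}. strip N k j)"
      using piece[of y "Suc i"] y by fastforce
  qed
qed

section \<open>Areas of the pieces\<close>

definition strip_area :: "nat \<Rightarrow> nat \<Rightarrow> real" where
  "strip_area N j = sqrt (1 + (slope N j)\<^sup>2) * (sqrt 3 * ((node (Suc j))\<^sup>2 - (node j)\<^sup>2))"

definition face_area :: "nat \<Rightarrow> real" where
  "face_area N = 3 / sqrt 2 * 4 ^ N"

definition gap_area :: "nat \<Rightarrow> nat \<Rightarrow> real" where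
  "gap_area N j = (1 / sqrt 2 - slope N j) * ((node (Suc j))\<^sup>2 - (node j)\<^sup>2)
    - 2 * offset N j * (node (Suc j) - node j)"

lemma node_nonneg: "0 \<le> node j"
  using node_mono[of 0 j] by simp

lemma hausdorff_measure_strip:
  "hausdorff_measure 2 (strip N k j) = ennreal (plane_const * strip_area N j)"
proof -
  have "hausdorff_measure 2 (strip N k j) = ennreal (plane_const * (sqrt (1 + (slope N j)\<^sup>2)
      * ((sqrt 3 - - sqrt 3) * ((node (Suc j))\<^sup>2 - (node j)\<^sup>2) / 2 + (0 - 0) * (node (Suc j) - node j))))"
    unfolding strip_def
  proof (rule hausdorff_measure_trapezoid)
    show "node j \<le> node (Suc j)" by (rule node_mono) simp
    show "norm (slope N j *\<^sub>R up - ridge_dir k) = sqrt (1 + (slope N j)\<^sup>2)" by (rule norm_inclined)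
    show "0 < sqrt (1 + (slope N j)\<^sup>2)" by (simp add: add_pos_nonneg)
    fix x assume "x \<in> {node j..node (Suc j)}"
    then have "0 \<le> x" using node_nonneg[of j] by (simp del: node_Suc)
    then show "- sqrt 3 * x + 0 \<le> sqrt 3 * x + 0" by simp
  qed (auto simp: ridge_dir_orthonormal inner_diff_left inner_commute[of up "side_dir k"] simp del: node_Suc)
  then show ?thesis by (simp add: strip_area_def del: node_Suc)
qed

lemma hausdorff_measure_face: "hausdorff_measure 2 (face N k) = ennreal (plane_const * face_area N)"
proof -
  have "hausdorff_measure 2 (face N k) = ennreal (plane_const * (sqrt (1 + (1 / sqrt 2)\<^sup>2)
      * ((sqrt 3 - - sqrt 3) * ((2 ^ N)\<^sup>2 - 0\<^sup>2) / 2 + (0 - 0) * (2 ^ N - 0))))"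
    unfolding face_def
  proof (rule hausdorff_measure_trapezoid)
    show "norm ((1 / sqrt 2) *\<^sub>R up - ridge_dir k) = sqrt (1 + (1 / sqrt 2)\<^sup>2)" by (rule norm_inclined)
    show "0 < sqrt (1 + (1 / sqrt 2)\<^sup>2)" by (simp add: add_pos_nonneg)
    show "- sqrt 3 * x + 0 \<le> sqrt 3 * x + 0" if "x \<in> {0..2 ^ N}" for x using that by simp
  qed (auto simp: ridge_dir_orthonormal inner_diff_left inner_commute[of up "side_dir k"])
  also have "sqrt (1 + (1 / sqrt 2)\<^sup>2) * ((sqrt 3 - - sqrt 3) * ((2 ^ N)\<^sup>2 - 0\<^sup>2) / 2 + (0 - 0) * (2 ^ N - 0))
      = (sqrt (1 + (1 / sqrt 2)\<^sup>2) * sqrt 3) * (2 ^ N)\<^sup>2"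
    by simp
  \<comment> \<open>The inclination factor \<open>sqrt (3 / 2)\<close> of the original sheet times
    \<open>sqrt 3\<close> from the opening of the sector.\<close>
  also have "sqrt (1 + (1 / sqrt 2)\<^sup>2) * sqrt 3 = 3 / sqrt 2"
    by (rule power2_eq_imp_eq) (simp_all add: power_mult_distrib power_divide)
  also have "3 / sqrt 2 * (2 ^ N)\<^sup>2 = face_area N"
    by (simp add: face_area_def power2_eq_square power_mult_distrib[symmetric])
  finally show ?thesis .
qed

lemma hausdorff_measure_gap:
  assumes "0 < N" "j \<le> N"
  shows "hausdorff_measure 2 (gap N k j) = ennreal (plane_const * gap_area N j)"
proof -
  have "hausdorff_measure 2 (gap N k j) = ennreal (plane_const * (2
      * ((1 / sqrt 2 - slope N j) * ((node (Suc j))\<^sup>2 - (node j)\<^sup>2) / 2 + (0 - offset N j) * (node (Suc j) - node j))))"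
    unfolding gap_def
  proof (rule hausdorff_measure_trapezoid)
    show "node j \<le> node (Suc j)" by (rule node_mono) simp
    fix x assume x: "x \<in> {node j..node (Suc j)}"
    then have "0 \<le> x" using node_nonneg[of j] by (simp del: node_Suc)
    then show "slope N j * x + offset N j \<le> 1 / sqrt 2 * x + 0"
      using ramp_le[OF assms(1), of x] ramp_piece[OF assms, of x] x by (simp del: node_Suc)
  qed (auto simp: ridge_dir_orthonormal simp del: node_Suc)
  also have "2 * ((1 / sqrt 2 - slope N j) * ((node (Suc j))\<^sup>2 - (node j)\<^sup>2) / 2
      + (0 - offset N j) * (node (Suc j) - node j)) = gap_area N j"
    unfolding gap_area_def by (simp add: distrib_left del: node_Suc)
  finally show ?thesis .
qed

lemma ennreal_max_0: "ennreal (max 0 x) = ennreal x"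
  by (cases "0 \<le> x") (auto simp: ennreal_neg max_def)

text \<open>Negative numbers are truncated to 0 by \<open>ennreal\<close>, so no signs have to be
  assumed. This spares a separate proof that the gap areas are nonnegative.\<close>

lemma ennreal_add_le: "ennreal (x + y) \<le> ennreal x + ennreal y"
proof -
  have "ennreal (x + y) \<le> ennreal (max 0 x + max 0 y)" by (intro ennreal_leI) auto
  also have "\<dots> = ennreal x + ennreal y" by (simp add: ennreal_plus ennreal_max_0)
  finally show ?thesis .
qed

lemma ennreal_sum_le: "ennreal (\<Sum>i\<in>I. f i) \<le> (\<Sum>i\<in>I. ennreal (f i))"
proof (cases "finite I")
  case True
  then show ?thesis
  proof induction
    case (insert i I)
    then show ?case by (simp add: order_trans[OF ennreal_add_le add_left_mono])
  qed simp
qed simp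

lemma face_gap_borel [measurable]: "face N k \<in> sets borel" "gap N k j \<in> sets borel"
proof -
  have "(1 / sqrt 2) *\<^sub>R up - ridge_dir k \<noteq> 0"
    using norm_inclined[of "1 / sqrt 2" k] by (auto simp: add_nonneg_eq_0_iff)
  then show "face N k \<in> sets borel"
    unfolding face_def using ridge_dir_orthonormal[of k]
    by (intro trapezoid_borel) (auto simp: inner_diff_left inner_commute[of up "side_dir k"])
  show "gap N k j \<in> sets borel"
    unfolding gap_def using ridge_dir_orthonormal[of k] by (intro trapezoid_borel) auto
qed

lemma removed_measure_ge:
  assumes N: "0 < N"
  shows "ennreal (3 * plane_const * (face_area N + (\<Sum>j\<le>N. gap_area N j)))
    \<le> hausdorff_measure 2 (T_plus - press N ` T_plus - sliding_boundary)"
proof -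
  let ?H = "emeasure (hausdorff 2) :: (real^3) set \<Rightarrow> ennreal"
  let ?C = plane_const
  define G where "G k = (\<Union>j\<le>N. gap N k j)" for k
  have G [measurable]: "G k \<in> sets borel" for k unfolding G_def by measurable
  have HG_eq: "?H (G k) = (\<Sum>j\<le>N. ?H (gap N k j))" if k: "k \<in> {1..3}" for k
    unfolding G_def
  proof (rule sum_emeasure[symmetric])
    show "disjoint_family_on (gap N k) {..N}"
      unfolding disjoint_family_on_def
    proof (intro ballI impI equals0I)
      fix i j x assume ij: "i \<in> {..N}" "j \<in> {..N}" "i \<noteq> j" and x: "x \<in> gap N k i \<inter> gap N k j"
      have "level x \<in> {node i..<node (Suc i)}" "level x \<in> {node j..<node (Suc j)}"
        using gap_properties(5)[OF N k] ij x by (auto simp del: node_Suc)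
      then show False
        using ij node_mono[of "Suc i" j] node_mono[of "Suc j" i] by (cases "i < j") (simp_all del: node_Suc)
    qed
  qed auto
  have HG: "ennreal (?C * (\<Sum>j\<le>N. gap_area N j)) \<le> ?H (G k)" if "k \<in> {1..3}" for k
  proof -
    have "?H (G k) = (\<Sum>j\<le>N. ennreal (?C * gap_area N j))"
      unfolding HG_eq[OF that] by (intro sum.cong refl) (simp add: emeasure_hausdorff hausdorff_measure_gap[OF N])
    then show ?thesis using ennreal_sum_le[of "\<lambda>j. ?C * gap_area N j" "{..N}"] by (simp only: sum_distrib_left)
  qed
  have V: "ennreal (?C * (face_area N + (\<Sum>j\<le>N. gap_area N j))) \<le> ?H (face N k \<union> G k)" if k: "k \<in> {1..3}" for k
  proof -
    have "face N k \<inter> G k = {}"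
      using face_properties(3)[OF N k] gap_properties(3)[OF N k] by (fastforce simp: G_def)
    then have "?H (face N k \<union> G k) = ?H (face N k) + ?H (G k)" by (intro plus_emeasure[symmetric]) auto
    moreover have "ennreal (?C * face_area N + ?C * (\<Sum>j\<le>N. gap_area N j))
        \<le> ennreal (?C * face_area N) + ennreal (?C * (\<Sum>j\<le>N. gap_area N j))"
      by (rule ennreal_add_le)
    ultimately show ?thesis
      using HG[OF k] by (simp add: distrib_left emeasure_hausdorff hausdorff_measure_face order_trans[OF _ add_left_mono])
  qed
  have "ennreal (\<Sum>k\<in>{1..3::nat}. ?C * (face_area N + (\<Sum>j\<le>N. gap_area N j)))
      \<le> (\<Sum>k\<in>{1..3}. ?H (face N k \<union> G k))"
    by (rule order_trans[OF ennreal_sum_le sum_mono[OF V]])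
  also have "\<dots> = ?H (\<Union>k\<in>{1..3}. face N k \<union> G k)"
  proof (rule sum_emeasure)
    show "disjoint_family_on (\<lambda>k. face N k \<union> G k) {1..3}"
      unfolding disjoint_family_on_def
    proof (intro ballI impI equals0I)
      fix k l x assume kl: "k \<in> {1..3}" "l \<in> {1..3}" "k \<noteq> l" and x: "x \<in> (face N k \<union> G k) \<inter> (face N l \<union> G l)"
      \<comment> \<open>\<open>out\<close> identifies the index: on a face it is a maximum attained
        only once, and on a gap it is \<open>- 2 * level x\<close>. Two such values would force the
        third to be \<open>4 * level x\<close>, as the three sum to zero.\<close>
      have "\<not> over_ridge x \<and> out k x = level x \<and> out l x = level x
          \<or> over_ridge x \<and> 0 < level x \<and> out k x = - 2 * level x \<and> out l x = - 2 * level x"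
        using x face_properties(2,3)[OF N kl(1)] face_properties(2,3)[OF N kl(2)]
          gap_properties(2,3,4)[OF N kl(1)] gap_properties(2,3,4)[OF N kl(2)]
        unfolding G_def by blast
      then show False
      proof
        assume "\<not> over_ridge x \<and> out k x = level x \<and> out l x = level x"
        then show False using kl unfolding ridge_cases over_ridge_def by metis
      next
        assume *: "over_ridge x \<and> 0 < level x \<and> out k x = - 2 * level x \<and> out l x = - 2 * level x"
        have "out 1 x + out 2 x + out 3 x = 0" "out 1 x \<le> level x" "out 2 x \<le> level x" "out 3 x \<le> level x"
          unfolding level_def by (simp_all add: out_eq[simplified])
        then show False using * kl unfolding ridge_cases by (elim disjE) simp_all
      qed
    qed
  qed auto
  also have "\<dots> \<le> hausdorff_measure 2 (T_plus - press N ` T_plus - sliding_boundary)"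
  proof -
    have "(\<Union>k\<in>{1..3}. face N k \<union> G k) \<subseteq> T_plus - press N ` T_plus - sliding_boundary"
    proof (rule UN_least)
      fix k :: nat assume k: "k \<in> {1..3}"
      have "gap N k j \<subseteq> T_plus - press N ` T_plus - sliding_boundary" if "j \<le> N" for j
        by (rule subsetI) (rule gap_properties(1)[OF N k that])
      moreover have "face N k \<subseteq> T_plus - press N ` T_plus - sliding_boundary"
        by (rule subsetI) (rule face_properties(1)[OF N k])
      ultimately show "face N k \<union> G k \<subseteq> T_plus - press N ` T_plus - sliding_boundary"
        unfolding G_def by (intro Un_least UN_least) simp_all
    qed
    moreover have "(\<Union>k\<in>{1..3}. face N k \<union> G k) \<in> sets borel" by (intro sets.finite_UN sets.Un) auto
    ultimately show ?thesis by (simp add: emeasure_hausdorff hausdorff_measure_mono)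
  qed
  finally show ?thesis by (simp add: mult.assoc)
qed

lemma added_energy_le:
  assumes N: "0 < N" and \<alpha>: "0 \<le> \<alpha>"
  shows "sliding_energy \<alpha> (press N ` T_plus - T_plus)
    \<le> ennreal (3 * plane_const * ((\<Sum>j\<in>{1..N}. strip_area N j) + \<alpha> * strip_area N 0))"
proof -
  let ?D = "press N ` T_plus - T_plus" let ?C = plane_const
  have area: "0 \<le> ?C * strip_area N j" for j
    unfolding strip_area_def using plane_const_pos node_nonneg[of j] node_mono[of j "Suc j"]
    by (intro mult_nonneg_nonneg) (auto intro: power_mono simp del: node_Suc)
  have 1: "hausdorff_measure 2 (?D - sliding_boundary) \<le> ennreal (3 * ?C * (\<Sum>j\<in>{1..N}. strip_area N j))"
  proof -
    have "hausdorff_measure 2 (?D - sliding_boundary) \<le> (\<Sum>k\<in>{1..3}. \<Sum>j\<in>{1..N}. hausdorff_measure 2 (strip N k j))"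
      using press_image_diff_subset(2)[OF N]
      by (intro order_trans[OF hausdorff_measure_mono order_trans[OF hausdorff_measure_finite_UN_le
          sum_mono[OF hausdorff_measure_finite_UN_le]]]) auto
    also have "\<dots> = ennreal (\<Sum>k\<in>{1..3::nat}. \<Sum>j\<in>{1..N}. ?C * strip_area N j)"
      by (simp only: hausdorff_measure_strip sum_ennreal area sum_nonneg)
    finally show ?thesis by (simp add: sum_distrib_left mult.assoc)
  qed
  have 2: "hausdorff_measure 2 (?D \<inter> sliding_boundary) \<le> ennreal (3 * ?C * strip_area N 0)"
  proof -
    have "hausdorff_measure 2 (?D \<inter> sliding_boundary) \<le> (\<Sum>k\<in>{1..3}. hausdorff_measure 2 (strip N k 0))"
      using press_image_diff_subset(1)[OF N]
      by (intro order_trans[OF hausdorff_measure_mono hausdorff_measure_finite_UN_le]) auto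
    also have "\<dots> = ennreal (\<Sum>k\<in>{1..3::nat}. ?C * strip_area N 0)"
      by (simp only: hausdorff_measure_strip sum_ennreal area)
    finally show ?thesis by (simp add: mult.assoc)
  qed
  have "sliding_energy \<alpha> ?D
      \<le> ennreal (3 * ?C * (\<Sum>j\<in>{1..N}. strip_area N j)) + ennreal \<alpha> * ennreal (3 * ?C * strip_area N 0)"
    unfolding sliding_energy_def by (intro add_mono mult_left_mono 1 2) simp
  also have "\<dots> = ennreal (3 * ?C * (\<Sum>j\<in>{1..N}. strip_area N j) + \<alpha> * (3 * ?C * strip_area N 0))"
  proof -
    have "0 \<le> 3 * ?C * (\<Sum>j\<in>{1..N}. strip_area N j)" "0 \<le> 3 * ?C * strip_area N 0"
      using area sum_nonneg[of "{1..N}" "\<lambda>j. ?C * strip_area N j"] by (simp_all add: sum_distrib_left[symmetric] mult.assoc)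
    then show ?thesis using \<alpha> by (simp add: ennreal_plus ennreal_mult del: ennreal_plus[symmetric])
  qed
  finally show ?thesis by (simp add: algebra_simps)
qed

section \<open>First and second order cost of pressing\<close>

lemma strip_area_0: "strip_area N 0 = sqrt 3"
  by (simp add: strip_area_def slope_def)

text \<open>\<open>u\<close> is the relative excess of the slope over that of the cone. Its linear
  contribution \<open>3 * 2 ^ i / real N\<close> is compensated by the gaps later. The quadratic one
  is the same \<open>3 / (2 * (real N)\<^sup>2)\<close> on every dyadic piece, so all
  \<open>N\<close> pieces together cost only \<open>3 / (2 * real N)\<close>.\<close>

lemma strip_area_Suc_le:
  assumes "0 < N"
  shows "sqrt 2 * strip_area N (Suc i) \<le> 9 * 4 ^ i + 3 * 2 ^ i / real N + 3 / (2 * (real N)\<^sup>2)"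
proof -
  define u where "u = 1 / (real N * 2 ^ i)"
  have u: "0 \<le> u" by (simp add: u_def)
  have "sqrt 2 * sqrt 3 * sqrt (1 + ((1 + u) / sqrt 2)\<^sup>2) = sqrt (3 * (2 + (1 + u)\<^sup>2))"
    by (simp add: real_sqrt_mult[symmetric] power_divide algebra_simps)
  also have "\<dots> \<le> 3 + u + u\<^sup>2 / 2"
  proof (rule real_le_lsqrt)
    have "3 * (2 + (1 + u)\<^sup>2) + (u\<^sup>2 + u ^ 4 / 4 + u ^ 3) = (3 + u + u\<^sup>2 / 2)\<^sup>2"
      by (simp add: power2_eq_square power4_eq_xxxx power3_eq_cube field_simps)
    moreover have "0 \<le> u\<^sup>2 + u ^ 4 / 4 + u ^ 3" using u by simp
    ultimately show "3 * (2 + (1 + u)\<^sup>2) \<le> (3 + u + u\<^sup>2 / 2)\<^sup>2" by linarith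
  qed (use u in simp_all)
  finally have le: "sqrt 2 * sqrt 3 * sqrt (1 + ((1 + u) / sqrt 2)\<^sup>2) \<le> 3 + u + u\<^sup>2 / 2" .
  have p: "(2 ^ i)\<^sup>2 = (4::real) ^ i" by (simp add: power2_eq_square power_mult_distrib[symmetric])
  have "sqrt 2 * strip_area N (Suc i) = sqrt 2 * sqrt 3 * sqrt (1 + ((1 + u) / sqrt 2)\<^sup>2) * (3 * 4 ^ i)"
    by (simp add: strip_area_def slope_def u_def power_mult_distrib p)
  also have "\<dots> \<le> (3 + u + u\<^sup>2 / 2) * (3 * 4 ^ i)" using le by (intro mult_right_mono) simp_all
  also have "\<dots> = 9 * 4 ^ i + 3 * (u * 4 ^ i) + 3 / 2 * (u\<^sup>2 * 4 ^ i)" by (simp add: algebra_simps)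
  also have "u * 4 ^ i = 2 ^ i / real N"
    unfolding u_def p[symmetric] using assms by (simp add: power2_eq_square)
  also have "u\<^sup>2 * 4 ^ i = 1 / (real N)\<^sup>2"
    unfolding u_def p[symmetric] using assms by (simp add: power_divide power_mult_distrib)
  finally show ?thesis by simp
qed

lemma strip_area_sum_le:
  assumes N: "0 < N"
  shows "sqrt 2 * (\<Sum>j\<in>{1..N}. strip_area N j) \<le> 3 * (4 ^ N - 1) + 3 * (2 ^ N - 1) / real N + 3 / (2 * real N)"
proof -
  have "sqrt 2 * (\<Sum>j\<in>{1..N}. strip_area N j) = (\<Sum>i<N. sqrt 2 * strip_area N (Suc i))"
    by (simp add: sum_distrib_left sum.atLeast1_atMost_eq)
  also have "\<dots> \<le> (\<Sum>i<N. 9 * 4 ^ i + 3 * 2 ^ i / real N + 3 / (2 * (real N)\<^sup>2))"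
    by (intro sum_mono strip_area_Suc_le[OF N])
  also have "\<dots> = 9 * (\<Sum>i<N. 4 ^ i) + 3 / real N * (\<Sum>i<N. 2 ^ i) + real N * (3 / (2 * (real N)\<^sup>2))"
    by (simp add: sum.distrib sum_distrib_left)
  also have "(\<Sum>i<N. (4::real) ^ i) = (4 ^ N - 1) / 3" by (simp add: geometric_sum)
  also have "(\<Sum>i<N. (2::real) ^ i) = 2 ^ N - 1" by (simp add: geometric_sum)
  also have "real N * (3 / (2 * (real N)\<^sup>2)) = 3 / (2 * real N)" using N by (simp add: power2_eq_square)
  also have "9 * (((4::real) ^ N - 1) / 3) + 3 / real N * (2 ^ N - 1) + 3 / (2 * real N)
      = 3 * (4 ^ N - 1) + 3 * (2 ^ N - 1) / real N + 3 / (2 * real N)"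
    by simp
  finally show ?thesis .
qed

text \<open>The term with \<open>2 ^ N - 1\<close> is the linear slope cost in
  \<open>strip_area_sum_le\<close>, so the two cancel. The remaining \<open>- 1\<close>, set against
  the strips' deficit of 3 compared with the faces, leaves the net gain 2 before the triangle is
  paid for.\<close>

lemma gap_area_sum:
  assumes N: "0 < N"
  shows "sqrt 2 * (\<Sum>j\<le>N. gap_area N j) = 3 * (2 ^ N - 1) / real N - 1"
proof -
  have zero: "sqrt 2 * gap_area N 0 = 1" by (simp add: gap_area_def slope_def offset_def)
  have Suc: "sqrt 2 * gap_area N (Suc i) = 2 * 2 ^ i - 2 ^ i * (2 * real i + 1) / real N" for i
  proof -
    have slope: "1 / sqrt 2 - slope N (Suc i) = - 1 / (real N * 2 ^ i) / sqrt 2"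
      by (simp add: slope_def add_divide_distrib)
    have "sqrt 2 * gap_area N (Suc i)
        = - 1 / (real N * 2 ^ i) * (4 * (2 ^ i)\<^sup>2 - (2 ^ i)\<^sup>2) - 2 * ((real i - 1) / real N - 1) * 2 ^ i"
      unfolding gap_area_def slope by (simp add: offset_def right_diff_distrib power_mult_distrib)
    also have "\<dots> = 2 * 2 ^ i - 2 ^ i * (2 * real i + 1) / real N"
      using N by (simp add: field_simps power2_eq_square)
    finally show ?thesis .
  qed
  \<comment> \<open>The closed form rests on the arithmetic-geometric sum of
    \<open>2 ^ i * (2 * real i + 1)\<close> over \<open>i < n\<close>, which is
    \<open>(2 * real n - 3) * 2 ^ n + 3\<close>.\<close>
  have sum: "(\<Sum>i<n. 2 * 2 ^ i - 2 ^ i * (2 * real i + 1) / real N)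
      = 2 * (2 ^ n - 1) - ((2 * real n - 3) * 2 ^ n + 3) / real N" for n
    using N by (induction n) (simp_all add: field_simps)
  have "sqrt 2 * (\<Sum>j\<le>N. gap_area N j) = (\<Sum>j<Suc N. sqrt 2 * gap_area N j)"
    by (simp add: sum_distrib_left lessThan_Suc_atMost)
  also have "\<dots> = 1 + (\<Sum>i<N. 2 * 2 ^ i - 2 ^ i * (2 * real i + 1) / real N)"
    unfolding sum.lessThan_Suc_shift by (simp only: zero Suc)
  also have "\<dots> = 3 * (2 ^ N - 1) / real N - 1"
    unfolding sum using N by (simp add: field_simps)
  finally show ?thesis .
qed

lemma T_plus_not_minimiser:
  assumes "0 \<le> \<alpha>" and \<alpha>: "\<alpha> < sqrt (2 / 3)"
  shows "\<not> sliding_minimiser \<alpha> T_plus"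
proof
  assume "sliding_minimiser \<alpha> T_plus"
  \<comment> \<open>\<open>sqrt 2\<close> times the first order gain per sheet, positive below the
    threshold because \<open>sqrt 6 * sqrt (2 / 3) = 2\<close>. The choice of \<open>N\<close> keeps
    the second order cost \<open>3 / (2 * real N)\<close> smaller.\<close>
  define \<epsilon> where "\<epsilon> = 2 - sqrt 6 * \<alpha>"
  have "sqrt 6 * \<alpha> < sqrt 6 * sqrt (2 / 3)" using \<alpha> by (intro mult_strict_left_mono) simp_all
  also have "\<dots> = 2" by (simp add: real_sqrt_mult[symmetric])
  finally have "0 < \<epsilon>" by (simp add: \<epsilon>_def)
  obtain N where N: "0 < N" "inverse (real N) < \<epsilon> / 2"
    using ex_inverse_of_nat_less[of "\<epsilon> / 2"] \<open>0 < \<epsilon>\<close> by auto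
  let ?F = "press N ` T_plus"
  let ?A = "face_area N + (\<Sum>j\<le>N. gap_area N j)"
  let ?B = "(\<Sum>j\<in>{1..N}. strip_area N j) + \<alpha> * strip_area N 0"
  have "ennreal (3 * plane_const * ?A) \<le> hausdorff_measure 2 (T_plus - ?F - sliding_boundary)"
    by (rule removed_measure_ge[OF N(1)])
  also have "\<dots> \<le> sliding_energy \<alpha> (T_plus - ?F)" by (simp add: sliding_energy_def)
  also have "\<dots> \<le> sliding_energy \<alpha> (?F - T_plus)"
    using \<open>sliding_minimiser \<alpha> T_plus\<close> sliding_competitor_press[OF N(1)] by (simp add: sliding_minimiser_def)
  also have "\<dots> \<le> ennreal (3 * plane_const * ?B)"
    by (rule added_energy_le[OF N(1) assms(1)])
  finally have "ennreal (3 * plane_const * ?A) \<le> ennreal (3 * plane_const * ?B)" .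
  \<comment> \<open>Positivity is what allows the inequality to be pulled back from
    \<open>ennreal\<close>, where negative numbers have become 0.\<close>
  moreover have "0 < ?A"
  proof -
    have "0 < sqrt 2 * ?A"
    proof -
      have "1 \<le> (4::real) ^ N" "0 \<le> 3 * (2 ^ N - 1) / real N" by simp_all
      moreover have "sqrt 2 * ?A = 3 * 4 ^ N + (3 * (2 ^ N - 1) / real N - 1)"
        using gap_area_sum[OF N(1)] by (simp add: distrib_left face_area_def)
      ultimately show ?thesis by linarith
    qed
    then show ?thesis by (simp add: zero_less_mult_iff)
  qed
  ultimately have "?A \<le> ?B"
    using plane_const_pos by (auto simp: ennreal_le_iff2 mult_le_0_iff)
  then have "sqrt 2 * ?A \<le> sqrt 2 * ?B" by simp
  moreover have "sqrt 2 * ?A = 3 * 4 ^ N + (3 * (2 ^ N - 1) / real N - 1)"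
    using gap_area_sum[OF N(1)] by (simp add: distrib_left face_area_def)
  moreover have "sqrt 2 * ?B = sqrt 2 * (\<Sum>j\<in>{1..N}. strip_area N j) + sqrt 6 * \<alpha>"
    by (simp add: distrib_left strip_area_0 real_sqrt_mult[symmetric])
  ultimately have "2 \<le> 3 / (2 * real N) + sqrt 6 * \<alpha>"
    using strip_area_sum_le[OF N(1)] by simp
  then have "\<epsilon> \<le> 3 / 2 * inverse (real N)" by (simp add: \<epsilon>_def field_simps)
  then show False using N(2) \<open>0 < \<epsilon>\<close> by linarith
qed

theorem theorem9:
  fixes \<alpha> :: real
  assumes "0 \<le> \<alpha>" and "\<alpha> \<le> 1"
  shows "sliding_minimiser \<alpha> T_plus \<longleftrightarrow> \<alpha> \<ge> sqrt (2 / 3)"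
  using T_plus_minimiser T_plus_not_minimiser[OF assms(1)] by (meson linorder_not_le)

end
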